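(* Let $n,r,d\in\mathbb{Z}_{\geq 1}$, let $\mathbb{K}$ be an algebraically closed field of characteristic $p\geq 0$ such that $p$ does not divide $r$, and let $v_1,\ldots,v_d\in\mathbb{K}$. Then there exists an algebra isomorphism between the degenerate cyclotomic Yokonuma-Hecke algebra $Y_{r,n}^{d}$ and the direct sum $\bigoplus_{\mu\in \mathcal{C}_{r,n}}\mathrm{Mat}_{m_{\mu}}(H^{\mu})$.
   Context: **Degenerate cyclotomic Hecke algebra.** For $m\geq 1$, $\widehat{H}_{m}$ is the associative unital $\mathbb{K}$-algebra generated by $\bar{x}_1,\ldots,\bar{x}_m,\bar{s}_1,\ldots,\bar{s}_{m-1}$ with relations $\bar{s}_i^2=1$; $\bar{s}_i\bar{s}_{i+1}\bar{s}_i=\bar{s}_{i+1}\bar{s}_i\bar{s}_{i+1}$; $\bar{s}_i\bar{s}_j=\bar{s}_j\bar{s}_i$ if $|i-j|>1$; $\bar{x}_i\bar{x}_j=\bar{x}_j\bar{x}_i$; $\bar{s}_i\bar{x}_{i+1}=\bar{x}_i\bar{s}_i+1$; $\bar{s}_i\bar{x}_j=\bar{x}_j\bar{s}_i$ if $j\neq i,i+1$. Put $H_m^d=\widehat{H}_m/\langle(\bar{x}_1-v_1)\cdots(\bar{x}_1-v_d)\rangle$ for $m\ge 1$ and $H_0^d=\mathbb{K}$. **Degenerate cyclotomic Yokonuma-Hecke algebra.** $\widehat{Y}_{r,n}$ is the associative unital $\mathbb{K}$-algebra generated by $t_1,\ldots,t_n,f_1,\ldots,f_{n-1},x_1,\ldots,x_n$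 with relations: $f_if_j=f_jf_i$ if $|i-j|\geq 2$; $f_if_{i+1}f_i=f_{i+1}f_if_{i+1}$; $t_it_j=t_jt_i$; $f_it_j=t_{s_i(j)}f_i$; $t_i^r=1$; $f_i^2=1$; $x_ix_j=x_jx_i$; $f_ix_{i+1}=x_if_i+e_i$; $f_ix_j=x_jf_i$ for $j\neq i,i+1$; $t_jx_i=x_it_j$ for all $i,j$; where $s_i=(i,i+1)$ and $e_i=\frac1r\sum_{s=0}^{r-1}t_i^st_{i+1}^{-s}$. Put $Y_{r,n}^d=\widehat{Y}_{r,n}/\langle(x_1-v_1)\cdots(x_1-v_d)\rangle$ (quotient by the two-sided ideal). **Compositions and matrix algebras.** $\mathcal{C}_{r,n}$ is the set of $r$-compositions of $n$, i.e. $\mu=(\mu_1,\ldots,\mu_r)\in\mathbb{Z}_{\geq0}^r$ with $\sum_a\mu_a=n$. For $\mu\in\mathcal{C}_{r,n}$, $m_\mu=n!/(\mu_1!\cdots\mu_r!)$, $H^\mu=H_{\mu_1}^d\otimes\cdots\otimes H_{\mu_r}^d$ (tensor products over $\mathbb{K}$, all factors with the same parameters $v_1,\ldots,v_d$), and $\mathrm{Mat}_{m_\mu}(H^\mu)$ is the algebra of $m_\mu\times m_\mu$ matrices over $H^\mu$. *)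

theory Defs
  imports
    "HOL-Computational_Algebra.Polynomial"
    "HOL-Combinatorics.Transposition"
    "HOL-Library.Poly_Mapping"
    "HOL-Algebra.Module"
    "HOL-Algebra.QuotRing"
    "HOL-Algebra.Product_Groups"
begin

text \<open>
  Associative unital algebras over the field (type) \<open>'k\<close> are represented by records of type
  \<open>('k, 'a) module\<close>, i.e. rings with a scalar multiplication.
\<close>

section \<open>General constructions on algebras\<close>

text \<open>The quotient of \<open>A\<close> by the two-sided ideal generated by \<open>S\<close>; the scalar multiplication on
  cosets is set up in the same way as \<^const>\<open>rcoset_mult\<close>.\<close>

definition alg_quot :: "('k, 'a) module \<Rightarrow> 'a set \<Rightarrow> ('k, 'a set) module" where
  "alg_quot A S =
    \<lparr>carrier = carrier (A Quot Idl\<^bsub>A\<^esub> S),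
     mult = mult (A Quot Idl\<^bsub>A\<^esub> S),
     one = one (A Quot Idl\<^bsub>A\<^esub> S),
     zero = zero (A Quot Idl\<^bsub>A\<^esub> S),
     add = add (A Quot Idl\<^bsub>A\<^esub> S),
     smult = (\<lambda>c X. \<Union>x\<in>X. Idl\<^bsub>A\<^esub> S +>\<^bsub>A\<^esub> (c \<odot>\<^bsub>A\<^esub> x))\<rparr>"

definition alg_quot_class :: "('k, 'a) module \<Rightarrow> 'a set \<Rightarrow> 'a \<Rightarrow> 'a set" where
  "alg_quot_class A S x = Idl\<^bsub>A\<^esub> S +>\<^bsub>A\<^esub> x"

text \<open>The monoid algebra of \<open>M\<close> over \<open>'k\<close>: finitely supported functions on \<open>carrier M\<close> with
  convolution; \<^term>\<open>Poly_Mapping.single a 1\<close> is the basis element belonging to \<open>a\<close>.\<close>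

definition monoid_algebra :: "'a monoid \<Rightarrow> ('k::field, 'a \<Rightarrow>\<^sub>0 'k) module" where
  "monoid_algebra M =
    \<lparr>carrier = {p. Poly_Mapping.keys p \<subseteq> carrier M},
     mult = (\<lambda>p q. \<Sum>a\<in>Poly_Mapping.keys p. \<Sum>b\<in>Poly_Mapping.keys q.
               Poly_Mapping.single (a \<otimes>\<^bsub>M\<^esub> b) (Poly_Mapping.lookup p a * Poly_Mapping.lookup q b)),
     one = Poly_Mapping.single \<one>\<^bsub>M\<^esub> 1,
     zero = 0,
     add = (+),
     smult = (\<lambda>c. Poly_Mapping.map ((*) c))\<rparr>"

definition free_monoid :: "'g set \<Rightarrow> 'g list monoid" where
  "free_monoid G = \<lparr>carrier = lists G, mult = (@), one = []\<rparr>"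

definition free_algebra :: "'g set \<Rightarrow> ('k::field, 'g list \<Rightarrow>\<^sub>0 'k) module" where
  "free_algebra G = monoid_algebra (free_monoid G)"

definition free_gen :: "'g \<Rightarrow> ('g list \<Rightarrow>\<^sub>0 'k::field)" where
  "free_gen g = Poly_Mapping.single [g] 1"

text \<open>The algebra generated by \<open>G\<close> with relations \<open>p = q\<close> for \<open>(p, q) \<in> R\<close>.\<close>

definition relators :: "'g set \<Rightarrow> (('g list \<Rightarrow>\<^sub>0 'k) \<times> ('g list \<Rightarrow>\<^sub>0 'k)) set \<Rightarrow>
    ('g list \<Rightarrow>\<^sub>0 'k::field) set" where
  "relators G R = {p \<ominus>\<^bsub>free_algebra G\<^esub> q | p q. (p, q) \<in> R}"

definition presented_algebra :: "'g set \<Rightarrow> (('g list \<Rightarrow>\<^sub>0 'k) \<times> ('g list \<Rightarrow>\<^sub>0 'k)) set \<Rightarrow>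
    ('k::field, ('g list \<Rightarrow>\<^sub>0 'k) set) module" where
  "presented_algebra G R = alg_quot (free_algebra G) (relators G R)"

definition presented_gen :: "'g set \<Rightarrow> (('g list \<Rightarrow>\<^sub>0 'k) \<times> ('g list \<Rightarrow>\<^sub>0 'k)) set \<Rightarrow> 'g \<Rightarrow>
    ('g list \<Rightarrow>\<^sub>0 'k::field) set" where
  "presented_gen G R g = alg_quot_class (free_algebra G) (relators G R) (free_gen g)"

text \<open>The tensor product over \<open>'k\<close> of the algebras \<open>A i\<close>, \<open>i \<in> I\<close> (\<open>I\<close> finite): the vector space with
  basis the product of the underlying sets \<open>carrier (A i)\<close>, modulo multilinearity.  As
  multiplication of basis elements is componentwise, multiplying an instance of multilinearity by a
  basis element gives another such instance, so that the subspace spanned by these instances is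
  already the ideal generated by them.\<close>

definition tensor_basis :: "'i set \<Rightarrow> ('i \<Rightarrow> ('k::field, 'a) module) \<Rightarrow>
    ('k, ('i \<Rightarrow> 'a) \<Rightarrow>\<^sub>0 'k) module" where
  "tensor_basis I A = monoid_algebra (product_group I A)"

definition multilinear_relators :: "'i set \<Rightarrow> ('i \<Rightarrow> ('k::field, 'a) module) \<Rightarrow>
    (('i \<Rightarrow> 'a) \<Rightarrow>\<^sub>0 'k) set" where
  "multilinear_relators I A =
    {Poly_Mapping.single (f(i := x \<oplus>\<^bsub>A i\<^esub> y)) 1
       - (Poly_Mapping.single (f(i := x)) 1 + Poly_Mapping.single (f(i := y)) 1) | f i x y.
       f \<in> (\<Pi>\<^sub>E j\<in>I. carrier (A j)) \<and> i \<in> I \<and> x \<in> carrier (A i) \<and> y \<in> carrier (A i)} \<union>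
    {Poly_Mapping.single (f(i := c \<odot>\<^bsub>A i\<^esub> x)) 1 - Poly_Mapping.single (f(i := x)) c | f i c x.
       f \<in> (\<Pi>\<^sub>E j\<in>I. carrier (A j)) \<and> i \<in> I \<and> x \<in> carrier (A i)}"

definition tensor_algebra :: "'i set \<Rightarrow> ('i \<Rightarrow> ('k::field, 'a) module) \<Rightarrow>
    ('k, (('i \<Rightarrow> 'a) \<Rightarrow>\<^sub>0 'k) set) module" where
  "tensor_algebra I A = alg_quot (tensor_basis I A) (multilinear_relators I A)"

definition mat_algebra :: "nat \<Rightarrow> ('k, 'a) module \<Rightarrow> ('k, nat \<times> nat \<Rightarrow> 'a) module" where
  "mat_algebra m A =
    \<lparr>carrier = {..<m} \<times> {..<m} \<rightarrow>\<^sub>E carrier A,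
     mult = (\<lambda>M N. \<lambda>(i, j)\<in>{..<m} \<times> {..<m}. \<Oplus>\<^bsub>A\<^esub>k\<in>{..<m}. M (i, k) \<otimes>\<^bsub>A\<^esub> N (k, j)),
     one = (\<lambda>(i, j)\<in>{..<m} \<times> {..<m}. if i = j then \<one>\<^bsub>A\<^esub> else \<zero>\<^bsub>A\<^esub>),
     zero = (\<lambda>ij\<in>{..<m} \<times> {..<m}. \<zero>\<^bsub>A\<^esub>),
     add = (\<lambda>M N. \<lambda>ij\<in>{..<m} \<times> {..<m}. M ij \<oplus>\<^bsub>A\<^esub> N ij),
     smult = (\<lambda>c M. \<lambda>ij\<in>{..<m} \<times> {..<m}. c \<odot>\<^bsub>A\<^esub> M ij)\<rparr>"

text \<open>Only meant for finite index sets \<open>I\<close>, where direct sum and direct product coincide.\<close>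

definition direct_sum_algebra :: "'i set \<Rightarrow> ('i \<Rightarrow> ('k, 'a) module) \<Rightarrow> ('k, 'i \<Rightarrow> 'a) module" where
  "direct_sum_algebra I A =
    \<lparr>carrier = (\<Pi>\<^sub>E i\<in>I. carrier (A i)),
     mult = (\<lambda>x y. \<lambda>i\<in>I. x i \<otimes>\<^bsub>A i\<^esub> y i),
     one = (\<lambda>i\<in>I. \<one>\<^bsub>A i\<^esub>),
     zero = (\<lambda>i\<in>I. \<zero>\<^bsub>A i\<^esub>),
     add = (\<lambda>x y. \<lambda>i\<in>I. x i \<oplus>\<^bsub>A i\<^esub> y i),
     smult = (\<lambda>c x. \<lambda>i\<in>I. c \<odot>\<^bsub>A i\<^esub> x i)\<rparr>"

definition alg_iso :: "('k, 'a) module \<Rightarrow> ('k, 'b) module \<Rightarrow> ('a \<Rightarrow> 'b) set" where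
  "alg_iso A B =
    {h \<in> ring_iso A B. \<forall>c. \<forall>x\<in>carrier A. h (c \<odot>\<^bsub>A\<^esub> x) = c \<odot>\<^bsub>B\<^esub> h x}"


section \<open>Degenerate cyclotomic Hecke algebras\<close>

text \<open>The element \<open>(x - v 1) \<cdots> (x - v d)\<close>.\<close>

definition cyclotomic_element :: "('k, 'a) module \<Rightarrow> nat \<Rightarrow> (nat \<Rightarrow> 'k) \<Rightarrow> 'a \<Rightarrow> 'a" where
  "cyclotomic_element A d v x =
    foldr (\<lambda>i y. (x \<ominus>\<^bsub>A\<^esub> v i \<odot>\<^bsub>A\<^esub> \<one>\<^bsub>A\<^esub>) \<otimes>\<^bsub>A\<^esub> y) [1..<Suc d] \<one>\<^bsub>A\<^esub>"

datatype hecke_gen = HX nat | HS nat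

definition hecke_gens :: "nat \<Rightarrow> hecke_gen set" where
  "hecke_gens m = HX ` {1..m} \<union> HS ` {1..<m}"

definition hecke_rels :: "('k, 'a) module \<Rightarrow> nat \<Rightarrow> (nat \<Rightarrow> 'a) \<Rightarrow> (nat \<Rightarrow> 'a) \<Rightarrow> ('a \<times> 'a) set" where
  "hecke_rels A m x s =
     {(s i \<otimes> s i, \<one>) | i. i \<in> {1..<m}} \<union>
     {(s i \<otimes> s (i + 1) \<otimes> s i, s (i + 1) \<otimes> s i \<otimes> s (i + 1)) | i. i \<in> {1..<m} \<and> i + 1 \<in> {1..<m}} \<union>
     {(s i \<otimes> s j, s j \<otimes> s i) | i j. i \<in> {1..<m} \<and> j \<in> {1..<m} \<and> \<bar>int i - int j\<bar> > 1} \<union>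
     {(x i \<otimes> x j, x j \<otimes> x i) | i j. i \<in> {1..m} \<and> j \<in> {1..m}} \<union>
     {(s i \<otimes> x (i + 1), x i \<otimes> s i \<oplus> \<one>) | i. i \<in> {1..<m}} \<union>
     {(s i \<otimes> x j, x j \<otimes> s i) | i j. i \<in> {1..<m} \<and> j \<in> {1..m} \<and> j \<noteq> i \<and> j \<noteq> i + 1}"
  for A (structure)

definition affine_hecke_rels ::
  "nat \<Rightarrow> ((hecke_gen list \<Rightarrow>\<^sub>0 'k::field) \<times> (hecke_gen list \<Rightarrow>\<^sub>0 'k)) set" where
  "affine_hecke_rels m =
     hecke_rels (free_algebra (hecke_gens m)) m (\<lambda>i. free_gen (HX i)) (\<lambda>i. free_gen (HS i))"

definition affine_hecke :: "nat \<Rightarrow> ('k::field, (hecke_gen list \<Rightarrow>\<^sub>0 'k) set) module" where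
  "affine_hecke m = presented_algebra (hecke_gens m) (affine_hecke_rels m)"

text \<open>For \<open>m = 0\<close> there are neither generators nor relations, which gives the one-dimensional
  algebra \<open>'k\<close>.\<close>

definition cyclotomic_hecke ::
  "nat \<Rightarrow> nat \<Rightarrow> (nat \<Rightarrow> 'k::field) \<Rightarrow> ('k, (hecke_gen list \<Rightarrow>\<^sub>0 'k) set set) module" where
  "cyclotomic_hecke m d v = alg_quot (affine_hecke m)
     (if m = 0 then {}
      else {cyclotomic_element (affine_hecke m) d v
              (presented_gen (hecke_gens m) (affine_hecke_rels m) (HX 1))})"


section \<open>Degenerate cyclotomic Yokonuma--Hecke algebras\<close>

datatype yh_gen = YT nat | YF nat | YX nat

definition yh_gens :: "nat \<Rightarrow> yh_gen set" where
  "yh_gens n = YT ` {1..n} \<union> YF ` {1..<n} \<union> YX ` {1..n}"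

text \<open>The elements \<open>e\<^sub>i\<close>; because of the relation \<open>t\<^sub>i\<^sub>+\<^sub>1\<^sup>r = 1\<close> the negative power of \<open>t\<^sub>i\<^sub>+\<^sub>1\<close> of exponent
  \<open>-k\<close> is written as the power of exponent \<open>r - k\<close>.\<close>

definition yh_e :: "('k::field, 'a) module \<Rightarrow> nat \<Rightarrow> (nat \<Rightarrow> 'a) \<Rightarrow> nat \<Rightarrow> 'a" where
  "yh_e A r t i =
     inverse (of_nat r) \<odot> (\<Oplus>k\<in>{..<r}. t i [^] k \<otimes> t (i + 1) [^] (r - k))"
  for A (structure)

definition yh_rels :: "('k::field, 'a) module \<Rightarrow> nat \<Rightarrow> nat \<Rightarrow>
    (nat \<Rightarrow> 'a) \<Rightarrow> (nat \<Rightarrow> 'a) \<Rightarrow> (nat \<Rightarrow> 'a) \<Rightarrow> ('a \<times> 'a) set" where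
  "yh_rels A r n t f x =
     {(f i \<otimes> f j, f j \<otimes> f i) | i j. i \<in> {1..<n} \<and> j \<in> {1..<n} \<and> \<bar>int i - int j\<bar> \<ge> 2} \<union>
     {(f i \<otimes> f (i + 1) \<otimes> f i, f (i + 1) \<otimes> f i \<otimes> f (i + 1)) | i. i \<in> {1..<n} \<and> i + 1 \<in> {1..<n}} \<union>
     {(t i \<otimes> t j, t j \<otimes> t i) | i j. i \<in> {1..n} \<and> j \<in> {1..n}} \<union>
     {(f i \<otimes> t j, t (Transposition.transpose i (i + 1) j) \<otimes> f i) | i j.
        i \<in> {1..<n} \<and> j \<in> {1..n}} \<union>
     {(t i [^] r, \<one>) | i. i \<in> {1..n}} \<union>
     {(f i \<otimes> f i, \<one>) | i. i \<in> {1..<n}} \<union>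
     {(x i \<otimes> x j, x j \<otimes> x i) | i j. i \<in> {1..n} \<and> j \<in> {1..n}} \<union>
     {(f i \<otimes> x (i + 1), x i \<otimes> f i \<oplus> yh_e A r t i) | i. i \<in> {1..<n}} \<union>
     {(f i \<otimes> x j, x j \<otimes> f i) | i j. i \<in> {1..<n} \<and> j \<in> {1..n} \<and> j \<noteq> i \<and> j \<noteq> i + 1} \<union>
     {(t j \<otimes> x i, x i \<otimes> t j) | i j. i \<in> {1..n} \<and> j \<in> {1..n}}"
  for A (structure)

definition affine_yh_rels ::
  "nat \<Rightarrow> nat \<Rightarrow> ((yh_gen list \<Rightarrow>\<^sub>0 'k::field) \<times> (yh_gen list \<Rightarrow>\<^sub>0 'k)) set" where
  "affine_yh_rels r n = yh_rels (free_algebra (yh_gens n)) r n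
     (\<lambda>i. free_gen (YT i)) (\<lambda>i. free_gen (YF i)) (\<lambda>i. free_gen (YX i))"

definition affine_yokonuma_hecke ::
  "nat \<Rightarrow> nat \<Rightarrow> ('k::field, (yh_gen list \<Rightarrow>\<^sub>0 'k) set) module" where
  "affine_yokonuma_hecke r n = presented_algebra (yh_gens n) (affine_yh_rels r n)"

text \<open>Here \<open>n \<ge> 1\<close> is presupposed, so that there is a generator \<open>x\<^sub>1\<close>.\<close>

definition cyclotomic_yokonuma_hecke ::
  "nat \<Rightarrow> nat \<Rightarrow> nat \<Rightarrow> (nat \<Rightarrow> 'k::field) \<Rightarrow> ('k, (yh_gen list \<Rightarrow>\<^sub>0 'k) set set) module" where
  "cyclotomic_yokonuma_hecke r n d v = alg_quot (affine_yokonuma_hecke r n)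
     {cyclotomic_element (affine_yokonuma_hecke r n) d v
        (presented_gen (yh_gens n) (affine_yh_rels r n) (YX 1))}"


section \<open>Compositions\<close>

definition compositions :: "nat \<Rightarrow> nat \<Rightarrow> nat list set" where
  "compositions r n = {\<mu>. length \<mu> = r \<and> sum_list \<mu> = n}"

definition comp_mult :: "nat list \<Rightarrow> nat" where
  "comp_mult \<mu> = fact (sum_list \<mu>) div (\<Prod>a<length \<mu>. fact (\<mu> ! a))"

definition hecke_tensor :: "nat list \<Rightarrow> nat \<Rightarrow> (nat \<Rightarrow> 'k::field) \<Rightarrow>
    ('k, ((nat \<Rightarrow> (hecke_gen list \<Rightarrow>\<^sub>0 'k) set set) \<Rightarrow>\<^sub>0 'k) set) module" where
  "hecke_tensor \<mu> d v = tensor_algebra {..<length \<mu>} (\<lambda>a. cyclotomic_hecke (\<mu> ! a) d v)"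

end

(*
  Let zeta_0, ..., zeta_(r-1) be the r-th roots of unity in K.  Fourier transform in the commuting
  elements t_1, ..., t_n yields orthogonal idempotents E_chi, one for each word chi of length n in r
  letters, with t_i E_chi = zeta_(chi_i) E_chi.  The f_i permute them, f_i E_chi = E_(s_i chi) f_i, and
  e_i E_chi is E_chi if chi_i = chi_(i+1) and 0 otherwise.  Hence, if chi_i and chi_(i+1) differ, f_i only
  transports everything from chi to s_i chi, whereas for equal letters f_i and the x_j satisfy the
  relations of the degenerate Hecke algebra.

  The words of content mu index the rows and columns of the matrices over H^mu.  The map Phi from the
  Yokonuma-Hecke algebra sends each generator to a monomial matrix: t_i and x_j to diagonal matrices with
  entries zeta_(chi_i), respectively the generator x of rank k in the tensor factor chi_j, where chi_j is
  the k-th occurrence of its letter in chi; f_i to the permutation matrix of s_i, with the generator s of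
  the Hecke algebra as entry where chi_i = chi_(i+1).

  Conversely let b be the sorted word of content mu.  Sorting by adjacent transpositions of different
  letters gives elements u_chi with u_chi E_b = E_chi u_chi = u_chi, invertible between the two corners; that
  they do not depend on the way of sorting is a diamond argument using only the commutation and braid
  relations (so no presentation of the symmetric group is needed).  There is a homomorphism psi from H^mu
  to the corner E_b Y E_b, and y u_chi is the sum of u_xi psi(Phi(y)_(xi, chi)) over xi, by induction on y.  So
  Phi is injective, and Phi(u_chi psi(h) u_xi^(-1)) is the matrix unit with entry h, so Phi is surjective.
*)

theory Submission
  imports Defs "HOL-Combinatorics.Multiset_Permutations"
begin

text \<open>Both sides are known only through generators and relations, so bijectivity of \<Phi>
  does not rest on comparing bases or dimensions. Injectivity works because the matrix of
  \<open>y\<close> records how \<open>y\<close> acts on the elements \<open>u_\<chi>\<close>: being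
  invertible between corners, these recover \<open>y E_\<chi>\<close> from
  \<open>y u_\<chi>\<close>, and the \<open>E_\<chi>\<close> of all words add up to 1. The delicate
  point is that \<psi> exists at all: the cyclotomic relation is imposed on \<open>x_1\<close>
  alone, but must hold for the first generator of every tensor factor. It is transported by a word
  that starts with the letter in question, along \<open>x_1 u_\<chi> = u_\<chi> x_q\<close>, where
  \<open>q\<close> is the place of the first such letter in \<open>b\<close>. Algebraic closedness
  supplies the roots of unity; that the characteristic does not divide \<open>r\<close> makes
  \<open>r\<close> of them distinct and makes \<open>1/r\<close> available in the Fourier transform
  and in \<open>e_i\<close>. For the direct sum, preimages in one block are taken from the two-sided
  ideal generated by \<open>E_b\<close>, which every other block annihilates.\<close>

locale kalg = ring A for A :: "('k::field, 'a) module" (structure) +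
  assumes smult_closed [simp, intro]: "x \<in> carrier A \<Longrightarrow> c \<odot> x \<in> carrier A"
    and smult_l_distr: "x \<in> carrier A \<Longrightarrow> (a + b) \<odot> x = a \<odot> x \<oplus> b \<odot> x"
    and smult_r_distr: "x \<in> carrier A \<Longrightarrow> y \<in> carrier A \<Longrightarrow> c \<odot> (x \<oplus> y) = c \<odot> x \<oplus> c \<odot> y"
    and smult_assoc1: "x \<in> carrier A \<Longrightarrow> (a * b) \<odot> x = a \<odot> (b \<odot> x)"
    and smult_one [simp]: "x \<in> carrier A \<Longrightarrow> 1 \<odot> x = x"
    and smult_assoc2: "x \<in> carrier A \<Longrightarrow> y \<in> carrier A \<Longrightarrow> (c \<odot> x) \<otimes> y = c \<odot> (x \<otimes> y)"
    and smult_assoc3: "x \<in> carrier A \<Longrightarrow> y \<in> carrier A \<Longrightarrow> x \<otimes> (c \<odot> y) = c \<odot> (x \<otimes> y)"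
begin

lemma smult_0 [simp]: assumes "x \<in> carrier A" shows "0 \<odot> x = \<zero>"
proof -
  have "0 \<odot> x = 0 \<odot> x \<oplus> 0 \<odot> x"
    using smult_l_distr[OF assms, of 0 0] by simp
  then show ?thesis
    using assms by (metis add.r_cancel_one' smult_closed)
qed

lemma smult_zero [simp]: "c \<odot> \<zero> = \<zero>"
  by (metis mult_zero_right smult_0 smult_assoc1 zero_closed)

lemma smult_eq_one_mult: "x \<in> carrier A \<Longrightarrow> c \<odot> x = (c \<odot> \<one>) \<otimes> x"
  by (simp add: smult_assoc2)

text \<open>Makes negation a scalar multiplication, so that maps compatible with scalars need no
  separate treatment of minus signs.\<close>

lemma smult_minus_one: assumes "x \<in> carrier A" shows "(- 1) \<odot> x = \<ominus> x"
proof -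
  have "x \<oplus> (- 1) \<odot> x = \<zero>"
    using smult_l_distr[OF assms, of 1 "- 1"] assms by simp
  then show ?thesis
    using assms by (metis minus_equality a_comm smult_closed)
qed

lemma smult_finsum:
  assumes "finite S" "f \<in> S \<rightarrow> carrier A"
  shows "c \<odot> (\<Oplus>i\<in>S. f i) = (\<Oplus>i\<in>S. c \<odot> f i)"
  using assms by (induction S rule: finite_induct) (auto simp: smult_r_distr Pi_iff)

lemma smult_sum:
  assumes "finite S" "x \<in> carrier A"
  shows "(\<Sum>i\<in>S. c i) \<odot> x = (\<Oplus>i\<in>S. c i \<odot> x)"
  using assms by (induction S rule: finite_induct) (auto simp: smult_l_distr)

end

text \<open>The unital subalgebra generated by \<open>G\<close>. Zero and negatives have no clauses
  of their own: they are the scalar multiples by 0 and -1. Membership in the carrier is not built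
  in, so \<open>alg_gen_closed\<close> asks that \<open>G\<close> lie there.\<close>

inductive_set alg_gen :: "('k, 'a) module \<Rightarrow> 'a set \<Rightarrow> 'a set" for A (structure) and G where
  gen: "g \<in> G \<Longrightarrow> g \<in> alg_gen A G"
| one: "\<one> \<in> alg_gen A G"
| add: "x \<in> alg_gen A G \<Longrightarrow> y \<in> alg_gen A G \<Longrightarrow> x \<oplus> y \<in> alg_gen A G"
| mult: "x \<in> alg_gen A G \<Longrightarrow> y \<in> alg_gen A G \<Longrightarrow> x \<otimes> y \<in> alg_gen A G"
| smult: "x \<in> alg_gen A G \<Longrightarrow> c \<odot> x \<in> alg_gen A G"

lemma (in kalg) alg_gen_closed: "x \<in> alg_gen A G \<Longrightarrow> G \<subseteq> carrier A \<Longrightarrow> x \<in> carrier A"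
  by (induction rule: alg_gen.induct) auto

lemma (in kalg) alg_gen_finsum:
  assumes "G \<subseteq> carrier A" "finite S" "f \<in> S \<rightarrow> alg_gen A G"
  shows "(\<Oplus>i\<in>S. f i) \<in> alg_gen A G"
  using assms(2,3)
proof (induction S rule: finite_induct)
  case empty
  then show ?case
    by (metis alg_gen.one alg_gen.smult finsum_empty one_closed smult_0)
next
  case (insert i S)
  then have "f \<in> S \<rightarrow> carrier A" "f i \<in> carrier A"
    using alg_gen_closed[OF _ assms(1)] by auto
  then show ?case
    using insert by (simp add: alg_gen.add)
qed

section \<open>Algebra homomorphisms and generating sets\<close>

definition alg_hom :: "('k, 'a) module \<Rightarrow> ('k, 'b) module \<Rightarrow> ('a \<Rightarrow> 'b) set" where
  "alg_hom A B =
    {h \<in> ring_hom A B. \<forall>c. \<forall>x\<in>carrier A. h (c \<odot>\<^bsub>A\<^esub> x) = c \<odot>\<^bsub>B\<^esub> h x}"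

lemma alg_isoI:
  "h \<in> alg_hom A B \<Longrightarrow> bij_betw h (carrier A) (carrier B) \<Longrightarrow> h \<in> alg_iso A B"
  by (auto simp: alg_iso_def alg_hom_def ring_iso_def)

locale alg_morphism = A: kalg A + B: kalg B for A :: "('k::field, 'a) module"
    and B :: "('k, 'b) module" +
  fixes h
  assumes hom: "h \<in> alg_hom A B"
begin

lemma hom_closed [simp, intro]: "x \<in> carrier A \<Longrightarrow> h x \<in> carrier B"
  and hom_mult [simp]: "x \<in> carrier A \<Longrightarrow> y \<in> carrier A \<Longrightarrow> h (x \<otimes>\<^bsub>A\<^esub> y) = h x \<otimes>\<^bsub>B\<^esub> h y"
  and hom_add [simp]: "x \<in> carrier A \<Longrightarrow> y \<in> carrier A \<Longrightarrow> h (x \<oplus>\<^bsub>A\<^esub> y) = h x \<oplus>\<^bsub>B\<^esub> h y"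
  and hom_one [simp]: "h \<one>\<^bsub>A\<^esub> = \<one>\<^bsub>B\<^esub>"
  and hom_smult [simp]: "x \<in> carrier A \<Longrightarrow> h (c \<odot>\<^bsub>A\<^esub> x) = c \<odot>\<^bsub>B\<^esub> h x"
  using hom by (auto simp: alg_hom_def ring_hom_def)

lemma hom_zero [simp]: "h \<zero>\<^bsub>A\<^esub> = \<zero>\<^bsub>B\<^esub>"
  using hom_smult[of "\<zero>\<^bsub>A\<^esub>" 0] by simp

lemma hom_uminus [simp]: "x \<in> carrier A \<Longrightarrow> h (\<ominus>\<^bsub>A\<^esub> x) = \<ominus>\<^bsub>B\<^esub> h x"
  by (metis hom_smult A.smult_minus_one B.smult_minus_one hom_closed)

lemma hom_minus [simp]:
  "x \<in> carrier A \<Longrightarrow> y \<in> carrier A \<Longrightarrow> h (x \<ominus>\<^bsub>A\<^esub> y) = h x \<ominus>\<^bsub>B\<^esub> h y"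
  by (simp add: a_minus_def)

lemma hom_pow [simp]: "x \<in> carrier A \<Longrightarrow> h (x [^]\<^bsub>A\<^esub> (k::nat)) = h x [^]\<^bsub>B\<^esub> k"
  by (induction k) auto

lemma hom_finsum:
  assumes "finite S" "f \<in> S \<rightarrow> carrier A"
  shows "h (\<Oplus>\<^bsub>A\<^esub>i\<in>S. f i) = (\<Oplus>\<^bsub>B\<^esub>i\<in>S. h (f i))"
  using assms by (induction S rule: finite_induct) (auto simp: Pi_iff)

lemma hom_alg_gen:
  assumes "G \<subseteq> carrier A" "x \<in> alg_gen A G" shows "h x \<in> alg_gen B (h ` G)"
  using assms(2)
proof (induction rule: alg_gen.induct)
  case (gen g)
  then show ?case by (simp add: alg_gen.gen)
qed (use assms A.alg_gen_closed[OF _ assms(1)] in \<open>auto intro: alg_gen.intros\<close>)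

text \<open>How generating sets descend to quotients; the presented and cyclotomic algebras below
  inherit their generators this way.\<close>

lemma surj_generated:
  assumes "G \<subseteq> carrier A" "alg_gen A G = carrier A" "h ` carrier A = carrier B"
  shows "alg_gen B (h ` G) = carrier B"
proof
  show "carrier B \<subseteq> alg_gen B (h ` G)"
  proof
    fix y assume "y \<in> carrier B"
    then obtain x where "x \<in> carrier A" "y = h x" using assms(3) by blast
    then show "y \<in> alg_gen B (h ` G)" using hom_alg_gen[OF assms(1), of x] assms(2) by simp
  qed
  have "h ` G \<subseteq> carrier B" using assms(1) by auto
  then show "alg_gen B (h ` G) \<subseteq> carrier B" using B.alg_gen_closed by blast
qed

end

lemma alg_homI:
  assumes "\<And>x. x \<in> carrier A \<Longrightarrow> h x \<in> carrier B"
    and "\<And>x y. x \<in> carrier A \<Longrightarrow> y \<in> carrier A \<Longrightarrow> h (x \<otimes>\<^bsub>A\<^esub> y) = h x \<otimes>\<^bsub>B\<^esub> h y"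
    and "\<And>x y. x \<in> carrier A \<Longrightarrow> y \<in> carrier A \<Longrightarrow> h (x \<oplus>\<^bsub>A\<^esub> y) = h x \<oplus>\<^bsub>B\<^esub> h y"
    and "h \<one>\<^bsub>A\<^esub> = \<one>\<^bsub>B\<^esub>"
    and "\<And>c x. x \<in> carrier A \<Longrightarrow> h (c \<odot>\<^bsub>A\<^esub> x) = c \<odot>\<^bsub>B\<^esub> h x"
  shows "h \<in> alg_hom A B"
  using assms by (auto simp: alg_hom_def ring_hom_def)

lemma alg_morphismI: "kalg A \<Longrightarrow> kalg B \<Longrightarrow> h \<in> alg_hom A B \<Longrightarrow> alg_morphism A B h"
  by (simp add: alg_morphism_def alg_morphism_axioms_def)

text \<open>The centralizer of \<open>y\<close> is a subalgebra, so commutation with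
  \<open>y\<close> need only be tested on generators.\<close>

lemma (in kalg) commute_alg_gen:
  assumes "G \<subseteq> carrier A" "y \<in> carrier A" "x \<in> alg_gen A G" "\<And>g. g \<in> G \<Longrightarrow> g \<otimes> y = y \<otimes> g"
  shows "x \<otimes> y = y \<otimes> x"
  using assms(3)
proof (induction rule: alg_gen.induct)
  case (mult x z)
  then have "x \<in> carrier A" "z \<in> carrier A" using alg_gen_closed[OF _ assms(1)] by auto
  then show ?case using mult assms(2) by (metis m_assoc)
qed (use assms alg_gen_closed[OF _ assms(1)] in
      \<open>auto simp: l_distr r_distr smult_assoc2 smult_assoc3\<close>)

section \<open>Quotients\<close>

text \<open>Additive inverses are not among the hypotheses: \<open>(- 1) \<odot> x\<close> supplies
  them, by distributivity and the law for the scalar 0.\<close>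

lemma kalgI:
  fixes A :: "('k::field, 'a) module" (structure)
  assumes add_closed: "\<And>x y. x \<in> carrier A \<Longrightarrow> y \<in> carrier A \<Longrightarrow> x \<oplus> y \<in> carrier A"
    and zero_closed: "\<zero> \<in> carrier A"
    and add_assoc: "\<And>x y z. x \<in> carrier A \<Longrightarrow> y \<in> carrier A \<Longrightarrow> z \<in> carrier A \<Longrightarrow>
      (x \<oplus> y) \<oplus> z = x \<oplus> (y \<oplus> z)"
    and add_comm: "\<And>x y. x \<in> carrier A \<Longrightarrow> y \<in> carrier A \<Longrightarrow> x \<oplus> y = y \<oplus> x"
    and l_zero: "\<And>x. x \<in> carrier A \<Longrightarrow> \<zero> \<oplus> x = x"
    and mult_closed: "\<And>x y. x \<in> carrier A \<Longrightarrow> y \<in> carrier A \<Longrightarrow> x \<otimes> y \<in> carrier A"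
    and one_closed: "\<one> \<in> carrier A"
    and mult_assoc: "\<And>x y z. x \<in> carrier A \<Longrightarrow> y \<in> carrier A \<Longrightarrow> z \<in> carrier A \<Longrightarrow>
      (x \<otimes> y) \<otimes> z = x \<otimes> (y \<otimes> z)"
    and l_one: "\<And>x. x \<in> carrier A \<Longrightarrow> \<one> \<otimes> x = x"
    and r_one: "\<And>x. x \<in> carrier A \<Longrightarrow> x \<otimes> \<one> = x"
    and l_distr: "\<And>x y z. x \<in> carrier A \<Longrightarrow> y \<in> carrier A \<Longrightarrow> z \<in> carrier A \<Longrightarrow>
      (x \<oplus> y) \<otimes> z = x \<otimes> z \<oplus> y \<otimes> z"
    and r_distr: "\<And>x y z. x \<in> carrier A \<Longrightarrow> y \<in> carrier A \<Longrightarrow> z \<in> carrier A \<Longrightarrow>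
      z \<otimes> (x \<oplus> y) = z \<otimes> x \<oplus> z \<otimes> y"
    and smult_closed: "\<And>c x. x \<in> carrier A \<Longrightarrow> c \<odot> x \<in> carrier A"
    and smult_zero: "\<And>x. x \<in> carrier A \<Longrightarrow> 0 \<odot> x = \<zero>"
    and smult_one: "\<And>x. x \<in> carrier A \<Longrightarrow> 1 \<odot> x = x"
    and smult_l_distr: "\<And>a b x. x \<in> carrier A \<Longrightarrow> (a + b) \<odot> x = a \<odot> x \<oplus> b \<odot> x"
    and smult_r_distr: "\<And>c x y. x \<in> carrier A \<Longrightarrow> y \<in> carrier A \<Longrightarrow> c \<odot> (x \<oplus> y) = c \<odot> x \<oplus> c \<odot> y"
    and smult_assoc1: "\<And>a b x. x \<in> carrier A \<Longrightarrow> (a * b) \<odot> x = a \<odot> (b \<odot> x)"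
    and smult_assoc2: "\<And>c x y. x \<in> carrier A \<Longrightarrow> y \<in> carrier A \<Longrightarrow> (c \<odot> x) \<otimes> y = c \<odot> (x \<otimes> y)"
    and smult_assoc3: "\<And>c x y. x \<in> carrier A \<Longrightarrow> y \<in> carrier A \<Longrightarrow> x \<otimes> (c \<odot> y) = c \<odot> (x \<otimes> y)"
  shows "kalg A"
proof -
  have "\<exists>y\<in>carrier A. y \<oplus> x = \<zero>" if x: "x \<in> carrier A" for x
    by (rule bexI[of _ "(- 1) \<odot> x"])
      (use smult_l_distr[OF x, of "- 1" 1] x smult_zero smult_one smult_closed in auto)
  then have "abelian_group A"
    by (intro abelian_groupI add_closed zero_closed add_assoc add_comm l_zero)
  moreover have "monoid A"
    by (intro monoidI mult_closed one_closed mult_assoc l_one r_one)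
  ultimately have "ring A"
    by (intro ringI l_distr r_distr)
  then show ?thesis
    by (intro kalg.intro kalg_axioms.intro smult_closed smult_one smult_l_distr smult_r_distr
        smult_assoc1 smult_assoc2 smult_assoc3)
qed

context kalg
begin

text \<open>Since \<open>c \<odot> x = (c \<odot> \<one>) \<otimes> x\<close>, a two-sided ideal is
  automatically a subspace, and the ring quotient is already an algebra quotient.\<close>

lemma ideal_smult: assumes "ideal I A" "x \<in> I" shows "c \<odot> x \<in> I"
proof -
  interpret ideal I A by fact
  show ?thesis using assms(2) smult_eq_one_mult[of x c] I_l_closed Icarr by auto
qed

text \<open>Makes the scalar multiplication of \<open>alg_quot\<close> computable: it is a union
  over all representatives, and each of them contributes the same coset because the ideal absorbs
  scalars.\<close>

lemma smult_coset:
  assumes "ideal I A" "x \<in> carrier A"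
  shows "(\<Union>y\<in>I +> x. I +> (c \<odot> y)) = I +> (c \<odot> x)"
proof -
  interpret ideal I A by fact
  have "I +> (c \<odot> y) = I +> (c \<odot> x)" if "y \<in> I +> x" for y
  proof -
    obtain i where i: "i \<in> I" "y = i \<oplus> x" using \<open>y \<in> I +> x\<close> by (auto simp: a_r_coset_def')
    then have "c \<odot> y = c \<odot> i \<oplus> c \<odot> x" using assms Icarr by (simp add: smult_r_distr)
    then have "c \<odot> y \<in> I +> (c \<odot> x)"
      using ideal_smult[OF assms(1) i(1)] by (auto simp: a_r_coset_def')
    then show ?thesis
      using a_repr_independence'[of "c \<odot> y" "c \<odot> x"] assms(2) by simp
  qed
  moreover have "x \<in> I +> x" using assms a_rcos_self by auto
  ultimately show ?thesis by blast
qed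

context
  fixes S assumes S: "S \<subseteq> carrier A"
begin

lemma idl: "ideal (Idl S) A"
  using S by (rule genideal_ideal)

lemma alg_quot_class_add: "x \<in> carrier A \<Longrightarrow> y \<in> carrier A \<Longrightarrow>
    alg_quot_class A S x \<oplus>\<^bsub>alg_quot A S\<^esub> alg_quot_class A S y = alg_quot_class A S (x \<oplus> y)"
  and alg_quot_class_mult: "x \<in> carrier A \<Longrightarrow> y \<in> carrier A \<Longrightarrow>
    alg_quot_class A S x \<otimes>\<^bsub>alg_quot A S\<^esub> alg_quot_class A S y = alg_quot_class A S (x \<otimes> y)"
  and alg_quot_class_smult: "x \<in> carrier A \<Longrightarrow>
    c \<odot>\<^bsub>alg_quot A S\<^esub> alg_quot_class A S x = alg_quot_class A S (c \<odot> x)"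
  and alg_quot_one: "\<one>\<^bsub>alg_quot A S\<^esub> = alg_quot_class A S \<one>"
  and alg_quot_carrier: "carrier (alg_quot A S) = alg_quot_class A S ` carrier A"
proof -
  interpret ideal "Idl S" A by (rule idl)
  note h = rcos_ring_hom
  show "x \<in> carrier A \<Longrightarrow> y \<in> carrier A \<Longrightarrow>
    alg_quot_class A S x \<oplus>\<^bsub>alg_quot A S\<^esub> alg_quot_class A S y = alg_quot_class A S (x \<oplus> y)"
    using h by (auto simp: alg_quot_def alg_quot_class_def ring_hom_def)
  show "x \<in> carrier A \<Longrightarrow> y \<in> carrier A \<Longrightarrow>
    alg_quot_class A S x \<otimes>\<^bsub>alg_quot A S\<^esub> alg_quot_class A S y = alg_quot_class A S (x \<otimes> y)"
    using h by (auto simp: alg_quot_def alg_quot_class_def ring_hom_def)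
  show "x \<in> carrier A \<Longrightarrow>
    c \<odot>\<^bsub>alg_quot A S\<^esub> alg_quot_class A S x = alg_quot_class A S (c \<odot> x)"
    using smult_coset[OF idl] by (simp add: alg_quot_def alg_quot_class_def)
  show "\<one>\<^bsub>alg_quot A S\<^esub> = alg_quot_class A S \<one>"
    using h by (auto simp: alg_quot_def alg_quot_class_def ring_hom_def)
  show "carrier (alg_quot A S) = alg_quot_class A S ` carrier A"
    by (auto simp: alg_quot_def alg_quot_class_def FactRing_def A_RCOSETS_def')
qed

lemma alg_quot_zero: "\<zero>\<^bsub>alg_quot A S\<^esub> = alg_quot_class A S \<zero>"
proof -
  interpret ideal "Idl S" A by (rule idl)
  show ?thesis
    by (simp add: alg_quot_def FactRing_def alg_quot_class_def a_rcos_zero idl)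
qed

lemma kalg_alg_quot: "kalg (alg_quot A S)"
  by (rule kalgI) (auto simp: alg_quot_carrier alg_quot_class_add alg_quot_class_mult
        alg_quot_class_smult alg_quot_one alg_quot_zero a_ac m_assoc l_distr r_distr
        smult_l_distr smult_r_distr smult_assoc1 smult_assoc2 smult_assoc3)

lemma alg_quot_class_hom: "alg_quot_class A S \<in> alg_hom A (alg_quot A S)"
  by (rule alg_homI) (auto simp: alg_quot_carrier alg_quot_class_add alg_quot_class_mult
      alg_quot_class_smult alg_quot_one)

lemma alg_quot_class_eq_zero: "s \<in> S \<Longrightarrow> alg_quot_class A S s = \<zero>\<^bsub>alg_quot A S\<^esub>"
proof -
  interpret I: ideal "Idl S" A by (rule idl)
  assume "s \<in> S"
  then have "s \<in> Idl S" using genideal_self[OF S] by auto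
  then show ?thesis
    by (simp add: alg_quot_class_def alg_quot_def FactRing_def I.a_rcos_const)
qed

text \<open>The universal property of the quotient: the kernel of \<open>h\<close> is an ideal
  containing \<open>S\<close>, hence contains the ideal generated by \<open>S\<close>, and
  \<open>h\<close> is constant on cosets.\<close>

lemma alg_quot_lift:
  assumes B: "kalg B" and h: "h \<in> alg_hom A B" and z: "\<And>s. s \<in> S \<Longrightarrow> h s = \<zero>\<^bsub>B\<^esub>"
  shows "\<exists>g\<in>alg_hom (alg_quot A S) B. \<forall>x\<in>carrier A. g (alg_quot_class A S x) = h x"
proof -
  interpret I: ideal "Idl S" A by (rule idl)
  interpret h: alg_morphism A B h by (rule alg_morphismI[OF kalg_axioms B h])
  have "ring_hom_ring A B h"
    by (rule ring_hom_ringI2[OF ring_axioms h.B.ring_axioms]) (use h in \<open>simp add: alg_hom_def\<close>)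
  then have "Idl S \<subseteq> a_kernel A B h"
    by (rule genideal_minimal[OF ring_hom_ring.kernel_is_ideal]) (use z S in \<open>auto simp: a_kernel_def'\<close>)
  then have ker: "h i = \<zero>\<^bsub>B\<^esub>" if "i \<in> Idl S" for i using that by (auto simp: a_kernel_def')
  have im: "h ` alg_quot_class A S x = {h x}" if x: "x \<in> carrier A" for x
  proof -
    have "h y = h x" if "y \<in> alg_quot_class A S x" for y
      using that x ker I.Icarr by (auto simp: alg_quot_class_def a_r_coset_def')
    moreover have "x \<in> alg_quot_class A S x"
      using x I.a_rcos_self by (simp add: alg_quot_class_def)
    ultimately show ?thesis by blast
  qed
  \<comment> \<open>The image of a coset is a singleton, so \<open>the_elem\<close> yields the
    common value without choosing a representative.\<close>
  define g where "g X = the_elem (h ` X)" for X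
  have g: "g (alg_quot_class A S x) = h x" if "x \<in> carrier A" for x
    using im[OF that] by (simp add: g_def)
  have "g \<in> alg_hom (alg_quot A S) B"
    by (rule alg_homI) (auto simp: alg_quot_carrier alg_quot_class_add alg_quot_class_mult
        alg_quot_class_smult alg_quot_one g)
  with g show ?thesis by blast
qed

lemma alg_quot_generated:
  assumes "G \<subseteq> carrier A" "alg_gen A G = carrier A"
  shows "alg_gen (alg_quot A S) (alg_quot_class A S ` G) = carrier (alg_quot A S)"
proof -
  interpret alg_morphism A "alg_quot A S" "alg_quot_class A S"
    by (intro alg_morphismI kalg_axioms kalg_alg_quot alg_quot_class_hom)
  show ?thesis using surj_generated[OF assms] by (simp add: alg_quot_carrier)
qed

end

end

section \<open>Monoid algebras and presented algebras\<close>

lemma (in ring) minus_eq_zeroD: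
  assumes "x \<ominus> y = \<zero>" "x \<in> carrier R" "y \<in> carrier R" shows "x = y"
  using assms minus_equality[of x "\<ominus> y"] by (simp add: a_minus_def)

lemma monoid_algebra_simps [simp]:
  "carrier (monoid_algebra M) = {p. Poly_Mapping.keys p \<subseteq> carrier M}"
  "\<one>\<^bsub>monoid_algebra M\<^esub> = Poly_Mapping.single \<one>\<^bsub>M\<^esub> 1"
  "\<zero>\<^bsub>monoid_algebra M\<^esub> = 0"
  "p \<oplus>\<^bsub>monoid_algebra M\<^esub> q = p + q"
  "c \<odot>\<^bsub>monoid_algebra M\<^esub> p = Poly_Mapping.map ((*) c) p"
  by (simp_all add: monoid_algebra_def)

lemma lookup_smult: "Poly_Mapping.lookup (Poly_Mapping.map ((*) c) p) a = c * Poly_Mapping.lookup p a"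
  for c :: "'k::field"
  by (simp add: Poly_Mapping.map.rep_eq when_def)

lemma keys_smult: "Poly_Mapping.keys (Poly_Mapping.map ((*) c) p) \<subseteq> Poly_Mapping.keys p"
  for c :: "'k::field"
  by (auto simp: in_keys_iff lookup_smult)

lemma smult_single: "Poly_Mapping.map ((*) c) (Poly_Mapping.single a b) = Poly_Mapping.single a (c * b)"
  for c :: "'k::field"
  by (rule poly_mapping_eqI) (simp add: lookup_smult lookup_single when_def)

lemma sum_single_keys:
  assumes "finite P" "Poly_Mapping.keys p \<subseteq> P"
  shows "(\<Sum>a\<in>P. Poly_Mapping.single a (Poly_Mapping.lookup p a)) = p"
proof (rule poly_mapping_eqI)
  fix b
  have "Poly_Mapping.lookup (\<Sum>a\<in>P. Poly_Mapping.single a (Poly_Mapping.lookup p a)) b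
      = (\<Sum>a\<in>P. if a = b then Poly_Mapping.lookup p b else 0)"
    by (auto simp: lookup_sum lookup_single when_def intro!: sum.cong)
  also have "\<dots> = Poly_Mapping.lookup p b"
    using assms by (auto simp: in_keys_iff)
  finally show "Poly_Mapping.lookup (\<Sum>a\<in>P. Poly_Mapping.single a (Poly_Mapping.lookup p a)) b
      = Poly_Mapping.lookup p b" .
qed

context
  fixes M :: "'a monoid"
begin

private abbreviation mm (infixl \<open>**\<close> 70) where
  "p ** q \<equiv> p \<otimes>\<^bsub>monoid_algebra M :: ('k::field, 'a \<Rightarrow>\<^sub>0 'k) module\<^esub> q"

text \<open>The convolution may be summed over any finite sets containing the supports, so that
  elements with different supports can be brought to a common index set.\<close>

lemma monoid_algebra_mult:
  fixes p q :: "'a \<Rightarrow>\<^sub>0 'k::field"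
  assumes "finite P" "finite Q" "Poly_Mapping.keys p \<subseteq> P" "Poly_Mapping.keys q \<subseteq> Q"
  shows "p ** q = (\<Sum>a\<in>P. \<Sum>b\<in>Q.
    Poly_Mapping.single (a \<otimes>\<^bsub>M\<^esub> b) (Poly_Mapping.lookup p a * Poly_Mapping.lookup q b))"
proof -
  have "p ** q = (\<Sum>a\<in>Poly_Mapping.keys p. \<Sum>b\<in>Poly_Mapping.keys q.
    Poly_Mapping.single (a \<otimes>\<^bsub>M\<^esub> b) (Poly_Mapping.lookup p a * Poly_Mapping.lookup q b))"
    by (simp add: monoid_algebra_def)
  also have "\<dots> = (\<Sum>a\<in>Poly_Mapping.keys p. \<Sum>b\<in>Q.
    Poly_Mapping.single (a \<otimes>\<^bsub>M\<^esub> b) (Poly_Mapping.lookup p a * Poly_Mapping.lookup q b))"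
    using assms by (intro sum.cong sum.mono_neutral_left) (auto simp: in_keys_iff)
  also have "\<dots> = (\<Sum>a\<in>P. \<Sum>b\<in>Q.
    Poly_Mapping.single (a \<otimes>\<^bsub>M\<^esub> b) (Poly_Mapping.lookup p a * Poly_Mapping.lookup q b))"
    using assms by (intro sum.mono_neutral_left) (auto simp: in_keys_iff)
  finally show ?thesis .
qed

lemma monoid_algebra_l_distr:
  fixes p q s :: "'a \<Rightarrow>\<^sub>0 'k::field"
  shows "(p + q) ** s = p ** s + q ** s"
proof -
  let ?P = "Poly_Mapping.keys p \<union> Poly_Mapping.keys q"
  show ?thesis
    using keys_add[of p q] by (simp add: monoid_algebra_mult[of ?P "Poly_Mapping.keys s"]
      lookup_add distrib_right single_add sum.distrib)
qed

lemma monoid_algebra_r_distr: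
  fixes p q s :: "'a \<Rightarrow>\<^sub>0 'k::field"
  shows "s ** (p + q) = s ** p + s ** q"
proof -
  let ?P = "Poly_Mapping.keys p \<union> Poly_Mapping.keys q"
  show ?thesis
    using keys_add[of p q] by (simp add: monoid_algebra_mult[of "Poly_Mapping.keys s" ?P]
      lookup_add distrib_left single_add sum.distrib)
qed

lemma monoid_algebra_zero_mult: "0 ** q = 0" "q ** 0 = 0"
  by (simp_all add: monoid_algebra_def)

lemma monoid_algebra_sum_mult:
  fixes q :: "'a \<Rightarrow>\<^sub>0 'k::field"
  shows "sum f A ** q = (\<Sum>a\<in>A. f a ** q)" "q ** sum f A = (\<Sum>a\<in>A. q ** f a)"
  by (induction A rule: infinite_finite_induct)
    (simp_all add: monoid_algebra_l_distr monoid_algebra_r_distr monoid_algebra_zero_mult)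

lemma single_mult_single:
  "Poly_Mapping.single a c ** Poly_Mapping.single b d = Poly_Mapping.single (a \<otimes>\<^bsub>M\<^esub> b) (c * d)"
  for c d :: "'k::field"
  by (subst monoid_algebra_mult[of "{a}" "{b}"]) auto

lemma keys_sum_subset:
  assumes "\<And>a. a \<in> A \<Longrightarrow> Poly_Mapping.keys (f a) \<subseteq> S"
  shows "Poly_Mapping.keys (\<Sum>a\<in>A. f a) \<subseteq> S"
  using assms
proof (induction A rule: infinite_finite_induct)
  case (insert x F)
  then show ?case using keys_add[of "f x" "sum f F"] by force
qed auto

lemma monoid_algebra_single_decomp:
  fixes p q :: "'a \<Rightarrow>\<^sub>0 'k::field"
  shows "p ** q = (\<Sum>a\<in>Poly_Mapping.keys p. \<Sum>b\<in>Poly_Mapping.keys q.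
    Poly_Mapping.single (a \<otimes>\<^bsub>M\<^esub> b) (Poly_Mapping.lookup p a * Poly_Mapping.lookup q b))"
  by (simp add: monoid_algebra_mult)

text \<open>Convolution is biadditive, so once elements are written as sums of singles,
  associativity and the unit laws reduce to those of \<open>M\<close>.\<close>

lemma kalg_monoid_algebra:
  assumes "monoid M" shows "kalg (monoid_algebra M :: ('k::field, 'a \<Rightarrow>\<^sub>0 'k) module)"
proof -
  interpret M: monoid M by fact
  have dec: "(\<Sum>a\<in>Poly_Mapping.keys p. Poly_Mapping.single a (Poly_Mapping.lookup p a)) = p"
    for p :: "'a \<Rightarrow>\<^sub>0 'k"
    by (rule sum_single_keys) auto
  have assoc: "(p ** q) ** s = p ** (q ** s)"
    if "Poly_Mapping.keys p \<subseteq> carrier M" "Poly_Mapping.keys q \<subseteq> carrier M"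
      "Poly_Mapping.keys s \<subseteq> carrier M" for p q s :: "'a \<Rightarrow>\<^sub>0 'k"
  proof -
    have "((\<Sum>a\<in>Poly_Mapping.keys p. Poly_Mapping.single a (Poly_Mapping.lookup p a)) **
        (\<Sum>a\<in>Poly_Mapping.keys q. Poly_Mapping.single a (Poly_Mapping.lookup q a))) **
        (\<Sum>a\<in>Poly_Mapping.keys s. Poly_Mapping.single a (Poly_Mapping.lookup s a)) =
       (\<Sum>a\<in>Poly_Mapping.keys p. Poly_Mapping.single a (Poly_Mapping.lookup p a)) **
        ((\<Sum>a\<in>Poly_Mapping.keys q. Poly_Mapping.single a (Poly_Mapping.lookup q a)) **
        (\<Sum>a\<in>Poly_Mapping.keys s. Poly_Mapping.single a (Poly_Mapping.lookup s a)))"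
      unfolding monoid_algebra_sum_mult single_mult_single
      by (subst sum.swap, rule sum.cong[OF refl])+
        (use that in \<open>auto simp: M.m_assoc subset_iff mult.assoc intro!: sum.cong\<close>)
    then show ?thesis by (simp add: dec)
  qed
  have one: "Poly_Mapping.single \<one>\<^bsub>M\<^esub> 1 ** p = p" "p ** Poly_Mapping.single \<one>\<^bsub>M\<^esub> 1 = p"
    if "Poly_Mapping.keys p \<subseteq> carrier M" for p :: "'a \<Rightarrow>\<^sub>0 'k"
  proof -
    have "Poly_Mapping.single \<one>\<^bsub>M\<^esub> 1 **
        (\<Sum>a\<in>Poly_Mapping.keys p. Poly_Mapping.single a (Poly_Mapping.lookup p a)) =
        (\<Sum>a\<in>Poly_Mapping.keys p. Poly_Mapping.single a (Poly_Mapping.lookup p a))"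
      unfolding monoid_algebra_sum_mult single_mult_single
      using that by (auto intro!: sum.cong)
    then show "Poly_Mapping.single \<one>\<^bsub>M\<^esub> 1 ** p = p" by (simp add: dec)
    have "(\<Sum>a\<in>Poly_Mapping.keys p. Poly_Mapping.single a (Poly_Mapping.lookup p a)) **
        Poly_Mapping.single \<one>\<^bsub>M\<^esub> 1 =
        (\<Sum>a\<in>Poly_Mapping.keys p. Poly_Mapping.single a (Poly_Mapping.lookup p a))"
      unfolding monoid_algebra_sum_mult single_mult_single
      using that by (auto intro!: sum.cong)
    then show "p ** Poly_Mapping.single \<one>\<^bsub>M\<^esub> 1 = p" by (simp add: dec)
  qed
  have smult: "Poly_Mapping.map ((*) c) p ** q = Poly_Mapping.map ((*) c) (p ** q)"
    "p ** Poly_Mapping.map ((*) c) q = Poly_Mapping.map ((*) c) (p ** q)" for c and p q :: "'a \<Rightarrow>\<^sub>0 'k"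
  proof -
    have *: "Poly_Mapping.map ((*) c) (sum f A) = (\<Sum>a\<in>A. Poly_Mapping.map ((*) c) (f a))"
      for f :: "'a \<Rightarrow> 'a \<Rightarrow>\<^sub>0 'k" and A
      by (rule poly_mapping_eqI) (simp add: lookup_smult lookup_sum sum_distrib_left)
    show "Poly_Mapping.map ((*) c) p ** q = Poly_Mapping.map ((*) c) (p ** q)"
      by (simp add: monoid_algebra_mult[of "Poly_Mapping.keys p" "Poly_Mapping.keys q"] keys_smult
         lookup_smult * smult_single mult.assoc)
    show "p ** Poly_Mapping.map ((*) c) q = Poly_Mapping.map ((*) c) (p ** q)"
      by (simp add: monoid_algebra_mult[of "Poly_Mapping.keys p" "Poly_Mapping.keys q"] keys_smult
         lookup_smult * smult_single mult_ac)
  qed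
  show ?thesis
  proof (rule kalgI)
    fix x y :: "'a \<Rightarrow>\<^sub>0 'k" assume xy: "x \<in> carrier (monoid_algebra M)" "y \<in> carrier (monoid_algebra M)"
    then show "x \<oplus>\<^bsub>monoid_algebra M\<^esub> y \<in> carrier (monoid_algebra M)"
      using keys_add[of x y] by auto
    have "Poly_Mapping.keys (x ** y) \<subseteq> carrier M"
      unfolding monoid_algebra_single_decomp
      by (intro keys_sum_subset) (use xy in \<open>auto split: if_splits\<close>)
    then show "x ** y \<in> carrier (monoid_algebra M)" by simp
  qed (auto simp: assoc one smult monoid_algebra_l_distr monoid_algebra_r_distr ac_simps
      keys_smult[THEN subsetD] lookup_smult lookup_add algebra_simps
      intro!: poly_mapping_eqI dest!: subsetD[OF keys_smult])
qed

end

lemma monoid_algebra_generated: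
  assumes "monoid M"
  shows "alg_gen (monoid_algebra M :: ('k::field, 'a \<Rightarrow>\<^sub>0 'k) module)
    ((\<lambda>a. Poly_Mapping.single a 1) ` carrier M) = carrier (monoid_algebra M)"
    (is "alg_gen ?A ?G = _")
proof -
  interpret kalg ?A using assms by (rule kalg_monoid_algebra)
  have G: "?G \<subseteq> carrier ?A" by auto
  have "p \<in> alg_gen ?A ?G" if p: "Poly_Mapping.keys p \<subseteq> carrier M" for p
  proof -
    \<comment> \<open>Addition in the algebra is that of the type, hence sums formed in the type and
      in the ring agree.\<close>
    have sum: "(\<Sum>a\<in>S. f a) = (\<Oplus>\<^bsub>?A\<^esub>a\<in>S. f a)" if "finite S" "f \<in> S \<rightarrow> carrier ?A" for f and S :: "'a set"
      using that by (induction S rule: finite_induct)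
        (auto simp: Pi_iff finsum_insert[unfolded Pi_iff] finsum_empty)
    have "(\<Oplus>\<^bsub>?A\<^esub>a\<in>Poly_Mapping.keys p. Poly_Mapping.lookup p a \<odot>\<^bsub>?A\<^esub> Poly_Mapping.single a 1) \<in> alg_gen ?A ?G"
      using p by (intro alg_gen_finsum G finite_keys Pi_I alg_gen.smult alg_gen.gen) auto
    also have "(\<Oplus>\<^bsub>?A\<^esub>a\<in>Poly_Mapping.keys p. Poly_Mapping.lookup p a \<odot>\<^bsub>?A\<^esub> Poly_Mapping.single a 1) =
        (\<Sum>a\<in>Poly_Mapping.keys p. Poly_Mapping.lookup p a \<odot>\<^bsub>?A\<^esub> Poly_Mapping.single a 1)"
      using p by (intro sum[symmetric]) (auto simp: smult_single split: if_splits)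
    also have "\<dots> = p"
      by (simp add: smult_single sum_single_keys)
    finally show ?thesis .
  qed
  then show ?thesis using alg_gen_closed[OF _ G] by auto
qed

text \<open>The universal property: a multiplicative map on \<open>M\<close> extends linearly. It
  serves both free algebras, where \<open>M\<close> consists of words, and tensor products, where
  \<open>M\<close> consists of families of elements.\<close>

lemma monoid_algebra_lift:
  fixes M :: "'a monoid" and B :: "('k::field, 'b) module"
  assumes M: "monoid M" and B: "kalg B"
    and h: "\<And>a. a \<in> carrier M \<Longrightarrow> h a \<in> carrier B"
    and h1: "h \<one>\<^bsub>M\<^esub> = \<one>\<^bsub>B\<^esub>"
    and hm: "\<And>a b. a \<in> carrier M \<Longrightarrow> b \<in> carrier M \<Longrightarrow> h (a \<otimes>\<^bsub>M\<^esub> b) = h a \<otimes>\<^bsub>B\<^esub> h b"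
  shows "\<exists>F\<in>alg_hom (monoid_algebra M) B.
    \<forall>a\<in>carrier M. \<forall>c. F (Poly_Mapping.single a c) = c \<odot>\<^bsub>B\<^esub> h a"
proof -
  interpret M: monoid M by fact
  interpret B: kalg B by fact
  interpret A: kalg "monoid_algebra M :: ('k, 'a \<Rightarrow>\<^sub>0 'k) module" using M by (rule kalg_monoid_algebra)
  define F where "F p = (\<Oplus>\<^bsub>B\<^esub>a\<in>Poly_Mapping.keys p. Poly_Mapping.lookup p a \<odot>\<^bsub>B\<^esub> h a)" for p
  \<comment> \<open>As with the convolution, summing over any finite set that contains the support
    turns additivity into a termwise statement.\<close>
  have F: "F p = (\<Oplus>\<^bsub>B\<^esub>a\<in>P. Poly_Mapping.lookup p a \<odot>\<^bsub>B\<^esub> h a)"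
    if "finite P" "Poly_Mapping.keys p \<subseteq> P" "P \<subseteq> carrier M" for p P
    unfolding F_def using that h
    by (intro B.add.finprod_mono_neutral_cong_left) (auto simp: in_keys_iff subset_iff)
  have F_closed: "F p \<in> carrier B" if "Poly_Mapping.keys p \<subseteq> carrier M" for p
    unfolding F_def using that h by (intro B.finsum_closed) auto
  have F_single: "F (Poly_Mapping.single a c) = c \<odot>\<^bsub>B\<^esub> h a" if "a \<in> carrier M" for a c
    using F[of "{a}" "Poly_Mapping.single a c"] h[OF that] that by (simp add: B.finsum_insert)
  have F_add: "F (p + q) = F p \<oplus>\<^bsub>B\<^esub> F q"
    if "Poly_Mapping.keys p \<subseteq> carrier M" "Poly_Mapping.keys q \<subseteq> carrier M" for p q
  proof -
    let ?P = "Poly_Mapping.keys p \<union> Poly_Mapping.keys q"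
    have "F (p + q) = (\<Oplus>\<^bsub>B\<^esub>a\<in>?P. Poly_Mapping.lookup (p + q) a \<odot>\<^bsub>B\<^esub> h a)"
      using that keys_add[of p q] by (intro F) auto
    also have "\<dots> = (\<Oplus>\<^bsub>B\<^esub>a\<in>?P. Poly_Mapping.lookup p a \<odot>\<^bsub>B\<^esub> h a \<oplus>\<^bsub>B\<^esub> Poly_Mapping.lookup q a \<odot>\<^bsub>B\<^esub> h a)"
      using that h by (intro B.finsum_cong') (auto simp: lookup_add B.smult_l_distr subset_iff)
    also have "\<dots> = F p \<oplus>\<^bsub>B\<^esub> F q"
      using that h by (subst B.finsum_addf) (auto simp: F[of ?P] subset_iff Pi_iff)
    finally show ?thesis .
  qed
  have F_zero: "F 0 = \<zero>\<^bsub>B\<^esub>" by (simp add: F_def)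
  have F_sum: "F (\<Sum>a\<in>S. f a) = (\<Oplus>\<^bsub>B\<^esub>a\<in>S. F (f a))"
    if "finite S" "\<And>a. a \<in> S \<Longrightarrow> Poly_Mapping.keys (f a) \<subseteq> carrier M" for f and S :: "'a set"
    using that
  proof (induction S rule: finite_induct)
    case (insert x S)
    then have "Poly_Mapping.keys (sum f S) \<subseteq> carrier M" by (intro keys_sum_subset) auto
    then show ?case using insert F_closed by (simp add: F_add B.finsum_insert Pi_iff)
  qed (simp add: F_zero)
  show ?thesis
  proof (intro bexI[of _ F] ballI allI)
    show "F \<in> alg_hom (monoid_algebra M) B"
    proof (rule alg_homI)
      fix x y :: "'a \<Rightarrow>\<^sub>0 'k"
      assume "x \<in> carrier (monoid_algebra M)" "y \<in> carrier (monoid_algebra M)"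
      then have x: "Poly_Mapping.keys x \<subseteq> carrier M" and y: "Poly_Mapping.keys y \<subseteq> carrier M" by auto
      let ?X = "Poly_Mapping.keys x" and ?Y = "Poly_Mapping.keys y"
      have k: "Poly_Mapping.keys (Poly_Mapping.single (a \<otimes>\<^bsub>M\<^esub> b) (c::'k)) \<subseteq> carrier M"
        if "a \<in> ?X" "b \<in> ?Y" for a b c using x y that by auto
      have "F (x \<otimes>\<^bsub>monoid_algebra M\<^esub> y) =
        (\<Oplus>\<^bsub>B\<^esub>a\<in>?X. \<Oplus>\<^bsub>B\<^esub>b\<in>?Y. F (Poly_Mapping.single (a \<otimes>\<^bsub>M\<^esub> b) (Poly_Mapping.lookup x a * Poly_Mapping.lookup y b)))"
        unfolding monoid_algebra_single_decomp
        by (subst F_sum, simp, intro keys_sum_subset k, assumption+)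
          (intro B.finsum_cong' refl F_sum funcsetI B.finsum_closed F_closed finite_keys k, assumption+)
      also have "\<dots> = (\<Oplus>\<^bsub>B\<^esub>a\<in>?X. \<Oplus>\<^bsub>B\<^esub>b\<in>?Y. (Poly_Mapping.lookup x a \<odot>\<^bsub>B\<^esub> h a) \<otimes>\<^bsub>B\<^esub> (Poly_Mapping.lookup y b \<odot>\<^bsub>B\<^esub> h b))"
        using x y h
        by (intro B.finsum_cong' refl)
          (auto simp: subset_iff F_single hm B.smult_assoc2 B.smult_assoc3 mult.commute
            simp flip: B.smult_assoc1 intro!: B.finsum_closed)
      also have "\<dots> = (\<Oplus>\<^bsub>B\<^esub>a\<in>?X. (Poly_Mapping.lookup x a \<odot>\<^bsub>B\<^esub> h a) \<otimes>\<^bsub>B\<^esub> F y)"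
        unfolding F_def using x y h
        by (intro B.finsum_cong' refl)
          (auto simp: subset_iff intro!: B.finsum_rdistr[symmetric] B.finsum_closed)
      also have "\<dots> = F x \<otimes>\<^bsub>B\<^esub> F y"
        unfolding F_def[of x] using x y h F_closed[OF y]
        by (intro B.finsum_ldistr[symmetric]) (auto simp: subset_iff)
      finally show "F (x \<otimes>\<^bsub>monoid_algebra M\<^esub> y) = F x \<otimes>\<^bsub>B\<^esub> F y" .
      fix c
      have "F (Poly_Mapping.map ((*) c) x) = (\<Oplus>\<^bsub>B\<^esub>a\<in>?X. c \<odot>\<^bsub>B\<^esub> (Poly_Mapping.lookup x a \<odot>\<^bsub>B\<^esub> h a))"
        using x h keys_smult[of c x] by (subst F[of ?X])
          (auto simp: lookup_smult subset_iff B.smult_assoc1 intro!: B.finsum_cong')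
      also have "\<dots> = c \<odot>\<^bsub>B\<^esub> F x"
        unfolding F_def using x h by (intro B.smult_finsum[symmetric]) (auto simp: subset_iff)
      finally show "F (c \<odot>\<^bsub>monoid_algebra M\<^esub> x) = c \<odot>\<^bsub>B\<^esub> F x" by simp
    qed (auto simp: F_add F_closed F_single h1)
  qed (rule F_single)
qed

section \<open>Free algebras\<close>

lemma monoid_free_monoid: "monoid (free_monoid G)"
  by (rule monoidI) (auto simp: free_monoid_def)

lemma kalg_free_algebra: "kalg (free_algebra G)"
  unfolding free_algebra_def by (rule kalg_monoid_algebra[OF monoid_free_monoid])

lemma free_gen_closed: "g \<in> G \<Longrightarrow> free_gen g \<in> carrier (free_algebra G)"
  by (simp add: free_algebra_def free_gen_def free_monoid_def)

lemma free_algebra_generated: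
  "alg_gen (free_algebra G) (free_gen ` G) = carrier (free_algebra G :: ('k::field, _) module)"
  (is "alg_gen ?A _ = _")
proof -
  interpret kalg ?A by (rule kalg_free_algebra)
  have G: "free_gen ` G \<subseteq> carrier ?A" by (auto intro: free_gen_closed)
  have w: "Poly_Mapping.single w 1 \<in> alg_gen ?A (free_gen ` G)" if "w \<in> lists G" for w
    using that
  proof (induction w)
    case Nil
    then show ?case using alg_gen.one[of ?A] by (simp add: free_algebra_def free_monoid_def)
  next
    case (Cons g w)
    then have "free_gen g \<otimes>\<^bsub>?A\<^esub> Poly_Mapping.single w 1 \<in> alg_gen ?A (free_gen ` G)"
      by (intro alg_gen.mult) (auto intro: alg_gen.gen)
    then show ?case
      by (simp add: free_gen_def free_algebra_def single_mult_single) (simp add: free_monoid_def)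
  qed
  have "x \<in> alg_gen ?A (free_gen ` G)" if "x \<in> carrier ?A" for x
  proof -
    have "x \<in> alg_gen ?A ((\<lambda>a. Poly_Mapping.single a 1) ` lists G)"
      using monoid_algebra_generated[OF monoid_free_monoid[of G], where 'k = 'k] that
      by (simp add: free_algebra_def free_monoid_def)
    then show ?thesis
      by induction (auto intro: w alg_gen.intros)
  qed
  then show ?thesis using alg_gen_closed[OF _ G] by auto
qed

text \<open>A word goes to the ordered product of the images of its letters, the empty word to
  1.\<close>

lemma free_algebra_lift:
  fixes B :: "('k::field, 'b) module"
  assumes B: "kalg B" and b: "\<And>g. g \<in> G \<Longrightarrow> b g \<in> carrier B"
  shows "\<exists>F\<in>alg_hom (free_algebra G) B. \<forall>g\<in>G. F (free_gen g) = b g"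
proof -
  interpret B: kalg B by fact
  define h where "h w = foldr (\<lambda>g y. b g \<otimes>\<^bsub>B\<^esub> y) w \<one>\<^bsub>B\<^esub>" for w
  have h: "h w \<in> carrier B" if "w \<in> lists G" for w
    using that by (induction w) (auto simp: h_def b)
  have hm: "h (w @ w') = h w \<otimes>\<^bsub>B\<^esub> h w'" if "w \<in> lists G" "w' \<in> lists G" for w w'
    using that(1)
  proof (induction w)
    case Nil
    then show ?case using h[OF that(2)] by (simp add: h_def)
  next
    case (Cons g w)
    then show ?case using h[OF that(2)] h[of w] b[of g] by (simp add: h_def B.m_assoc)
  qed
  have "\<exists>F\<in>alg_hom (monoid_algebra (free_monoid G)) B.
    \<forall>a\<in>carrier (free_monoid G). \<forall>c. F (Poly_Mapping.single a c) = c \<odot>\<^bsub>B\<^esub> h a"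
    by (rule monoid_algebra_lift[OF monoid_free_monoid B])
      (auto simp: free_monoid_def h hm, auto simp: h_def)
  then obtain F where F: "F \<in> alg_hom (free_algebra G) B"
    "\<And>a c. a \<in> carrier (free_monoid G) \<Longrightarrow> F (Poly_Mapping.single a c) = c \<odot>\<^bsub>B\<^esub> h a"
    unfolding free_algebra_def by blast
  have "F (free_gen g) = b g" if "g \<in> G" for g
    using F(2)[of "[g]" 1] b[OF that] that by (simp add: free_gen_def free_monoid_def h_def)
  with F(1) show ?thesis by blast
qed

section \<open>Algebras given by generators and relations\<close>

context
  fixes G :: "'g set" and R :: "(('g list \<Rightarrow>\<^sub>0 'k) \<times> ('g list \<Rightarrow>\<^sub>0 'k::field)) set"
  assumes R: "R \<subseteq> carrier (free_algebra G) \<times> carrier (free_algebra G)"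
begin

interpretation A: kalg "free_algebra G :: ('k, _) module" by (rule kalg_free_algebra)

lemma relators_closed: "relators G R \<subseteq> carrier (free_algebra G)"
  using R by (auto simp: relators_def intro!: A.minus_closed)

lemma kalg_presented_algebra: "kalg (presented_algebra G R)"
  unfolding presented_algebra_def by (rule A.kalg_alg_quot[OF relators_closed])

lemma presented_class_hom:
  "alg_quot_class (free_algebra G) (relators G R) \<in> alg_hom (free_algebra G) (presented_algebra G R)"
  unfolding presented_algebra_def by (rule A.alg_quot_class_hom[OF relators_closed])

lemma presented_gen_closed: "g \<in> G \<Longrightarrow> presented_gen G R g \<in> carrier (presented_algebra G R)"
  unfolding presented_gen_def presented_algebra_def
  by (auto simp: A.alg_quot_carrier[OF relators_closed] free_gen_closed)

lemma presented_generated: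
  "alg_gen (presented_algebra G R) (presented_gen G R ` G) = carrier (presented_algebra G R)"
  using A.alg_quot_generated[OF relators_closed image_subsetI[OF free_gen_closed] free_algebra_generated]
  by (simp add: presented_algebra_def presented_gen_def image_image)

lemma presented_relation:
  assumes "(p, q) \<in> R"
  shows "alg_quot_class (free_algebra G) (relators G R) p =
    alg_quot_class (free_algebra G) (relators G R) q"
proof -
  interpret alg_morphism "free_algebra G" "presented_algebra G R"
      "alg_quot_class (free_algebra G) (relators G R)"
    by (intro alg_morphismI A.kalg_axioms kalg_presented_algebra presented_class_hom)
  have pq: "p \<in> carrier (free_algebra G)" "q \<in> carrier (free_algebra G)" using assms R by auto
  have "p \<ominus>\<^bsub>free_algebra G\<^esub> q \<in> relators G R" using assms by (auto simp: relators_def)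
  from A.alg_quot_class_eq_zero[OF relators_closed this] show ?thesis
    using pq B.minus_eq_zeroD by (simp flip: presented_algebra_def)
qed

text \<open>Relations are pairs of elements of the free algebra, built with its operations. Hence
  the requirement is phrased through the homomorphisms \<open>F\<close> extending \<open>b\<close>:
  in applications they push these expressions forward to the same expressions in
  \<open>B\<close>.\<close>

lemma presented_lift:
  fixes B :: "('k, 'b) module"
  assumes B: "kalg B" and b: "\<And>g. g \<in> G \<Longrightarrow> b g \<in> carrier B"
    and rel: "\<And>F p q. F \<in> alg_hom (free_algebra G) B \<Longrightarrow> (\<And>g. g \<in> G \<Longrightarrow> F (free_gen g) = b g) \<Longrightarrow>
      (p, q) \<in> R \<Longrightarrow> F p = F q"
  shows "\<exists>h\<in>alg_hom (presented_algebra G R) B. \<forall>g\<in>G. h (presented_gen G R g) = b g"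
proof -
  obtain F where F: "F \<in> alg_hom (free_algebra G) B" "\<And>g. g \<in> G \<Longrightarrow> F (free_gen g) = b g"
    using free_algebra_lift[where b = b and G = G, OF B b] by blast
  interpret F: alg_morphism "free_algebra G" B F
    by (rule alg_morphismI[OF A.kalg_axioms B F(1)])
  have z: "F s = \<zero>\<^bsub>B\<^esub>" if s: "s \<in> relators G R" for s
  proof -
    obtain p q where pq: "s = p \<ominus>\<^bsub>free_algebra G\<^esub> q" "(p, q) \<in> R" using s unfolding relators_def by blast
    moreover have "p \<in> carrier (free_algebra G)" "q \<in> carrier (free_algebra G)" using pq R by auto
    ultimately show ?thesis using rel[OF F, of p q] by (simp add: a_minus_def F.B.r_neg)
  qed
  obtain h where h: "h \<in> alg_hom (alg_quot (free_algebra G) (relators G R)) B"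
      "\<And>x. x \<in> carrier (free_algebra G) \<Longrightarrow> h (alg_quot_class (free_algebra G) (relators G R) x) = F x"
    using A.alg_quot_lift[OF relators_closed B F(1) z] by blast
  then have "\<forall>g\<in>G. h (presented_gen G R g) = b g"
    using F(2) by (simp add: presented_gen_def h(2) free_gen_closed)
  with h(1) show ?thesis by (auto simp: presented_algebra_def)
qed

end

section \<open>Tensor products\<close>

locale tensor_factors =
  fixes I :: "'i set" and A :: "'i \<Rightarrow> ('k::field, 'a) module"
  assumes factor: "\<And>i. i \<in> I \<Longrightarrow> kalg (A i)"
begin

abbreviation "T \<equiv> tensor_algebra I A"

abbreviation (input) "fun_one \<equiv> (\<lambda>j\<in>I. \<one>\<^bsub>A j\<^esub>)"

text \<open>Pure tensors: the family \<open>f\<close> stands for the tensor product of its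
  components.\<close>

definition pure :: "('i \<Rightarrow> 'a) \<Rightarrow> (('i \<Rightarrow> 'a) \<Rightarrow>\<^sub>0 'k) set" where
  "pure f = alg_quot_class (tensor_basis I A) (multilinear_relators I A) (Poly_Mapping.single f 1)"

text \<open>The canonical map of the factor \<open>i\<close> into the tensor product, with
  \<open>x\<close> in place \<open>i\<close> and 1 in all other places.\<close>

definition tensor_incl :: "'i \<Rightarrow> 'a \<Rightarrow> (('i \<Rightarrow> 'a) \<Rightarrow>\<^sub>0 'k) set" where
  "tensor_incl i x = pure (fun_one(i := x))"

lemma factor_closed:
  "i \<in> I \<Longrightarrow> \<one>\<^bsub>A i\<^esub> \<in> carrier (A i)"
  "i \<in> I \<Longrightarrow> x \<in> carrier (A i) \<Longrightarrow> y \<in> carrier (A i) \<Longrightarrow> x \<otimes>\<^bsub>A i\<^esub> y \<in> carrier (A i)"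
  "i \<in> I \<Longrightarrow> x \<in> carrier (A i) \<Longrightarrow> y \<in> carrier (A i) \<Longrightarrow> x \<oplus>\<^bsub>A i\<^esub> y \<in> carrier (A i)"
  "i \<in> I \<Longrightarrow> x \<in> carrier (A i) \<Longrightarrow> c \<odot>\<^bsub>A i\<^esub> x \<in> carrier (A i)"
  "i \<in> I \<Longrightarrow> x \<in> carrier (A i) \<Longrightarrow> \<one>\<^bsub>A i\<^esub> \<otimes>\<^bsub>A i\<^esub> x = x"
  "i \<in> I \<Longrightarrow> x \<in> carrier (A i) \<Longrightarrow> x \<otimes>\<^bsub>A i\<^esub> \<one>\<^bsub>A i\<^esub> = x"
proof -
  assume "i \<in> I"
  then interpret kalg "A i" by (rule factor)
  show "\<one>\<^bsub>A i\<^esub> \<in> carrier (A i)"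
    "x \<in> carrier (A i) \<Longrightarrow> y \<in> carrier (A i) \<Longrightarrow> x \<otimes>\<^bsub>A i\<^esub> y \<in> carrier (A i)"
    "x \<in> carrier (A i) \<Longrightarrow> y \<in> carrier (A i) \<Longrightarrow> x \<oplus>\<^bsub>A i\<^esub> y \<in> carrier (A i)"
    "x \<in> carrier (A i) \<Longrightarrow> c \<odot>\<^bsub>A i\<^esub> x \<in> carrier (A i)"
    "x \<in> carrier (A i) \<Longrightarrow> \<one>\<^bsub>A i\<^esub> \<otimes>\<^bsub>A i\<^esub> x = x"
    "x \<in> carrier (A i) \<Longrightarrow> x \<otimes>\<^bsub>A i\<^esub> \<one>\<^bsub>A i\<^esub> = x"
    by auto
qed

text \<open>Of its factors \<open>product_group\<close> uses only multiplication and unit; applied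
  to algebras it forms the product of the multiplicative monoids.\<close>

lemma monoid_product: "monoid (product_group I A)"
proof -
  have assoc: "x \<otimes>\<^bsub>A i\<^esub> y \<otimes>\<^bsub>A i\<^esub> z = x \<otimes>\<^bsub>A i\<^esub> (y \<otimes>\<^bsub>A i\<^esub> z)"
    if "i \<in> I" "x \<in> carrier (A i)" "y \<in> carrier (A i)" "z \<in> carrier (A i)" for i x y z
  proof -
    interpret kalg "A i" using that(1) by (rule factor)
    show ?thesis using that by (simp add: m_assoc)
  qed
  show ?thesis
    by (rule monoidI) (auto simp: PiE_iff factor_closed assoc restrict_def fun_eq_iff extensional_def)
qed

lemma kalg_tensor_basis: "kalg (tensor_basis I A)"
  unfolding tensor_basis_def by (rule kalg_monoid_algebra[OF monoid_product])

lemma upd_PiE: "f \<in> (\<Pi>\<^sub>E j\<in>I. carrier (A j)) \<Longrightarrow> i \<in> I \<Longrightarrow> x \<in> carrier (A i) \<Longrightarrow>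
    f(i := x) \<in> (\<Pi>\<^sub>E j\<in>I. carrier (A j))"
  by (auto simp: PiE_iff extensional_def)

lemma single_closed: "f \<in> (\<Pi>\<^sub>E j\<in>I. carrier (A j)) \<Longrightarrow>
    Poly_Mapping.single f c \<in> carrier (tensor_basis I A)"
  by (simp add: tensor_basis_def)

lemma relators_subset: "multilinear_relators I A \<subseteq> carrier (tensor_basis I A)"
proof -
  have diff: "p - q \<in> carrier (tensor_basis I A)"
    if "p \<in> carrier (tensor_basis I A)" "q \<in> carrier (tensor_basis I A)" for p q :: "('i \<Rightarrow> 'a) \<Rightarrow>\<^sub>0 'k"
    using that keys_diff[of p q] by (auto simp: tensor_basis_def simp del: carrier_product_group)
  have add: "p + q \<in> carrier (tensor_basis I A)"
    if "p \<in> carrier (tensor_basis I A)" "q \<in> carrier (tensor_basis I A)" for p q :: "('i \<Rightarrow> 'a) \<Rightarrow>\<^sub>0 'k"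
    using that keys_add[of p q] by (auto simp: tensor_basis_def simp del: carrier_product_group)
  show ?thesis
    unfolding multilinear_relators_def
    by (auto intro!: diff add single_closed simp: factor_closed)
qed

sublocale B: kalg "tensor_basis I A" by (rule kalg_tensor_basis)

lemma kalg_tensor: "kalg T"
  unfolding tensor_algebra_def by (rule B.kalg_alg_quot[OF relators_subset])

sublocale T: kalg T by (rule kalg_tensor)

sublocale cls: alg_morphism "tensor_basis I A" T
    "alg_quot_class (tensor_basis I A) (multilinear_relators I A)"
  by (intro alg_morphismI B.kalg_axioms T.kalg_axioms)
    (unfold tensor_algebra_def, rule B.alg_quot_class_hom[OF relators_subset])

lemma pure_closed: "f \<in> (\<Pi>\<^sub>E j\<in>I. carrier (A j)) \<Longrightarrow> pure f \<in> carrier T"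
  by (simp add: pure_def single_closed)

lemma pure_mult:
  assumes "f \<in> (\<Pi>\<^sub>E j\<in>I. carrier (A j))" "g \<in> (\<Pi>\<^sub>E j\<in>I. carrier (A j))"
  shows "pure f \<otimes>\<^bsub>T\<^esub> pure g = pure (\<lambda>i\<in>I. f i \<otimes>\<^bsub>A i\<^esub> g i)"
proof -
  have "Poly_Mapping.single f (1::'k) \<otimes>\<^bsub>tensor_basis I A\<^esub> Poly_Mapping.single g 1 =
      Poly_Mapping.single (\<lambda>i\<in>I. f i \<otimes>\<^bsub>A i\<^esub> g i) 1"
    unfolding tensor_basis_def single_mult_single by simp
  with assms show ?thesis by (simp add: pure_def single_closed flip: cls.hom_mult)
qed

lemma pure_one: "pure fun_one = \<one>\<^bsub>T\<^esub>"
proof -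
  have "\<one>\<^bsub>tensor_basis I A\<^esub> = Poly_Mapping.single fun_one (1::'k)"
    by (simp add: tensor_basis_def)
  then show ?thesis by (simp add: pure_def flip: cls.hom_one)
qed

lemma relator_zero: "s \<in> multilinear_relators I A \<Longrightarrow>
    alg_quot_class (tensor_basis I A) (multilinear_relators I A) s = \<zero>\<^bsub>T\<^esub>"
  unfolding tensor_algebra_def by (rule B.alg_quot_class_eq_zero[OF relators_subset])

text \<open>The multilinear relators are differences of finitely supported functions, whereas the
  lemmas on quotients refer to the subtraction of the ring; on the carrier both agree.\<close>

lemma basis_minus:
  assumes "p \<in> carrier (tensor_basis I A)" "q \<in> carrier (tensor_basis I A)"
  shows "p \<ominus>\<^bsub>tensor_basis I A\<^esub> q = p - q"
proof -
  have "p - q \<in> carrier (tensor_basis I A)"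
    using assms keys_diff[of p q] by (auto simp: tensor_basis_def simp del: carrier_product_group)
  then have "(p - q) \<oplus>\<^bsub>tensor_basis I A\<^esub> q = p"
    by (simp add: tensor_basis_def)
  then show ?thesis
    using assms \<open>p - q \<in> _\<close> by (metis B.minus_eq B.add.inv_solve_right)
qed

lemma pure_add:
  assumes f: "f \<in> (\<Pi>\<^sub>E j\<in>I. carrier (A j))" and i: "i \<in> I"
    and x: "x \<in> carrier (A i)" and y: "y \<in> carrier (A i)"
  shows "pure (f(i := x \<oplus>\<^bsub>A i\<^esub> y)) = pure (f(i := x)) \<oplus>\<^bsub>T\<^esub> pure (f(i := y))"
proof -
  let ?s = "\<lambda>z. Poly_Mapping.single (f(i := z)) (1::'k)"
  have c: "?s (x \<oplus>\<^bsub>A i\<^esub> y) \<in> carrier (tensor_basis I A)" "?s x \<in> carrier (tensor_basis I A)"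
    "?s y \<in> carrier (tensor_basis I A)"
    using assms by (auto intro!: single_closed upd_PiE factor_closed)
  have "?s (x \<oplus>\<^bsub>A i\<^esub> y) - (?s x + ?s y) \<in> multilinear_relators I A"
    unfolding multilinear_relators_def
    by (rule UnI1, rule CollectI, intro exI conjI, rule refl) (use assms in auto)
  moreover have "?s x + ?s y = ?s x \<oplus>\<^bsub>tensor_basis I A\<^esub> ?s y" by (simp add: tensor_basis_def)
  ultimately have "?s (x \<oplus>\<^bsub>A i\<^esub> y) \<ominus>\<^bsub>tensor_basis I A\<^esub> (?s x \<oplus>\<^bsub>tensor_basis I A\<^esub> ?s y) \<in> multilinear_relators I A"
    using basis_minus[OF c(1) B.a_closed[OF c(2,3)]] by (simp only:)
  note z = relator_zero[OF this]
  show ?thesis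
    by (rule T.minus_eq_zeroD) (use c z in \<open>simp_all add: pure_def\<close>)
qed

lemma pure_smult:
  assumes f: "f \<in> (\<Pi>\<^sub>E j\<in>I. carrier (A j))" and i: "i \<in> I" and x: "x \<in> carrier (A i)"
  shows "pure (f(i := c \<odot>\<^bsub>A i\<^esub> x)) = c \<odot>\<^bsub>T\<^esub> pure (f(i := x))"
proof -
  let ?s = "\<lambda>z. Poly_Mapping.single (f(i := z))"
  have c: "?s (c \<odot>\<^bsub>A i\<^esub> x) 1 \<in> carrier (tensor_basis I A)" "?s x b \<in> carrier (tensor_basis I A)" for b :: 'k
    using assms by (auto intro!: single_closed upd_PiE factor_closed)
  have "?s (c \<odot>\<^bsub>A i\<^esub> x) 1 - ?s x c \<in> multilinear_relators I A"
    unfolding multilinear_relators_def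
    by (rule UnI2, rule CollectI, intro exI conjI, rule refl) (use assms in auto)
  moreover have "?s x c = c \<odot>\<^bsub>tensor_basis I A\<^esub> ?s x 1" by (simp add: tensor_basis_def smult_single)
  ultimately have "?s (c \<odot>\<^bsub>A i\<^esub> x) 1 \<ominus>\<^bsub>tensor_basis I A\<^esub> (c \<odot>\<^bsub>tensor_basis I A\<^esub> ?s x 1) \<in> multilinear_relators I A"
    using basis_minus[OF c(1) B.smult_closed[OF c(2)]] by (simp only:)
  note z = relator_zero[OF this]
  show ?thesis
    by (rule T.minus_eq_zeroD) (use c z in \<open>simp_all add: pure_def\<close>)
qed

lemma fun_one_PiE: "fun_one \<in> (\<Pi>\<^sub>E j\<in>I. carrier (A j))"
  by (auto simp: factor_closed)

lemma tensor_incl_hom: assumes i: "i \<in> I" shows "tensor_incl i \<in> alg_hom (A i) T"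
proof (rule alg_homI)
  fix x y assume x: "x \<in> carrier (A i)" and y: "y \<in> carrier (A i)"
  have eq: "(\<lambda>j\<in>I. (fun_one(i := x)) j \<otimes>\<^bsub>A j\<^esub> (fun_one(i := y)) j) = fun_one(i := x \<otimes>\<^bsub>A i\<^esub> y)"
    using i by (auto simp: fun_eq_iff factor_closed)
  show "tensor_incl i (x \<otimes>\<^bsub>A i\<^esub> y) = tensor_incl i x \<otimes>\<^bsub>T\<^esub> tensor_incl i y"
    using pure_mult[OF upd_PiE[OF fun_one_PiE i x] upd_PiE[OF fun_one_PiE i y]]
    by (simp only: eq tensor_incl_def)
  show "tensor_incl i (x \<oplus>\<^bsub>A i\<^esub> y) = tensor_incl i x \<oplus>\<^bsub>T\<^esub> tensor_incl i y"
    unfolding tensor_incl_def by (rule pure_add[OF fun_one_PiE i x y])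
next
  have "fun_one(i := \<one>\<^bsub>A i\<^esub>) = fun_one"
    using i by (auto simp: fun_eq_iff)
  then show "tensor_incl i \<one>\<^bsub>A i\<^esub> = \<one>\<^bsub>T\<^esub>" by (simp add: tensor_incl_def pure_one)
next
  fix x c assume x: "x \<in> carrier (A i)"
  show "tensor_incl i x \<in> carrier T"
    unfolding tensor_incl_def by (intro pure_closed upd_PiE fun_one_PiE i x)
  show "tensor_incl i (c \<odot>\<^bsub>A i\<^esub> x) = c \<odot>\<^bsub>T\<^esub> tensor_incl i x"
    unfolding tensor_incl_def by (rule pure_smult[OF fun_one_PiE i x])
qed

text \<open>In each place at least one of the two factors is 1, so their order does not
  matter.\<close>

lemma tensor_incl_commute:
  assumes "i \<in> I" "j \<in> I" "i \<noteq> j" "x \<in> carrier (A i)" "y \<in> carrier (A j)"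
  shows "tensor_incl i x \<otimes>\<^bsub>T\<^esub> tensor_incl j y = tensor_incl j y \<otimes>\<^bsub>T\<^esub> tensor_incl i x"
proof -
  have eq: "(\<lambda>k\<in>I. (fun_one(i := x)) k \<otimes>\<^bsub>A k\<^esub> (fun_one(j := y)) k) =
      (\<lambda>k\<in>I. (fun_one(j := y)) k \<otimes>\<^bsub>A k\<^esub> (fun_one(i := x)) k)"
    using assms by (auto simp: fun_eq_iff factor_closed)
  show ?thesis
    unfolding tensor_incl_def
    using pure_mult[OF upd_PiE[OF fun_one_PiE assms(1,4)] upd_PiE[OF fun_one_PiE assms(2,5)]]
      pure_mult[OF upd_PiE[OF fun_one_PiE assms(2,5)] upd_PiE[OF fun_one_PiE assms(1,4)]]
    by (simp only: eq)
qed

text \<open>Every pure tensor is a product of images of its components under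
  \<open>tensor_incl\<close>: they are multiplied in one at a time, by induction on the set
  \<open>J\<close> of places already filled. Pure tensors in turn generate the tensor
  product.\<close>

lemma tensor_generated:
  assumes I: "finite I" and G: "\<And>i. i \<in> I \<Longrightarrow> G i \<subseteq> carrier (A i)"
    and gen: "\<And>i. i \<in> I \<Longrightarrow> alg_gen (A i) (G i) = carrier (A i)"
  shows "alg_gen T (\<Union>i\<in>I. tensor_incl i ` G i) = carrier T" (is "alg_gen T ?G = _")
proof -
  have hom: "alg_morphism (A i) T (tensor_incl i)" if "i \<in> I" for i
    using that by (intro alg_morphismI factor T.kalg_axioms tensor_incl_hom)
  have G': "?G \<subseteq> carrier T"
    using G alg_morphism.hom_closed[OF hom] by blast
  have mono: "alg_gen T X \<subseteq> alg_gen T Y" if "X \<subseteq> Y" for X Y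
  proof
    show "x \<in> alg_gen T Y" if "x \<in> alg_gen T X" for x
      using that by induction (use \<open>X \<subseteq> Y\<close> in \<open>auto intro: alg_gen.intros\<close>)
  qed
  have incl: "tensor_incl i x \<in> alg_gen T ?G" if "i \<in> I" "x \<in> carrier (A i)" for i x
    using alg_morphism.hom_alg_gen[OF hom G, of i x] gen[of i] that
      mono[of "tensor_incl i ` G i" ?G] by blast
  have pure: "pure f \<in> alg_gen T ?G" if f: "f \<in> (\<Pi>\<^sub>E j\<in>I. carrier (A j))" for f
  proof -
    have "pure (\<lambda>j\<in>I. if j \<in> J then f j else \<one>\<^bsub>A j\<^esub>) \<in> alg_gen T ?G" if "finite J" "J \<subseteq> I" for J
      using that
    proof (induction J rule: finite_induct)
      case empty
      have "pure fun_one \<in> alg_gen T ?G" by (simp only: pure_one alg_gen.one)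
      then show ?case by (simp add: restrict_def)
    next
      case (insert i J)
      let ?g = "\<lambda>J. \<lambda>j\<in>I. if j \<in> J then f j else \<one>\<^bsub>A j\<^esub>"
      have g: "?g J \<in> (\<Pi>\<^sub>E j\<in>I. carrier (A j))" for J
        using f by (auto simp: factor_closed)
      have fc: "f j \<in> carrier (A j)" if "j \<in> I" for j using f that by auto
      then have i: "i \<in> I" "f i \<in> carrier (A i)" using insert by auto
      have "tensor_incl i (f i) \<otimes>\<^bsub>T\<^esub> pure (?g J) = pure (?g (insert i J))"
        unfolding tensor_incl_def
        by (subst pure_mult) (use i g insert f in \<open>auto simp: fun_eq_iff factor_closed fc intro!: upd_PiE
            fun_one_PiE arg_cong[of _ _ pure]\<close>)
      moreover have "tensor_incl i (f i) \<otimes>\<^bsub>T\<^esub> pure (?g J) \<in> alg_gen T ?G"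
        using insert.IH insert.prems i by (intro alg_gen.mult incl) blast+
      ultimately show ?case by (simp add: restrict_def)
    qed
    from this[OF I] have "pure (\<lambda>j\<in>I. if j \<in> I then f j else \<one>\<^bsub>A j\<^esub>) \<in> alg_gen T ?G" by simp
    also have "(\<lambda>j\<in>I. if j \<in> I then f j else \<one>\<^bsub>A j\<^esub>) = f"
      using f by (auto simp: fun_eq_iff PiE_iff extensional_def)
    finally show ?thesis .
  qed
  let ?s = "(\<lambda>f. Poly_Mapping.single f 1) ` (\<Pi>\<^sub>E j\<in>I. carrier (A j))"
  have "alg_gen (tensor_basis I A) ?s = carrier (tensor_basis I A)"
    using monoid_algebra_generated[OF monoid_product, where 'k = 'k] by (simp add: tensor_basis_def)
  then have "alg_gen T (alg_quot_class (tensor_basis I A) (multilinear_relators I A) ` ?s) = carrier T"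
    unfolding tensor_algebra_def
    by (intro B.alg_quot_generated[OF relators_subset]) (auto simp: single_closed)
  also have "alg_quot_class (tensor_basis I A) (multilinear_relators I A) ` ?s =
      pure ` (\<Pi>\<^sub>E j\<in>I. carrier (A j))"
    by (simp add: pure_def image_image)
  finally have carr: "carrier T = alg_gen T (pure ` (\<Pi>\<^sub>E j\<in>I. carrier (A j)))" by simp
  have "x \<in> alg_gen T ?G" if "x \<in> carrier T" for x
    using that unfolding carr
    by induction (use pure in \<open>auto intro: alg_gen.intros\<close>)
  then show ?thesis using T.alg_gen_closed[OF _ G'] by blast
qed

end

text \<open>The universal property for mutually commuting maps. The index set is an initial segment
  of the naturals, so that the product of the images has a definite order; commutation makes this
  product multiplicative.\<close>

lemma tensor_lift:
  fixes A :: "nat \<Rightarrow> ('k::field, 'a) module" and B :: "('k, 'b) module"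
  assumes A: "\<And>i. i < r \<Longrightarrow> kalg (A i)" and B: "kalg B"
    and \<phi>: "\<And>i. i < r \<Longrightarrow> \<phi> i \<in> alg_hom (A i) B"
    and comm: "\<And>i j x y. i < r \<Longrightarrow> j < r \<Longrightarrow> i \<noteq> j \<Longrightarrow> x \<in> carrier (A i) \<Longrightarrow> y \<in> carrier (A j) \<Longrightarrow>
      \<phi> i x \<otimes>\<^bsub>B\<^esub> \<phi> j y = \<phi> j y \<otimes>\<^bsub>B\<^esub> \<phi> i x"
  shows "\<exists>h\<in>alg_hom (tensor_algebra {..<r} A) B. \<forall>i<r. \<forall>x\<in>carrier (A i).
      h (tensor_factors.tensor_incl {..<r} A i x) = \<phi> i x"
proof -
  interpret tensor_factors "{..<r}" A by (rule tensor_factors.intro) (use A in simp)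
  interpret K: kalg B by fact
  have \<phi>i: "alg_morphism (A i) B (\<phi> i)" if "i < r" for i
    using that by (intro alg_morphismI A B \<phi>)
  have \<phi>x: "\<phi> i x \<in> carrier B" if "i < r" "x \<in> carrier (A i)" for i x
    using alg_morphism.hom_closed[OF \<phi>i] that by blast
  have \<phi>add: "\<phi> i (x \<oplus>\<^bsub>A i\<^esub> y) = \<phi> i x \<oplus>\<^bsub>B\<^esub> \<phi> i y"
    if "i < r" "x \<in> carrier (A i)" "y \<in> carrier (A i)" for i x y
    using alg_morphism.hom_add[OF \<phi>i] that by blast
  have \<phi>smult: "\<phi> i (c \<odot>\<^bsub>A i\<^esub> x) = c \<odot>\<^bsub>B\<^esub> \<phi> i x" if "i < r" "x \<in> carrier (A i)" for i x c
    using alg_morphism.hom_smult[OF \<phi>i] that by blast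
  have \<phi>one: "\<phi> i \<one>\<^bsub>A i\<^esub> = \<one>\<^bsub>B\<^esub>" if "i < r" for i
    using alg_morphism.hom_one[OF \<phi>i] that by blast
  \<comment> \<open>Ordered partial products of the images; multiplicativity and multilinearity are
    proved for all \<open>k\<close> by induction and used for \<open>k = r\<close>.\<close>
  define H where "H k f = foldl (\<lambda>y i. y \<otimes>\<^bsub>B\<^esub> \<phi> i (f i)) \<one>\<^bsub>B\<^esub> [0..<k]" for k f
  have H0: "H 0 f = \<one>\<^bsub>B\<^esub>" and HS: "H (Suc k) f = H k f \<otimes>\<^bsub>B\<^esub> \<phi> k (f k)" for k f
    by (simp_all add: H_def)
  let ?P = "\<Pi>\<^sub>E j\<in>{..<r}. carrier (A j)"
  have \<phi>c: "\<phi> i (f i) \<in> carrier B" if "f \<in> ?P" "i < r" for f i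
    using that alg_morphism.hom_closed[OF \<phi>i] by (auto simp: PiE_iff)
  have Hc: "H k f \<in> carrier B" if "f \<in> ?P" "k \<le> r" for k f
    using that(2) by (induction k) (auto simp: H0 HS \<phi>c[OF that(1)])
  \<comment> \<open>Used with \<open>j = k\<close>; the general \<open>j\<close> lets the induction
    run over the earlier factors.\<close>
  have Hcomm: "H k f \<otimes>\<^bsub>B\<^esub> \<phi> j (g j) = \<phi> j (g j) \<otimes>\<^bsub>B\<^esub> H k f" if "f \<in> ?P" "g \<in> ?P" "k \<le> j" "j < r" for k f j g
    using that(3)
  proof (induction k)
    case 0
    then show ?case using that by (simp add: H0 \<phi>c)
  next
    case (Suc k)
    then have "\<phi> k (f k) \<otimes>\<^bsub>B\<^esub> \<phi> j (g j) = \<phi> j (g j) \<otimes>\<^bsub>B\<^esub> \<phi> k (f k)"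
      using that by (intro comm) (auto simp: PiE_iff)
    moreover have "H k f \<in> carrier B" "\<phi> k (f k) \<in> carrier B" "\<phi> j (g j) \<in> carrier B"
      using Suc that Hc[of f k] \<phi>c[of f k] \<phi>c[of g j] by simp_all
    moreover have "H k f \<otimes>\<^bsub>B\<^esub> \<phi> j (g j) = \<phi> j (g j) \<otimes>\<^bsub>B\<^esub> H k f" using Suc by simp
    ultimately show ?case
      by (simp only: HS K.m_assoc) (simp only: flip: K.m_assoc)
  qed
  have Hm: "H k (\<lambda>i\<in>{..<r}. f i \<otimes>\<^bsub>A i\<^esub> g i) = H k f \<otimes>\<^bsub>B\<^esub> H k g" if f: "f \<in> ?P" and g: "g \<in> ?P" and k: "k \<le> r" for k f g
    using k
  proof (induction k)
    case (Suc k)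
    have m: "\<phi> k (f k \<otimes>\<^bsub>A k\<^esub> g k) = \<phi> k (f k) \<otimes>\<^bsub>B\<^esub> \<phi> k (g k)"
      using alg_morphism.hom_mult[OF \<phi>i[of k]] f g Suc by (auto simp: PiE_iff)
    have c: "H k g \<otimes>\<^bsub>B\<^esub> \<phi> k (f k) = \<phi> k (f k) \<otimes>\<^bsub>B\<^esub> H k g"
      by (rule Hcomm[OF g f]) (use Suc in simp_all)
    have cl: "H k f \<in> carrier B" "H k g \<in> carrier B" "\<phi> k (f k) \<in> carrier B" "\<phi> k (g k) \<in> carrier B"
      using f g Suc Hc[of f k] Hc[of g k] \<phi>c[of f k] \<phi>c[of g k] by simp_all
    have "H (Suc k) (\<lambda>i\<in>{..<r}. f i \<otimes>\<^bsub>A i\<^esub> g i) = (H k f \<otimes>\<^bsub>B\<^esub> H k g) \<otimes>\<^bsub>B\<^esub> (\<phi> k (f k) \<otimes>\<^bsub>B\<^esub> \<phi> k (g k))"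
      using Suc m by (simp add: HS restrict_def)
    also have "\<dots> = H k f \<otimes>\<^bsub>B\<^esub> (H k g \<otimes>\<^bsub>B\<^esub> \<phi> k (f k)) \<otimes>\<^bsub>B\<^esub> \<phi> k (g k)"
      using cl by (simp add: K.m_assoc)
    also have "\<dots> = H (Suc k) f \<otimes>\<^bsub>B\<^esub> H (Suc k) g"
      unfolding c HS using cl by (simp add: K.m_assoc)
    finally show ?case .
  qed (simp add: H0)
  have Hcong: "H k f = H k g" if "\<And>j. j < k \<Longrightarrow> f j = g j" for k f g
    using that by (induction k) (simp_all add: H0 HS)
  \<comment> \<open>Additivity in place \<open>i\<close>: the factors before \<open>i\<close> agree,
    at \<open>i\<close> distributivity splits the product, and the factors after \<open>i\<close>
    are multiplied into both parts.\<close>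
  have Hadd: "H k f = H k g \<oplus>\<^bsub>B\<^esub> H k h"
    if P: "f \<in> ?P" "g \<in> ?P" "h \<in> ?P" and i: "i < k" "k \<le> r" and fi: "f i = g i \<oplus>\<^bsub>A i\<^esub> h i"
      and fj: "\<And>j. j \<noteq> i \<Longrightarrow> f j = g j \<and> h j = g j" for k i f g h
    using i
  proof (induction k)
    case (Suc k)
    note c = Hc[OF P(2), of k] Hc[OF P(3), of k] \<phi>c[OF P(2), of k] \<phi>c[OF P(3), of k]
    show ?case
    proof (cases "i = k")
      case True
      have "H k f = H k g" "H k h = H k g" by (rule Hcong; use fj True in auto)+
      moreover have "\<phi> k (f k) = \<phi> k (g k) \<oplus>\<^bsub>B\<^esub> \<phi> k (h k)"
        using fi True Suc.prems PiE_mem[OF P(2), of k] PiE_mem[OF P(3), of k] by (simp add: \<phi>add)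
      ultimately show ?thesis using c Suc.prems by (simp add: HS K.r_distr)
    next
      case False
      then have "f k = g k" "h k = g k" using fj[of k] by auto
      then show ?thesis using Suc False c by (simp add: HS K.l_distr)
    qed
  qed simp
  have Hsmult: "H k f = c \<odot>\<^bsub>B\<^esub> H k g"
    if P: "f \<in> ?P" "g \<in> ?P" and i: "i < k" "k \<le> r" and fi: "f i = c \<odot>\<^bsub>A i\<^esub> g i"
      and fj: "\<And>j. j \<noteq> i \<Longrightarrow> f j = g j" for k i f g c
    using i
  proof (induction k)
    case (Suc k)
    note c = Hc[OF P(2), of k] \<phi>c[OF P(2), of k]
    show ?case
    proof (cases "i = k")
      case True
      have "H k f = H k g" by (rule Hcong) (use fj True in auto)
      moreover have "\<phi> k (f k) = c \<odot>\<^bsub>B\<^esub> \<phi> k (g k)"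
        using fi True Suc.prems PiE_mem[OF P(2), of k] by (simp add: \<phi>smult)
      ultimately show ?thesis using c Suc.prems by (simp add: HS K.smult_assoc3)
    next
      case False
      then have "f k = g k" using fj[of k] by auto
      then show ?thesis using Suc False c by (simp add: HS K.smult_assoc2)
    qed
  qed simp
  have H1: "H k (\<lambda>j\<in>{..<r}. \<one>\<^bsub>A j\<^esub>) = \<one>\<^bsub>B\<^esub>" if "k \<le> r" for k
    using that
  proof (induction k)
    case (Suc k)
    then show ?case by (simp add: HS \<phi>one)
  qed (simp add: H0)
  have Hincl: "H k f = \<phi> i (f i)"
    if "i < k" "k \<le> r" "f i \<in> carrier (A i)" "\<And>j. j < r \<Longrightarrow> j \<noteq> i \<Longrightarrow> f j = \<one>\<^bsub>A j\<^esub>" for k i f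
    using that(1,2)
  proof (induction k)
    case (Suc k)
    show ?case
    proof (cases "i = k")
      case True
      have "H k f = H k (\<lambda>j\<in>{..<r}. \<one>\<^bsub>A j\<^esub>)" by (rule Hcong) (use that True Suc.prems in auto)
      then show ?thesis using that True Suc.prems H1[of k] by (simp only: HS) (simp add: \<phi>x)
    next
      case False
      then show ?thesis using that Suc by (simp add: HS \<phi>one \<phi>x)
    qed
  qed simp
  have "\<exists>F\<in>alg_hom (monoid_algebra (product_group {..<r} A)) B.
    \<forall>a\<in>carrier (product_group {..<r} A). \<forall>c. F (Poly_Mapping.single a c) = c \<odot>\<^bsub>B\<^esub> H r a"
    by (rule monoid_algebra_lift[OF monoid_product B]) (auto simp: Hc H1 Hm)
  then obtain F where F: "F \<in> alg_hom (tensor_basis {..<r} A) B"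
    "\<And>a c. a \<in> ?P \<Longrightarrow> F (Poly_Mapping.single a c) = c \<odot>\<^bsub>B\<^esub> H r a"
    unfolding tensor_basis_def by auto
  interpret F: alg_morphism "tensor_basis {..<r} A" B F
    by (rule alg_morphismI[OF B.kalg_axioms B F(1)])
  have z: "F s = \<zero>\<^bsub>B\<^esub>" if s: "s \<in> multilinear_relators {..<r} A" for s
  proof -
    consider (add) f i x y where
        "s = Poly_Mapping.single (f(i := x \<oplus>\<^bsub>A i\<^esub> y)) 1 -
          (Poly_Mapping.single (f(i := x)) 1 + Poly_Mapping.single (f(i := y)) 1)"
        "f \<in> ?P" "i < r" "x \<in> carrier (A i)" "y \<in> carrier (A i)"
      | (smult) f i c x where
        "s = Poly_Mapping.single (f(i := c \<odot>\<^bsub>A i\<^esub> x)) 1 - Poly_Mapping.single (f(i := x)) c"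
        "f \<in> ?P" "i < r" "x \<in> carrier (A i)"
      using s unfolding multilinear_relators_def by fast
    then show ?thesis
    proof cases
      case add
      have P: "f(i := x \<oplus>\<^bsub>A i\<^esub> y) \<in> ?P" "f(i := x) \<in> ?P" "f(i := y) \<in> ?P"
        by (rule upd_PiE[OF add(2)]; use add(3-5) in \<open>simp add: factor_closed\<close>)+
      note C = P[THEN single_closed[where c = 1]]
      have "s = Poly_Mapping.single (f(i := x \<oplus>\<^bsub>A i\<^esub> y)) 1 \<ominus>\<^bsub>tensor_basis {..<r} A\<^esub>
          (Poly_Mapping.single (f(i := x)) 1 \<oplus>\<^bsub>tensor_basis {..<r} A\<^esub> Poly_Mapping.single (f(i := y)) 1)"
        unfolding add(1) using C basis_minus[OF C(1) B.a_closed[OF C(2,3)]]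
        by (simp add: tensor_basis_def)
      then have "F s = H r (f(i := x \<oplus>\<^bsub>A i\<^esub> y)) \<ominus>\<^bsub>B\<^esub> (H r (f(i := x)) \<oplus>\<^bsub>B\<^esub> H r (f(i := y)))"
        using C P by (simp add: F Hc)
      also have "\<dots> = \<zero>\<^bsub>B\<^esub>"
        using Hadd[OF P, of i r] add(3) Hc[OF P(1), of r] by (simp add: a_minus_def K.r_neg)
      finally show ?thesis .
    next
      case smult
      have P: "f(i := c \<odot>\<^bsub>A i\<^esub> x) \<in> ?P" "f(i := x) \<in> ?P"
        by (rule upd_PiE[OF smult(2)]; use smult(3,4) in \<open>simp add: factor_closed\<close>)+
      have "s = Poly_Mapping.single (f(i := c \<odot>\<^bsub>A i\<^esub> x)) 1 \<ominus>\<^bsub>tensor_basis {..<r} A\<^esub>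
          Poly_Mapping.single (f(i := x)) c"
        unfolding smult(1) using P basis_minus single_closed by simp
      then have "F s = H r (f(i := c \<odot>\<^bsub>A i\<^esub> x)) \<ominus>\<^bsub>B\<^esub> c \<odot>\<^bsub>B\<^esub> H r (f(i := x))"
        using P by (simp add: F Hc single_closed)
      also have "\<dots> = \<zero>\<^bsub>B\<^esub>"
        using Hsmult[OF P, of i r c] smult(3) Hc[OF P(1), of r] by (simp add: a_minus_def K.r_neg)
      finally show ?thesis .
    qed
  qed
  obtain h where h: "h \<in> alg_hom T B"
      "\<And>x. x \<in> carrier (tensor_basis {..<r} A) \<Longrightarrow>
        h (alg_quot_class (tensor_basis {..<r} A) (multilinear_relators {..<r} A) x) = F x"
    using B.alg_quot_lift[OF relators_subset B F(1) z] unfolding tensor_algebra_def by blast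
  have "h (tensor_incl i x) = \<phi> i x" if "i < r" "x \<in> carrier (A i)" for i x
  proof -
    have P: "fun_one(i := x) \<in> ?P" using that by (intro upd_PiE fun_one_PiE) auto
    show ?thesis
      unfolding tensor_incl_def pure_def
      using h(2)[OF single_closed[OF P, of 1]] F(2)[OF P, of 1] Hincl[of i r "fun_one(i := x)"] that \<phi>x by simp
  qed
  with h(1) show ?thesis by blast
qed

section \<open>Families satisfying the defining relations\<close>

lemma ball_pairs1: "(\<forall>(p, q)\<in>{(a i, b i) | i. P i}. Q p q) \<longleftrightarrow> (\<forall>i. P i \<longrightarrow> Q (a i) (b i))"
  and ball_pairs2: "(\<forall>(p, q)\<in>{(c i j, e i j) | i j. P' i j}. Q p q) \<longleftrightarrow> (\<forall>i j. P' i j \<longrightarrow> Q (c i j) (e i j))"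
  by blast+

text \<open>Turns the set of relations into a conjunction whose members can be treated one by one.
  The predicate \<open>Q\<close> is kept general because it is used both for equality and for
  equality of images under a homomorphism.\<close>

lemma hecke_rels_all:
  fixes A (structure)
  shows "(\<forall>(p, q)\<in>hecke_rels A m x s. Q p q) \<longleftrightarrow>
    (\<forall>i\<in>{1..<m}. Q (s i \<otimes> s i) \<one>) \<and>
    (\<forall>i\<in>{i\<in>{1..<m}. i + 1 < m}. Q (s i \<otimes> s (i + 1) \<otimes> s i) (s (i + 1) \<otimes> s i \<otimes> s (i + 1))) \<and>
    (\<forall>i\<in>{1..<m}. \<forall>j\<in>{j\<in>{1..<m}. \<bar>int i - int j\<bar> > 1}. Q (s i \<otimes> s j) (s j \<otimes> s i)) \<and>
    (\<forall>i\<in>{1..m}. \<forall>j\<in>{1..m}. Q (x i \<otimes> x j) (x j \<otimes> x i)) \<and>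
    (\<forall>i\<in>{1..<m}. Q (s i \<otimes> x (i + 1)) (x i \<otimes> s i \<oplus> \<one>)) \<and>
    (\<forall>i\<in>{1..<m}. \<forall>j\<in>{j\<in>{1..m}. j \<noteq> i \<and> j \<noteq> i + 1}. Q (s i \<otimes> x j) (x j \<otimes> s i))"
  unfolding hecke_rels_def ball_Un ball_pairs1 ball_pairs2
  by (simp only: conj_assoc, intro arg_cong2[of _ _ _ _ conj]) auto

lemma yh_rels_all:
  fixes A (structure)
  shows "(\<forall>(p, q)\<in>yh_rels A r n t f x. Q p q) \<longleftrightarrow>
    (\<forall>i\<in>{1..<n}. \<forall>j\<in>{j\<in>{1..<n}. \<bar>int i - int j\<bar> \<ge> 2}. Q (f i \<otimes> f j) (f j \<otimes> f i)) \<and>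
    (\<forall>i\<in>{i\<in>{1..<n}. i + 1 < n}. Q (f i \<otimes> f (i + 1) \<otimes> f i) (f (i + 1) \<otimes> f i \<otimes> f (i + 1))) \<and>
    (\<forall>i\<in>{1..n}. \<forall>j\<in>{1..n}. Q (t i \<otimes> t j) (t j \<otimes> t i)) \<and>
    (\<forall>i\<in>{1..<n}. \<forall>j\<in>{1..n}. Q (f i \<otimes> t j) (t (Transposition.transpose i (i + 1) j) \<otimes> f i)) \<and>
    (\<forall>i\<in>{1..n}. Q (t i [^] r) \<one>) \<and>
    (\<forall>i\<in>{1..<n}. Q (f i \<otimes> f i) \<one>) \<and>
    (\<forall>i\<in>{1..n}. \<forall>j\<in>{1..n}. Q (x i \<otimes> x j) (x j \<otimes> x i)) \<and>
    (\<forall>i\<in>{1..<n}. Q (f i \<otimes> x (i + 1)) (x i \<otimes> f i \<oplus> yh_e A r t i)) \<and>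
    (\<forall>i\<in>{1..<n}. \<forall>j\<in>{j\<in>{1..n}. j \<noteq> i \<and> j \<noteq> i + 1}. Q (f i \<otimes> x j) (x j \<otimes> f i)) \<and>
    (\<forall>i\<in>{1..n}. \<forall>j\<in>{1..n}. Q (t j \<otimes> x i) (x i \<otimes> t j))"
  unfolding yh_rels_def ball_Un ball_pairs1 ball_pairs2
  by (simp only: conj_assoc, intro arg_cong2[of _ _ _ _ conj]) auto

context kalg
begin

lemma cyclotomic_closed: "x \<in> carrier A \<Longrightarrow> cyclotomic_element A d v x \<in> carrier A"
proof -
  assume x: "x \<in> carrier A"
  have "foldr (\<lambda>i y. (x \<ominus> v i \<odot> \<one>) \<otimes> y) l \<one> \<in> carrier A" for l
    using x by (induction l) auto
  then show ?thesis by (simp add: cyclotomic_element_def)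
qed

lemma hecke_rels_closed:
  assumes "x \<in> {1..m} \<rightarrow> carrier A" "s \<in> {1..<m} \<rightarrow> carrier A"
  shows "hecke_rels A m x s \<subseteq> carrier A \<times> carrier A"
proof -
  have x: "x i \<in> carrier A" if "1 \<le> i" "i \<le> m" for i using assms that by auto
  have s: "s i \<in> carrier A" if "1 \<le> i" "i < m" for i using assms that by auto
  show ?thesis
    unfolding hecke_rels_def by (auto simp: x s)
qed

lemma yh_e_closed:
  assumes "t i \<in> carrier A" "t (i + 1) \<in> carrier A" shows "yh_e A r t i \<in> carrier A"
  using assms unfolding yh_e_def by (auto intro!: finsum_closed)

lemma yh_rels_closed:
  assumes "t \<in> {1..n} \<rightarrow> carrier A" "f \<in> {1..<n} \<rightarrow> carrier A" "x \<in> {1..n} \<rightarrow> carrier A"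
  shows "yh_rels A r n t f x \<subseteq> carrier A \<times> carrier A"
proof -
  have x: "x i \<in> carrier A" if "1 \<le> i" "i \<le> n" for i using assms that by auto
  have f: "f i \<in> carrier A" if "1 \<le> i" "i < n" for i using assms that by auto
  have t: "t i \<in> carrier A" if "1 \<le> i" "i \<le> n" for i using assms that by auto
  show ?thesis
    unfolding yh_rels_def by (auto simp: x f t yh_e_closed Transposition.transpose_def)
qed

end

context alg_morphism
begin

lemma hom_cyclotomic:
  assumes x: "x \<in> carrier A"
  shows "h (cyclotomic_element A d v x) = cyclotomic_element B d v (h x)"
proof -
  let ?f = "\<lambda>l. foldr (\<lambda>i y. (x \<ominus>\<^bsub>A\<^esub> v i \<odot>\<^bsub>A\<^esub> \<one>\<^bsub>A\<^esub>) \<otimes>\<^bsub>A\<^esub> y) l \<one>\<^bsub>A\<^esub>"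
  have "?f l \<in> carrier A \<and>
    h (?f l) = foldr (\<lambda>i y. (h x \<ominus>\<^bsub>B\<^esub> v i \<odot>\<^bsub>B\<^esub> \<one>\<^bsub>B\<^esub>) \<otimes>\<^bsub>B\<^esub> y) l \<one>\<^bsub>B\<^esub>" for l
    using x by (induction l) auto
  then show ?thesis by (simp add: cyclotomic_element_def)
qed

lemma hom_yh_e:
  assumes "t i \<in> carrier A" "t (i + 1) \<in> carrier A"
    and "t' i = h (t i)" "t' (i + 1) = h (t (i + 1))"
  shows "h (yh_e A r t i) = yh_e B r t' i"
  unfolding yh_e_def using assms by (simp add: hom_finsum)

text \<open>The relations are the same expressions in both algebras. Both directions are used: to
  push relations of the free algebra into a quotient, and to pull relations in \<open>B\<close> back
  when a homomorphism out of a presented algebra is constructed.\<close>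

lemma hecke_rels_hom:
  assumes "x \<in> {1..m} \<rightarrow> carrier A" "s \<in> {1..<m} \<rightarrow> carrier A"
    and "\<And>i. i \<in> {1..m} \<Longrightarrow> h (x i) = x' i" "\<And>i. i \<in> {1..<m} \<Longrightarrow> h (s i) = s' i"
  shows "(\<forall>(p, q)\<in>hecke_rels A m x s. h p = h q) \<longleftrightarrow> (\<forall>(p, q)\<in>hecke_rels B m x' s'. p = q)"
proof -
  have x: "x i \<in> carrier A" "h (x i) = x' i" if "Suc 0 \<le> i" "i \<le> m" for i using assms that by auto
  have s: "s i \<in> carrier A" "h (s i) = s' i" if "Suc 0 \<le> i" "i < m" for i using assms that by auto
  show ?thesis
    unfolding hecke_rels_all
    by (intro arg_cong2[of _ _ _ _ conj] ball_cong refl) (simp_all add: x s)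
qed

lemma yh_rels_hom:
  assumes "t \<in> {1..n} \<rightarrow> carrier A" "f \<in> {1..<n} \<rightarrow> carrier A" "x \<in> {1..n} \<rightarrow> carrier A"
    and "\<And>i. i \<in> {1..n} \<Longrightarrow> h (t i) = t' i" "\<And>i. i \<in> {1..<n} \<Longrightarrow> h (f i) = f' i"
      "\<And>i. i \<in> {1..n} \<Longrightarrow> h (x i) = x' i"
  shows "(\<forall>(p, q)\<in>yh_rels A r n t f x. h p = h q) \<longleftrightarrow> (\<forall>(p, q)\<in>yh_rels B r n t' f' x'. p = q)"
proof -
  have t: "t i \<in> carrier A" "h (t i) = t' i" if "Suc 0 \<le> i" "i \<le> n" for i using assms that by auto
  have f: "f i \<in> carrier A" "h (f i) = f' i" if "Suc 0 \<le> i" "i < n" for i using assms that by auto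
  have x: "x i \<in> carrier A" "h (x i) = x' i" if "Suc 0 \<le> i" "i \<le> n" for i using assms that by auto
  have e: "yh_e A r t i \<in> carrier A" "h (yh_e A r t i) = yh_e B r t' i" if "Suc 0 \<le> i" "i < n" for i
    using that t[of i] t[of "Suc i"] by (auto intro: hom_yh_e A.yh_e_closed)
  have st: "t (Transposition.transpose i (Suc i) j) \<in> carrier A"
    "h (t (Transposition.transpose i (Suc i) j)) = t' (Transposition.transpose i (Suc i) j)"
    if "Suc 0 \<le> i" "i < n" "Suc 0 \<le> j" "j \<le> n" for i j
    using that t by (auto simp: Transposition.transpose_def)
  show ?thesis
    unfolding yh_rels_all
    by (intro arg_cong2[of _ _ _ _ conj] ball_cong refl) (simp_all add: t f x e st)
qed

end

text \<open>Families satisfying the defining relations, wherever they live; by the universal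
  property such a family amounts to a homomorphism from the cyclotomic Hecke algebra. The cyclotomic
  condition carries the guard \<open>1 \<le> m\<close> because for \<open>m = 0\<close> there is no
  first generator.\<close>

definition hecke_family ::
  "('k::field, 'a) module \<Rightarrow> nat \<Rightarrow> nat \<Rightarrow> (nat \<Rightarrow> 'k) \<Rightarrow> (nat \<Rightarrow> 'a) \<Rightarrow> (nat \<Rightarrow> 'a) \<Rightarrow> bool" where
  "hecke_family A m d v x s \<longleftrightarrow> x \<in> {1..m} \<rightarrow> carrier A \<and> s \<in> {1..<m} \<rightarrow> carrier A \<and>
    (\<forall>(p, q)\<in>hecke_rels A m x s. p = q) \<and> (1 \<le> m \<longrightarrow> cyclotomic_element A d v (x 1) = \<zero>\<^bsub>A\<^esub>)"

definition yh_family ::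
  "('k::field, 'a) module \<Rightarrow> nat \<Rightarrow> nat \<Rightarrow> nat \<Rightarrow> (nat \<Rightarrow> 'k) \<Rightarrow>
    (nat \<Rightarrow> 'a) \<Rightarrow> (nat \<Rightarrow> 'a) \<Rightarrow> (nat \<Rightarrow> 'a) \<Rightarrow> bool" where
  "yh_family A r n d v t f x \<longleftrightarrow> t \<in> {1..n} \<rightarrow> carrier A \<and> f \<in> {1..<n} \<rightarrow> carrier A \<and>
    x \<in> {1..n} \<rightarrow> carrier A \<and> (\<forall>(p, q)\<in>yh_rels A r n t f x. p = q) \<and>
    cyclotomic_element A d v (x 1) = \<zero>\<^bsub>A\<^esub>"

lemma (in alg_morphism) hecke_family_hom:
  assumes fam: "hecke_family A m d v x s"
  shows "hecke_family B m d v (\<lambda>k. h (x k)) (\<lambda>k. h (s k))"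
proof -
  have x: "x \<in> {1..m} \<rightarrow> carrier A" and s: "s \<in> {1..<m} \<rightarrow> carrier A"
    and rel: "\<forall>(p, q)\<in>hecke_rels A m x s. p = q"
    using fam by (auto simp: hecke_family_def)
  have "\<forall>(p, q)\<in>hecke_rels A m x s. h p = h q" using rel by auto
  then have "\<forall>(p, q)\<in>hecke_rels B m (\<lambda>k. h (x k)) (\<lambda>k. h (s k)). p = q"
    by (subst (asm) hecke_rels_hom[OF x s refl refl])
  moreover have "cyclotomic_element B d v (h (x 1)) = \<zero>\<^bsub>B\<^esub>" if "1 \<le> m"
    using fam that funcset_mem[OF x, of 1] hom_cyclotomic[of "x 1" d v, symmetric]
    by (auto simp: hecke_family_def)
  ultimately show ?thesis using x s by (auto simp: hecke_family_def)
qed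

section \<open>Cyclotomic Hecke algebras\<close>

context
  fixes m d :: nat and v :: "nat \<Rightarrow> 'k::field"
begin

private abbreviation (input) "R \<equiv> affine_hecke_rels m :: ((hecke_gen list \<Rightarrow>\<^sub>0 'k) \<times> _) set"
private abbreviation (input) "x0 \<equiv> (\<lambda>k. presented_gen (hecke_gens m) R (HX k))"
private abbreviation (input) "s0 \<equiv> (\<lambda>k. presented_gen (hecke_gens m) R (HS k))"
private abbreviation (input) "S \<equiv> (if m = 0 then {} else {cyclotomic_element (affine_hecke m) d v (x0 1)})"

interpretation F: kalg "free_algebra (hecke_gens m) :: ('k, _) module" by (rule kalg_free_algebra)

lemma free_hecke_closed:
  "(\<lambda>k. free_gen (HX k)) \<in> {1..m} \<rightarrow> carrier (free_algebra (hecke_gens m) :: ('k, _) module)"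
  "(\<lambda>k. free_gen (HS k)) \<in> {1..<m} \<rightarrow> carrier (free_algebra (hecke_gens m) :: ('k, _) module)"
  by (auto simp: hecke_gens_def intro!: free_gen_closed)

lemma affine_hecke_rels_closed:
  "R \<subseteq> carrier (free_algebra (hecke_gens m)) \<times> carrier (free_algebra (hecke_gens m))"
  unfolding affine_hecke_rels_def by (rule F.hecke_rels_closed[OF free_hecke_closed])

interpretation A: kalg "affine_hecke m :: ('k, _) module"
  unfolding affine_hecke_def by (rule kalg_presented_algebra[OF affine_hecke_rels_closed])

lemma affine_hecke_gen_closed: "k \<in> {1..m} \<Longrightarrow> x0 k \<in> carrier (affine_hecke m)"
  "k \<in> {1..<m} \<Longrightarrow> s0 k \<in> carrier (affine_hecke m)"
  unfolding affine_hecke_def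
  by (rule presented_gen_closed[OF affine_hecke_rels_closed], simp add: hecke_gens_def)+

lemma cyclotomic_relator_closed: "S \<subseteq> carrier (affine_hecke m)"
  using affine_hecke_gen_closed(1)[of 1] A.cyclotomic_closed by auto

definition hecke_x :: "nat \<Rightarrow> (hecke_gen list \<Rightarrow>\<^sub>0 'k) set set" where
  "hecke_x k = alg_quot_class (affine_hecke m) S (x0 k)"

definition hecke_s :: "nat \<Rightarrow> (hecke_gen list \<Rightarrow>\<^sub>0 'k) set set" where
  "hecke_s k = alg_quot_class (affine_hecke m) S (s0 k)"

lemma kalg_cyclotomic_hecke: "kalg (cyclotomic_hecke m d v)"
  unfolding cyclotomic_hecke_def by (rule A.kalg_alg_quot[OF cyclotomic_relator_closed])

interpretation cls: alg_morphism "affine_hecke m" "cyclotomic_hecke m d v"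
    "alg_quot_class (affine_hecke m) S"
  by (intro alg_morphismI A.kalg_axioms kalg_cyclotomic_hecke)
    (unfold cyclotomic_hecke_def, rule A.alg_quot_class_hom[OF cyclotomic_relator_closed])

interpretation pcls: alg_morphism "free_algebra (hecke_gens m)" "affine_hecke m"
    "alg_quot_class (free_algebra (hecke_gens m)) (relators (hecke_gens m) R)"
  by (intro alg_morphismI A.kalg_axioms kalg_free_algebra)
    (unfold affine_hecke_def, rule presented_class_hom[OF affine_hecke_rels_closed])

lemma hecke_gen_closed: "k \<in> {1..m} \<Longrightarrow> hecke_x k \<in> carrier (cyclotomic_hecke m d v)"
  "k \<in> {1..<m} \<Longrightarrow> hecke_s k \<in> carrier (cyclotomic_hecke m d v)"
  unfolding hecke_x_def hecke_s_def by (rule cls.hom_closed, erule affine_hecke_gen_closed)+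

text \<open>The defining relations hold already in the affine algebra and pass to the cyclotomic
  quotient, where the cyclotomic element is killed in addition.\<close>

lemma hecke_family_cyclotomic: "hecke_family (cyclotomic_hecke m d v) m d v hecke_x hecke_s"
proof -
  let ?c = "alg_quot_class (free_algebra (hecke_gens m)) (relators (hecke_gens m) R)"
  have "\<forall>(p, q)\<in>R. ?c p = ?c q"
    using presented_relation[OF affine_hecke_rels_closed] by blast
  moreover have "(\<forall>(p, q)\<in>R. ?c p = ?c q) \<longleftrightarrow>
      (\<forall>(p, q)\<in>hecke_rels (affine_hecke m) m x0 s0. p = q)"
    by (subst (1) affine_hecke_rels_def, rule pcls.hecke_rels_hom[OF free_hecke_closed])
      (simp_all add: presented_gen_def)
  ultimately have "\<forall>(p, q)\<in>hecke_rels (affine_hecke m) m x0 s0. p = q" by blast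
  then have "\<forall>(p, q)\<in>hecke_rels (affine_hecke m) m x0 s0.
      alg_quot_class (affine_hecke m) S p = alg_quot_class (affine_hecke m) S q"
    by auto
  then have "\<forall>(p, q)\<in>hecke_rels (cyclotomic_hecke m d v) m hecke_x hecke_s. p = q"
    by (subst (asm) cls.hecke_rels_hom) (use affine_hecke_gen_closed in \<open>auto simp: hecke_x_def hecke_s_def\<close>)
  moreover have "cyclotomic_element (cyclotomic_hecke m d v) d v (hecke_x 1) =
      \<zero>\<^bsub>cyclotomic_hecke m d v\<^esub>" if "1 \<le> m"
  proof -
    have "alg_quot_class (affine_hecke m) S (cyclotomic_element (affine_hecke m) d v (x0 1)) =
        \<zero>\<^bsub>cyclotomic_hecke m d v\<^esub>"
      unfolding cyclotomic_hecke_def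
      by (rule A.alg_quot_class_eq_zero[OF cyclotomic_relator_closed]) (use that in auto)
    then show ?thesis
      unfolding hecke_x_def
      using cls.hom_cyclotomic[OF affine_hecke_gen_closed(1)[of 1], of d v] that by simp
  qed
  ultimately show ?thesis
    using hecke_gen_closed by (auto simp: hecke_family_def)
qed

lemma cyclotomic_hecke_generated:
  "alg_gen (cyclotomic_hecke m d v) (hecke_x ` {1..m} \<union> hecke_s ` {1..<m}) =
    carrier (cyclotomic_hecke m d v)"
proof -
  have "alg_gen (affine_hecke m) (presented_gen (hecke_gens m) R ` hecke_gens m) = carrier (affine_hecke m)"
    unfolding affine_hecke_def by (rule presented_generated[OF affine_hecke_rels_closed])
  moreover have "presented_gen (hecke_gens m) R ` hecke_gens m = x0 ` {1..m} \<union> s0 ` {1..<m}"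
    by (auto simp: hecke_gens_def)
  ultimately have "alg_gen (affine_hecke m) (x0 ` {1..m} \<union> s0 ` {1..<m}) = carrier (affine_hecke m)"
    by (simp only:)
  moreover have "x0 ` {1..m} \<union> s0 ` {1..<m} \<subseteq> carrier (affine_hecke m)"
    using affine_hecke_gen_closed by blast
  ultimately have "alg_gen (cyclotomic_hecke m d v) (alg_quot_class (affine_hecke m) S ` (x0 ` {1..m} \<union> s0 ` {1..<m})) =
      carrier (cyclotomic_hecke m d v)"
    unfolding cyclotomic_hecke_def by (intro A.alg_quot_generated[OF cyclotomic_relator_closed])
  moreover have "alg_quot_class (affine_hecke m) S ` (x0 ` {1..m} \<union> s0 ` {1..<m}) =
      hecke_x ` {1..m} \<union> hecke_s ` {1..<m}"
    unfolding image_Un image_image hecke_x_def[abs_def] hecke_s_def[abs_def] ..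
  ultimately show ?thesis by (simp only:)
qed

text \<open>Two universal properties in a row: the relations give a map on the affine algebra, and
  it kills the relator of the second quotient because homomorphisms are compatible with
  \<open>cyclotomic_element\<close>.\<close>

lemma cyclotomic_hecke_lift:
  fixes B :: "('k, 'b) module"
  assumes B: "kalg B" and fam: "hecke_family B m d v x s"
  shows "\<exists>h\<in>alg_hom (cyclotomic_hecke m d v) B.
    (\<forall>k\<in>{1..m}. h (hecke_x k) = x k) \<and> (\<forall>k\<in>{1..<m}. h (hecke_s k) = s k)"
proof -
  define b where "b g = (case g of HX k \<Rightarrow> x k | HS k \<Rightarrow> s k)" for g
  have x: "x \<in> {1..m} \<rightarrow> carrier B" and s: "s \<in> {1..<m} \<rightarrow> carrier B"
    and rel: "\<forall>(p, q)\<in>hecke_rels B m x s. p = q"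
    and cyc: "1 \<le> m \<Longrightarrow> cyclotomic_element B d v (x 1) = \<zero>\<^bsub>B\<^esub>"
    using fam by (auto simp: hecke_family_def)
  have b: "b g \<in> carrier B" if "g \<in> hecke_gens m" for g
    using that x s by (auto simp: hecke_gens_def b_def)
  have "F p = F q"
    if F: "F \<in> alg_hom (free_algebra (hecke_gens m)) B" and g: "\<And>g. g \<in> hecke_gens m \<Longrightarrow> F (free_gen g) = b g"
      and pq: "(p, q) \<in> R" for F p q
  proof -
    interpret F: alg_morphism "free_algebra (hecke_gens m)" B F
      by (rule alg_morphismI[OF kalg_free_algebra B F])
    have "\<forall>(p, q)\<in>R. F p = F q"
      unfolding affine_hecke_rels_def
      by (subst F.hecke_rels_hom[OF free_hecke_closed, of x s])
        (use rel in \<open>simp_all add: g hecke_gens_def b_def\<close>)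
    with pq show ?thesis by auto
  qed
  then obtain g where g: "g \<in> alg_hom (affine_hecke m) B"
      "\<And>a. a \<in> hecke_gens m \<Longrightarrow> g (presented_gen (hecke_gens m) R a) = b a"
    unfolding affine_hecke_def
    using presented_lift[where b = b, OF affine_hecke_rels_closed B b] by blast
  interpret g: alg_morphism "affine_hecke m" B g
    by (rule alg_morphismI[OF A.kalg_axioms B g(1)])
  have gx: "g (x0 k) = x k" if "k \<in> {1..m}" for k
    using g(2)[of "HX k"] that by (simp add: hecke_gens_def b_def)
  have gs: "g (s0 k) = s k" if "k \<in> {1..<m}" for k
    using g(2)[of "HS k"] that by (simp add: hecke_gens_def b_def)
  have z: "g a = \<zero>\<^bsub>B\<^esub>" if "a \<in> S" for a
    using that affine_hecke_gen_closed(1)[of 1] cyc gx[of 1]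
    by (auto simp: g.hom_cyclotomic split: if_splits)
  obtain h where h: "h \<in> alg_hom (cyclotomic_hecke m d v) B"
      "\<And>a. a \<in> carrier (affine_hecke m) \<Longrightarrow> h (alg_quot_class (affine_hecke m) S a) = g a"
    using A.alg_quot_lift[OF cyclotomic_relator_closed B g(1) z] unfolding cyclotomic_hecke_def by blast
  have "\<forall>k\<in>{1..m}. h (hecke_x k) = x k" "\<forall>k\<in>{1..<m}. h (hecke_s k) = s k"
    using gx gs h(2) affine_hecke_gen_closed by (auto simp: hecke_x_def hecke_s_def)
  with h(1) show ?thesis by blast
qed

end

section \<open>Cyclotomic Yokonuma--Hecke algebras\<close>

context
  fixes r n d :: nat and v :: "nat \<Rightarrow> 'k::field"
  assumes n: "1 \<le> n"
begin

private abbreviation (input) "YR \<equiv> affine_yh_rels r n :: ((yh_gen list \<Rightarrow>\<^sub>0 'k) \<times> _) set"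
private abbreviation (input) "t0 \<equiv> (\<lambda>k. presented_gen (yh_gens n) YR (YT k))"
private abbreviation (input) "f0 \<equiv> (\<lambda>k. presented_gen (yh_gens n) YR (YF k))"
private abbreviation (input) "x1 \<equiv> (\<lambda>k. presented_gen (yh_gens n) YR (YX k))"
private abbreviation (input) "YS \<equiv> {cyclotomic_element (affine_yokonuma_hecke r n) d v (x1 1)}"
private abbreviation (input) "Y \<equiv> cyclotomic_yokonuma_hecke r n d v"

interpretation F: kalg "free_algebra (yh_gens n) :: ('k, _) module" by (rule kalg_free_algebra)

lemma free_yh_closed:
  "(\<lambda>k. free_gen (YT k)) \<in> {1..n} \<rightarrow> carrier (free_algebra (yh_gens n) :: ('k, _) module)"
  "(\<lambda>k. free_gen (YF k)) \<in> {1..<n} \<rightarrow> carrier (free_algebra (yh_gens n) :: ('k, _) module)"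
  "(\<lambda>k. free_gen (YX k)) \<in> {1..n} \<rightarrow> carrier (free_algebra (yh_gens n) :: ('k, _) module)"
  by (auto simp: yh_gens_def intro!: free_gen_closed)

lemma affine_yh_rels_closed:
  "YR \<subseteq> carrier (free_algebra (yh_gens n)) \<times> carrier (free_algebra (yh_gens n))"
  unfolding affine_yh_rels_def by (rule F.yh_rels_closed[OF free_yh_closed])

interpretation A: kalg "affine_yokonuma_hecke r n :: ('k, _) module"
  unfolding affine_yokonuma_hecke_def by (rule kalg_presented_algebra[OF affine_yh_rels_closed])

lemma affine_yh_gen_closed: "k \<in> {1..n} \<Longrightarrow> t0 k \<in> carrier (affine_yokonuma_hecke r n)"
  "k \<in> {1..<n} \<Longrightarrow> f0 k \<in> carrier (affine_yokonuma_hecke r n)"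
  "k \<in> {1..n} \<Longrightarrow> x1 k \<in> carrier (affine_yokonuma_hecke r n)"
  unfolding affine_yokonuma_hecke_def
  by (rule presented_gen_closed[OF affine_yh_rels_closed], simp add: yh_gens_def)+

lemma cyclotomic_yh_relator_closed: "YS \<subseteq> carrier (affine_yokonuma_hecke r n)"
  using affine_yh_gen_closed(3)[of 1] n A.cyclotomic_closed by auto

definition yh_t :: "nat \<Rightarrow> (yh_gen list \<Rightarrow>\<^sub>0 'k) set set" where
  "yh_t k = alg_quot_class (affine_yokonuma_hecke r n) YS (t0 k)"

definition yh_f :: "nat \<Rightarrow> (yh_gen list \<Rightarrow>\<^sub>0 'k) set set" where
  "yh_f k = alg_quot_class (affine_yokonuma_hecke r n) YS (f0 k)"

definition yh_x :: "nat \<Rightarrow> (yh_gen list \<Rightarrow>\<^sub>0 'k) set set" where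
  "yh_x k = alg_quot_class (affine_yokonuma_hecke r n) YS (x1 k)"

lemma kalg_cyclotomic_yh: "kalg Y"
  unfolding cyclotomic_yokonuma_hecke_def by (rule A.kalg_alg_quot[OF cyclotomic_yh_relator_closed])

interpretation cls: alg_morphism "affine_yokonuma_hecke r n" Y
    "alg_quot_class (affine_yokonuma_hecke r n) YS"
  by (intro alg_morphismI A.kalg_axioms kalg_cyclotomic_yh)
    (unfold cyclotomic_yokonuma_hecke_def, rule A.alg_quot_class_hom[OF cyclotomic_yh_relator_closed])

interpretation pcls: alg_morphism "free_algebra (yh_gens n)" "affine_yokonuma_hecke r n"
    "alg_quot_class (free_algebra (yh_gens n)) (relators (yh_gens n) YR)"
  by (intro alg_morphismI A.kalg_axioms kalg_free_algebra)
    (unfold affine_yokonuma_hecke_def, rule presented_class_hom[OF affine_yh_rels_closed])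

lemma yh_gen_closed: "k \<in> {1..n} \<Longrightarrow> yh_t k \<in> carrier Y"
  "k \<in> {1..<n} \<Longrightarrow> yh_f k \<in> carrier Y" "k \<in> {1..n} \<Longrightarrow> yh_x k \<in> carrier Y"
  unfolding yh_t_def yh_f_def yh_x_def by (rule cls.hom_closed, erule affine_yh_gen_closed)+

lemma yh_family_cyclotomic: "yh_family Y r n d v yh_t yh_f yh_x"
proof -
  let ?c = "alg_quot_class (free_algebra (yh_gens n)) (relators (yh_gens n) YR)"
  have "\<forall>(p, q)\<in>YR. ?c p = ?c q"
    using presented_relation[OF affine_yh_rels_closed] by blast
  moreover have "(\<forall>(p, q)\<in>YR. ?c p = ?c q) \<longleftrightarrow>
      (\<forall>(p, q)\<in>yh_rels (affine_yokonuma_hecke r n) r n t0 f0 x1. p = q)"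
    by (subst (1) affine_yh_rels_def, rule pcls.yh_rels_hom[OF free_yh_closed])
      (simp_all add: presented_gen_def)
  ultimately have "\<forall>(p, q)\<in>yh_rels (affine_yokonuma_hecke r n) r n t0 f0 x1. p = q" by blast
  then have "\<forall>(p, q)\<in>yh_rels (affine_yokonuma_hecke r n) r n t0 f0 x1.
      alg_quot_class (affine_yokonuma_hecke r n) YS p = alg_quot_class (affine_yokonuma_hecke r n) YS q"
    by auto
  then have "\<forall>(p, q)\<in>yh_rels Y r n yh_t yh_f yh_x. p = q"
    by (subst (asm) cls.yh_rels_hom)
      (use affine_yh_gen_closed in \<open>auto simp: yh_t_def yh_f_def yh_x_def\<close>)
  moreover have "cyclotomic_element Y d v (yh_x 1) = \<zero>\<^bsub>Y\<^esub>"
  proof -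
    have "alg_quot_class (affine_yokonuma_hecke r n) YS
        (cyclotomic_element (affine_yokonuma_hecke r n) d v (x1 1)) = \<zero>\<^bsub>Y\<^esub>"
      unfolding cyclotomic_yokonuma_hecke_def
      by (rule A.alg_quot_class_eq_zero[OF cyclotomic_yh_relator_closed]) auto
    then show ?thesis
      unfolding yh_x_def
      using cls.hom_cyclotomic[OF affine_yh_gen_closed(3)[of 1], of d v] n by simp
  qed
  ultimately show ?thesis
    using yh_gen_closed by (auto simp: yh_family_def)
qed

lemma cyclotomic_yh_generated:
  "alg_gen Y (yh_t ` {1..n} \<union> yh_f ` {1..<n} \<union> yh_x ` {1..n}) = carrier Y"
proof -
  let ?G = "t0 ` {1..n} \<union> f0 ` {1..<n} \<union> x1 ` {1..n}"
  have "alg_gen (affine_yokonuma_hecke r n) (presented_gen (yh_gens n) YR ` yh_gens n) =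
      carrier (affine_yokonuma_hecke r n)"
    unfolding affine_yokonuma_hecke_def by (rule presented_generated[OF affine_yh_rels_closed])
  moreover have "presented_gen (yh_gens n) YR ` yh_gens n = ?G"
    by (auto simp: yh_gens_def)
  ultimately have "alg_gen (affine_yokonuma_hecke r n) ?G = carrier (affine_yokonuma_hecke r n)"
    by (simp only:)
  moreover have "?G \<subseteq> carrier (affine_yokonuma_hecke r n)"
    using affine_yh_gen_closed by blast
  ultimately have "alg_gen Y (alg_quot_class (affine_yokonuma_hecke r n) YS ` ?G) = carrier Y"
    unfolding cyclotomic_yokonuma_hecke_def by (intro A.alg_quot_generated[OF cyclotomic_yh_relator_closed])
  moreover have "alg_quot_class (affine_yokonuma_hecke r n) YS ` ?G =
      yh_t ` {1..n} \<union> yh_f ` {1..<n} \<union> yh_x ` {1..n}"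
    unfolding image_Un image_image yh_t_def[abs_def] yh_f_def[abs_def] yh_x_def[abs_def] ..
  ultimately show ?thesis by (simp only:)
qed

lemma cyclotomic_yh_lift:
  fixes B :: "('k, 'b) module"
  assumes B: "kalg B" and fam: "yh_family B r n d v t f x"
  shows "\<exists>h\<in>alg_hom Y B. (\<forall>k\<in>{1..n}. h (yh_t k) = t k) \<and> (\<forall>k\<in>{1..<n}. h (yh_f k) = f k) \<and>
    (\<forall>k\<in>{1..n}. h (yh_x k) = x k)"
proof -
  define b where "b g = (case g of YT k \<Rightarrow> t k | YF k \<Rightarrow> f k | YX k \<Rightarrow> x k)" for g
  have t: "t \<in> {1..n} \<rightarrow> carrier B" and f: "f \<in> {1..<n} \<rightarrow> carrier B"
    and x: "x \<in> {1..n} \<rightarrow> carrier B"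
    and rel: "\<forall>(p, q)\<in>yh_rels B r n t f x. p = q"
    and cyc: "cyclotomic_element B d v (x 1) = \<zero>\<^bsub>B\<^esub>"
    using fam by (auto simp: yh_family_def)
  have b: "b g \<in> carrier B" if "g \<in> yh_gens n" for g
    using that t f x by (auto simp: yh_gens_def b_def)
  have "F p = F q"
    if F: "F \<in> alg_hom (free_algebra (yh_gens n)) B" and g: "\<And>g. g \<in> yh_gens n \<Longrightarrow> F (free_gen g) = b g"
      and pq: "(p, q) \<in> YR" for F p q
  proof -
    interpret F: alg_morphism "free_algebra (yh_gens n)" B F
      by (rule alg_morphismI[OF kalg_free_algebra B F])
    have "\<forall>(p, q)\<in>YR. F p = F q"
      unfolding affine_yh_rels_def
      by (subst F.yh_rels_hom[OF free_yh_closed, of t f x])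
        (use rel in \<open>simp_all add: g yh_gens_def b_def\<close>)
    with pq show ?thesis by auto
  qed
  then obtain g where g: "g \<in> alg_hom (affine_yokonuma_hecke r n) B"
      "\<And>a. a \<in> yh_gens n \<Longrightarrow> g (presented_gen (yh_gens n) YR a) = b a"
    unfolding affine_yokonuma_hecke_def
    using presented_lift[where b = b, OF affine_yh_rels_closed B b] by blast
  interpret g: alg_morphism "affine_yokonuma_hecke r n" B g
    by (rule alg_morphismI[OF A.kalg_axioms B g(1)])
  have gt: "g (t0 k) = t k" if "k \<in> {1..n}" for k
    using g(2)[of "YT k"] that by (simp add: yh_gens_def b_def)
  have gf: "g (f0 k) = f k" if "k \<in> {1..<n}" for k
    using g(2)[of "YF k"] that by (simp add: yh_gens_def b_def)
  have gx: "g (x1 k) = x k" if "k \<in> {1..n}" for k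
    using g(2)[of "YX k"] that by (simp add: yh_gens_def b_def)
  have z: "g a = \<zero>\<^bsub>B\<^esub>" if "a \<in> YS" for a
    using that affine_yh_gen_closed(3)[of 1] cyc gx[of 1] n
    by (auto simp: g.hom_cyclotomic)
  obtain h where h: "h \<in> alg_hom Y B"
      "\<And>a. a \<in> carrier (affine_yokonuma_hecke r n) \<Longrightarrow> h (alg_quot_class (affine_yokonuma_hecke r n) YS a) = g a"
    using A.alg_quot_lift[OF cyclotomic_yh_relator_closed B g(1) z] unfolding cyclotomic_yokonuma_hecke_def by blast
  have "\<forall>k\<in>{1..n}. h (yh_t k) = t k" "\<forall>k\<in>{1..<n}. h (yh_f k) = f k" "\<forall>k\<in>{1..n}. h (yh_x k) = x k"
    using gt gf gx h(2) affine_yh_gen_closed by (auto simp: yh_t_def yh_f_def yh_x_def)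
  with h(1) show ?thesis by blast
qed

end

section \<open>Tensor products of cyclotomic Hecke algebras\<close>

context
  fixes \<mu> :: "nat list" and d :: nat and v :: "nat \<Rightarrow> 'k::field"
begin

private abbreviation (input) "r \<equiv> length \<mu>"
private abbreviation (input) "H \<equiv> (\<lambda>a. cyclotomic_hecke (\<mu> ! a) d v)"

interpretation tensor_factors "{..<r}" H
  by (rule tensor_factors.intro) (rule kalg_cyclotomic_hecke)

definition tensor_x :: "nat \<Rightarrow> nat \<Rightarrow> ((nat \<Rightarrow> (hecke_gen list \<Rightarrow>\<^sub>0 'k) set set) \<Rightarrow>\<^sub>0 'k) set" where
  "tensor_x a k = tensor_incl a (hecke_x (\<mu> ! a) d v k)"

definition tensor_s :: "nat \<Rightarrow> nat \<Rightarrow> ((nat \<Rightarrow> (hecke_gen list \<Rightarrow>\<^sub>0 'k) set set) \<Rightarrow>\<^sub>0 'k) set" where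
  "tensor_s a k = tensor_incl a (hecke_s (\<mu> ! a) d v k)"

definition tensor_gens :: "nat \<Rightarrow> ((nat \<Rightarrow> (hecke_gen list \<Rightarrow>\<^sub>0 'k) set set) \<Rightarrow>\<^sub>0 'k) set set" where
  "tensor_gens a = tensor_x a ` {1..\<mu> ! a} \<union> tensor_s a ` {1..<\<mu> ! a}"

lemma kalg_hecke_tensor: "kalg (hecke_tensor \<mu> d v)"
  unfolding hecke_tensor_def by (rule kalg_tensor)

lemma incl_morphism: "a < r \<Longrightarrow> alg_morphism (H a) (hecke_tensor \<mu> d v) (tensor_incl a)"
  unfolding hecke_tensor_def
  by (intro alg_morphismI kalg_cyclotomic_hecke kalg_tensor tensor_incl_hom) simp

lemma hecke_family_tensor:
  assumes "a < r"
  shows "hecke_family (hecke_tensor \<mu> d v) (\<mu> ! a) d v (tensor_x a) (tensor_s a)"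
  unfolding tensor_x_def[abs_def] tensor_s_def[abs_def]
  by (rule alg_morphism.hecke_family_hom[OF incl_morphism[OF assms] hecke_family_cyclotomic])

lemma tensor_gens_incl:
  "tensor_gens a = tensor_incl a ` (hecke_x (\<mu> ! a) d v ` {1..\<mu> ! a} \<union> hecke_s (\<mu> ! a) d v ` {1..<\<mu> ! a})"
  unfolding tensor_gens_def tensor_x_def[abs_def] tensor_s_def[abs_def] image_Un image_image ..

lemma hecke_gens_subset:
  "hecke_x (\<mu> ! a) d v ` {1..\<mu> ! a} \<union> hecke_s (\<mu> ! a) d v ` {1..<\<mu> ! a} \<subseteq> carrier (H a)"
  using hecke_gen_closed by blast

lemma tensor_gens_commute:
  assumes "a < r" "b < r" "a \<noteq> b" "p \<in> tensor_gens a" "q \<in> tensor_gens b"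
  shows "p \<otimes>\<^bsub>hecke_tensor \<mu> d v\<^esub> q = q \<otimes>\<^bsub>hecke_tensor \<mu> d v\<^esub> p"
proof -
  obtain p' q' where "p = tensor_incl a p'" "p' \<in> carrier (H a)" "q = tensor_incl b q'" "q' \<in> carrier (H b)"
    using assms(4,5) hecke_gens_subset unfolding tensor_gens_incl by blast
  then show ?thesis
    using tensor_incl_commute[of a b p' q'] assms(1-3) by (simp add: hecke_tensor_def)
qed

lemma hecke_tensor_generated:
  "alg_gen (hecke_tensor \<mu> d v) (\<Union>a<r. tensor_gens a) = carrier (hecke_tensor \<mu> d v)"
  unfolding tensor_gens_incl hecke_tensor_def
  by (rule tensor_generated[OF finite_lessThan hecke_gens_subset cyclotomic_hecke_generated])

text \<open>Unlike in \<open>tensor_lift\<close>, commutation is asked only of generators;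
  \<open>commute_alg_gen\<close>, applied in each argument, extends it to the images of the whole
  factors.\<close>

lemma hecke_tensor_lift:
  fixes B :: "('k, 'b) module"
  assumes B: "kalg B" and fam: "\<And>a. a < r \<Longrightarrow> hecke_family B (\<mu> ! a) d v (x a) (s a)"
    and comm: "\<And>a b p q. a < r \<Longrightarrow> b < r \<Longrightarrow> a \<noteq> b \<Longrightarrow>
      p \<in> x a ` {1..\<mu> ! a} \<union> s a ` {1..<\<mu> ! a} \<Longrightarrow> q \<in> x b ` {1..\<mu> ! b} \<union> s b ` {1..<\<mu> ! b} \<Longrightarrow>
      p \<otimes>\<^bsub>B\<^esub> q = q \<otimes>\<^bsub>B\<^esub> p"
  shows "\<exists>h\<in>alg_hom (hecke_tensor \<mu> d v) B. \<forall>a<r.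
    (\<forall>k\<in>{1..\<mu> ! a}. h (tensor_x a k) = x a k) \<and> (\<forall>k\<in>{1..<\<mu> ! a}. h (tensor_s a k) = s a k)"
proof -
  interpret K: kalg B by fact
  have "\<forall>a. \<exists>\<phi>. a < r \<longrightarrow> \<phi> \<in> alg_hom (H a) B \<and>
    (\<forall>k\<in>{1..\<mu> ! a}. \<phi> (hecke_x (\<mu> ! a) d v k) = x a k) \<and>
    (\<forall>k\<in>{1..<\<mu> ! a}. \<phi> (hecke_s (\<mu> ! a) d v k) = s a k)"
    using cyclotomic_hecke_lift[OF B fam] by blast
  then obtain \<phi> where \<phi>: "\<And>a. a < r \<Longrightarrow> \<phi> a \<in> alg_hom (H a) B"
    "\<And>a k. a < r \<Longrightarrow> k \<in> {1..\<mu> ! a} \<Longrightarrow> \<phi> a (hecke_x (\<mu> ! a) d v k) = x a k"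
    "\<And>a k. a < r \<Longrightarrow> k \<in> {1..<\<mu> ! a} \<Longrightarrow> \<phi> a (hecke_s (\<mu> ! a) d v k) = s a k"
    by metis
  have gen: "\<phi> a p \<in> alg_gen B (x a ` {1..\<mu> ! a} \<union> s a ` {1..<\<mu> ! a})"
    if a: "a < r" and p: "p \<in> carrier (H a)" for a p
  proof -
    interpret m: alg_morphism "H a" B "\<phi> a"
      by (rule alg_morphismI[OF kalg_cyclotomic_hecke B \<phi>(1)[OF a]])
    have "\<phi> a p \<in> alg_gen B (\<phi> a ` (hecke_x (\<mu> ! a) d v ` {1..\<mu> ! a} \<union> hecke_s (\<mu> ! a) d v ` {1..<\<mu> ! a}))"
      using m.hom_alg_gen[OF hecke_gens_subset] p cyclotomic_hecke_generated by blast
    also have "\<phi> a ` (hecke_x (\<mu> ! a) d v ` {1..\<mu> ! a} \<union> hecke_s (\<mu> ! a) d v ` {1..<\<mu> ! a}) =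
        x a ` {1..\<mu> ! a} \<union> s a ` {1..<\<mu> ! a}"
      unfolding image_Un image_image using \<phi>(2,3)[OF a] by (intro arg_cong2[of _ _ _ _ "(\<union>)"] image_cong) auto
    finally show ?thesis .
  qed
  have G: "x a ` {1..\<mu> ! a} \<union> s a ` {1..<\<mu> ! a} \<subseteq> carrier B" if "a < r" for a
    using fam[OF that] by (auto simp: hecke_family_def)
  have "\<phi> a p \<otimes>\<^bsub>B\<^esub> \<phi> b q = \<phi> b q \<otimes>\<^bsub>B\<^esub> \<phi> a p"
    if ab: "a < r" "b < r" "a \<noteq> b" and p: "p \<in> carrier (H a)" and q: "q \<in> carrier (H b)" for a b p q
  proof -
    have bq: "\<phi> b q \<in> carrier B" using gen[OF ab(2) q] G[OF ab(2)] K.alg_gen_closed by blast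
    show ?thesis
    proof (rule K.commute_alg_gen[OF G[OF ab(1)] bq gen[OF ab(1) p]])
      fix g assume g: "g \<in> x a ` {1..\<mu> ! a} \<union> s a ` {1..<\<mu> ! a}"
      then have "g \<in> carrier B" using G[OF ab(1)] by blast
      then have "\<phi> b q \<otimes>\<^bsub>B\<^esub> g = g \<otimes>\<^bsub>B\<^esub> \<phi> b q"
        by (rule K.commute_alg_gen[OF G[OF ab(2)] _ gen[OF ab(2) q]]) (rule comm[OF ab(2,1) ab(3)[symmetric] _ g])
      then show "g \<otimes>\<^bsub>B\<^esub> \<phi> b q = \<phi> b q \<otimes>\<^bsub>B\<^esub> g" by simp
    qed
  qed
  then have "\<exists>h\<in>alg_hom (tensor_algebra {..<r} H) B. \<forall>a<r. \<forall>p\<in>carrier (H a). h (tensor_incl a p) = \<phi> a p"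
    by (intro tensor_lift[OF kalg_cyclotomic_hecke B \<phi>(1)]) blast+
  then obtain h where h: "h \<in> alg_hom (hecke_tensor \<mu> d v) B"
    "\<And>a p. a < r \<Longrightarrow> p \<in> carrier (H a) \<Longrightarrow> h (tensor_incl a p) = \<phi> a p"
    unfolding hecke_tensor_def by blast
  show ?thesis
    by (intro bexI[OF _ h(1)] allI impI conjI ballI; unfold tensor_x_def tensor_s_def)
      (simp_all add: h(2) hecke_gen_closed \<phi>(2,3))
qed

end

section \<open>Direct sums and matrix algebras\<close>

lemma direct_sum_algebra_simps [simp]:
  "carrier (direct_sum_algebra I A) = (\<Pi>\<^sub>E i\<in>I. carrier (A i))"
  "\<one>\<^bsub>direct_sum_algebra I A\<^esub> = (\<lambda>i\<in>I. \<one>\<^bsub>A i\<^esub>)"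
  "\<zero>\<^bsub>direct_sum_algebra I A\<^esub> = (\<lambda>i\<in>I. \<zero>\<^bsub>A i\<^esub>)"
  "x \<otimes>\<^bsub>direct_sum_algebra I A\<^esub> y = (\<lambda>i\<in>I. x i \<otimes>\<^bsub>A i\<^esub> y i)"
  "x \<oplus>\<^bsub>direct_sum_algebra I A\<^esub> y = (\<lambda>i\<in>I. x i \<oplus>\<^bsub>A i\<^esub> y i)"
  "c \<odot>\<^bsub>direct_sum_algebra I A\<^esub> x = (\<lambda>i\<in>I. c \<odot>\<^bsub>A i\<^esub> x i)"
  by (simp_all add: direct_sum_algebra_def)

lemma (in abelian_monoid) finsum_swap:
  assumes "finite I" "finite J" "\<And>i j. i \<in> I \<Longrightarrow> j \<in> J \<Longrightarrow> f i j \<in> carrier G"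
  shows "(\<Oplus>i\<in>I. \<Oplus>j\<in>J. f i j) = (\<Oplus>j\<in>J. \<Oplus>i\<in>I. f i j)"
  using assms(1,3)
proof (induction I rule: finite_induct)
  case empty
  then show ?case by (simp add: finsum_zero)
next
  case (insert i I)
  have "(\<Oplus>i\<in>insert i I. \<Oplus>j\<in>J. f i j) = (\<Oplus>j\<in>J. f i j) \<oplus> (\<Oplus>i\<in>I. \<Oplus>j\<in>J. f i j)"
    using insert by (intro finsum_insert) (auto intro!: finsum_closed)
  also have "(\<Oplus>i\<in>I. \<Oplus>j\<in>J. f i j) = (\<Oplus>j\<in>J. \<Oplus>i\<in>I. f i j)" using insert by simp
  also have "(\<Oplus>j\<in>J. f i j) \<oplus> (\<Oplus>j\<in>J. \<Oplus>i\<in>I. f i j) = (\<Oplus>j\<in>J. f i j \<oplus> (\<Oplus>i\<in>I. f i j))"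
    using insert by (intro finsum_addf[symmetric]) (auto intro!: finsum_closed)
  also have "\<dots> = (\<Oplus>j\<in>J. \<Oplus>i\<in>insert i I. f i j)"
    using insert by (intro finsum_cong') (auto intro!: finsum_closed finsum_insert[symmetric])
  finally show ?case .
qed

text \<open>Monomial matrices and matrix units leave at most one nonzero term in each entry of a
  product; this lemma isolates it.\<close>

lemma (in abelian_monoid) finsum_only:
  assumes "finite I" "k \<in> I" "f k \<in> carrier G" "\<And>i. i \<in> I \<Longrightarrow> i \<noteq> k \<Longrightarrow> f i = \<zero>"
  shows "(\<Oplus>i\<in>I. f i) = f k"
proof -
  have c: "f i \<in> carrier G" if "i \<in> I" for i
    using assms(3) assms(4)[OF that] by (cases "i = k") auto
  have "(\<Oplus>i\<in>I. f i) = (\<Oplus>i\<in>I. if k = i then f i else \<zero>)"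
    using assms c by (intro finsum_cong') auto
  also have "\<dots> = f k"
    using assms c by (intro add.finprod_singleton) auto
  finally show ?thesis .
qed

lemma mat_algebra_simps [simp]:
  "carrier (mat_algebra m A) = {..<m} \<times> {..<m} \<rightarrow>\<^sub>E carrier A"
  "\<one>\<^bsub>mat_algebra m A\<^esub> = (\<lambda>(i, j)\<in>{..<m} \<times> {..<m}. if i = j then \<one>\<^bsub>A\<^esub> else \<zero>\<^bsub>A\<^esub>)"
  "\<zero>\<^bsub>mat_algebra m A\<^esub> = (\<lambda>ij\<in>{..<m} \<times> {..<m}. \<zero>\<^bsub>A\<^esub>)"
  "M \<otimes>\<^bsub>mat_algebra m A\<^esub> N = (\<lambda>(i, j)\<in>{..<m} \<times> {..<m}. \<Oplus>\<^bsub>A\<^esub>k\<in>{..<m}. M (i, k) \<otimes>\<^bsub>A\<^esub> N (k, j))"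
  "M \<oplus>\<^bsub>mat_algebra m A\<^esub> N = (\<lambda>ij\<in>{..<m} \<times> {..<m}. M ij \<oplus>\<^bsub>A\<^esub> N ij)"
  "c \<odot>\<^bsub>mat_algebra m A\<^esub> M = (\<lambda>ij\<in>{..<m} \<times> {..<m}. c \<odot>\<^bsub>A\<^esub> M ij)"
  by (simp_all add: mat_algebra_def)

context kalg
begin

lemma mat_ext:
  assumes "M \<in> extensional ({..<m} \<times> {..<m})" "N \<in> extensional ({..<m} \<times> {..<m})"
    and "\<And>i j. i < m \<Longrightarrow> j < m \<Longrightarrow> M (i, j) = N (i, j)"
  shows "M = N"
  using assms by (intro extensionalityI[of M "{..<m} \<times> {..<m}"]) auto

lemma kalg_mat_algebra: "kalg (mat_algebra m A)"
proof (rule kalgI)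
  fix M N P assume "M \<in> carrier (mat_algebra m A)" "N \<in> carrier (mat_algebra m A)"
    "P \<in> carrier (mat_algebra m A)"
  then have c: "M (i, j) \<in> carrier A" "N (i, j) \<in> carrier A" "P (i, j) \<in> carrier A"
    if "i < m" "j < m" for i j using that by auto
  show "M \<otimes>\<^bsub>mat_algebra m A\<^esub> N \<otimes>\<^bsub>mat_algebra m A\<^esub> P = M \<otimes>\<^bsub>mat_algebra m A\<^esub> (N \<otimes>\<^bsub>mat_algebra m A\<^esub> P)"
  proof (rule mat_ext)
    fix i j assume ij: "i < m" "j < m"
    have "(\<Oplus>k\<in>{..<m}. (\<Oplus>l\<in>{..<m}. M (i, l) \<otimes> N (l, k)) \<otimes> P (k, j)) =
        (\<Oplus>k\<in>{..<m}. \<Oplus>l\<in>{..<m}. M (i, l) \<otimes> (N (l, k) \<otimes> P (k, j)))"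
      using ij by (intro finsum_cong') (auto simp: finsum_ldistr c m_assoc intro!: finsum_closed finsum_cong')
    also have "\<dots> = (\<Oplus>l\<in>{..<m}. \<Oplus>k\<in>{..<m}. M (i, l) \<otimes> (N (l, k) \<otimes> P (k, j)))"
      using ij by (intro finsum_swap) (auto simp: c)
    also have "\<dots> = (\<Oplus>l\<in>{..<m}. M (i, l) \<otimes> (\<Oplus>k\<in>{..<m}. N (l, k) \<otimes> P (k, j)))"
      using ij by (intro finsum_cong') (auto simp: finsum_rdistr c intro!: finsum_closed)
    finally show "(M \<otimes>\<^bsub>mat_algebra m A\<^esub> N \<otimes>\<^bsub>mat_algebra m A\<^esub> P) (i, j) =
        (M \<otimes>\<^bsub>mat_algebra m A\<^esub> (N \<otimes>\<^bsub>mat_algebra m A\<^esub> P)) (i, j)"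
      using ij by (simp add: c Pi_iff finsum_closed cong: finsum_cong)
  qed auto
  show "(M \<oplus>\<^bsub>mat_algebra m A\<^esub> N) \<otimes>\<^bsub>mat_algebra m A\<^esub> P =
      M \<otimes>\<^bsub>mat_algebra m A\<^esub> P \<oplus>\<^bsub>mat_algebra m A\<^esub> N \<otimes>\<^bsub>mat_algebra m A\<^esub> P"
  proof (rule mat_ext)
    fix i j assume ij: "i < m" "j < m"
    have "(\<Oplus>k\<in>{..<m}. (M (i, k) \<oplus> N (i, k)) \<otimes> P (k, j)) =
        (\<Oplus>k\<in>{..<m}. M (i, k) \<otimes> P (k, j)) \<oplus> (\<Oplus>k\<in>{..<m}. N (i, k) \<otimes> P (k, j))"
      using ij by (subst finsum_addf[symmetric]) (auto simp: c l_distr simp del: finsum_addf intro!: finsum_cong')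
    then show "((M \<oplus>\<^bsub>mat_algebra m A\<^esub> N) \<otimes>\<^bsub>mat_algebra m A\<^esub> P) (i, j) =
      (M \<otimes>\<^bsub>mat_algebra m A\<^esub> P \<oplus>\<^bsub>mat_algebra m A\<^esub> N \<otimes>\<^bsub>mat_algebra m A\<^esub> P) (i, j)"
      using ij by (simp add: c Pi_iff finsum_closed cong: finsum_cong)
  qed auto
  show "P \<otimes>\<^bsub>mat_algebra m A\<^esub> (M \<oplus>\<^bsub>mat_algebra m A\<^esub> N) =
      P \<otimes>\<^bsub>mat_algebra m A\<^esub> M \<oplus>\<^bsub>mat_algebra m A\<^esub> P \<otimes>\<^bsub>mat_algebra m A\<^esub> N"
  proof (rule mat_ext)
    fix i j assume ij: "i < m" "j < m"
    have "(\<Oplus>k\<in>{..<m}. P (i, k) \<otimes> (M (k, j) \<oplus> N (k, j))) =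
        (\<Oplus>k\<in>{..<m}. P (i, k) \<otimes> M (k, j)) \<oplus> (\<Oplus>k\<in>{..<m}. P (i, k) \<otimes> N (k, j))"
      using ij by (subst finsum_addf[symmetric]) (auto simp: c r_distr simp del: finsum_addf intro!: finsum_cong')
    then show "(P \<otimes>\<^bsub>mat_algebra m A\<^esub> (M \<oplus>\<^bsub>mat_algebra m A\<^esub> N)) (i, j) =
      (P \<otimes>\<^bsub>mat_algebra m A\<^esub> M \<oplus>\<^bsub>mat_algebra m A\<^esub> P \<otimes>\<^bsub>mat_algebra m A\<^esub> N) (i, j)"
      using ij by (simp add: c Pi_iff finsum_closed cong: finsum_cong)
  qed auto
next
  fix M N assume "M \<in> carrier (mat_algebra m A)" "N \<in> carrier (mat_algebra m A)"
  then have c: "M (i, j) \<in> carrier A" "N (i, j) \<in> carrier A" if "i < m" "j < m" for i j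
    using that by auto
  show "M \<otimes>\<^bsub>mat_algebra m A\<^esub> N \<in> carrier (mat_algebra m A)"
    by (auto simp: c intro!: finsum_closed)
  fix a
  show "a \<odot>\<^bsub>mat_algebra m A\<^esub> M \<otimes>\<^bsub>mat_algebra m A\<^esub> N = a \<odot>\<^bsub>mat_algebra m A\<^esub> (M \<otimes>\<^bsub>mat_algebra m A\<^esub> N)"
  proof (rule mat_ext)
    fix i j assume ij: "i < m" "j < m"
    have "(\<Oplus>k\<in>{..<m}. (a \<odot> M (i, k)) \<otimes> N (k, j)) = a \<odot> (\<Oplus>k\<in>{..<m}. M (i, k) \<otimes> N (k, j))"
      using ij by (subst smult_finsum) (auto simp: c smult_assoc2 intro!: finsum_cong')
    then show "(a \<odot>\<^bsub>mat_algebra m A\<^esub> M \<otimes>\<^bsub>mat_algebra m A\<^esub> N) (i, j) = (a \<odot>\<^bsub>mat_algebra m A\<^esub> (M \<otimes>\<^bsub>mat_algebra m A\<^esub> N)) (i, j)"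
      using ij by (simp add: c Pi_iff finsum_closed cong: finsum_cong)
  qed auto
  show "M \<otimes>\<^bsub>mat_algebra m A\<^esub> (a \<odot>\<^bsub>mat_algebra m A\<^esub> N) = a \<odot>\<^bsub>mat_algebra m A\<^esub> (M \<otimes>\<^bsub>mat_algebra m A\<^esub> N)"
  proof (rule mat_ext)
    fix i j assume ij: "i < m" "j < m"
    have "(\<Oplus>k\<in>{..<m}. M (i, k) \<otimes> (a \<odot> N (k, j))) = a \<odot> (\<Oplus>k\<in>{..<m}. M (i, k) \<otimes> N (k, j))"
      using ij by (subst smult_finsum) (auto simp: c smult_assoc3 intro!: finsum_cong')
    then show "(M \<otimes>\<^bsub>mat_algebra m A\<^esub> (a \<odot>\<^bsub>mat_algebra m A\<^esub> N)) (i, j) = (a \<odot>\<^bsub>mat_algebra m A\<^esub> (M \<otimes>\<^bsub>mat_algebra m A\<^esub> N)) (i, j)"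
      using ij by (simp add: c Pi_iff finsum_closed cong: finsum_cong)
  qed auto
next
  fix M assume M: "M \<in> carrier (mat_algebra m A)"
  then have c: "M (i, j) \<in> carrier A" if "i < m" "j < m" for i j
    using that by auto
  show "\<one>\<^bsub>mat_algebra m A\<^esub> \<otimes>\<^bsub>mat_algebra m A\<^esub> M = M"
  proof (rule mat_ext)
    fix i j assume ij: "i < m" "j < m"
    have "(\<Oplus>k\<in>{..<m}. (if i = k then \<one> else \<zero>) \<otimes> M (k, j)) = M (i, j)"
      using ij by (subst finsum_only[of _ i]) (auto simp: c)
    then show "(\<one>\<^bsub>mat_algebra m A\<^esub> \<otimes>\<^bsub>mat_algebra m A\<^esub> M) (i, j) = M (i, j)"
      using ij by (simp add: c Pi_iff finsum_closed cong: finsum_cong)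
  qed (use M in \<open>auto simp: PiE_iff\<close>)
  show "M \<otimes>\<^bsub>mat_algebra m A\<^esub> \<one>\<^bsub>mat_algebra m A\<^esub> = M"
  proof (rule mat_ext)
    fix i j assume ij: "i < m" "j < m"
    have "(\<Oplus>k\<in>{..<m}. M (i, k) \<otimes> (if k = j then \<one> else \<zero>)) = M (i, j)"
      using ij by (subst finsum_only[of _ j]) (auto simp: c)
    then show "(M \<otimes>\<^bsub>mat_algebra m A\<^esub> \<one>\<^bsub>mat_algebra m A\<^esub>) (i, j) = M (i, j)"
      using ij by (simp add: c Pi_iff finsum_closed cong: finsum_cong)
  qed (use M in \<open>auto simp: PiE_iff\<close>)
qed (auto simp: PiE_iff extensional_def fun_eq_iff a_ac smult_l_distr smult_r_distr smult_assoc1)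

end

text \<open>Rows and columns of \<open>mat_algebra\<close> are numbers below \<open>m\<close>, while
  the construction indexes them by words; \<open>\<beta>\<close> is an arbitrary numbering of the
  index set.\<close>

locale indexed_matrices = kalg A for A :: "('k::field, 'a) module" (structure) +
  fixes m :: nat and W :: "'w set" and \<beta> :: "nat \<Rightarrow> 'w"
  assumes \<beta>: "bij_betw \<beta> {..<m} W"
begin

abbreviation "Mat \<equiv> mat_algebra m A"

sublocale Mat: kalg Mat by (rule kalg_mat_algebra)

lemma \<beta>_in: "i < m \<Longrightarrow> \<beta> i \<in> W"
  using \<beta> by (auto simp: bij_betw_def)

lemma \<beta>_eq_iff: "i < m \<Longrightarrow> j < m \<Longrightarrow> \<beta> i = \<beta> j \<longleftrightarrow> i = j"
  using \<beta> by (auto simp: bij_betw_def inj_on_def)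

lemma \<beta>_surj: "\<chi> \<in> W \<Longrightarrow> \<exists>i<m. \<beta> i = \<chi>"
  using \<beta> by (auto simp: bij_betw_def image_iff)

text \<open>In column \<open>\<chi>\<close> the only possibly nonzero entry is
  \<open>c \<chi>\<close>, in row \<open>\<sigma> \<chi>\<close>. Coefficients thus belong to
  columns, and a column with \<open>\<sigma> \<chi>\<close> outside \<open>W\<close>
  vanishes.\<close>

definition monomial :: "('w \<Rightarrow> 'w) \<Rightarrow> ('w \<Rightarrow> 'a) \<Rightarrow> nat \<times> nat \<Rightarrow> 'a" where
  "monomial \<sigma> c = (\<lambda>(i, j)\<in>{..<m} \<times> {..<m}. if \<beta> i = \<sigma> (\<beta> j) then c (\<beta> j) else \<zero>)"

lemma monomial_apply: "i < m \<Longrightarrow> j < m \<Longrightarrow> monomial \<sigma> c (i, j) = (if \<beta> i = \<sigma> (\<beta> j) then c (\<beta> j) else \<zero>)"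
  by (simp add: monomial_def)

lemma monomial_closed: "c \<in> W \<rightarrow> carrier A \<Longrightarrow> monomial \<sigma> c \<in> carrier Mat"
  using \<beta>_in by (auto simp: monomial_def)

lemma monomial_cong:
  "(\<And>\<chi>. \<chi> \<in> W \<Longrightarrow> \<sigma> \<chi> = \<sigma>' \<chi>) \<Longrightarrow> (\<And>\<chi>. \<chi> \<in> W \<Longrightarrow> c \<chi> = c' \<chi>) \<Longrightarrow> monomial \<sigma> c = monomial \<sigma>' c'"
  using \<beta>_in by (auto simp: monomial_def fun_eq_iff)

text \<open>The right factor sends column \<open>\<chi>\<close> to \<open>\<tau> \<chi>\<close>,
  whose coefficient in the left factor then multiplies from the left. As \<open>\<tau>\<close>
  preserves \<open>W\<close>, there is an index through which the product passes.\<close>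

lemma monomial_mult:
  assumes "c \<in> W \<rightarrow> carrier A" "e \<in> W \<rightarrow> carrier A" "\<tau> \<in> W \<rightarrow> W"
  shows "monomial \<sigma> c \<otimes>\<^bsub>Mat\<^esub> monomial \<tau> e = monomial (\<lambda>\<chi>. \<sigma> (\<tau> \<chi>)) (\<lambda>\<chi>. c (\<tau> \<chi>) \<otimes> e \<chi>)"
proof (rule mat_ext)
  fix i j assume ij: "i < m" "j < m"
  have c: "c (\<beta> k) \<in> carrier A" "e (\<beta> k) \<in> carrier A" "c (\<tau> (\<beta> k)) \<in> carrier A" if "k < m" for k
    using that assms \<beta>_in by auto
  obtain k where k: "k < m" "\<beta> k = \<tau> (\<beta> j)" using \<beta>_surj[of "\<tau> (\<beta> j)"] assms(3) \<beta>_in[OF ij(2)] by auto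
  have "(\<Oplus>l\<in>{..<m}. monomial \<sigma> c (i, l) \<otimes> monomial \<tau> e (l, j)) = monomial \<sigma> c (i, k) \<otimes> monomial \<tau> e (k, j)"
  proof (rule finsum_only)
    fix l assume l: "l \<in> {..<m}" "l \<noteq> k"
    then have "\<beta> l \<noteq> \<tau> (\<beta> j)" using k \<beta>_eq_iff[of l k] by auto
    then show "monomial \<sigma> c (i, l) \<otimes> monomial \<tau> e (l, j) = \<zero>"
      using l ij by (simp add: monomial_apply c)
  qed (use ij k in \<open>auto simp: monomial_apply c\<close>)
  then show "(monomial \<sigma> c \<otimes>\<^bsub>Mat\<^esub> monomial \<tau> e) (i, j) = monomial (\<lambda>\<chi>. \<sigma> (\<tau> \<chi>)) (\<lambda>\<chi>. c (\<tau> \<chi>) \<otimes> e \<chi>) (i, j)"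
    using ij k c[of j] by (simp add: monomial_apply c Pi_iff cong: finsum_cong)
qed (auto simp: monomial_def)

lemma monomial_one: "\<one>\<^bsub>Mat\<^esub> = monomial (\<lambda>\<chi>. \<chi>) (\<lambda>_. \<one>)"
  by (rule mat_ext) (auto simp: monomial_def \<beta>_eq_iff)

lemma monomial_zero: "monomial \<sigma> (\<lambda>_. \<zero>) = \<zero>\<^bsub>Mat\<^esub>"
  by (rule mat_ext) (auto simp: monomial_def)

lemma monomial_smult: "c \<in> W \<rightarrow> carrier A \<Longrightarrow> a \<odot>\<^bsub>Mat\<^esub> monomial \<sigma> c = monomial \<sigma> (\<lambda>\<chi>. a \<odot> c \<chi>)"
  using \<beta>_in by (intro mat_ext[where m = m]) (auto simp: monomial_def)

lemma monomial_add: "c \<in> W \<rightarrow> carrier A \<Longrightarrow> e \<in> W \<rightarrow> carrier A \<Longrightarrow>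
    monomial \<sigma> c \<oplus>\<^bsub>Mat\<^esub> monomial \<sigma> e = monomial \<sigma> (\<lambda>\<chi>. c \<chi> \<oplus> e \<chi>)"
  using \<beta>_in by (intro mat_ext[where m = m]) (auto simp: monomial_def)

definition unit :: "'w \<Rightarrow> 'w \<Rightarrow> 'a \<Rightarrow> nat \<times> nat \<Rightarrow> 'a" where
  "unit \<chi> \<xi> h = (\<lambda>(i, j)\<in>{..<m} \<times> {..<m}. if \<beta> i = \<chi> \<and> \<beta> j = \<xi> then h else \<zero>)"

lemma unit_closed: "h \<in> carrier A \<Longrightarrow> unit \<chi> \<xi> h \<in> carrier Mat"
  by (auto simp: unit_def)

lemma unit_apply: "i < m \<Longrightarrow> j < m \<Longrightarrow> unit \<chi> \<xi> h (i, j) = (if \<beta> i = \<chi> \<and> \<beta> j = \<xi> then h else \<zero>)"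
  by (simp add: unit_def)

lemma unit_mult:
  assumes "g \<in> carrier A" "h \<in> carrier A" "\<xi> \<in> W"
  shows "unit \<chi> \<xi> g \<otimes>\<^bsub>Mat\<^esub> unit \<xi> \<eta> h = unit \<chi> \<eta> (g \<otimes> h)"
proof (rule mat_ext)
  fix i j assume ij: "i < m" "j < m"
  obtain k where k: "k < m" "\<beta> k = \<xi>" using \<beta>_surj assms by blast
  have "(\<Oplus>l\<in>{..<m}. unit \<chi> \<xi> g (i, l) \<otimes> unit \<xi> \<eta> h (l, j)) = unit \<chi> \<xi> g (i, k) \<otimes> unit \<xi> \<eta> h (k, j)"
  proof (rule finsum_only)
    fix l assume l: "l \<in> {..<m}" "l \<noteq> k"
    then have "\<beta> l \<noteq> \<xi>" using k \<beta>_eq_iff[of l k] by auto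
    then show "unit \<chi> \<xi> g (i, l) \<otimes> unit \<xi> \<eta> h (l, j) = \<zero>"
      using l ij assms by (simp add: unit_apply)
  qed (use ij k assms in \<open>auto simp: unit_apply\<close>)
  then show "(unit \<chi> \<xi> g \<otimes>\<^bsub>Mat\<^esub> unit \<xi> \<eta> h) (i, j) = unit \<chi> \<eta> (g \<otimes> h) (i, j)"
    using ij k assms by (simp add: unit_apply cong: finsum_cong)
qed (auto simp: unit_def)

lemma monomial_unit:
  assumes "c \<in> W \<rightarrow> carrier A" "h \<in> carrier A" "\<chi> \<in> W"
  shows "monomial \<sigma> c \<otimes>\<^bsub>Mat\<^esub> unit \<chi> \<xi> h = unit (\<sigma> \<chi>) \<xi> (c \<chi> \<otimes> h)"
proof (rule mat_ext)
  fix i j assume ij: "i < m" "j < m"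
  have c: "c (\<beta> k) \<in> carrier A" if "k < m" for k using that assms \<beta>_in by auto
  obtain k where k: "k < m" "\<beta> k = \<chi>" using \<beta>_surj assms by blast
  have "(\<Oplus>l\<in>{..<m}. monomial \<sigma> c (i, l) \<otimes> unit \<chi> \<xi> h (l, j)) = monomial \<sigma> c (i, k) \<otimes> unit \<chi> \<xi> h (k, j)"
  proof (rule finsum_only)
    fix l assume l: "l \<in> {..<m}" "l \<noteq> k"
    then have "\<beta> l \<noteq> \<chi>" using k \<beta>_eq_iff[of l k] by auto
    then show "monomial \<sigma> c (i, l) \<otimes> unit \<chi> \<xi> h (l, j) = \<zero>"
      using l ij assms by (simp add: unit_apply monomial_apply c)
  qed (use ij k assms in \<open>auto simp: unit_apply monomial_apply\<close>)
  then show "(monomial \<sigma> c \<otimes>\<^bsub>Mat\<^esub> unit \<chi> \<xi> h) (i, j) = unit (\<sigma> \<chi>) \<xi> (c \<chi> \<otimes> h) (i, j)"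
    using ij k assms c[of k] by (auto simp: unit_apply monomial_apply cong: finsum_cong)
qed (auto simp: unit_def)

lemma mat_eq_sum_units:
  assumes "M \<in> carrier Mat"
  shows "M = (\<Oplus>\<^bsub>Mat\<^esub>i\<in>{..<m}. \<Oplus>\<^bsub>Mat\<^esub>j\<in>{..<m}. unit (\<beta> i) (\<beta> j) (M (i, j)))"
proof (rule mat_ext)
  have c: "M (i, j) \<in> carrier A" if "i < m" "j < m" for i j using assms that by auto
  have ev: "(\<Oplus>\<^bsub>Mat\<^esub>i\<in>S. F i) (a, b) = (\<Oplus>i\<in>S. F i (a, b))"
    if "finite S" "\<And>i. i \<in> S \<Longrightarrow> F i \<in> carrier Mat" "a < m" "b < m" for F and S :: "nat set" and a b
    using that(1,2)
  proof (induction S rule: finite_induct)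
    case empty
    then show ?case using that by (simp add: Mat.finsum_empty)
  next
    case (insert x S)
    then have "F i (a, b) \<in> carrier A" if "i \<in> insert x S" for i
      using insert.prems[OF that] \<open>a < m\<close> \<open>b < m\<close> by auto
    then show ?case using insert that by (simp add: Mat.finsum_insert Pi_iff)
  qed
  have cl: "(\<Oplus>\<^bsub>Mat\<^esub>j\<in>{..<m}. unit (\<beta> i) (\<beta> j) (M (i, j))) \<in> carrier Mat" if "i < m" for i
    using that by (intro Mat.finsum_closed) (auto intro!: unit_closed c simp del: mat_algebra_simps)
  show "(\<Oplus>\<^bsub>Mat\<^esub>i\<in>{..<m}. \<Oplus>\<^bsub>Mat\<^esub>j\<in>{..<m}. unit (\<beta> i) (\<beta> j) (M (i, j))) \<in> extensional ({..<m} \<times> {..<m})"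
  proof -
    have "(\<Oplus>\<^bsub>Mat\<^esub>i\<in>{..<m}. \<Oplus>\<^bsub>Mat\<^esub>j\<in>{..<m}. unit (\<beta> i) (\<beta> j) (M (i, j))) \<in> carrier Mat"
      using cl by (intro Mat.finsum_closed) (simp add: Pi_iff del: mat_algebra_simps)
    then show ?thesis by (simp add: PiE_iff)
  qed
  fix a b assume ab: "a < m" "b < m"
  have "(\<Oplus>\<^bsub>Mat\<^esub>i\<in>{..<m}. \<Oplus>\<^bsub>Mat\<^esub>j\<in>{..<m}. unit (\<beta> i) (\<beta> j) (M (i, j))) (a, b) =
    (\<Oplus>i\<in>{..<m}. (\<Oplus>\<^bsub>Mat\<^esub>j\<in>{..<m}. unit (\<beta> i) (\<beta> j) (M (i, j))) (a, b))"
    using cl ab by (intro ev) (auto simp del: mat_algebra_simps)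
  also have "\<dots> = (\<Oplus>i\<in>{..<m}. \<Oplus>j\<in>{..<m}. unit (\<beta> i) (\<beta> j) (M (i, j)) (a, b))"
  proof (intro finsum_cong' refl)
    show "(\<lambda>i. \<Oplus>j\<in>{..<m}. unit (\<beta> i) (\<beta> j) (M (i, j)) (a, b)) \<in> {..<m} \<rightarrow> carrier A"
      using ab c by (auto simp: unit_apply intro!: finsum_closed)
    show "(\<Oplus>\<^bsub>Mat\<^esub>j\<in>{..<m}. unit (\<beta> i) (\<beta> j) (M (i, j))) (a, b) =
        (\<Oplus>j\<in>{..<m}. unit (\<beta> i) (\<beta> j) (M (i, j)) (a, b))" if "i \<in> {..<m}" for i
      using ab that by (intro ev unit_closed c) auto
  qed
  also have "\<dots> = (\<Oplus>j\<in>{..<m}. unit (\<beta> a) (\<beta> j) (M (a, j)) (a, b))"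
  proof (rule finsum_only[where k = a])
    fix i assume "i \<in> {..<m}" "i \<noteq> a"
    then have "(\<Oplus>j\<in>{..<m}. unit (\<beta> i) (\<beta> j) (M (i, j)) (a, b)) = (\<Oplus>j\<in>{..<m}. \<zero>)"
      using ab by (intro finsum_cong') (auto simp: unit_apply \<beta>_eq_iff)
    then show "(\<Oplus>j\<in>{..<m}. unit (\<beta> i) (\<beta> j) (M (i, j)) (a, b)) = \<zero>" by (simp add: finsum_zero)
  qed (use ab c in \<open>auto simp: unit_apply intro!: finsum_closed\<close>)
  also have "\<dots> = unit (\<beta> a) (\<beta> b) (M (a, b)) (a, b)"
    by (rule finsum_only) (use ab c in \<open>auto simp: unit_apply \<beta>_eq_iff\<close>)
  also have "\<dots> = M (a, b)" using ab by (simp add: unit_apply)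
  finally show "M (a, b) = (\<Oplus>\<^bsub>Mat\<^esub>i\<in>{..<m}. \<Oplus>\<^bsub>Mat\<^esub>j\<in>{..<m}. unit (\<beta> i) (\<beta> j) (M (i, j))) (a, b)" by simp
qed (use assms in \<open>auto simp: PiE_iff\<close>)

end

section \<open>Words and ranks\<close>

text \<open>Positions run from 1, like the generators, and letters from 0, like the entries of the
  list \<open>\<mu>\<close>. Extensionality makes a word determined by its letters at these
  positions.\<close>

definition words :: "nat list \<Rightarrow> (nat \<Rightarrow> nat) set" where
  "words \<mu> = {\<chi> \<in> {1..sum_list \<mu>} \<rightarrow>\<^sub>E {..<length \<mu>}.
    \<forall>a<length \<mu>. card {i\<in>{1..sum_list \<mu>}. \<chi> i = a} = \<mu> ! a}"

definition swap :: "nat \<Rightarrow> (nat \<Rightarrow> nat) \<Rightarrow> nat \<Rightarrow> nat" where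
  "swap i \<chi> = \<chi> \<circ> Transposition.transpose i (Suc i)"

text \<open>The occurrence at \<open>i\<close> itself is counted, so for positions from 1 on ranks
  begin with 1 and match the numbering of the Hecke generators.\<close>

definition rank :: "(nat \<Rightarrow> nat) \<Rightarrow> nat \<Rightarrow> nat" where
  "rank \<chi> i = card {j\<in>{1..i}. \<chi> j = \<chi> i}"

lemma swap_swap [simp]: "swap i (swap i \<chi>) = \<chi>"
  by (simp add: swap_def comp_assoc)

lemma swap_apply: "swap i \<chi> j = \<chi> (Transposition.transpose i (Suc i) j)"
  by (simp add: swap_def)

lemma swap_eq: "\<chi> i = \<chi> (Suc i) \<Longrightarrow> swap i \<chi> = \<chi>"
  by (auto simp: swap_apply Transposition.transpose_def fun_eq_iff)

lemma swap_commute: "Suc i < j \<Longrightarrow> swap i (swap j \<chi>) = swap j (swap i \<chi>)"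
  by (auto simp: swap_apply Transposition.transpose_def fun_eq_iff)

lemma swap_braid: "swap i (swap (Suc i) (swap i \<chi>)) = swap (Suc i) (swap i (swap (Suc i) \<chi>))"
  by (auto simp: swap_apply Transposition.transpose_def fun_eq_iff)

text \<open>Exchanging two different neighbouring letters preserves the order among equal letters,
  so each letter carries its rank along. The transposition maps one counted set onto the other,
  although it need not map one prefix onto the other.\<close>

lemma rank_transpose:
  assumes "1 \<le> i" "\<chi> i \<noteq> \<chi> (Suc i)"
  shows "rank (swap i \<chi>) j = rank \<chi> (Transposition.transpose i (Suc i) j)"
proof -
  let ?s = "Transposition.transpose i (Suc i)"
  have "{k\<in>{1..?s j}. \<chi> k = \<chi> (?s j)} = ?s ` {k\<in>{1..j}. \<chi> (?s k) = \<chi> (?s j)}" (is "?A = ?s ` ?B")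
  proof
    show "?s ` ?B \<subseteq> ?A"
      using assms by (auto simp: Transposition.transpose_def split: if_splits)
    have sB: "?s k \<in> ?B" if "k \<in> ?A" for k
      using assms that by (auto simp: Transposition.transpose_def split: if_splits)
    show "?A \<subseteq> ?s ` ?B"
      by (rule subsetI, rule image_eqI[OF _ sB]) simp_all
  qed
  then have "card ?A = card ?B"
    by (simp add: card_image)
  then show ?thesis by (simp add: rank_def swap_apply)
qed

lemma rank_swap_other: "1 \<le> i \<Longrightarrow> j \<noteq> i \<Longrightarrow> j \<noteq> Suc i \<Longrightarrow> rank (swap i \<chi>) j = rank \<chi> j"
  using rank_transpose[of i \<chi> j] swap_eq[of \<chi> i] by (cases "\<chi> i = \<chi> (Suc i)") auto

lemma rank_Suc: "\<chi> i = \<chi> (Suc i) \<Longrightarrow> rank \<chi> (Suc i) = Suc (rank \<chi> i)"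
proof -
  assume "\<chi> i = \<chi> (Suc i)"
  then have "{j\<in>{1..Suc i}. \<chi> j = \<chi> (Suc i)} = insert (Suc i) {j\<in>{1..i}. \<chi> j = \<chi> i}"
    by (auto simp: le_Suc_eq)
  then show ?thesis by (simp add: rank_def)
qed

lemma rank_less: assumes "i < j" "\<chi> i = \<chi> j" shows "rank \<chi> i < rank \<chi> j"
  unfolding rank_def
proof (rule psubset_card_mono)
  show "{k\<in>{1..i}. \<chi> k = \<chi> i} \<subset> {k\<in>{1..j}. \<chi> k = \<chi> j}"
    using assms by (auto simp: psubset_eq set_eq_iff intro!: exI[of _ j])
qed simp

lemma rank_inj: "\<chi> i = \<chi> j \<Longrightarrow> rank \<chi> i = rank \<chi> j \<Longrightarrow> i = j"
  using rank_less[of i j \<chi>] rank_less[of j i \<chi>] by (metis linorder_neqE_nat less_irrefl)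

lemma rank_pos: "1 \<le> i \<Longrightarrow> 1 \<le> rank \<chi> i"
proof -
  assume "1 \<le> i"
  then have "i \<in> {j\<in>{1..i}. \<chi> j = \<chi> i}" by auto
  then have "card {j\<in>{1..i}. \<chi> j = \<chi> i} > 0" by (auto simp: card_gt_0_iff)
  then show ?thesis unfolding rank_def by linarith
qed

lemma rank_first: "rank \<chi> 1 = 1"
proof -
  have "{j\<in>{1..1}. \<chi> j = \<chi> 1} = {1}" by auto
  then show ?thesis by (simp add: rank_def)
qed

lemma transpose_mem: "i \<in> {1..<n} \<Longrightarrow> Transposition.transpose i (Suc i) j \<in> {1..n} \<longleftrightarrow> j \<in> {1..n}"
  by (auto simp: Transposition.transpose_def)

context
  fixes \<mu> :: "nat list"
begin

private abbreviation (input) "n \<equiv> sum_list \<mu>"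

lemma words_less: "\<chi> \<in> words \<mu> \<Longrightarrow> i \<in> {1..n} \<Longrightarrow> \<chi> i < length \<mu>"
  by (auto simp: words_def)

lemma words_card: "\<chi> \<in> words \<mu> \<Longrightarrow> a < length \<mu> \<Longrightarrow> card {i\<in>{1..n}. \<chi> i = a} = \<mu> ! a"
  by (auto simp: words_def)

lemma transpose_in_words:
  assumes \<chi>: "\<chi> \<in> words \<mu>" and i: "i \<in> {1..n}" "j \<in> {1..n}"
  shows "\<chi> \<circ> Transposition.transpose i j \<in> words \<mu>"
proof -
  let ?s = "Transposition.transpose i j"
  have mem: "?s k \<in> {1..n} \<longleftrightarrow> k \<in> {1..n}" for k
    using i by (auto simp: Transposition.transpose_def)
  have "card {k\<in>{1..n}. \<chi> (?s k) = a} = card {k\<in>{1..n}. \<chi> k = a}" for a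
  proof -
    have "{k\<in>{1..n}. \<chi> k = a} = ?s ` {k\<in>{1..n}. \<chi> (?s k) = a}"
    proof
      show "{k\<in>{1..n}. \<chi> k = a} \<subseteq> ?s ` {k\<in>{1..n}. \<chi> (?s k) = a}"
      proof
        fix k assume "k \<in> {k\<in>{1..n}. \<chi> k = a}"
        then have "?s k \<in> {k\<in>{1..n}. \<chi> (?s k) = a}" using mem[of k] by auto
        then show "k \<in> ?s ` {k\<in>{1..n}. \<chi> (?s k) = a}" by (rule image_eqI[rotated]) simp
      qed
    qed (use mem in blast)
    then show ?thesis by (simp add: card_image)
  qed
  moreover have "\<chi> \<circ> ?s \<in> {1..n} \<rightarrow>\<^sub>E {..<length \<mu>}"
  proof (rule PiE_I)
    show "(\<chi> \<circ> ?s) k \<in> {..<length \<mu>}" if "k \<in> {1..n}" for k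
      using words_less[OF \<chi>, of "?s k"] mem[of k] that by simp
    show "(\<chi> \<circ> ?s) k = undefined" if "k \<notin> {1..n}" for k
      using \<chi> mem[of k] that by (auto simp: words_def PiE_iff extensional_def)
  qed
  ultimately show ?thesis using \<chi> by (auto simp: words_def)
qed

lemma swap_in_words: "\<chi> \<in> words \<mu> \<Longrightarrow> i \<in> {1..<n} \<Longrightarrow> swap i \<chi> \<in> words \<mu>"
  unfolding swap_def by (rule transpose_in_words) auto

lemma rank_le: assumes \<chi>: "\<chi> \<in> words \<mu>" "i \<in> {1..n}" shows "rank \<chi> i \<le> \<mu> ! \<chi> i"
proof -
  have "rank \<chi> i \<le> card {j\<in>{1..n}. \<chi> j = \<chi> i}"
    unfolding rank_def by (rule card_mono) (use assms in auto)
  then show ?thesis using words_card[OF \<chi>(1) words_less[OF \<chi>]] by simp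
qed

text \<open>On the positions of one letter the rank is injective, with values in a set that has as
  many elements as there are positions; hence it is onto.\<close>

lemma rank_surj:
  assumes \<chi>: "\<chi> \<in> words \<mu>" and a: "a < length \<mu>" and k: "k \<in> {1..\<mu> ! a}"
  shows "\<exists>i\<in>{1..n}. \<chi> i = a \<and> rank \<chi> i = k"
proof -
  let ?I = "{i\<in>{1..n}. \<chi> i = a}"
  have "inj_on (rank \<chi>) ?I" by (intro inj_onI) (auto intro: rank_inj[of \<chi>])
  then have "card (rank \<chi> ` ?I) = \<mu> ! a" using words_card[OF \<chi> a] by (simp add: card_image)
  moreover have "rank \<chi> ` ?I \<subseteq> {1..\<mu> ! a}"
    using rank_le[OF \<chi>] rank_pos[of _ \<chi>] by force
  ultimately have "rank \<chi> ` ?I = {1..\<mu> ! a}" by (intro card_subset_eq) auto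
  with k have "k \<in> rank \<chi> ` ?I" by simp
  then show ?thesis by auto
qed

section \<open>Words as arrangements of a multiset, and their number\<close>

definition content_mset :: "nat multiset" where
  "content_mset = (\<Sum>a<length \<mu>. replicate_mset (\<mu> ! a) a)"

lemma count_content: "count content_mset a = (if a < length \<mu> then \<mu> ! a else 0)"
  by (simp add: content_mset_def count_sum)

lemma size_content: "size content_mset = n"
  by (simp add: content_mset_def sum_list_sum_nth atLeast0LessThan)

definition word_list :: "(nat \<Rightarrow> nat) \<Rightarrow> nat list" where
  "word_list \<chi> = map \<chi> [1..<Suc n]"

lemma count_word_list: "count (mset (word_list \<chi>)) a = card {i\<in>{1..n}. \<chi> i = a}"
proof -
  have "count (mset (word_list \<chi>)) a = (\<Sum>x | x \<in># mset_set {1..<Suc n} \<and> a = \<chi> x. count (mset_set {1..<Suc n}) x)"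
    unfolding word_list_def mset_map mset_upt by (rule count_image_mset')
  also have "\<dots> = (\<Sum>x\<in>{i\<in>{1..n}. \<chi> i = a}. 1)"
    by (rule sum.cong) auto
  finally show ?thesis by simp
qed

text \<open>Identifies words with the arrangements of a multiset; their number and the uniqueness of
  the sorted one then come from facts about multisets and lists.\<close>

lemma words_iff: "\<chi> \<in> words \<mu> \<longleftrightarrow> \<chi> \<in> extensional {1..n} \<and> mset (word_list \<chi>) = content_mset"
proof
  assume \<chi>: "\<chi> \<in> words \<mu>"
  have "count (mset (word_list \<chi>)) a = count content_mset a" for a
  proof (cases "a < length \<mu>")
    case True
    then show ?thesis using words_card[OF \<chi>] by (simp add: count_word_list count_content)
  next
    case False
    then have "{i\<in>{1..n}. \<chi> i = a} = {}" using words_less[OF \<chi>] by blast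
    then show ?thesis using False by (simp only: count_word_list count_content) simp
  qed
  then show "\<chi> \<in> extensional {1..n} \<and> mset (word_list \<chi>) = content_mset"
    using \<chi> by (auto simp: words_def PiE_iff intro: multiset_eqI)
next
  assume *: "\<chi> \<in> extensional {1..n} \<and> mset (word_list \<chi>) = content_mset"
  have c: "card {i\<in>{1..n}. \<chi> i = a} = (if a < length \<mu> then \<mu> ! a else 0)" for a
    using * count_word_list[of \<chi> a] by (simp add: count_content)
  have "\<chi> i < length \<mu>" if "i \<in> {1..n}" for i
  proof (rule ccontr)
    assume "\<not> \<chi> i < length \<mu>"
    then have "card {j\<in>{1..n}. \<chi> j = \<chi> i} = 0" using c[of "\<chi> i"] by simp
    then show False using that by auto
  qed
  then show "\<chi> \<in> words \<mu>" using * c by (auto simp: words_def PiE_iff)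
qed

lemma word_list_inj: "inj_on word_list (extensional {1..n})"
proof (rule inj_onI)
  fix \<chi> \<xi> assume *: "\<chi> \<in> extensional {1..n}" "\<xi> \<in> extensional {1..n}" "word_list \<chi> = word_list \<xi>"
  then have "\<chi> i = \<xi> i" if "i \<in> {1..n}" for i
    using that by (auto simp: word_list_def simp del: upt_Suc)
  then show "\<chi> = \<xi>" using * by (intro extensionalityI)
qed

lemma word_list_of_list:
  assumes "length l = n" shows "word_list (\<lambda>i\<in>{1..n}. l ! (i - 1)) = l"
  using assms by (intro nth_equalityI) (auto simp: word_list_def simp del: upt_Suc)

lemma word_list_bij: "bij_betw word_list (words \<mu>) (permutations_of_multiset content_mset)"
proof (rule bij_betw_imageI)
  show "inj_on word_list (words \<mu>)"
    by (rule inj_on_subset[OF word_list_inj]) (auto simp: words_iff)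
  show "word_list ` words \<mu> = permutations_of_multiset content_mset"
  proof
    show "permutations_of_multiset content_mset \<subseteq> word_list ` words \<mu>"
    proof
      fix l assume "l \<in> permutations_of_multiset content_mset"
      then have l: "mset l = content_mset" by (rule permutations_of_multisetD)
      then have "length l = n" by (metis size_content size_mset)
      note this[THEN word_list_of_list]
      moreover from this have "(\<lambda>i\<in>{1..n}. l ! (i - 1)) \<in> words \<mu>" using l by (simp add: words_iff)
      ultimately show "l \<in> word_list ` words \<mu>" by (metis image_eqI)
    qed
  qed (auto simp: words_iff intro: permutations_of_multisetI)
qed

lemma finite_words: "finite (words \<mu>)"
  using bij_betw_finite[OF word_list_bij] by simp

lemma card_words: "card (words \<mu>) = comp_mult \<mu>"
proof -
  have "card (words \<mu>) = fact n div (\<Prod>x\<in>set_mset content_mset. fact (count content_mset x))"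
    using bij_betw_same_card[OF word_list_bij] by (simp add: card_permutations_of_multiset size_content)
  \<comment> \<open>Letters with \<open>\<mu> ! a = 0\<close> are missing from the multiset, but
    contribute the factor \<open>fact 0 = 1\<close>.\<close>
  also have "(\<Prod>x\<in>set_mset content_mset. fact (count content_mset x) :: nat) =
      (\<Prod>x<length \<mu>. fact (count content_mset x))"
  proof (rule prod.mono_neutral_left)
    show "set_mset content_mset \<subseteq> {..<length \<mu>}"
      using count_content by (auto simp: set_mset_def split: if_splits)
  qed (auto simp: not_in_iff)
  also have "\<dots> = (\<Prod>a<length \<mu>. fact (\<mu> ! a))" by (simp add: count_content)
  finally show ?thesis by (simp add: comp_mult_def)
qed

section \<open>The sorted word and the removal of descents\<close>

definition base :: "nat \<Rightarrow> nat" where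
  "base = (\<lambda>i\<in>{1..n}. sorted_list_of_multiset content_mset ! (i - 1))"

lemma length_sorted_content: "length (sorted_list_of_multiset content_mset) = n"
  by (metis mset_sorted_list_of_multiset size_content size_mset)

lemma base_in_words: "base \<in> words \<mu>"
  unfolding words_iff base_def using word_list_of_list[OF length_sorted_content] by simp

lemma base_mono: "i \<in> {1..n} \<Longrightarrow> j \<in> {1..n} \<Longrightarrow> i \<le> j \<Longrightarrow> base i \<le> base j"
  using length_sorted_content by (auto simp: base_def intro!: sorted_nth_mono)

text \<open>A word without descents is its own sorting, and a sorted list is determined by its
  multiset.\<close>

lemma sorted_word_eq_base:
  assumes \<chi>: "\<chi> \<in> words \<mu>" and s: "\<And>i. i \<in> {1..<n} \<Longrightarrow> \<chi> i \<le> \<chi> (Suc i)"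
  shows "\<chi> = base"
proof -
  have "sorted (word_list \<chi>)"
    using s by (auto simp: word_list_def sorted_iff_nth_Suc simp del: upt_Suc)
  then have "sorted_list_of_multiset content_mset = word_list \<chi>"
    using \<chi> by (metis words_iff sorted_list_of_multiset_mset sorted_sort_id)
  also have "sorted_list_of_multiset content_mset = word_list base"
    unfolding base_def using word_list_of_list[OF length_sorted_content] by simp
  finally show ?thesis
    using word_list_inj \<chi> base_in_words by (auto simp: words_iff inj_on_def)
qed

lemma exists_descent: "\<chi> \<in> words \<mu> \<Longrightarrow> \<chi> \<noteq> base \<Longrightarrow> \<exists>i\<in>{1..<n}. \<chi> (Suc i) < \<chi> i"
  using sorted_word_eq_base[of \<chi>] by (meson not_le)

text \<open>A measure for induction, in the role of the number of inversions: earlier positions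
  weigh more, so moving the smaller letter forward lowers the sum.\<close>

definition disorder :: "(nat \<Rightarrow> nat) \<Rightarrow> nat" where
  "disorder \<chi> = (\<Sum>i\<in>{1..n}. (n - i) * \<chi> i)"

text \<open>The weights of neighbouring positions differ by exactly 1, so the sum drops by
  \<open>\<chi> i - \<chi> (Suc i)\<close>.\<close>

lemma disorder_swap:
  assumes i: "i \<in> {1..<n}" and d: "\<chi> (Suc i) < \<chi> i" shows "disorder (swap i \<chi>) < disorder \<chi>"
proof -
  have split: "(\<Sum>j\<in>{1..n}. f j) = f i + f (Suc i) + (\<Sum>j\<in>{1..n} - {i, Suc i}. f j)" for f :: "nat \<Rightarrow> nat"
    using i by (subst sum.subset_diff[of "{i, Suc i}"]) auto
  have "(\<Sum>j\<in>{1..n} - {i, Suc i}. (n - j) * swap i \<chi> j) = (\<Sum>j\<in>{1..n} - {i, Suc i}. (n - j) * \<chi> j)"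
    by (rule sum.cong) (auto simp: swap_apply)
  moreover have "(n - i) * \<chi> (Suc i) + (n - Suc i) * \<chi> i < (n - i) * \<chi> i + (n - Suc i) * \<chi> (Suc i)"
  proof -
    have "n - i = Suc (n - Suc i)" using i by auto
    then show ?thesis using d by simp
  qed
  ultimately show ?thesis
    unfolding disorder_def split by (simp add: swap_apply)
qed

text \<open>The position of the \<open>k\<close>-th letter \<open>a\<close> in the sorted word, counted from 1.\<close>

definition pos :: "nat \<Rightarrow> nat \<Rightarrow> nat" where
  "pos a k = (THE i. i \<in> {1..n} \<and> base i = a \<and> rank base i = k)"

lemma pos_props:
  assumes "a < length \<mu>" "k \<in> {1..\<mu> ! a}"
  shows "pos a k \<in> {1..n}" "base (pos a k) = a" "rank base (pos a k) = k"
proof -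
  have "\<exists>!i. i \<in> {1..n} \<and> base i = a \<and> rank base i = k"
    using rank_surj[OF base_in_words assms] rank_inj[of base] by metis
  from theI'[OF this] show "pos a k \<in> {1..n}" "base (pos a k) = a" "rank base (pos a k) = k"
    by (simp_all add: pos_def)
qed

lemma pos_rank: assumes "i \<in> {1..n}" shows "pos (base i) (rank base i) = i"
  unfolding pos_def
  by (rule the_equality) (use assms rank_inj[of base] in auto)

text \<open>Equal letters are contiguous in the sorted word: by monotonicity nothing else fits
  between two consecutive occurrences.\<close>

lemma pos_Suc:
  assumes a: "a < length \<mu>" and k: "k \<in> {1..<\<mu> ! a}"
  shows "pos a (Suc k) = Suc (pos a k)"
proof -
  let ?i = "pos a k" and ?j = "pos a (Suc k)"
  have i: "?i \<in> {1..n}" "base ?i = a" "rank base ?i = k"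
    and j: "?j \<in> {1..n}" "base ?j = a" "rank base ?j = Suc k"
    using pos_props[OF a, of k] pos_props[OF a, of "Suc k"] k by auto
  have "?i < ?j"
  proof (rule ccontr)
    assume "\<not> ?i < ?j"
    then have "rank base ?j \<le> rank base ?i"
      using rank_less[of ?j ?i base] i j by (cases "?i = ?j") auto
    then show False using i j by simp
  qed
  then have s: "Suc ?i \<in> {1..n}" using j by auto
  have "base (Suc ?i) = a"
    using base_mono[of ?i "Suc ?i"] base_mono[of "Suc ?i" ?j] i j s \<open>?i < ?j\<close> by auto
  then have "rank base (Suc ?i) = Suc k" using rank_Suc[of base ?i] i by simp
  then show ?thesis using rank_inj[of base ?j "Suc ?i"] j \<open>base (Suc ?i) = a\<close> by simp
qed

end

section \<open>All words, partitioned by content\<close>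

lemma words_exists:
  assumes \<chi>: "\<chi> \<in> {1..n} \<rightarrow>\<^sub>E {..<r}"
  shows "\<exists>\<mu>\<in>compositions r n. \<chi> \<in> words \<mu>"
proof -
  define \<mu> where "\<mu> = map (\<lambda>a. card {i\<in>{1..n}. \<chi> i = a}) [0..<r]"
  have "sum_list \<mu> = (\<Sum>a<r. card {i\<in>{1..n}. \<chi> i = a})"
    by (simp add: \<mu>_def sum_list_sum_nth atLeast0LessThan)
  also have "\<dots> = card (\<Union>a<r. {i\<in>{1..n}. \<chi> i = a})"
    by (rule card_UN_disjoint[symmetric]) auto
  also have "(\<Union>a<r. {i\<in>{1..n}. \<chi> i = a}) = {1..n}"
    using \<chi> by auto
  finally have "sum_list \<mu> = n" by simp
  moreover have "length \<mu> = r" by (simp add: \<mu>_def)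
  ultimately show ?thesis
    using \<chi> by (intro bexI[of _ \<mu>]) (auto simp: compositions_def words_def \<mu>_def)
qed

lemma words_subset: "\<mu> \<in> compositions r n \<Longrightarrow> words \<mu> \<subseteq> {1..n} \<rightarrow>\<^sub>E {..<r}"
  by (auto simp: compositions_def words_def)

lemma words_disjoint:
  assumes "\<mu> \<in> compositions r n" "\<nu> \<in> compositions r n" "\<chi> \<in> words \<mu>" "\<chi> \<in> words \<nu>"
  shows "\<mu> = \<nu>"
  using assms words_card[OF assms(3)] words_card[OF assms(4)]
  by (intro nth_equalityI) (auto simp: compositions_def)

section \<open>Roots of unity\<close>

text \<open>The polynomial \<open>z^r - 1\<close> splits into linear factors. A multiple root would
  be a root of the derivative \<open>r z^(r-1)\<close>, hence 0, which is no root; so there are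
  \<open>r\<close> distinct roots.\<close>

lemma card_roots_of_unity:
  fixes r :: nat
  assumes r: "r \<ge> 1" and char: "\<not> CHAR('k::alg_closed_field) dvd r"
  shows "finite {z::'k. z ^ r = 1}" "card {z::'k. z ^ r = 1} = r"
proof -
  have r0: "of_nat r \<noteq> (0::'k)" using char by (simp add: of_nat_eq_0_iff_char_dvd)
  define p :: "'k poly" where "p = monom 1 r + [:- 1:]"
  have deg: "degree p = r"
  proof -
    have "degree (monom (1::'k) r) = r" by (simp add: degree_monom_eq)
    then show ?thesis unfolding p_def using r by (subst degree_add_eq_left) auto
  qed
  then have p0: "p \<noteq> 0" using r by auto
  have poly: "poly p z = z ^ r - 1" for z by (simp add: p_def poly_monom)
  have dpoly: "poly (pderiv p) z = of_nat r * z ^ (r - 1)" for z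
    by (simp add: p_def pderiv_add pderiv_pCons pderiv_monom poly_monom)
  obtain A where A: "size A = degree p" "p = Polynomial.smult (lead_coeff p) (\<Prod>x\<in>#A. [:- x, 1:])"
    using alg_closed_imp_factorization[OF p0] by blast
  have root: "poly p z = 0 \<longleftrightarrow> z \<in># A" for z
    by (subst A(2), use p0 in \<open>simp add: poly_prod_mset\<close>) (force simp: prod_mset_zero_iff)
  have count: "count A x \<le> 1" for x
  proof (rule ccontr)
    assume "\<not> count A x \<le> 1"
    then have "x \<in># A" "x \<in># A - {#x#}" by (simp_all flip: count_greater_zero_iff)
    then obtain B where B: "A = add_mset x (add_mset x B)" by (metis insert_DiffM)
    define q where "q = Polynomial.smult (lead_coeff p) (\<Prod>x\<in>#B. [:- x, 1:])"
    \<comment> \<open>Two factors for the same \<open>x\<close> make it a root of the derivative as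
      well, by the product rule.\<close>
    have "p = [:- x, 1:] * ([:- x, 1:] * q)" by (subst A(2)) (simp add: B q_def)
    moreover have "poly (pderiv ([:- x, 1:] * ([:- x, 1:] * q))) x = 0"
      by (simp only: pderiv_mult poly_add poly_mult) simp
    ultimately have "poly (pderiv p) x = 0" by (simp only:)
    then have "x = 0" using r0 unfolding dpoly by auto
    moreover have "x ^ r = 1" using root[of x] \<open>x \<in># A\<close> by (simp add: poly)
    ultimately show False using r by (simp add: power_0_left split: if_splits)
  qed
  then have "A = mset_set (set_mset A)"
    by (intro multiset_eqI) (metis count_greater_eq_one_iff count_mset_set(1) count_mset_set(3)
        finite_set_mset le_antisym not_in_iff)
  then have "size A = card (set_mset A)" by (metis size_mset_set)
  moreover have "{z. z ^ r = 1} = set_mset A"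
    using root by (auto simp: poly)
  ultimately show "finite {z::'k. z ^ r = 1}" "card {z::'k. z ^ r = 1} = r"
    using A(1) deg by auto
qed

text \<open>Some root \<open>w\<close> has \<open>w^k \<noteq> 1\<close>, since
  \<open>z^k - 1\<close> has at most \<open>k < r\<close> roots. Multiplication by \<open>w\<close>
  permutes the roots of unity, so the sum equals \<open>w^k\<close> times itself and must
  vanish.\<close>

lemma sum_powers_roots_of_unity:
  fixes k r :: nat
  assumes r: "r \<ge> 1" and char: "\<not> CHAR('k::alg_closed_field) dvd r" and k: "0 < k" "k < r"
  shows "(\<Sum>z | z ^ r = 1. z ^ k) = (0::'k)"
proof -
  let ?Z = "{z::'k. z ^ r = 1}"
  note Z = card_roots_of_unity[OF r char]
  have "\<exists>w\<in>?Z. w ^ k \<noteq> 1"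
  proof (rule ccontr)
    assume "\<not> ?thesis"
    then have "?Z \<subseteq> {z. poly (monom 1 k + [:- 1:]) z = (0::'k)}" by (auto simp: poly_monom)
    moreover have deg: "degree (monom (1::'k) k + [:- 1:]) = k"
    proof -
      have "degree (monom (1::'k) k) = k" by (simp add: degree_monom_eq)
      then show ?thesis using k by (subst degree_add_eq_left) auto
    qed
    then have "monom (1::'k) k + [:- 1:] \<noteq> 0" using k by (metis degree_0 less_irrefl)
    ultimately have "card ?Z \<le> k"
      using card_poly_roots_bound[of "monom (1::'k) k + [:- 1:]"] poly_roots_finite[of "monom (1::'k) k + [:- 1:]"] deg
      by (metis (no_types, lifting) card_mono order_trans)
    then show False using k by (simp add: Z)
  qed
  then obtain w :: 'k where w: "w ^ r = 1" "w ^ k \<noteq> 1" by auto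
  then have w0: "w \<noteq> 0" using r by (auto simp: power_0_left split: if_splits)
  have "bij_betw (\<lambda>z. w * z) ?Z ?Z"
  proof (rule bij_betwI[where g = "\<lambda>z. inverse w * z"])
  qed (use w w0 in \<open>auto simp: power_mult_distrib power_inverse\<close>)
  then have "(\<Sum>z\<in>?Z. z ^ k) = (\<Sum>z\<in>?Z. (w * z) ^ k)" by (simp add: sum.reindex_bij_betw[where g = "\<lambda>z. z ^ k"])
  also have "\<dots> = w ^ k * (\<Sum>z\<in>?Z. z ^ k)" by (simp add: power_mult_distrib sum_distrib_left)
  finally have "(1 - w ^ k) * (\<Sum>z\<in>?Z. z ^ k) = 0" by (simp add: algebra_simps)
  then show ?thesis using w by simp
qed

lemma roots_of_unity_enumeration:
  fixes r :: nat
  assumes r: "r \<ge> 1" and char: "\<not> CHAR('k::alg_closed_field) dvd r"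
  shows "\<exists>z :: nat \<Rightarrow> 'k. inj_on z {..<r} \<and> (\<forall>a<r. z a ^ r = 1) \<and> (\<forall>k. 0 < k \<and> k < r \<longrightarrow> (\<Sum>a<r. z a ^ k) = 0)"
proof -
  let ?Z = "{z::'k. z ^ r = 1}"
  note Z = card_roots_of_unity[OF r char]
  obtain z where z: "bij_betw z {..<r} ?Z"
    using ex_bij_betw_nat_finite[OF Z(1)] Z(2) by (auto simp: atLeast0LessThan)
  have "(\<Sum>a<r. z a ^ k) = 0" if "0 < k" "k < r" for k
    using sum.reindex_bij_betw[OF z, of "\<lambda>z. z ^ k"] sum_powers_roots_of_unity[OF r char that] by simp
  with z show ?thesis by (intro exI[of _ z]) (auto simp: bij_betw_def)
qed

section \<open>Weight idempotents\<close>

text \<open>Here \<open>z\<close> enumerates the \<open>r\<close>-th roots of unity;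
  \<open>r_nz\<close> and \<open>z_sum\<close> are what the inversion of the Fourier transform rests
  on.\<close>

locale unity_roots =
  fixes r :: nat and z :: "nat \<Rightarrow> 'k::field"
  assumes r: "1 \<le> r" and r_nz: "of_nat r \<noteq> (0::'k)"
    and z_inj: "inj_on z {..<r}" and z_root: "a < r \<Longrightarrow> z a ^ r = 1"
    and z_sum: "0 < k \<Longrightarrow> k < r \<Longrightarrow> (\<Sum>a<r. z a ^ k) = 0"
begin

text \<open>Orthogonality of characters, with \<open>z a ^ (r - k)\<close> for the inverse of
  \<open>z a ^ k\<close>. For \<open>a \<noteq> b\<close> the sum is a multiple of the quotient of
  \<open>z b ^ r - z a ^ r = 0\<close> by \<open>z b - z a\<close>.\<close>

lemma z_orthogonal:
  assumes "a < r" "b < r"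
  shows "(\<Sum>k<r. z b ^ k * z a ^ (r - k)) = (if a = b then of_nat r else 0)"
proof (cases "a = b")
  case True
  have "z a ^ k * z a ^ (r - k) = 1" if "k < r" for k
    using that z_root[OF assms(1)] by (simp flip: power_add)
  then show ?thesis using True by simp
next
  case False
  have "(\<Sum>k<r. z b ^ k * z a ^ (r - k)) = z a * (\<Sum>k<r. z a ^ (r - Suc k) * z b ^ k)"
    unfolding sum_distrib_left
  proof (rule sum.cong)
    fix k assume "k \<in> {..<r}"
    then have "z a ^ (r - k) = z a * z a ^ (r - Suc k)" by (metis Suc_diff_Suc lessThan_iff power_Suc)
    then show "z b ^ k * z a ^ (r - k) = z a * (z a ^ (r - Suc k) * z b ^ k)" by simp
  qed simp
  also have "(\<Sum>k<r. z a ^ (r - Suc k) * z b ^ k) = 0"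
  proof -
    have "(z b - z a) * (\<Sum>k<r. z a ^ (r - Suc k) * z b ^ k) = z b ^ r - z a ^ r"
      by (rule power_diff_sumr2[symmetric])
    also have "\<dots> = 0" using assms by (simp add: z_root)
    finally show ?thesis using False assms z_inj by (auto simp: inj_on_def)
  qed
  finally show ?thesis using False by simp
qed

end

text \<open>An arbitrary algebra with a family satisfying the relations, because the theory of
  weights is applied twice: to the Yokonuma-Hecke algebra and, in \<open>hecke_matrices\<close>, to
  the matrix algebra representing it.\<close>

locale yh_algebra = kalg A + unity_roots r z for A :: "('k::field, 'a) module" (structure)
    and r n d :: nat and v :: "nat \<Rightarrow> 'k" and t f x :: "nat \<Rightarrow> 'a" and z :: "nat \<Rightarrow> 'k" +
  assumes family: "yh_family A r n d v t f x" and n: "1 \<le> n"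
begin

lemma t_closed [simp]: "i \<in> {1..n} \<Longrightarrow> t i \<in> carrier A"
  and f_closed [simp]: "i \<in> {1..<n} \<Longrightarrow> f i \<in> carrier A"
  and x_closed [simp]: "i \<in> {1..n} \<Longrightarrow> x i \<in> carrier A"
  using family by (auto simp: yh_family_def)

lemma
  shows f_commute: "i \<in> {1..<n} \<Longrightarrow> j \<in> {1..<n} \<Longrightarrow> \<bar>int i - int j\<bar> \<ge> 2 \<Longrightarrow> f i \<otimes> f j = f j \<otimes> f i"
    and f_braid: "1 \<le> i \<Longrightarrow> Suc i < n \<Longrightarrow> f i \<otimes> f (Suc i) \<otimes> f i = f (Suc i) \<otimes> f i \<otimes> f (Suc i)"
    and t_commute: "i \<in> {1..n} \<Longrightarrow> j \<in> {1..n} \<Longrightarrow> t i \<otimes> t j = t j \<otimes> t i"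
    and f_t: "i \<in> {1..<n} \<Longrightarrow> j \<in> {1..n} \<Longrightarrow> f i \<otimes> t j = t (Transposition.transpose i (Suc i) j) \<otimes> f i"
    and t_pow: "i \<in> {1..n} \<Longrightarrow> t i [^] r = \<one>"
    and f_square: "i \<in> {1..<n} \<Longrightarrow> f i \<otimes> f i = \<one>"
    and x_commute: "i \<in> {1..n} \<Longrightarrow> j \<in> {1..n} \<Longrightarrow> x i \<otimes> x j = x j \<otimes> x i"
    and f_x_Suc: "i \<in> {1..<n} \<Longrightarrow> f i \<otimes> x (Suc i) = x i \<otimes> f i \<oplus> yh_e A r t i"
    and f_x_other: "i \<in> {1..<n} \<Longrightarrow> j \<in> {1..n} \<Longrightarrow> j \<noteq> i \<Longrightarrow> j \<noteq> Suc i \<Longrightarrow> f i \<otimes> x j = x j \<otimes> f i"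
    and t_x: "i \<in> {1..n} \<Longrightarrow> j \<in> {1..n} \<Longrightarrow> t j \<otimes> x i = x i \<otimes> t j"
    and x_cyclotomic: "cyclotomic_element A d v (x 1) = \<zero>"
proof -
  have "\<forall>(p, q)\<in>yh_rels A r n t f x. p = q" using family by (simp add: yh_family_def)
  note R = this[unfolded yh_rels_all]
  show "i \<in> {1..<n} \<Longrightarrow> j \<in> {1..<n} \<Longrightarrow> \<bar>int i - int j\<bar> \<ge> 2 \<Longrightarrow> f i \<otimes> f j = f j \<otimes> f i"
    "1 \<le> i \<Longrightarrow> Suc i < n \<Longrightarrow> f i \<otimes> f (Suc i) \<otimes> f i = f (Suc i) \<otimes> f i \<otimes> f (Suc i)"
    "i \<in> {1..n} \<Longrightarrow> j \<in> {1..n} \<Longrightarrow> t i \<otimes> t j = t j \<otimes> t i"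
    "i \<in> {1..<n} \<Longrightarrow> j \<in> {1..n} \<Longrightarrow> f i \<otimes> t j = t (Transposition.transpose i (Suc i) j) \<otimes> f i"
    "i \<in> {1..n} \<Longrightarrow> t i [^] r = \<one>"
    "i \<in> {1..<n} \<Longrightarrow> f i \<otimes> f i = \<one>"
    "i \<in> {1..n} \<Longrightarrow> j \<in> {1..n} \<Longrightarrow> x i \<otimes> x j = x j \<otimes> x i"
    "i \<in> {1..<n} \<Longrightarrow> f i \<otimes> x (Suc i) = x i \<otimes> f i \<oplus> yh_e A r t i"
    "i \<in> {1..<n} \<Longrightarrow> j \<in> {1..n} \<Longrightarrow> j \<noteq> i \<Longrightarrow> j \<noteq> Suc i \<Longrightarrow> f i \<otimes> x j = x j \<otimes> f i"
    "i \<in> {1..n} \<Longrightarrow> j \<in> {1..n} \<Longrightarrow> t j \<otimes> x i = x i \<otimes> t j"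
    using R by (simp_all, blast?)
  show "cyclotomic_element A d v (x 1) = \<zero>" using family by (simp add: yh_family_def)
qed

lemma e_closed [simp]: "i \<in> {1..<n} \<Longrightarrow> yh_e A r t i \<in> carrier A"
  by (rule yh_e_closed) auto

text \<open>The projection onto the eigenspace of \<open>t i\<close> for the eigenvalue \<open>z a\<close>; as \<open>z a ^ r = 1\<close>, the Fourier
  coefficient \<open>z a ^ - k\<close> is written as \<open>z a ^ (r - k)\<close>.\<close>

definition P :: "nat \<Rightarrow> nat \<Rightarrow> 'a" where
  "P a i = inverse (of_nat r) \<odot> (\<Oplus>k\<in>{..<r}. z a ^ (r - k) \<odot> (t i [^] k))"

lemma P_closed [simp]: "i \<in> {1..n} \<Longrightarrow> P a i \<in> carrier A"
  unfolding P_def by (auto intro!: finsum_closed)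

lemma t_pow_eigen:
  assumes "y \<in> carrier A" "i \<in> {1..n}" "t i \<otimes> y = c \<odot> y"
  shows "t i [^] k \<otimes> y = c ^ k \<odot> y"
proof (induction k)
  case (Suc k)
  have "t i [^] Suc k \<otimes> y = t i [^] k \<otimes> (c \<odot> y)" using assms by (simp add: m_assoc)
  also have "\<dots> = c ^ Suc k \<odot> y"
    using assms Suc by (simp add: smult_assoc3 smult_assoc1)
  finally show ?case .
qed (use assms in simp)

text \<open>On an eigenvector the powers of \<open>t i\<close> become scalars, and orthogonality of
  the roots of unity decides whether the projection keeps or kills it.\<close>

lemma P_eigen:
  assumes y: "y \<in> carrier A" and i: "i \<in> {1..n}" and e: "t i \<otimes> y = z b \<odot> y" and ab: "a < r" "b < r"
  shows "P a i \<otimes> y = (if a = b then y else \<zero>)"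
proof -
  have "P a i \<otimes> y = inverse (of_nat r) \<odot> (\<Oplus>k\<in>{..<r}. (z a ^ (r - k) \<odot> (t i [^] k)) \<otimes> y)"
    unfolding P_def using y i by (subst smult_assoc2) (auto simp: finsum_ldistr intro!: finsum_closed)
  also have "(\<Oplus>k\<in>{..<r}. (z a ^ (r - k) \<odot> (t i [^] k)) \<otimes> y) = (\<Oplus>k\<in>{..<r}. (z b ^ k * z a ^ (r - k)) \<odot> y)"
    using y i by (intro finsum_cong') (auto simp: smult_assoc2 t_pow_eigen[OF y i e] mult.commute simp flip: smult_assoc1)
  also have "\<dots> = (\<Sum>k<r. z b ^ k * z a ^ (r - k)) \<odot> y" using y by (simp add: smult_sum)
  finally show ?thesis using y r_nz by (auto simp: z_orthogonal[OF ab] simp flip: smult_assoc1)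
qed

text \<open>Multiplication by \<open>t i\<close> shifts the summation index. As \<open>t i\<close>
  and \<open>z a\<close> both have trivial \<open>r\<close>-th power, the summand at
  \<open>r\<close> equals the one at 0, and the shifted sum is the old one.\<close>

lemma t_P: assumes i: "i \<in> {1..n}" and a: "a < r" shows "t i \<otimes> P a i = z a \<odot> P a i"
proof -
  define g where "g k = z a ^ (r - k) \<odot> (t i [^] k)" for k
  have g: "g k \<in> carrier A" for k using i by (simp add: g_def)
  have "t i \<otimes> (\<Oplus>k\<in>{..<r}. g k) = (\<Oplus>k\<in>{..<r}. t i \<otimes> g k)"
    using g i by (intro finsum_rdistr) auto
  also have "\<dots> = (\<Oplus>k\<in>{..<r}. z a \<odot> g (Suc k))"
  proof (intro finsum_cong' refl)
    fix k assume k: "k \<in> {..<r}"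
    then have "z a ^ (r - k) = z a * z a ^ (r - Suc k)" by (metis Suc_diff_Suc lessThan_iff power_Suc)
    then show "t i \<otimes> g k = z a \<odot> g (Suc k)"
      using i by (simp add: g_def smult_assoc3 smult_assoc1 nat_pow_mult flip: nat_pow_Suc2)
  qed (use g in auto)
  also have "\<dots> = z a \<odot> (\<Oplus>k\<in>{..<r}. g (Suc k))" using g by (intro smult_finsum[symmetric]) auto
  also have "(\<Oplus>k\<in>{..<r}. g (Suc k)) = (\<Oplus>k\<in>{..<r}. g k)"
  proof -
    obtain q where q: "r = Suc q" using r by (cases r) auto
    have "(\<Oplus>k\<in>{..<r}. g (Suc k)) \<oplus> g 0 = (\<Oplus>k\<in>{..Suc q}. g k)"
      unfolding q lessThan_Suc_atMost using g by (intro finsum_Suc2[symmetric]) auto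
    also have "\<dots> = g r \<oplus> (\<Oplus>k\<in>{..<r}. g k)"
      unfolding q lessThan_Suc_atMost using g by (intro finsum_Suc) auto
    also have "g r = g 0" using i a by (simp add: g_def t_pow z_root)
    finally have "(\<Oplus>k\<in>{..<r}. g (Suc k)) \<oplus> g 0 = (\<Oplus>k\<in>{..<r}. g k) \<oplus> g 0"
      using g by (simp add: a_comm)
    then show ?thesis using g by (simp add: finsum_closed add.right_cancel)
  qed
  finally show ?thesis
    using i g unfolding P_def g_def[symmetric]
    by (simp add: smult_assoc3 finsum_closed mult.commute flip: smult_assoc1)
qed

lemma t_P_commute: assumes "i \<in> {1..n}" "j \<in> {1..n}" shows "t j \<otimes> P a i = P a i \<otimes> t j"
proof -
  have c: "t i [^] k \<otimes> t j = t j \<otimes> t i [^] k" for k :: nat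
  proof (induction k)
    case (Suc k)
    have "t i [^] Suc k \<otimes> t j = t i [^] k \<otimes> (t j \<otimes> t i)"
      using assms by (simp add: m_assoc t_commute)
    also have "\<dots> = (t i [^] k \<otimes> t j) \<otimes> t i" using assms by (simp only: m_assoc nat_pow_closed t_closed)
    also have "\<dots> = t j \<otimes> t i [^] Suc k" unfolding Suc using assms by (simp add: m_assoc)
    finally show ?case .
  qed (use assms in simp)
  have "t j \<otimes> (\<Oplus>k\<in>{..<r}. z a ^ (r - k) \<odot> (t i [^] k)) = (\<Oplus>k\<in>{..<r}. t j \<otimes> (z a ^ (r - k) \<odot> (t i [^] k)))"
    using assms by (intro finsum_rdistr) auto
  also have "\<dots> = (\<Oplus>k\<in>{..<r}. (z a ^ (r - k) \<odot> (t i [^] k)) \<otimes> t j)"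
    using assms by (intro finsum_cong') (auto simp: smult_assoc2 smult_assoc3 c)
  also have "\<dots> = (\<Oplus>k\<in>{..<r}. z a ^ (r - k) \<odot> (t i [^] k)) \<otimes> t j"
    using assms by (intro finsum_ldistr[symmetric]) auto
  finally show ?thesis
    using assms by (simp add: P_def smult_assoc2 smult_assoc3 finsum_closed)
qed

text \<open>Summing the Fourier coefficients over all roots of unity leaves only the summand
  \<open>k = 0\<close>, by \<open>z_sum\<close>.\<close>

lemma sum_P: assumes i: "i \<in> {1..n}" shows "(\<Oplus>a\<in>{..<r}. P a i) = \<one>"
proof -
  have s: "(\<Sum>a<r. z a ^ (r - k)) = (if k = 0 then of_nat r else 0)" if "k < r" for k
    using that z_sum[of "r - k"] by (auto simp: z_root)
  have "(\<Oplus>a\<in>{..<r}. P a i) = inverse (of_nat r) \<odot> (\<Oplus>a\<in>{..<r}. \<Oplus>k\<in>{..<r}. z a ^ (r - k) \<odot> (t i [^] k))"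
    unfolding P_def using i by (intro smult_finsum[symmetric]) (auto intro!: finsum_closed)
  also have "(\<Oplus>a\<in>{..<r}. \<Oplus>k\<in>{..<r}. z a ^ (r - k) \<odot> (t i [^] k)) =
      (\<Oplus>k\<in>{..<r}. \<Oplus>a\<in>{..<r}. z a ^ (r - k) \<odot> (t i [^] k))"
    using i by (intro finsum_swap) auto
  also have "\<dots> = (\<Oplus>k\<in>{..<r}. (\<Sum>a<r. z a ^ (r - k)) \<odot> (t i [^] k))"
    using i by (intro finsum_cong') (auto simp: smult_sum)
  also have "\<dots> = (\<Sum>a<r. z a ^ (r - 0)) \<odot> (t i [^] (0::nat))"
    using i r by (intro finsum_only) (auto simp: s)
  also have "\<dots> = of_nat r \<odot> \<one>" using s[of 0] r by simp
  finally show ?thesis using r_nz by (simp flip: smult_assoc1)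
qed

text \<open>Partial products allow induction on the number of positions; the idempotent of a whole
  word is \<open>E n\<close>.\<close>

primrec E :: "nat \<Rightarrow> (nat \<Rightarrow> nat) \<Rightarrow> 'a" where
  "E 0 \<chi> = \<one>"
| "E (Suc m) \<chi> = E m \<chi> \<otimes> P (\<chi> (Suc m)) (Suc m)"

abbreviation "idem \<equiv> E n"

lemma E_closed [simp]: "m \<le> n \<Longrightarrow> E m \<chi> \<in> carrier A"
  by (induction m) auto

abbreviation "colorings \<equiv> {\<chi>. \<forall>i\<in>{1..n}. \<chi> i < r}"

text \<open>Weight vectors for left multiplication. They form the right ideal cut out by the
  idempotent of \<open>\<chi>\<close>, so right multiplication preserves the weight.\<close>

definition wt :: "(nat \<Rightarrow> nat) \<Rightarrow> 'a \<Rightarrow> bool" where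
  "wt \<chi> y \<longleftrightarrow> y \<in> carrier A \<and> (\<forall>i\<in>{1..n}. t i \<otimes> y = z (\<chi> i) \<odot> y)"

lemma wt_closed: "wt \<chi> y \<Longrightarrow> y \<in> carrier A"
  by (simp add: wt_def)

lemma t_E_commute: "m \<le> n \<Longrightarrow> j \<in> {1..n} \<Longrightarrow> t j \<otimes> E m \<chi> = E m \<chi> \<otimes> t j"
proof (induction m)
  case (Suc m)
  have "t j \<otimes> (E m \<chi> \<otimes> P (\<chi> (Suc m)) (Suc m)) = (t j \<otimes> E m \<chi>) \<otimes> P (\<chi> (Suc m)) (Suc m)"
    using Suc.prems by (simp add: m_assoc)
  also have "t j \<otimes> E m \<chi> = E m \<chi> \<otimes> t j" using Suc by simp
  also have "E m \<chi> \<otimes> t j \<otimes> P (\<chi> (Suc m)) (Suc m) = E m \<chi> \<otimes> (t j \<otimes> P (\<chi> (Suc m)) (Suc m))"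
    using Suc.prems by (simp add: m_assoc)
  also have "\<dots> = E m \<chi> \<otimes> (P (\<chi> (Suc m)) (Suc m) \<otimes> t j)" using Suc.prems by (simp add: t_P_commute)
  also have "\<dots> = E m \<chi> \<otimes> P (\<chi> (Suc m)) (Suc m) \<otimes> t j" using Suc.prems by (simp add: m_assoc)
  finally show ?case by simp
qed simp

lemma t_E: "m \<le> n \<Longrightarrow> \<chi> \<in> colorings \<Longrightarrow> j \<in> {1..m} \<Longrightarrow> t j \<otimes> E m \<chi> = z (\<chi> j) \<odot> E m \<chi>"
proof (induction m)
  case (Suc m)
  have eq: "t j \<otimes> E (Suc m) \<chi> = (t j \<otimes> E m \<chi>) \<otimes> P (\<chi> (Suc m)) (Suc m)"
    using Suc.prems by (simp add: m_assoc)
  show ?case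
  proof (cases "j = Suc m")
    case True
    have "t j \<otimes> E m \<chi> = E m \<chi> \<otimes> t j" using Suc.prems by (simp add: t_E_commute)
    then have "(t j \<otimes> E m \<chi>) \<otimes> P (\<chi> (Suc m)) (Suc m) = E m \<chi> \<otimes> (t j \<otimes> P (\<chi> (Suc m)) (Suc m))"
      using Suc.prems by (simp add: m_assoc)
    also have "t j \<otimes> P (\<chi> (Suc m)) (Suc m) = z (\<chi> j) \<odot> P (\<chi> (Suc m)) (Suc m)"
      using True Suc.prems by (simp add: t_P)
    finally show ?thesis using eq Suc.prems by (simp add: smult_assoc3)
  next
    case False
    then show ?thesis using eq Suc by (simp add: smult_assoc2)
  qed
qed simp

lemma wt_idem: "\<chi> \<in> colorings \<Longrightarrow> wt \<chi> (idem \<chi>)"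
  unfolding wt_def using t_E[of n \<chi>] by simp

text \<open>Each projection keeps \<open>y\<close> if the letters agree at its position and kills it
  otherwise, so the product acts as a Kronecker delta.\<close>

lemma E_wt:
  assumes y: "wt \<xi> y" and c: "\<chi> \<in> colorings" "\<xi> \<in> colorings"
  shows "m \<le> n \<Longrightarrow> E m \<chi> \<otimes> y = (if \<forall>i\<in>{1..m}. \<chi> i = \<xi> i then y else \<zero>)"
proof (induction m)
  case 0
  then show ?case using wt_closed[OF y] by simp
next
  case (Suc m)
  have "E (Suc m) \<chi> \<otimes> y = E m \<chi> \<otimes> (P (\<chi> (Suc m)) (Suc m) \<otimes> y)"
    using Suc.prems wt_closed[OF y] by (simp add: m_assoc)
  also have "P (\<chi> (Suc m)) (Suc m) \<otimes> y = (if \<chi> (Suc m) = \<xi> (Suc m) then y else \<zero>)"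
    using Suc.prems y c by (intro P_eigen) (auto simp: wt_def)
  finally show ?case using Suc by (auto simp: le_Suc_eq)
qed

lemma idem_wt: "wt \<chi> y \<Longrightarrow> \<chi> \<in> colorings \<Longrightarrow> idem \<chi> \<otimes> y = y"
  using E_wt[of \<chi> y \<chi> n] by simp

lemma E_cong: "(\<And>i. i \<in> {1..m} \<Longrightarrow> \<chi> i = \<xi> i) \<Longrightarrow> E m \<chi> = E m \<xi>"
  by (induction m) auto

text \<open>Testing equality on all weight idempotents replaces the decomposition of 1 into them.\<close>

lemma eq_by_weights_aux:
  assumes "y \<in> carrier A" "w \<in> carrier A" "m \<le> n"
    and "\<And>\<chi>. \<chi> \<in> {1..m} \<rightarrow>\<^sub>E {..<r} \<Longrightarrow> y \<otimes> E m \<chi> = w \<otimes> E m \<chi>"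
  shows "y = w"
  using assms(3,4)
proof (induction m)
  case 0
  then show ?case using assms by (simp add: PiE_empty_domain)
next
  case (Suc m)
  show ?case
  proof (rule Suc.IH)
    fix \<chi> assume \<chi>: "\<chi> \<in> {1..m} \<rightarrow>\<^sub>E {..<r}"
    have E: "E m (\<chi>(Suc m := a)) = E m \<chi>" for a by (rule E_cong) auto
    have c: "E m \<chi> \<in> carrier A" "P a (Suc m) \<in> carrier A" for a using Suc.prems by auto
    have "y \<otimes> E m \<chi> \<otimes> P a (Suc m) = w \<otimes> E m \<chi> \<otimes> P a (Suc m)" if "a < r" for a
    proof -
      define \<xi> where "\<xi> = \<chi>(Suc m := a)"
      have "\<xi> \<in> {1..Suc m} \<rightarrow>\<^sub>E {..<r}"
        using \<chi> that by (auto simp: PiE_iff extensional_def \<xi>_def)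
      moreover have "E m \<xi> = E m \<chi>" "\<xi> (Suc m) = a" by (simp_all only: \<xi>_def E fun_upd_same)
      ultimately show ?thesis using Suc.prems(2)[of \<xi>] assms(1,2) c by (simp add: m_assoc)
    qed
    \<comment> \<open>Summing over the last letter removes the last projection, because the
      projections at one position add up to 1.\<close>
    then have "(\<Oplus>a\<in>{..<r}. y \<otimes> E m \<chi> \<otimes> P a (Suc m)) = (\<Oplus>a\<in>{..<r}. w \<otimes> E m \<chi> \<otimes> P a (Suc m))"
      using assms c by (intro finsum_cong') auto
    then have "y \<otimes> E m \<chi> \<otimes> (\<Oplus>a\<in>{..<r}. P a (Suc m)) = w \<otimes> E m \<chi> \<otimes> (\<Oplus>a\<in>{..<r}. P a (Suc m))"
      using assms c by (simp add: finsum_rdistr)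
    then show "y \<otimes> E m \<chi> = w \<otimes> E m \<chi>"
      using assms c sum_P[of "Suc m"] Suc.prems by simp
  qed (use Suc.prems in simp)
qed

lemma eq_by_weights:
  assumes "y \<in> carrier A" "w \<in> carrier A" "\<And>\<chi>. \<chi> \<in> {1..n} \<rightarrow>\<^sub>E {..<r} \<Longrightarrow> y \<otimes> idem \<chi> = w \<otimes> idem \<chi>"
  shows "y = w"
  by (rule eq_by_weights_aux[OF assms(1,2) le_refl assms(3)])

lemma PiE_colorings: "\<chi> \<in> {1..n} \<rightarrow>\<^sub>E {..<r} \<Longrightarrow> \<chi> \<in> colorings"
  by auto

lemma swap_colorings: "\<chi> \<in> colorings \<Longrightarrow> i \<in> {1..<n} \<Longrightarrow> swap i \<chi> \<in> colorings"
  by (auto simp: swap_apply Transposition.transpose_def)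

text \<open>Passing \<open>t j\<close> through \<open>f i\<close> applies the transposition to the
  index, so the weight is swapped.\<close>

lemma wt_f: assumes y: "wt \<chi> y" and i: "i \<in> {1..<n}" shows "wt (swap i \<chi>) (f i \<otimes> y)"
  unfolding wt_def
proof (intro conjI ballI)
  fix j assume j: "j \<in> {1..n}"
  let ?s = "Transposition.transpose i (Suc i)"
  have sj: "?s j \<in> {1..n}" using transpose_mem[OF i, of j] j by blast
  have "t j \<otimes> (f i \<otimes> y) = (t (?s (?s j)) \<otimes> f i) \<otimes> y" using i j wt_closed[OF y] by (simp add: m_assoc)
  also have "\<dots> = f i \<otimes> (t (?s j) \<otimes> y)"
    using i sj wt_closed[OF y] by (subst f_t[symmetric]) (auto simp: m_assoc)
  also have "\<dots> = z (swap i \<chi> j) \<odot> (f i \<otimes> y)"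
    using y sj i wt_closed[OF y] by (simp add: wt_def swap_apply smult_assoc3)
  finally show "t j \<otimes> (f i \<otimes> y) = z (swap i \<chi> j) \<odot> (f i \<otimes> y)" .
qed (use assms wt_closed in simp)

lemma wt_x: assumes y: "wt \<chi> y" and i: "i \<in> {1..n}" shows "wt \<chi> (x i \<otimes> y)"
  unfolding wt_def
proof (intro conjI ballI)
  fix j assume j: "j \<in> {1..n}"
  have "t j \<otimes> (x i \<otimes> y) = (t j \<otimes> x i) \<otimes> y" using i j wt_closed[OF y] by (simp add: m_assoc)
  also have "\<dots> = x i \<otimes> (t j \<otimes> y)" unfolding t_x[OF i j] using i j wt_closed[OF y] by (simp add: m_assoc)
  also have "\<dots> = z (\<chi> j) \<odot> (x i \<otimes> y)" using y j i wt_closed[OF y] by (simp add: wt_def smult_assoc3)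
  finally show "t j \<otimes> (x i \<otimes> y) = z (\<chi> j) \<odot> (x i \<otimes> y)" .
qed (use assms wt_closed in simp)

text \<open>An element mapping each weight \<open>\<xi>\<close> to weight \<open>s \<xi>\<close>
  intertwines the idempotents: tested against \<open>idem \<xi>\<close>, both sides give
  \<open>g \<otimes> idem \<xi>\<close> or zero, and \<open>inj\<close> ensures that they do so in
  the same cases.\<close>

lemma idem_intertwine:
  assumes g: "g \<in> carrier A" and \<chi>: "\<chi> \<in> colorings"
    and s: "\<And>\<xi>. \<xi> \<in> colorings \<Longrightarrow> s \<xi> \<in> colorings \<and> wt (s \<xi>) (g \<otimes> idem \<xi>)"
    and inj: "\<And>\<xi>. (\<forall>i\<in>{1..n}. s \<chi> i = s \<xi> i) \<longleftrightarrow> (\<forall>i\<in>{1..n}. \<chi> i = \<xi> i)"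
  shows "idem (s \<chi>) \<otimes> g = g \<otimes> idem \<chi>"
proof (rule eq_by_weights)
  fix \<xi> assume "\<xi> \<in> {1..n} \<rightarrow>\<^sub>E {..<r}"
  then have \<xi>: "\<xi> \<in> colorings" by (rule PiE_colorings)
  have "idem (s \<chi>) \<otimes> g \<otimes> idem \<xi> = (if \<forall>i\<in>{1..n}. s \<chi> i = s \<xi> i then g \<otimes> idem \<xi> else \<zero>)"
    using E_wt[of "s \<xi>" "g \<otimes> idem \<xi>" "s \<chi>" n] s[OF \<xi>] s[OF \<chi>] g by (simp add: m_assoc)
  also have "\<dots> = g \<otimes> idem \<chi> \<otimes> idem \<xi>"
    using E_wt[OF wt_idem[OF \<xi>] \<chi> \<xi>, of n] g unfolding inj by (simp add: m_assoc)
  finally show "idem (s \<chi>) \<otimes> g \<otimes> idem \<xi> = g \<otimes> idem \<chi> \<otimes> idem \<xi>" .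
qed (use g in auto)

lemma idem_f: assumes i: "i \<in> {1..<n}" and \<chi>: "\<chi> \<in> colorings"
  shows "idem (swap i \<chi>) \<otimes> f i = f i \<otimes> idem \<chi>"
proof (rule idem_intertwine)
  show "(\<forall>j\<in>{1..n}. swap i \<chi> j = swap i \<xi> j) \<longleftrightarrow> (\<forall>j\<in>{1..n}. \<chi> j = \<xi> j)" for \<xi>
  proof -
    have "(\<forall>j\<in>{1..n}. \<chi> j = \<xi> j)" if *: "\<forall>j\<in>{1..n}. swap i \<chi> j = swap i \<xi> j"
    proof
      fix j assume "j \<in> {1..n}"
      then have "Transposition.transpose i (Suc i) j \<in> {1..n}" using transpose_mem[OF i] by blast
      then have "swap i \<chi> (Transposition.transpose i (Suc i) j) = swap i \<xi> (Transposition.transpose i (Suc i) j)"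
        using * by blast
      then show "\<chi> j = \<xi> j" by (simp add: swap_apply)
    qed
    then show ?thesis using i transpose_mem[OF i] by (auto simp: swap_apply)
  qed
  show "swap i \<xi> \<in> colorings \<and> wt (swap i \<xi>) (f i \<otimes> idem \<xi>)" if "\<xi> \<in> colorings" for \<xi>
    by (intro conjI swap_colorings wt_f wt_idem that i)
qed (use assms in simp_all)

lemma idem_x: assumes "i \<in> {1..n}" "\<chi> \<in> colorings"
  shows "idem \<chi> \<otimes> x i = x i \<otimes> idem \<chi>"
  by (rule idem_intertwine[where s = "\<lambda>\<chi>. \<chi>"]) (use assms in \<open>auto intro!: wt_x wt_idem\<close>)

lemma idem_idem: "\<chi> \<in> colorings \<Longrightarrow> idem \<chi> \<otimes> idem \<chi> = idem \<chi>"
  by (rule idem_wt[OF wt_idem])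

text \<open>The definition of \<open>e_i\<close> is the Fourier expansion of the projection onto
  words with equal letters at \<open>i\<close> and \<open>Suc i\<close>: on a weight vector it is
  the orthogonality sum divided by \<open>r\<close>.\<close>

lemma e_wt:
  assumes y: "wt \<chi> y" and \<chi>: "\<chi> \<in> colorings" and i: "i \<in> {1..<n}"
  shows "yh_e A r t i \<otimes> y = (if \<chi> i = \<chi> (Suc i) then y else \<zero>)"
proof -
  have i': "i \<in> {1..n}" "Suc i \<in> {1..n}" using i by auto
  have yc: "y \<in> carrier A" using y by (rule wt_closed)
  have "yh_e A r t i \<otimes> y = inverse (of_nat r) \<odot> (\<Oplus>k\<in>{..<r}. (t i [^] k \<otimes> t (Suc i) [^] (r - k)) \<otimes> y)"
    unfolding yh_e_def using yc i' by (subst smult_assoc2) (auto simp: finsum_ldistr intro!: finsum_closed)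
  also have "(\<Oplus>k\<in>{..<r}. (t i [^] k \<otimes> t (Suc i) [^] (r - k)) \<otimes> y) =
      (\<Oplus>k\<in>{..<r}. (z (\<chi> i) ^ k * z (\<chi> (Suc i)) ^ (r - k)) \<odot> y)"
  proof (intro finsum_cong' refl)
    fix k
    have "(t i [^] k \<otimes> t (Suc i) [^] (r - k)) \<otimes> y = t i [^] k \<otimes> (z (\<chi> (Suc i)) ^ (r - k) \<odot> y)"
      using y i' yc by (simp add: m_assoc t_pow_eigen[of y "Suc i"] wt_def)
    also have "\<dots> = z (\<chi> (Suc i)) ^ (r - k) \<odot> (z (\<chi> i) ^ k \<odot> y)"
      using y i' yc by (simp add: smult_assoc3 t_pow_eigen[of y i] wt_def)
    finally show "(t i [^] k \<otimes> t (Suc i) [^] (r - k)) \<otimes> y = (z (\<chi> i) ^ k * z (\<chi> (Suc i)) ^ (r - k)) \<odot> y"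
      using yc by (simp add: mult.commute flip: smult_assoc1)
  qed (use yc in auto)
  also have "\<dots> = (\<Sum>k<r. z (\<chi> i) ^ k * z (\<chi> (Suc i)) ^ (r - k)) \<odot> y" using yc by (simp add: smult_sum)
  also have "(\<Sum>k<r. z (\<chi> i) ^ k * z (\<chi> (Suc i)) ^ (r - k)) = (if \<chi> (Suc i) = \<chi> i then of_nat r else 0)"
    using \<chi> i' by (intro z_orthogonal) auto
  finally show ?thesis using yc r_nz by (auto simp flip: smult_assoc1)
qed

end

section \<open>Corner algebras\<close>

text \<open>For an idempotent \<open>e\<close> this is \<open>e A e\<close>, described as the set of
  elements that \<open>e\<close> fixes on both sides; apart from the carrier only the unit
  changes.\<close>

definition corner :: "('k, 'a) module \<Rightarrow> 'a \<Rightarrow> ('k, 'a) module" where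
  "corner A e = A\<lparr>carrier := {x \<in> carrier A. e \<otimes>\<^bsub>A\<^esub> x = x \<and> x \<otimes>\<^bsub>A\<^esub> e = x}, one := e\<rparr>"

lemma corner_simps [simp]:
  "carrier (corner A e) = {x \<in> carrier A. e \<otimes>\<^bsub>A\<^esub> x = x \<and> x \<otimes>\<^bsub>A\<^esub> e = x}"
  "\<one>\<^bsub>corner A e\<^esub> = e" "\<zero>\<^bsub>corner A e\<^esub> = \<zero>\<^bsub>A\<^esub>"
  "mult (corner A e) = mult A" "add (corner A e) = add A" "module.smult (corner A e) = module.smult A"
  by (simp_all add: corner_def)

context kalg
begin

lemma kalg_corner:
  assumes e: "e \<in> carrier A" "e \<otimes> e = e" shows "kalg (corner A e)"
proof -
  have "e \<otimes> (x \<otimes> y) = x \<otimes> y" if "e \<otimes> x = x" "x \<in> carrier A" "y \<in> carrier A" for x y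
    using that e by (simp flip: m_assoc)
  moreover have "x \<otimes> y \<otimes> e = x \<otimes> y" if "y \<otimes> e = y" "x \<in> carrier A" "y \<in> carrier A" for x y
    using that e by (simp add: m_assoc)
  ultimately show ?thesis
    by (intro kalgI) (use e in \<open>auto simp: a_ac m_assoc l_distr r_distr smult_l_distr smult_r_distr
      smult_assoc1 smult_assoc2 smult_assoc3\<close>)
qed

text \<open>Cutting by an idempotent is compatible with products as soon as it commutes with the
  right factor; relations among elements commuting with \<open>e\<close> therefore pass to the
  corner.\<close>

lemma corner_mult:
  assumes "g \<in> carrier A" "h \<in> carrier A" "e \<in> carrier A" "e \<otimes> e = e" "e \<otimes> h = h \<otimes> e"
  shows "(g \<otimes> e) \<otimes> (h \<otimes> e) = (g \<otimes> h) \<otimes> e"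
proof -
  have "(g \<otimes> e) \<otimes> (h \<otimes> e) = g \<otimes> (e \<otimes> h) \<otimes> e" using assms(1-4) by (simp add: m_assoc)
  also have "\<dots> = (g \<otimes> h) \<otimes> (e \<otimes> e)" unfolding assms(5) using assms(1-3) by (simp add: m_assoc)
  finally show ?thesis using assms(4) by simp
qed

lemma corner_closed:
  assumes "h \<in> carrier A" "e \<in> carrier A" "e \<otimes> e = e" "e \<otimes> h = h \<otimes> e"
  shows "h \<otimes> e \<in> carrier (corner A e)"
proof -
  have "e \<otimes> (h \<otimes> e) = e \<otimes> h \<otimes> e" using assms(1,2) by (simp add: m_assoc)
  also have "\<dots> = h \<otimes> (e \<otimes> e)" unfolding assms(4) using assms(1,2) by (simp add: m_assoc)
  finally show ?thesis using assms(1-3) by (simp add: m_assoc)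
qed

text \<open>If \<open>g y = y h\<close>, then \<open>q(g) y = y q(h)\<close> for every polynomial
  \<open>q\<close>; here this is done factor by factor. With a cancellable \<open>y\<close> it
  transports the cyclotomic relation from \<open>g\<close> to \<open>h\<close>.\<close>

lemma cyclotomic_intertwine:
  assumes "g \<in> carrier A" "h \<in> carrier A" "y \<in> carrier A" "g \<otimes> y = y \<otimes> h"
  shows "cyclotomic_element A d v g \<otimes> y = y \<otimes> cyclotomic_element A d v h"
proof -
  let ?f = "\<lambda>x l. foldr (\<lambda>i y. (x \<ominus> v i \<odot> \<one>) \<otimes> y) l \<one>"
  have c: "?f x l \<in> carrier A" if "x \<in> carrier A" for x l
    using that by (induction l) auto
  have step: "(g \<ominus> a \<odot> \<one>) \<otimes> y = y \<otimes> (h \<ominus> a \<odot> \<one>)" for a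
    using assms by (simp add: a_minus_def l_distr r_distr l_minus r_minus smult_assoc2 smult_assoc3)
  have "?f g l \<otimes> y = y \<otimes> ?f h l" for l
  proof (induction l)
    case (Cons i l)
    have "?f g (i # l) \<otimes> y = (g \<ominus> v i \<odot> \<one>) \<otimes> (?f g l \<otimes> y)" using assms c by (simp add: m_assoc)
    also have "\<dots> = ((g \<ominus> v i \<odot> \<one>) \<otimes> y) \<otimes> ?f h l" unfolding Cons using assms c by (simp add: m_assoc)
    also have "\<dots> = y \<otimes> ?f h (i # l)" unfolding step using assms c by (simp add: m_assoc)
    finally show ?case .
  qed (use assms in simp)
  then show ?thesis by (simp add: cyclotomic_element_def)
qed

text \<open>In the corner the constants \<open>v i\<close> multiply \<open>e\<close> instead of 1,
  so each factor is the original one times \<open>e\<close>; commutation collects these into a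
  single \<open>e\<close>.\<close>

lemma cyclotomic_corner:
  assumes e: "e \<in> carrier A" "e \<otimes> e = e" and h: "h \<in> carrier A" "e \<otimes> h = h \<otimes> e"
  shows "cyclotomic_element (corner A e) d v (h \<otimes> e) = cyclotomic_element A d v h \<otimes> e"
proof -
  interpret C: kalg "corner A e" by (rule kalg_corner[OF e])
  have he: "h \<otimes> e \<in> carrier (corner A e)" by (rule corner_closed[OF h(1) e h(2)])
  \<comment> \<open>Negation is multiplication by the scalar -1, which is the same in the corner as
    in the whole algebra.\<close>
  have inv: "\<ominus>\<^bsub>corner A e\<^esub> y = \<ominus> y" if "y \<in> carrier (corner A e)" for y
    using C.smult_minus_one[OF that] smult_minus_one[of y] that by simp
  have fac: "h \<otimes> e \<ominus>\<^bsub>corner A e\<^esub> a \<odot>\<^bsub>corner A e\<^esub> \<one>\<^bsub>corner A e\<^esub> = (h \<ominus> a \<odot> \<one>) \<otimes> e" for a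
  proof -
    have "h \<otimes> e \<ominus>\<^bsub>corner A e\<^esub> a \<odot>\<^bsub>corner A e\<^esub> \<one>\<^bsub>corner A e\<^esub> = h \<otimes> e \<oplus> \<ominus> (a \<odot> e)"
      using e by (simp add: a_minus_def inv smult_assoc2 smult_assoc3)
    also have "\<dots> = (h \<ominus> a \<odot> \<one>) \<otimes> e"
      using e h(1) by (simp add: a_minus_def l_distr l_minus smult_assoc2)
    finally show ?thesis .
  qed
  let ?f = "\<lambda>l. foldr (\<lambda>i y. (h \<ominus> v i \<odot> \<one>) \<otimes> y) l \<one>"
  have comm: "e \<otimes> (h \<ominus> a \<odot> \<one>) = (h \<ominus> a \<odot> \<one>) \<otimes> e" for a
    using e h by (simp add: a_minus_def l_distr r_distr l_minus r_minus smult_assoc2 smult_assoc3)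
  have f: "?f l \<in> carrier A \<and> e \<otimes> ?f l = ?f l \<otimes> e" for l
  proof (induction l)
    case (Cons i l)
    have "e \<otimes> ((h \<ominus> v i \<odot> \<one>) \<otimes> ?f l) = (e \<otimes> (h \<ominus> v i \<odot> \<one>)) \<otimes> ?f l"
      using e h(1) Cons by (simp add: m_assoc)
    also have "\<dots> = (h \<ominus> v i \<odot> \<one>) \<otimes> (e \<otimes> ?f l)" unfolding comm using e h(1) Cons by (simp add: m_assoc)
    also have "e \<otimes> ?f l = ?f l \<otimes> e" using Cons by simp
    finally show ?case using e h(1) Cons by (simp add: m_assoc)
  qed (use e in simp)
  have "foldr (\<lambda>i y. (h \<otimes> e \<ominus>\<^bsub>corner A e\<^esub> v i \<odot>\<^bsub>corner A e\<^esub> \<one>\<^bsub>corner A e\<^esub>) \<otimes>\<^bsub>corner A e\<^esub> y) l \<one>\<^bsub>corner A e\<^esub> =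
      ?f l \<otimes> e" for l
  proof (induction l)
    case (Cons i l)
    then show ?case
      unfolding foldr.simps comp_def fac
      using f[of l] e h(1) corner_mult[of "h \<ominus> v i \<odot> \<one>" "?f l" e] by simp
  qed (use e in simp)
  then show ?thesis by (simp only: cyclotomic_element_def)
qed

end

section \<open>Paths from the sorted word\<close>

locale yh_block = yh_algebra A r n d v t f x z for A :: "('k::field, 'a) module" (structure)
    and r n d v t f x z +
  fixes \<mu> :: "nat list"
  assumes len: "length \<mu> = r" and sum: "sum_list \<mu> = n"
begin

abbreviation "b \<equiv> base \<mu>"
abbreviation "W \<equiv> words \<mu>"
abbreviation "p \<equiv> pos \<mu>"

lemma W_colorings: "\<chi> \<in> W \<Longrightarrow> \<chi> \<in> colorings"
  using words_less[of \<chi> \<mu>] by (simp add: len sum)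

lemma b_word: "b \<in> W" by (rule base_in_words)

lemma W_swap: "\<chi> \<in> W \<Longrightarrow> i \<in> {1..<n} \<Longrightarrow> swap i \<chi> \<in> W"
  using swap_in_words[of \<chi> \<mu> i] by (simp add: sum)

text \<open>\<open>path \<chi> y\<close> says that \<open>y\<close> is \<open>f\<^sub>w E\<^sub>b\<close> for the shortest permutation \<open>w\<close> taking the sorted word \<open>b\<close> to \<open>\<chi>\<close>.\<close>

inductive path :: "(nat \<Rightarrow> nat) \<Rightarrow> 'a \<Rightarrow> bool" where
  base: "path b (idem b)"
| step: "path \<chi> y \<Longrightarrow> i \<in> {1..<n} \<Longrightarrow> \<chi> i < \<chi> (Suc i) \<Longrightarrow> path (swap i \<chi>) (f i \<otimes> y)"

lemma path_word: "path \<chi> y \<Longrightarrow> \<chi> \<in> W"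
  by (induction rule: path.induct) (auto simp: b_word intro!: W_swap)

lemma path_wt: "path \<chi> y \<Longrightarrow> wt \<chi> y"
proof (induction rule: path.induct)
  case base
  then show ?case by (intro wt_idem W_colorings b_word)
next
  case (step \<chi> y i)
  then show ?case by (intro wt_f)
qed

lemma path_closed [simp]: "path \<chi> y \<Longrightarrow> y \<in> carrier A"
  using path_wt wt_closed by blast

lemma path_idem: "path \<chi> y \<Longrightarrow> y \<otimes> idem b = y"
  by (induction rule: path.induct) (simp_all add: idem_idem[OF W_colorings[OF b_word]] m_assoc)

text \<open>The rule \<open>step\<close> seen from its result: it applies to a word with a descent,
  which is where sorting by induction begins.\<close>

lemma path_descent:
  assumes "path (swap i \<chi>) y" "i \<in> {1..<n}" "\<chi> (Suc i) < \<chi> i" shows "path \<chi> (f i \<otimes> y)"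
  using path.step[OF assms(1,2)] assms(3) by (simp add: swap_apply)

text \<open>Removing a descent lowers \<open>disorder\<close>, and only the sorted word has
  none.\<close>

lemma path_exists: "\<chi> \<in> W \<Longrightarrow> \<exists>y. path \<chi> y"
proof (induction "disorder \<mu> \<chi>" arbitrary: \<chi> rule: less_induct)
  case less
  show ?case
  proof (cases "\<chi> = b")
    case True
    then show ?thesis using path.base by blast
  next
    case False
    then obtain i where i: "i \<in> {1..<n}" "\<chi> (Suc i) < \<chi> i"
      using exists_descent[OF less.prems] sum by auto
    then obtain y where "path (swap i \<chi>) y"
      using less.hyps[OF _ W_swap[OF less.prems i(1)]] disorder_swap[of i \<mu> \<chi>] sum by auto
    then show ?thesis using path_descent[OF _ i] by blast
  qed
qed

lemma base_no_descent: "i \<in> {1..<n} \<Longrightarrow> b i \<le> b (Suc i)"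
  using base_mono[of i \<mu> "Suc i"] sum by auto

text \<open>Every step ends in a word with a descent; as the sorted word has none, only the initial
  rule leads to \<open>b\<close>.\<close>

lemma path_base: "path b y \<Longrightarrow> y = idem b"
proof -
  assume "path b y"
  then show ?thesis
  proof cases
    case (step \<chi> y i)
    then have "b (Suc i) < b i" by (metis swap_apply transpose_apply_first transpose_apply_second)
    then show ?thesis using base_no_descent[of i] step by simp
  qed
qed

lemma path_cases_descent:
  assumes "path \<chi> y" "\<chi> \<noteq> b"
  obtains i w where "i \<in> {1..<n}" "\<chi> (Suc i) < \<chi> i" "path (swap i \<chi>) w" "y = f i \<otimes> w"
  using assms(1)
proof cases
  case (step \<xi> w i)
  then show ?thesis using that[of i w] by (simp add: swap_apply)
qed (use assms(2) in simp)

lemma f_square_cancel: "i \<in> {1..<n} \<Longrightarrow> y \<in> carrier A \<Longrightarrow> f i \<otimes> (f i \<otimes> y) = y"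
  by (simp add: f_square flip: m_assoc)

lemma f_braid_apply:
  assumes "i \<in> {1..<n}" "Suc i \<in> {1..<n}" "y \<in> carrier A"
  shows "f i \<otimes> (f (Suc i) \<otimes> (f i \<otimes> y)) = f (Suc i) \<otimes> (f i \<otimes> (f (Suc i) \<otimes> y))"
proof -
  have "(f i \<otimes> f (Suc i) \<otimes> f i) \<otimes> y = (f (Suc i) \<otimes> f i \<otimes> f (Suc i)) \<otimes> y"
    using f_braid[of i] assms by simp
  then show ?thesis using assms by (simp add: m_assoc)
qed

lemma f_commute_apply:
  assumes "i \<in> {1..<n}" "j \<in> {1..<n}" "Suc i < j" "y \<in> carrier A"
  shows "f i \<otimes> (f j \<otimes> y) = f j \<otimes> (f i \<otimes> y)"
proof -
  have "(f i \<otimes> f j) \<otimes> y = (f j \<otimes> f i) \<otimes> y"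
    using f_commute[of i j] assms by simp
  then show ?thesis using assms by (simp add: m_assoc)
qed

text \<open>The diamond argument: two descents of a word can be joined, and the two resulting elements
  agree by the commutation or the braid relation.\<close>

lemma path_unique: "path \<chi> y \<Longrightarrow> path \<chi> w \<Longrightarrow> y = w"
proof (induction "disorder \<mu> \<chi>" arbitrary: \<chi> y w rule: less_induct)
  case less
  have IH: "y = w" if "path (swap i \<chi>) y" "path (swap i \<chi>) w" "i \<in> {1..<n}" "\<chi> (Suc i) < \<chi> i" for i y w
    using less.hyps[OF _ that(1,2)] disorder_swap[of i \<mu> \<chi>] that sum by simp
  have \<chi>: "\<chi> \<in> W" using less.prems path_word by blast
  have join: "f i \<otimes> y' = f j \<otimes> w'"
    if i: "i \<in> {1..<n}" "\<chi> (Suc i) < \<chi> i" "path (swap i \<chi>) y'"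
      and j: "j \<in> {1..<n}" "\<chi> (Suc j) < \<chi> j" "path (swap j \<chi>) w'" and ij: "i < j" for i j y' w'
  proof (cases "j = Suc i")
    case False
    \<comment> \<open>The two descents can be removed independently; \<open>q\<close> below belongs
      to the word in which both are gone.\<close>
    then have far: "Suc i < j" using ij by simp
    have "swap i (swap j \<chi>) \<in> W" using \<chi> i j by (intro W_swap) auto
    then obtain q where q: "path (swap i (swap j \<chi>)) q" using path_exists by blast
    have "path (swap j \<chi>) (f i \<otimes> q)"
      by (rule path_descent) (use q i far in \<open>auto simp: swap_apply\<close>)
    moreover have "path (swap i \<chi>) (f j \<otimes> q)"
      by (rule path_descent) (use q[unfolded swap_commute[OF far]] j far in \<open>auto simp: swap_apply\<close>)
    ultimately have "y' = f j \<otimes> q" "w' = f i \<otimes> q" using IH i j by blast+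
    then show ?thesis using f_commute_apply[of i j q] i j far q by simp
  next
    case True
    \<comment> \<open>Three consecutive letters decrease strictly. Reversing them takes three swaps,
      in either of two orders, so the element \<open>q\<close> at the reversed word links both sides
      through the braid relation.\<close>
    have "swap i (swap j (swap i \<chi>)) \<in> W" using \<chi> i j by (intro W_swap) auto
    then obtain q where q: "path (swap i (swap j (swap i \<chi>))) q" using path_exists by blast
    have "path (swap j (swap i \<chi>)) (f i \<otimes> q)"
      by (rule path_descent) (use q i j True in \<open>auto simp: swap_apply\<close>)
    then have "path (swap i \<chi>) (f j \<otimes> (f i \<otimes> q))"
      by (rule path_descent) (use i j True in \<open>auto simp: swap_apply\<close>)
    moreover have "path (swap i (swap j \<chi>)) (f j \<otimes> q)"
      by (rule path_descent) (use q[unfolded True swap_braid] i j True in \<open>auto simp: swap_apply\<close>)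
    then have "path (swap j \<chi>) (f i \<otimes> (f j \<otimes> q))"
      by (rule path_descent) (use i j True in \<open>auto simp: swap_apply\<close>)
    ultimately have "y' = f j \<otimes> (f i \<otimes> q)" "w' = f i \<otimes> (f j \<otimes> q)" using IH i j by blast+
    then show ?thesis using f_braid_apply[of i q] i j True q by simp
  qed
  show ?case
  proof (cases "\<chi> = b")
    case True
    then show ?thesis using less.prems path_base by blast
  next
    case False
    obtain i y' where i: "i \<in> {1..<n}" "\<chi> (Suc i) < \<chi> i" "path (swap i \<chi>) y'" "y = f i \<otimes> y'"
      by (rule path_cases_descent[OF less.prems(1) False])
    obtain j w' where j: "j \<in> {1..<n}" "\<chi> (Suc j) < \<chi> j" "path (swap j \<chi>) w'" "w = f j \<otimes> w'"
      by (rule path_cases_descent[OF less.prems(2) False])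
    consider "i < j" | "j < i" | "i = j" by linarith
    then show ?thesis
    proof cases
      case 1
      then show ?thesis using join[OF i(1-3) j(1-3)] i j by simp
    next
      case 2
      then show ?thesis using join[OF j(1-3) i(1-3)] i j by simp
    next
      case 3
      then show ?thesis using IH[OF i(3) _ i(1,2)] i j by simp
    qed
  qed
qed

text \<open>Along a path only different letters are exchanged. There the term \<open>e_i\<close>
  vanishes and \<open>x\<close> moves through \<open>f i\<close> with a mere change of index; since
  ranks follow the letters, it arrives at the place of the same occurrence in the sorted
  word.\<close>

lemma path_x: "path \<chi> y \<Longrightarrow> j \<in> {1..n} \<Longrightarrow> x j \<otimes> y = y \<otimes> x (p (\<chi> j) (rank \<chi> j))"
proof (induction arbitrary: j rule: path.induct)
  case base
  then show ?case using pos_rank[of j \<mu>] idem_x[of j b] W_colorings[OF b_word] sum by simp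
next
  case (step \<chi> y i)
  note i = \<open>i \<in> {1..<n}\<close>
  have y: "y \<in> carrier A" using step by simp
  have px: "x (p (\<chi> k) (rank \<chi> k)) \<in> carrier A" if "k \<in> {1..n}" for k
    using pos_props(1)[of "\<chi> k" \<mu> "rank \<chi> k"] words_less[OF path_word[OF step(1)], of k]
      rank_le[OF path_word[OF step(1)], of k] rank_pos[of k \<chi>] that sum by simp
  have i': "i \<in> {1..n}" "Suc i \<in> {1..n}" using i by auto
  have ne: "\<chi> i \<noteq> \<chi> (Suc i)" using step by simp
  have rk: "rank (swap i \<chi>) j = rank \<chi> (Transposition.transpose i (Suc i) j)" for j
    using rank_transpose[of i \<chi> j] i ne by simp
  \<comment> \<open>Before and after the swap the letters at \<open>i\<close> and
    \<open>Suc i\<close> differ, so \<open>e_i\<close> kills both \<open>y\<close> and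
    \<open>f i \<otimes> y\<close>.\<close>
  have ey: "yh_e A r t i \<otimes> y = \<zero>"
    using e_wt[OF path_wt[OF step(1)] W_colorings[OF path_word[OF step(1)]] i] ne by simp
  have ey': "yh_e A r t i \<otimes> (f i \<otimes> y) = \<zero>"
    using e_wt[OF wt_f[OF path_wt[OF step(1)] i] swap_colorings[OF W_colorings[OF path_word[OF step(1)]] i] i] ne
    by (simp add: swap_apply)
  have fx: "f i \<otimes> (x (Suc i) \<otimes> w) = x i \<otimes> (f i \<otimes> w)"
    if "w \<in> carrier A" "yh_e A r t i \<otimes> w = \<zero>" for w
  proof -
    have "f i \<otimes> (x (Suc i) \<otimes> w) = (f i \<otimes> x (Suc i)) \<otimes> w" using that i i' by (simp add: m_assoc)
    also have "\<dots> = x i \<otimes> (f i \<otimes> w)" unfolding f_x_Suc[OF i] using that i i' by (simp add: l_distr m_assoc)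
    finally show ?thesis .
  qed
  show ?case
  proof (cases "j = i \<or> j = Suc i")
    case False
    then have "x j \<otimes> (f i \<otimes> y) = (f i \<otimes> x j) \<otimes> y"
      using f_x_other[OF i step.prems] step.prems y i by (simp add: m_assoc)
    also have "\<dots> = f i \<otimes> (x j \<otimes> y)" using step.prems y i by (simp add: m_assoc)
    also have "\<dots> = f i \<otimes> y \<otimes> x (p (\<chi> j) (rank \<chi> j))"
      unfolding step.IH[OF step.prems] using px[OF step.prems] y i by (simp add: m_assoc)
    finally show ?thesis using False unfolding rk unfolding swap_apply by simp
  next
    case True
    then show ?thesis
    proof
      assume j: "j = i"
      have "x i \<otimes> (f i \<otimes> y) = f i \<otimes> (x (Suc i) \<otimes> y)" using fx[OF y ey] by simp
      also have "\<dots> = f i \<otimes> y \<otimes> x (p (\<chi> (Suc i)) (rank \<chi> (Suc i)))"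
        unfolding step.IH[OF i'(2)] using px[OF i'(2)] y i by (simp add: m_assoc)
      finally show ?thesis using j unfolding rk unfolding swap_apply by simp
    next
      assume j: "j = Suc i"
      \<comment> \<open>The rule \<open>fx\<close>, applied to \<open>f i \<otimes> y\<close> and
        multiplied by the involution \<open>f i\<close>, gives the relation for the other
        index.\<close>
      have "f i \<otimes> (f i \<otimes> (x (Suc i) \<otimes> (f i \<otimes> y))) = f i \<otimes> (x i \<otimes> (f i \<otimes> (f i \<otimes> y)))"
        using fx[OF _ ey'] y i by simp
      then have "x (Suc i) \<otimes> (f i \<otimes> y) = f i \<otimes> (x i \<otimes> y)"
        using i i' y by (simp add: f_square_cancel)
      also have "\<dots> = f i \<otimes> y \<otimes> x (p (\<chi> i) (rank \<chi> i))"
        unfolding step.IH[OF i'(1)] using px[OF i'(1)] y i by (simp add: m_assoc)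
      finally show ?thesis using j unfolding rk unfolding swap_apply by simp
    qed
  qed
qed

lemma p_less:
  assumes "\<chi> \<in> W" "i \<in> {1..<n}" "\<chi> i = \<chi> (Suc i)"
  shows "p (\<chi> i) (rank \<chi> i) \<in> {1..<n}"
proof -
  have i: "\<chi> i < length \<mu>" "rank \<chi> i \<in> {1..<\<mu> ! \<chi> i}"
    using words_less[OF assms(1), of i] rank_Suc[OF assms(3)] rank_le[OF assms(1), of "Suc i"]
      rank_pos[of i \<chi>] assms sum by auto
  then have "Suc (p (\<chi> i) (rank \<chi> i)) \<in> {1..n}"
    using pos_Suc[OF i] pos_props(1)[OF i(1), of "Suc (rank \<chi> i)"] sum by simp
  moreover have "p (\<chi> i) (rank \<chi> i) \<in> {1..n}"
    using pos_props(1)[OF i(1), of "rank \<chi> i"] i sum by simp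
  ultimately show ?thesis by simp
qed

text \<open>Two equal neighbouring letters travel together. Induction removes a descent at
  \<open>j\<close>: if \<open>j\<close> is far from \<open>i\<close>, then \<open>f i\<close> and
  \<open>f j\<close> commute; if it is adjacent, the third letter has to pass both equal ones, which
  moves the pair by one place and brings in the braid relation
  \<open>f i f j f i = f j f i f j\<close>.\<close>

lemma path_f:
  "path \<chi> y \<Longrightarrow> i \<in> {1..<n} \<Longrightarrow> \<chi> i = \<chi> (Suc i) \<Longrightarrow> f i \<otimes> y = y \<otimes> f (p (\<chi> i) (rank \<chi> i))"
proof (induction "disorder \<mu> \<chi>" arbitrary: \<chi> y i rule: less_induct)
  case less
  note y = less.prems(1) and i = less.prems(2) and eq = less.prems(3)
  have \<chi>: "\<chi> \<in> W" using y by (rule path_word)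
  have fp: "f (p (\<xi> i) (rank \<xi> i)) \<in> carrier A" if "\<xi> \<in> W" "i \<in> {1..<n}" "\<xi> i = \<xi> (Suc i)" for \<xi> i
    using p_less[OF that] by simp
  show ?case
  proof (cases "\<chi> = b")
    case True
    then show ?thesis
      using path_base y i eq idem_f[OF i W_colorings[OF b_word]] pos_rank[of i \<mu>] sum
      by (auto simp: swap_eq)
  next
    case False
    obtain j w where j: "j \<in> {1..<n}" "\<chi> (Suc j) < \<chi> j" "path (swap j \<chi>) w" "y = f j \<otimes> w"
      by (rule path_cases_descent[OF y False])
    have d1: "disorder \<mu> (swap j \<chi>) < disorder \<mu> \<chi>" using disorder_swap[of j \<mu> \<chi>] j sum by simp
    have w: "w \<in> carrier A" using j by simp
    have "j \<noteq> i" using j eq by auto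
    then consider (far) "Suc i < j \<or> Suc j < i" | (right) "j = Suc i" | (left) "i = Suc j" by linarith
    then show ?thesis
    proof cases
      case far
      then have eq': "swap j \<chi> i = swap j \<chi> (Suc i)" "swap j \<chi> i = \<chi> i" "rank (swap j \<chi>) i = rank \<chi> i"
        using eq j by (auto simp: swap_apply rank_swap_other)
      have "f i \<otimes> (f j \<otimes> w) = f j \<otimes> (f i \<otimes> w)"
        using far f_commute_apply[of i j w] f_commute_apply[of j i w] i j w by auto
      also have "f i \<otimes> w = w \<otimes> f (p (\<chi> i) (rank \<chi> i))"
        using less.hyps[OF d1 j(3) i] eq' by simp
      finally show ?thesis using j w i fp[OF \<chi> i eq] by (simp add: m_assoc)
    next
      case right
      \<comment> \<open>Letters \<open>a a c\<close> with \<open>c < a\<close> become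
        \<open>c a a\<close> by swapping at \<open>j\<close> and then at \<open>i\<close>, so the
        equal pair now sits at \<open>j\<close>.\<close>
      have "swap i (swap j \<chi>) \<in> W" using \<chi> i j by (intro W_swap) auto
      then obtain q where q: "path (swap i (swap j \<chi>)) q" using path_exists by blast
      have qc: "q \<in> carrier A" using q by simp
      have de: "swap j \<chi> (Suc i) < swap j \<chi> i" using right j eq by (simp add: swap_apply)
      have wq: "w = f i \<otimes> q" using path_unique[OF j(3) path_descent[OF q i de]] .
      have d2: "disorder \<mu> (swap i (swap j \<chi>)) < disorder \<mu> \<chi>"
        using disorder_swap[of i \<mu> "swap j \<chi>"] i de sum d1 by simp
      have "rank (swap i (swap j \<chi>)) j = rank \<chi> i"
        using right i j eq de rank_transpose[of i "swap j \<chi>" j] by (simp add: rank_swap_other)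
      moreover have "swap i (swap j \<chi>) j = \<chi> i" "swap i (swap j \<chi>) (Suc j) = \<chi> i"
        using right eq by (auto simp: swap_apply)
      ultimately have fq: "f j \<otimes> q = q \<otimes> f (p (\<chi> i) (rank \<chi> i))"
        using less.hyps[OF d2 q j(1)] by simp
      have "f i \<otimes> y = f j \<otimes> (f i \<otimes> (f j \<otimes> q))"
        using f_braid_apply[of i q] right i j qc wq by simp
      then show ?thesis unfolding fq using j wq qc i fp[OF \<chi> i eq] by (simp add: m_assoc)
    next
      case left
      \<comment> \<open>The mirror image: letters \<open>c a a\<close> with \<open>a < c\<close>
        become \<open>a a c\<close>, and again the pair sits at \<open>j\<close>.\<close>
      have "swap i (swap j \<chi>) \<in> W" using \<chi> i j by (intro W_swap) auto
      then obtain q where q: "path (swap i (swap j \<chi>)) q" using path_exists by blast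
      have qc: "q \<in> carrier A" using q by simp
      have de: "swap j \<chi> (Suc i) < swap j \<chi> i" using left j eq by (simp add: swap_apply)
      have wq: "w = f i \<otimes> q" using path_unique[OF j(3) path_descent[OF q i de]] .
      have d2: "disorder \<mu> (swap i (swap j \<chi>)) < disorder \<mu> \<chi>"
        using disorder_swap[of i \<mu> "swap j \<chi>"] i de sum d1 by simp
      have "rank (swap i (swap j \<chi>)) j = rank \<chi> i"
        using left i j eq de rank_transpose[of j \<chi> j] rank_swap_other[of i j "swap j \<chi>"] by simp
      moreover have "swap i (swap j \<chi>) j = \<chi> i" "swap i (swap j \<chi>) (Suc j) = \<chi> i"
        using left eq by (auto simp: swap_apply)
      ultimately have fq: "f j \<otimes> q = q \<otimes> f (p (\<chi> i) (rank \<chi> i))"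
        using less.hyps[OF d2 q j(1)] by simp
      have "f i \<otimes> y = f j \<otimes> (f i \<otimes> (f j \<otimes> q))"
        using f_braid_apply[of j q] left i j qc wq by simp
      then show ?thesis unfolding fq using j wq qc i fp[OF \<chi> i eq] by (simp add: m_assoc)
    qed
  qed
qed

text \<open>Each \<open>f i\<close> is its own inverse, so the reversed product inverts
  \<open>y\<close> between the corners of \<open>b\<close> and \<open>\<chi>\<close>.\<close>

lemma path_inverse: "path \<chi> y \<Longrightarrow> \<exists>w\<in>carrier A. y \<otimes> w = idem \<chi> \<and> w \<otimes> y = idem b"
proof (induction rule: path.induct)
  case base
  then show ?case using idem_idem[OF W_colorings[OF b_word]] by (intro bexI[of _ "idem b"]) auto
next
  case (step \<chi> y i)
  then obtain w where w: "w \<in> carrier A" "y \<otimes> w = idem \<chi>" "w \<otimes> y = idem b" by blast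
  have y: "y \<in> carrier A" using step by simp
  note i = \<open>i \<in> {1..<n}\<close>
  have "f i \<otimes> y \<otimes> (w \<otimes> f i) = f i \<otimes> (y \<otimes> w) \<otimes> f i" using y w(1) i by (simp add: m_assoc)
  also have "\<dots> = idem (swap i \<chi>) \<otimes> f i \<otimes> f i"
    unfolding w(2) using idem_f[OF i W_colorings[OF path_word[OF step(1)]]] by simp
  also have "\<dots> = idem (swap i \<chi>)" using i by (simp add: m_assoc f_square)
  finally have "f i \<otimes> y \<otimes> (w \<otimes> f i) = idem (swap i \<chi>)" .
  moreover have "w \<otimes> f i \<otimes> (f i \<otimes> y) = w \<otimes> (f i \<otimes> (f i \<otimes> y))" using y w(1) i by (simp add: m_assoc)
  then have "w \<otimes> f i \<otimes> (f i \<otimes> y) = idem b" using i y w(3) by (simp add: f_square_cancel)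
  ultimately show ?case using w(1) i by (intro bexI[of _ "w \<otimes> f i"]) auto
qed

text \<open>The choice is harmless by \<open>path_unique\<close>; fixing an element makes it a
  function of the word.\<close>

definition u :: "(nat \<Rightarrow> nat) \<Rightarrow> 'a" where
  "u \<chi> = (SOME y. path \<chi> y)"

lemma u_path: "\<chi> \<in> W \<Longrightarrow> path \<chi> (u \<chi>)"
  unfolding u_def using someI_ex[OF path_exists] .

lemma u_closed [simp]: "\<chi> \<in> W \<Longrightarrow> u \<chi> \<in> carrier A"
  using u_path path_closed by blast

text \<open>For an ascent this is a step of a path; for a descent it is the step from
  \<open>swap i \<chi>\<close>, undone by the involution \<open>f i\<close>. So the direction of the
  swap no longer matters.\<close>

lemma u_swap:
  assumes \<chi>: "\<chi> \<in> W" and i: "i \<in> {1..<n}" and ne: "\<chi> i \<noteq> \<chi> (Suc i)"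
  shows "f i \<otimes> u \<chi> = u (swap i \<chi>)"
proof (cases "\<chi> i < \<chi> (Suc i)")
  case True
  then show ?thesis
    using path_unique[OF path.step[OF u_path[OF \<chi>] i] u_path[OF W_swap[OF \<chi> i]]] by simp
next
  case False
  then have "path \<chi> (f i \<otimes> u (swap i \<chi>))"
    using path_descent[OF u_path[OF W_swap[OF \<chi> i]] i] ne by simp
  then have "u \<chi> = f i \<otimes> u (swap i \<chi>)" using path_unique[OF u_path[OF \<chi>]] by simp
  then show ?thesis using i W_swap[OF \<chi> i] by (simp add: f_square_cancel)
qed

end

section \<open>The Hecke relations in the corner of the sorted word\<close>

context yh_block
begin

abbreviation "e \<equiv> idem b"

lemma e_idem: "e \<otimes> e = e" by (rule idem_idem[OF W_colorings[OF b_word]])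

lemma e_carrier [simp]: "e \<in> carrier A" by simp

lemma e_x: "i \<in> {1..n} \<Longrightarrow> e \<otimes> x i = x i \<otimes> e"
  by (rule idem_x[OF _ W_colorings[OF b_word]])

lemma pos_mem:
  assumes "a < r" "k \<in> {1..\<mu> ! a}"
  shows "p a k \<in> {1..n}" "b (p a k) = a" "rank b (p a k) = k"
  using pos_props[of a \<mu> k] assms len sum by auto

lemma pos_inj: "a < r \<Longrightarrow> c < r \<Longrightarrow> k \<in> {1..\<mu> ! a} \<Longrightarrow> l \<in> {1..\<mu> ! c} \<Longrightarrow> p a k = p c l \<longleftrightarrow> a = c \<and> k = l"
  using pos_mem[of a k] pos_mem[of c l] by auto

lemma pos_next: "a < r \<Longrightarrow> k \<in> {1..<\<mu> ! a} \<Longrightarrow> Suc (p a k) = p a (Suc k)"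
  using pos_Suc[of a \<mu> k] len by simp

lemma pos_less: "a < r \<Longrightarrow> k \<in> {1..<\<mu> ! a} \<Longrightarrow> p a k \<in> {1..<n}"
  using pos_next[of a k] pos_mem(1)[of a k] pos_mem(1)[of a "Suc k"] by simp

text \<open>The letters of \<open>b\<close> at \<open>p a k\<close> and at its successor are both
  \<open>a\<close>, so this swap fixes \<open>b\<close>.\<close>

lemma e_f:
  assumes "a < r" "k \<in> {1..<\<mu> ! a}" shows "e \<otimes> f (p a k) = f (p a k) \<otimes> e"
proof -
  have "b (p a k) = b (Suc (p a k))"
    using pos_next[OF assms] pos_mem(2)[OF assms(1), of k] pos_mem(2)[OF assms(1), of "Suc k"] assms(2) by simp
  then show ?thesis
    using idem_f[OF pos_less[OF assms] W_colorings[OF b_word]] by (simp only: swap_eq)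
qed

text \<open>Occurrence \<open>k\<close> of the letter \<open>a\<close> in the sorted word plays the
  part of strand \<open>k\<close> in the tensor factor \<open>a\<close>.\<close>

definition corner_x :: "nat \<Rightarrow> nat \<Rightarrow> 'a" where "corner_x a k = x (p a k) \<otimes> e"

definition corner_s :: "nat \<Rightarrow> nat \<Rightarrow> 'a" where "corner_s a k = f (p a k) \<otimes> e"

lemma kalg_corner_e: "kalg (corner A e)"
  by (rule kalg_corner[OF e_carrier e_idem])

lemma corner_x_closed: "a < r \<Longrightarrow> k \<in> {1..\<mu> ! a} \<Longrightarrow> corner_x a k \<in> carrier (corner A e)"
  unfolding corner_x_def using pos_mem(1)[of a k]
  by (intro corner_closed x_closed e_carrier e_idem e_x)

lemma corner_s_closed: "a < r \<Longrightarrow> k \<in> {1..<\<mu> ! a} \<Longrightarrow> corner_s a k \<in> carrier (corner A e)"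
  unfolding corner_s_def using pos_less[of a k]
  by (intro corner_closed f_closed e_carrier e_idem e_f)

lemma corner_xx: "a < r \<Longrightarrow> c < r \<Longrightarrow> k \<in> {1..\<mu> ! a} \<Longrightarrow> l \<in> {1..\<mu> ! c} \<Longrightarrow>
    corner_x a k \<otimes> corner_x c l = corner_x c l \<otimes> corner_x a k"
  unfolding corner_x_def using pos_mem(1)[of a k] pos_mem(1)[of c l]
  by (simp only: corner_mult x_closed e_carrier e_idem e_x x_commute)

text \<open>As \<open>k < \<mu> ! a\<close>, the successor of \<open>p a k\<close> is again a place
  of the letter \<open>a\<close>. For different letters, or ranks at least two apart, the places
  therefore differ by two or more and the generators commute.\<close>

lemma corner_ss:
  assumes a: "a < r" "k \<in> {1..<\<mu> ! a}" and c: "c < r" "l \<in> {1..<\<mu> ! c}"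
    and ne: "a \<noteq> c \<or> \<bar>int k - int l\<bar> > 1"
  shows "corner_s a k \<otimes> corner_s c l = corner_s c l \<otimes> corner_s a k"
proof -
  have m: "k \<in> {1..\<mu> ! a}" "Suc k \<in> {1..\<mu> ! a}" "l \<in> {1..\<mu> ! c}" "Suc l \<in> {1..\<mu> ! c}"
    using a(2) c(2) by auto
  have ne': "\<not> (a = c \<and> k = l)" "\<not> (a = c \<and> Suc k = l)" "\<not> (a = c \<and> k = Suc l)" using ne by auto
  have d: "p a k \<noteq> p c l" "Suc (p a k) \<noteq> p c l" "p a k \<noteq> Suc (p c l)"
    unfolding pos_next[OF a] pos_next[OF c]
    using pos_inj[OF a(1) c(1) m(1,3)] pos_inj[OF a(1) c(1) m(2,3)] pos_inj[OF a(1) c(1) m(1,4)] ne'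
    by (simp_all only:) simp_all
  then have "\<bar>int (p a k) - int (p c l)\<bar> \<ge> 2" by linarith
  then have "f (p a k) \<otimes> f (p c l) = f (p c l) \<otimes> f (p a k)"
    using pos_less[OF a] pos_less[OF c] by (intro f_commute)
  then show ?thesis
    unfolding corner_s_def using pos_less[OF a] pos_less[OF c]
    by (simp only: corner_mult f_closed e_carrier e_idem e_f[OF a] e_f[OF c])
qed

lemma corner_sx:
  assumes a: "a < r" "k \<in> {1..<\<mu> ! a}" and c: "c < r" "l \<in> {1..\<mu> ! c}"
    and ne: "a \<noteq> c \<or> l \<noteq> k \<and> l \<noteq> Suc k"
  shows "corner_s a k \<otimes> corner_x c l = corner_x c l \<otimes> corner_s a k"
proof -
  have m: "k \<in> {1..\<mu> ! a}" "Suc k \<in> {1..\<mu> ! a}" using a(2) by auto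
  have ne': "\<not> (c = a \<and> l = k)" "\<not> (c = a \<and> l = Suc k)" using ne by auto
  have d: "p c l \<noteq> p a k" "p c l \<noteq> Suc (p a k)"
    unfolding pos_next[OF a]
    using pos_inj[OF c(1) a(1) c(2) m(1)] pos_inj[OF c(1) a(1) c(2) m(2)] ne' by (simp_all only:) simp_all
  show ?thesis
    unfolding corner_s_def corner_x_def using pos_less[OF a] pos_mem(1)[OF c]
    by (simp only: corner_mult f_closed x_closed e_carrier e_idem e_f[OF a] e_x
        f_x_other[OF pos_less[OF a] pos_mem(1)[OF c] d])
qed

text \<open>A word beginning with \<open>a\<close> has an \<open>a\<close> of rank 1 at position 1,
  so \<open>x 1\<close> passes through \<open>u \<chi>\<close> as \<open>x (p a 1)\<close>;
  cancelling \<open>u \<chi>\<close> leaves the relation on the corner.\<close>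

lemma corner_cyclotomic:
  assumes a: "a < r" "1 \<le> \<mu> ! a"
  shows "cyclotomic_element (corner A e) d v (corner_x a 1) = \<zero>"
proof -
  let ?q = "p a 1"
  have q: "?q \<in> {1..n}" "b ?q = a" using pos_mem[of a 1] a by auto
  \<comment> \<open>Exchanging position 1 with the first \<open>a\<close> of \<open>b\<close> keeps
    the content and puts \<open>a\<close> in front.\<close>
  define \<chi> where "\<chi> = b \<circ> Transposition.transpose 1 ?q"
  have \<chi>: "\<chi> \<in> W"
    unfolding \<chi>_def by (rule transpose_in_words[OF b_word]) (use q n sum in auto)
  have \<chi>1: "\<chi> 1 = a" using q by (simp add: \<chi>_def)
  obtain w where w: "w \<in> carrier A" "w \<otimes> u \<chi> = e" using path_inverse[OF u_path[OF \<chi>]] by blast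
  have uc: "u \<chi> \<in> carrier A" using \<chi> by simp
  have x1: "x 1 \<in> carrier A" "x ?q \<in> carrier A" using n q by auto
  let ?c = "cyclotomic_element A d v (x ?q)"
  have cc: "?c \<in> carrier A" using x1 by (intro cyclotomic_closed)
  have "x 1 \<otimes> u \<chi> = u \<chi> \<otimes> x ?q"
    using path_x[OF u_path[OF \<chi>], of 1] n rank_first[of \<chi>] \<chi>1 by simp
  then have "cyclotomic_element A d v (x 1) \<otimes> u \<chi> = u \<chi> \<otimes> ?c"
    by (rule cyclotomic_intertwine[OF x1 uc])
  then have "u \<chi> \<otimes> ?c = \<zero>" using x_cyclotomic uc by simp
  then have "w \<otimes> (u \<chi> \<otimes> ?c) = \<zero>" using w by simp
  then have "e \<otimes> ?c = \<zero>" using w uc cc by (simp flip: m_assoc)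
  moreover have "?c \<otimes> e = e \<otimes> ?c"
    by (rule cyclotomic_intertwine) (use x1 e_x[OF q(1)] in auto)
  ultimately show ?thesis
    unfolding corner_x_def using cyclotomic_corner[OF e_carrier e_idem x1(2) e_x[OF q(1)], of d v] by simp
qed

lemma hecke_family_corner:
  assumes a: "a < r" shows "hecke_family (corner A e) (\<mu> ! a) d v (corner_x a) (corner_s a)"
  unfolding hecke_family_def hecke_rels_all
proof (intro conjI ballI impI)
  fix k assume k: "k \<in> {1..<\<mu> ! a}"
  have pk: "p a k \<in> {1..<n}" by (rule pos_less[OF a k])
  have Sk: "Suc k \<in> {1..\<mu> ! a}" and k': "k \<in> {1..\<mu> ! a}" using k by auto
  show "corner_s a k \<otimes>\<^bsub>corner A e\<^esub> corner_s a k = \<one>\<^bsub>corner A e\<^esub>"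
    unfolding corner_simps corner_s_def using pk
    by (simp only: corner_mult f_closed e_carrier e_idem e_f[OF a k] f_square l_one)
  have "corner_s a k \<otimes> corner_x a (Suc k) = f (p a k) \<otimes> x (Suc (p a k)) \<otimes> e"
    unfolding corner_s_def corner_x_def pos_next[OF a k]
    by (intro corner_mult f_closed pk x_closed pos_mem[OF a Sk] e_carrier e_idem e_x)
  also have "\<dots> = x (p a k) \<otimes> f (p a k) \<otimes> e \<oplus> yh_e A r t (p a k) \<otimes> e"
    unfolding f_x_Suc[OF pk] using pk by (simp add: l_distr)
  \<comment> \<open>The two letters agree, so \<open>e_i\<close> acts as the unit of the corner;
    this is the inhomogeneous term of the Hecke relation.\<close>
  also have "yh_e A r t (p a k) \<otimes> e = e"
    using e_wt[OF wt_idem[OF W_colorings[OF b_word]] W_colorings[OF b_word] pk]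
      pos_next[OF a k] pos_mem(2)[OF a k'] pos_mem(2)[OF a Sk] by simp
  also have "x (p a k) \<otimes> f (p a k) \<otimes> e = corner_x a k \<otimes> corner_s a k"
    unfolding corner_s_def corner_x_def
    by (rule corner_mult[symmetric]) (use pk pos_mem[OF a k'] e_idem e_f[OF a k] in auto)
  finally show "corner_s a k \<otimes>\<^bsub>corner A e\<^esub> corner_x a (k + 1) =
      corner_x a k \<otimes>\<^bsub>corner A e\<^esub> corner_s a k \<oplus>\<^bsub>corner A e\<^esub> \<one>\<^bsub>corner A e\<^esub>"
    by simp
  fix l assume "l \<in> {j \<in> {1..<\<mu> ! a}. \<bar>int k - int j\<bar> > 1}"
  then show "corner_s a k \<otimes>\<^bsub>corner A e\<^esub> corner_s a l = corner_s a l \<otimes>\<^bsub>corner A e\<^esub> corner_s a k"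
    unfolding corner_simps by (intro corner_ss a k) auto
next
  fix k l assume "k \<in> {1..<\<mu> ! a}" "l \<in> {j \<in> {1..\<mu> ! a}. j \<noteq> k \<and> j \<noteq> k + 1}"
  then show "corner_s a k \<otimes>\<^bsub>corner A e\<^esub> corner_x a l = corner_x a l \<otimes>\<^bsub>corner A e\<^esub> corner_s a k"
    unfolding corner_simps by (intro corner_sx a) auto
next
  fix k assume "k \<in> {i \<in> {1..<\<mu> ! a}. i + 1 < \<mu> ! a}"
  then have k: "k \<in> {1..<\<mu> ! a}" and Sk: "Suc k \<in> {1..<\<mu> ! a}" by auto
  let ?i = "p a k"
  have i: "?i \<in> {1..<n}" "Suc ?i \<in> {1..<n}" using pos_less[OF a k] pos_less[OF a Sk] pos_next[OF a k] by auto
  have ef: "e \<otimes> f ?i = f ?i \<otimes> e" "e \<otimes> f (Suc ?i) = f (Suc ?i) \<otimes> e"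
    using e_f[OF a k] e_f[OF a Sk] pos_next[OF a k] by auto
  have "f ?i \<otimes> f (Suc ?i) \<otimes> f ?i = f (Suc ?i) \<otimes> f ?i \<otimes> f (Suc ?i)"
    using i by (intro f_braid) auto
  then show "corner_s a k \<otimes>\<^bsub>corner A e\<^esub> corner_s a (k + 1) \<otimes>\<^bsub>corner A e\<^esub> corner_s a k =
      corner_s a (k + 1) \<otimes>\<^bsub>corner A e\<^esub> corner_s a k \<otimes>\<^bsub>corner A e\<^esub> corner_s a (k + 1)"
    unfolding corner_simps corner_s_def Suc_eq_plus1[symmetric] pos_next[OF a k, symmetric] using i ef
    by (simp only: corner_mult f_closed m_closed e_carrier e_idem)
next
  show "cyclotomic_element (corner A e) d v (corner_x a 1) = \<zero>\<^bsub>corner A e\<^esub>" if "1 \<le> \<mu> ! a"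
    using corner_cyclotomic[OF a that] by simp
qed (use a corner_xx in \<open>auto simp del: corner_simps(1) intro!: corner_x_closed corner_s_closed\<close>)

lemma corner_lift:
  "\<exists>\<psi>\<in>alg_hom (hecke_tensor \<mu> d v) (corner A e). \<forall>a<r.
    (\<forall>k\<in>{1..\<mu> ! a}. \<psi> (tensor_x \<mu> d v a k) = corner_x a k) \<and>
    (\<forall>k\<in>{1..<\<mu> ! a}. \<psi> (tensor_s \<mu> d v a k) = corner_s a k)"
proof -
  have "g \<otimes> h = h \<otimes> g"
    if ac: "a < r" "c < r" "a \<noteq> c" and g: "g \<in> corner_x a ` {1..\<mu> ! a} \<union> corner_s a ` {1..<\<mu> ! a}"
      and h: "h \<in> corner_x c ` {1..\<mu> ! c} \<union> corner_s c ` {1..<\<mu> ! c}" for a c g h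
    using g h
  proof (elim UnE imageE)
    fix k l assume "g = corner_x a k" "k \<in> {1..\<mu> ! a}" "h = corner_x c l" "l \<in> {1..\<mu> ! c}"
    then show ?thesis using corner_xx ac by blast
  next
    fix k l assume "g = corner_x a k" "k \<in> {1..\<mu> ! a}" "h = corner_s c l" "l \<in> {1..<\<mu> ! c}"
    then show ?thesis using corner_sx[of c l a k] ac by auto
  next
    fix k l assume "g = corner_s a k" "k \<in> {1..<\<mu> ! a}" "h = corner_x c l" "l \<in> {1..\<mu> ! c}"
    then show ?thesis using corner_sx[of a k c l] ac by auto
  next
    fix k l assume "g = corner_s a k" "k \<in> {1..<\<mu> ! a}" "h = corner_s c l" "l \<in> {1..<\<mu> ! c}"
    then show ?thesis using corner_ss[of a k c l] ac by auto
  qed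
  then show ?thesis
    using hecke_tensor_lift[where \<mu> = \<mu> and d = d and v = v and x = corner_x and s = corner_s and B = "corner A e",
        OF kalg_corner_e hecke_family_corner]
    unfolding corner_simps len by blast
qed

end

section \<open>The representation by monomial matrices\<close>

context indexed_matrices
begin

lemma monomial_closed' [simp]: "(\<And>\<chi>. \<chi> \<in> W \<Longrightarrow> c \<chi> \<in> carrier A) \<Longrightarrow> monomial \<sigma> c \<in> carrier Mat"
  by (rule monomial_closed) auto

lemma diagonal_mult:
  assumes "\<And>\<chi>. \<chi> \<in> W \<Longrightarrow> c \<chi> \<in> carrier A" "\<And>\<chi>. \<chi> \<in> W \<Longrightarrow> e \<chi> \<in> carrier A"
  shows "monomial (\<lambda>\<chi>. \<chi>) c \<otimes>\<^bsub>Mat\<^esub> monomial (\<lambda>\<chi>. \<chi>) e = monomial (\<lambda>\<chi>. \<chi>) (\<lambda>\<chi>. c \<chi> \<otimes> e \<chi>)"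
  by (rule monomial_mult) (use assms in auto)

lemma diagonal_pow:
  assumes "\<And>\<chi>. \<chi> \<in> W \<Longrightarrow> c \<chi> \<in> carrier A"
  shows "monomial (\<lambda>\<chi>. \<chi>) c [^]\<^bsub>Mat\<^esub> (k::nat) = monomial (\<lambda>\<chi>. \<chi>) (\<lambda>\<chi>. c \<chi> [^] k)"
  using assms by (induction k) (simp_all add: monomial_one diagonal_mult del: mat_algebra_simps)

lemma monomial_finsum:
  assumes "finite S" "\<And>i \<chi>. i \<in> S \<Longrightarrow> \<chi> \<in> W \<Longrightarrow> c i \<chi> \<in> carrier A"
  shows "(\<Oplus>\<^bsub>Mat\<^esub>i\<in>S. monomial \<sigma> (c i)) = monomial \<sigma> (\<lambda>\<chi>. \<Oplus>i\<in>S. c i \<chi>)"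
  using assms
proof (induction S rule: finite_induct)
  case empty
  then show ?case by (simp add: Mat.finsum_empty monomial_zero del: mat_algebra_simps)
next
  case (insert i S)
  have "(\<Oplus>\<^bsub>Mat\<^esub>i\<in>insert i S. monomial \<sigma> (c i)) = monomial \<sigma> (c i) \<oplus>\<^bsub>Mat\<^esub> monomial \<sigma> (\<lambda>\<chi>. \<Oplus>i\<in>S. c i \<chi>)"
    using insert by (simp add: Mat.finsum_insert Pi_iff del: mat_algebra_simps)
  also have "\<dots> = monomial \<sigma> (\<lambda>\<chi>. c i \<chi> \<oplus> (\<Oplus>i\<in>S. c i \<chi>))"
    using insert by (intro monomial_add) (auto intro!: finsum_closed)
  also have "\<dots> = monomial \<sigma> (\<lambda>\<chi>. \<Oplus>i\<in>insert i S. c i \<chi>)"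
    using insert by (intro monomial_cong) (auto simp: finsum_insert)
  finally show ?case .
qed

lemma diagonal_cyclotomic:
  assumes c: "\<And>\<chi>. \<chi> \<in> W \<Longrightarrow> c \<chi> \<in> carrier A"
  shows "cyclotomic_element Mat d v (monomial (\<lambda>\<chi>. \<chi>) c) =
    monomial (\<lambda>\<chi>. \<chi>) (\<lambda>\<chi>. cyclotomic_element A d v (c \<chi>))"
proof -
  let ?f = "\<lambda>l y. foldr (\<lambda>i w. (y \<ominus> v i \<odot> \<one>) \<otimes> w) l \<one>"
  have cl: "?f l (c \<chi>) \<in> carrier A" if "\<chi> \<in> W" for l \<chi>
    using c[OF that] by (induction l) auto
  have fac: "monomial (\<lambda>\<chi>. \<chi>) c \<ominus>\<^bsub>Mat\<^esub> a \<odot>\<^bsub>Mat\<^esub> \<one>\<^bsub>Mat\<^esub> = monomial (\<lambda>\<chi>. \<chi>) (\<lambda>\<chi>. c \<chi> \<ominus> a \<odot> \<one>)" for a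
  proof -
    have "monomial (\<lambda>\<chi>. \<chi>) c \<ominus>\<^bsub>Mat\<^esub> a \<odot>\<^bsub>Mat\<^esub> \<one>\<^bsub>Mat\<^esub> =
      monomial (\<lambda>\<chi>. \<chi>) c \<oplus>\<^bsub>Mat\<^esub> (- 1) \<odot>\<^bsub>Mat\<^esub> monomial (\<lambda>\<chi>. \<chi>) (\<lambda>\<chi>. a \<odot> \<one>)"
      unfolding a_minus_def monomial_one
      by (subst monomial_smult, simp, subst Mat.smult_minus_one, rule monomial_closed', simp_all del: mat_algebra_simps)
    also have "\<dots> = monomial (\<lambda>\<chi>. \<chi>) (\<lambda>\<chi>. c \<chi> \<oplus> (- 1) \<odot> (a \<odot> \<one>))"
      by (subst monomial_smult, simp, rule monomial_add) (use c in auto)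
    also have "\<dots> = monomial (\<lambda>\<chi>. \<chi>) (\<lambda>\<chi>. c \<chi> \<ominus> a \<odot> \<one>)"
      by (rule monomial_cong) (simp_all add: a_minus_def smult_minus_one)
    finally show ?thesis .
  qed
  have "foldr (\<lambda>i w. (monomial (\<lambda>\<chi>. \<chi>) c \<ominus>\<^bsub>Mat\<^esub> v i \<odot>\<^bsub>Mat\<^esub> \<one>\<^bsub>Mat\<^esub>) \<otimes>\<^bsub>Mat\<^esub> w) l \<one>\<^bsub>Mat\<^esub> =
      monomial (\<lambda>\<chi>. \<chi>) (\<lambda>\<chi>. ?f l (c \<chi>))" for l
  proof (induction l)
    case Nil
    then show ?case by (simp only: foldr.simps id_apply monomial_one)
  next
    case (Cons i l)
    show ?case
      unfolding foldr.simps comp_def fac Cons[unfolded fac]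
      by (rule diagonal_mult) (use c cl in auto)
  qed
  then show ?thesis by (simp only: cyclotomic_element_def)
qed

text \<open>Where a coefficient vanishes, the target row is irrelevant. Thus the diagonal matrix of
  \<open>e_i\<close> can be rewritten with \<open>swap i\<close> as its permutation and added to
  other matrices of that shape.\<close>

lemma monomial_cong_support:
  assumes "\<And>\<chi>. \<chi> \<in> W \<Longrightarrow> \<sigma> \<chi> = \<sigma>' \<chi> \<or> c \<chi> = \<zero>"
  shows "monomial \<sigma> c = monomial \<sigma>' c"
  using assms \<beta>_in by (auto simp: monomial_def fun_eq_iff) (metis \<beta>_in)+

end

text \<open>The entries come from any algebra with \<open>r\<close> mutually commuting Hecke
  families \<open>X a\<close>, \<open>S a\<close>; it is taken to be the tensor product
  \<open>H^\<mu>\<close> in the end.\<close>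

locale hecke_matrices = indexed_matrices A m "words \<mu>" \<beta> + unity_roots r z
  for A :: "('k::field, 'a) module" (structure) and m \<mu> \<beta> r and z :: "nat \<Rightarrow> 'k" +
  fixes n d :: nat and v :: "nat \<Rightarrow> 'k" and X S :: "nat \<Rightarrow> nat \<Rightarrow> 'a"
  assumes n: "1 \<le> n" and len: "length \<mu> = r" and sum: "sum_list \<mu> = n"
    and hecke: "a < r \<Longrightarrow> hecke_family A (\<mu> ! a) d v (X a) (S a)"
    and cross: "a < r \<Longrightarrow> c < r \<Longrightarrow> a \<noteq> c \<Longrightarrow> g \<in> X a ` {1..\<mu> ! a} \<union> S a ` {1..<\<mu> ! a} \<Longrightarrow>
      h \<in> X c ` {1..\<mu> ! c} \<union> S c ` {1..<\<mu> ! c} \<Longrightarrow> g \<otimes> h = h \<otimes> g"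
begin

abbreviation "W \<equiv> words \<mu>"

lemma X_closed [simp]: "a < r \<Longrightarrow> k \<in> {1..\<mu> ! a} \<Longrightarrow> X a k \<in> carrier A"
  and S_closed [simp]: "a < r \<Longrightarrow> k \<in> {1..<\<mu> ! a} \<Longrightarrow> S a k \<in> carrier A"
  using hecke[of a] by (auto simp: hecke_family_def)

lemma
  assumes a: "a < r"
  shows S_square: "k \<in> {1..<\<mu> ! a} \<Longrightarrow> S a k \<otimes> S a k = \<one>"
    and S_braid: "1 \<le> k \<Longrightarrow> Suc k < \<mu> ! a \<Longrightarrow> S a k \<otimes> S a (Suc k) \<otimes> S a k = S a (Suc k) \<otimes> S a k \<otimes> S a (Suc k)"
    and S_commute: "k \<in> {1..<\<mu> ! a} \<Longrightarrow> l \<in> {1..<\<mu> ! a} \<Longrightarrow> \<bar>int k - int l\<bar> > 1 \<Longrightarrow> S a k \<otimes> S a l = S a l \<otimes> S a k"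
    and X_commute: "k \<in> {1..\<mu> ! a} \<Longrightarrow> l \<in> {1..\<mu> ! a} \<Longrightarrow> X a k \<otimes> X a l = X a l \<otimes> X a k"
    and S_X_Suc: "k \<in> {1..<\<mu> ! a} \<Longrightarrow> S a k \<otimes> X a (Suc k) = X a k \<otimes> S a k \<oplus> \<one>"
    and S_X_other: "k \<in> {1..<\<mu> ! a} \<Longrightarrow> l \<in> {1..\<mu> ! a} \<Longrightarrow> l \<noteq> k \<Longrightarrow> l \<noteq> Suc k \<Longrightarrow> S a k \<otimes> X a l = X a l \<otimes> S a k"
    and X_cyclotomic: "1 \<le> \<mu> ! a \<Longrightarrow> cyclotomic_element A d v (X a 1) = \<zero>"
proof -
  have "\<forall>(p, q)\<in>hecke_rels A (\<mu> ! a) (X a) (S a). p = q" using hecke[OF a] by (simp add: hecke_family_def)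
  note R = this[unfolded hecke_rels_all]
  show "k \<in> {1..<\<mu> ! a} \<Longrightarrow> S a k \<otimes> S a k = \<one>"
    "1 \<le> k \<Longrightarrow> Suc k < \<mu> ! a \<Longrightarrow> S a k \<otimes> S a (Suc k) \<otimes> S a k = S a (Suc k) \<otimes> S a k \<otimes> S a (Suc k)"
    "k \<in> {1..<\<mu> ! a} \<Longrightarrow> l \<in> {1..<\<mu> ! a} \<Longrightarrow> \<bar>int k - int l\<bar> > 1 \<Longrightarrow> S a k \<otimes> S a l = S a l \<otimes> S a k"
    "k \<in> {1..\<mu> ! a} \<Longrightarrow> l \<in> {1..\<mu> ! a} \<Longrightarrow> X a k \<otimes> X a l = X a l \<otimes> X a k"
    "k \<in> {1..<\<mu> ! a} \<Longrightarrow> S a k \<otimes> X a (Suc k) = X a k \<otimes> S a k \<oplus> \<one>"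
    "k \<in> {1..<\<mu> ! a} \<Longrightarrow> l \<in> {1..\<mu> ! a} \<Longrightarrow> l \<noteq> k \<Longrightarrow> l \<noteq> Suc k \<Longrightarrow> S a k \<otimes> X a l = X a l \<otimes> S a k"
    using R by (simp_all, blast?)
  show "1 \<le> \<mu> ! a \<Longrightarrow> cyclotomic_element A d v (X a 1) = \<zero>"
    using hecke[OF a] by (simp add: hecke_family_def)
qed

lemma word_less: "\<chi> \<in> W \<Longrightarrow> i \<in> {1..n} \<Longrightarrow> \<chi> i < r"
  using words_less[of \<chi> \<mu> i] by (simp add: len sum)

lemma rank_mem: "\<chi> \<in> W \<Longrightarrow> i \<in> {1..n} \<Longrightarrow> rank \<chi> i \<in> {1..\<mu> ! \<chi> i}"
  using rank_le[of \<chi> \<mu> i] rank_pos[of i \<chi>] by (simp add: sum)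

lemma rank_mem': "\<chi> \<in> W \<Longrightarrow> i \<in> {1..<n} \<Longrightarrow> \<chi> i = \<chi> (Suc i) \<Longrightarrow> rank \<chi> i \<in> {1..<\<mu> ! \<chi> i}"
  using rank_mem[of \<chi> i] rank_mem[of \<chi> "Suc i"] rank_Suc[of \<chi> i] by simp

lemma W_swap: "\<chi> \<in> W \<Longrightarrow> i \<in> {1..<n} \<Longrightarrow> swap i \<chi> \<in> W"
  using swap_in_words[of \<chi> \<mu> i] by (simp add: sum)

text \<open>Strands with different letters cross freely, with coefficient 1; equal ones cross by the
  Hecke generator indexed by the rank of the left strand.\<close>

definition crossing :: "nat \<Rightarrow> (nat \<Rightarrow> nat) \<Rightarrow> 'a" where
  "crossing i \<chi> = (if \<chi> i = \<chi> (Suc i) then S (\<chi> i) (rank \<chi> i) else \<one>)"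

definition dot :: "nat \<Rightarrow> (nat \<Rightarrow> nat) \<Rightarrow> 'a" where
  "dot i \<chi> = X (\<chi> i) (rank \<chi> i)"

lemma crossing_closed [simp]: "\<chi> \<in> W \<Longrightarrow> i \<in> {1..<n} \<Longrightarrow> crossing i \<chi> \<in> carrier A"
  using rank_mem'[of \<chi> i] word_less[of \<chi> i] by (auto simp: crossing_def)

lemma dot_closed [simp]: "\<chi> \<in> W \<Longrightarrow> i \<in> {1..n} \<Longrightarrow> dot i \<chi> \<in> carrier A"
  using rank_mem[of \<chi> i] word_less[of \<chi> i] by (simp add: dot_def)

definition T_mat :: "nat \<Rightarrow> nat \<times> nat \<Rightarrow> 'a" where
  "T_mat i = monomial (\<lambda>\<chi>. \<chi>) (\<lambda>\<chi>. z (\<chi> i) \<odot> \<one>)"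

definition X_mat :: "nat \<Rightarrow> nat \<times> nat \<Rightarrow> 'a" where
  "X_mat i = monomial (\<lambda>\<chi>. \<chi>) (dot i)"

definition F_mat :: "nat \<Rightarrow> nat \<times> nat \<Rightarrow> 'a" where
  "F_mat i = monomial (swap i) (crossing i)"

lemma crossing_swap_far:
  "i \<in> {1..<n} \<Longrightarrow> j \<in> {1..<n} \<Longrightarrow> Suc i < j \<or> Suc j < i \<Longrightarrow> crossing i (swap j \<chi>) = crossing i \<chi>"
  by (auto simp: crossing_def swap_apply rank_swap_other)

text \<open>Only two nontrivial crossings need an argument. If all four letters agree, the ranks
  increase strictly from \<open>i\<close> over \<open>Suc i\<close> to \<open>j\<close>, so the
  generators are two apart; otherwise they belong to different factors.\<close>

lemma crossing_commute:
  assumes \<chi>: "\<chi> \<in> W" and i: "i \<in> {1..<n}" and j: "j \<in> {1..<n}" and ij: "Suc i < j"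
  shows "crossing i \<chi> \<otimes> crossing j \<chi> = crossing j \<chi> \<otimes> crossing i \<chi>"
proof (cases "\<chi> i = \<chi> (Suc i) \<and> \<chi> j = \<chi> (Suc j)")
  case True
  have ri: "rank \<chi> i \<in> {1..<\<mu> ! \<chi> i}" and rj: "rank \<chi> j \<in> {1..<\<mu> ! \<chi> j}"
    using rank_mem'[OF \<chi> i] rank_mem'[OF \<chi> j] True by auto
  have ci: "\<chi> i < r" "\<chi> j < r" using word_less[OF \<chi>] i j by auto
  show ?thesis
  proof (cases "\<chi> i = \<chi> j")
    case same: True
    have "rank \<chi> (Suc i) < rank \<chi> j" using True same ij by (intro rank_less) auto
    then have gt: "\<bar>int (rank \<chi> i) - int (rank \<chi> j)\<bar> > 1" using rank_Suc[of \<chi> i] True by simp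
    have rj': "rank \<chi> j \<in> {1..<\<mu> ! \<chi> i}" using rj unfolding same .
    have "crossing i \<chi> = S (\<chi> i) (rank \<chi> i)" "crossing j \<chi> = S (\<chi> i) (rank \<chi> j)"
      using True same by (auto simp: crossing_def)
    then show ?thesis using S_commute[OF ci(1) ri rj' gt] by (simp only:)
  next
    case False
    then show ?thesis using cross[OF ci False, of "S (\<chi> i) (rank \<chi> i)" "S (\<chi> j) (rank \<chi> j)"] ri rj True
      by (simp add: crossing_def)
  qed
next
  case False
  then show ?thesis
    using crossing_closed[OF \<chi> i] crossing_closed[OF \<chi> j] by (auto simp: crossing_def)
qed

lemma F_mat_mult:
  assumes i: "i \<in> {1..<n}" and c: "\<And>\<chi>. \<chi> \<in> W \<Longrightarrow> c \<chi> \<in> carrier A" 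
  shows "monomial \<sigma> c \<otimes>\<^bsub>Mat\<^esub> F_mat i = monomial (\<lambda>\<chi>. \<sigma> (swap i \<chi>)) (\<lambda>\<chi>. c (swap i \<chi>) \<otimes> crossing i \<chi>)"
  unfolding F_mat_def by (rule monomial_mult) (use assms W_swap in auto)

lemma F_mat_far:
  assumes i: "i \<in> {1..<n}" and j: "j \<in> {1..<n}" and ij: "Suc i < j"
  shows "F_mat i \<otimes>\<^bsub>Mat\<^esub> F_mat j = F_mat j \<otimes>\<^bsub>Mat\<^esub> F_mat i"
proof -
  have "F_mat i \<otimes>\<^bsub>Mat\<^esub> F_mat j = monomial (\<lambda>\<chi>. swap i (swap j \<chi>)) (\<lambda>\<chi>. crossing i (swap j \<chi>) \<otimes> crossing j \<chi>)"
    using F_mat_mult[OF j, of "crossing i" "swap i"] i by (simp add: F_mat_def del: mat_algebra_simps)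
  also have "\<dots> = monomial (\<lambda>\<chi>. swap j (swap i \<chi>)) (\<lambda>\<chi>. crossing j (swap i \<chi>) \<otimes> crossing i \<chi>)"
    by (rule monomial_cong, rule swap_commute[OF ij])
      (use crossing_commute[OF _ i j ij] crossing_swap_far[OF i j] crossing_swap_far[OF j i] ij in simp)
  also have "\<dots> = F_mat j \<otimes>\<^bsub>Mat\<^esub> F_mat i"
    using F_mat_mult[OF i, of "crossing j" "swap j"] j by (simp add: F_mat_def del: mat_algebra_simps)
  finally show ?thesis .
qed

text \<open>The cases are the patterns of equality among three letters. Three equal ones give the
  braid relation of the Hecke family. If exactly two agree, at most the crossing of these two is
  nontrivial on each side, and their ranks show that the coefficients coincide. Without equal
  letters everything is 1.\<close>

lemma crossing_braid:
  assumes \<chi>: "\<chi> \<in> W" and i: "i \<in> {1..<n}" "Suc i \<in> {1..<n}"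
  shows "crossing i (swap (Suc i) (swap i \<chi>)) \<otimes> crossing (Suc i) (swap i \<chi>) \<otimes> crossing i \<chi> =
    crossing (Suc i) (swap i (swap (Suc i) \<chi>)) \<otimes> crossing i (swap (Suc i) \<chi>) \<otimes> crossing (Suc i) \<chi>"
proof -
  let ?p = "\<chi> i" and ?q = "\<chi> (Suc i)" and ?s = "\<chi> (Suc (Suc i))"
  have i1: "1 \<le> i" "1 \<le> Suc i" using i by auto
  consider (all) "?p = ?q" "?q = ?s" | (pq) "?p = ?q" "?q \<noteq> ?s" | (ps) "?p = ?s" "?p \<noteq> ?q"
    | (qs) "?q = ?s" "?p \<noteq> ?q" | (none) "?p \<noteq> ?q" "?q \<noteq> ?s" "?p \<noteq> ?s" by metis
  then show ?thesis
  proof cases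
    case all
    have s: "swap i \<chi> = \<chi>" "swap (Suc i) \<chi> = \<chi>" using all by (auto intro: swap_eq)
    have "rank \<chi> (Suc i) = Suc (rank \<chi> i)" "1 \<le> rank \<chi> i" "rank \<chi> (Suc i) \<in> {1..<\<mu> ! ?p}"
      using rank_Suc[of \<chi> i] all rank_pos[OF i1(1)] rank_mem'[OF \<chi> i(2)] by auto
    then show ?thesis
      using S_braid[of ?p "rank \<chi> i"] word_less[OF \<chi>, of i] i all by (simp add: s crossing_def)
  next
    case pq
    have s: "swap i \<chi> = \<chi>" using pq by (auto intro: swap_eq)
    have 1: "crossing i (swap (Suc i) (swap i \<chi>)) = \<one>" "crossing (Suc i) (swap i \<chi>) = \<one>"
      "crossing i (swap (Suc i) \<chi>) = \<one>" "crossing (Suc i) \<chi> = \<one>"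
      using pq by (simp_all add: s crossing_def swap_apply)
    have "rank (swap i (swap (Suc i) \<chi>)) (Suc i) = rank \<chi> i"
      using rank_transpose[OF i1(1), of "swap (Suc i) \<chi>" "Suc i"] pq rank_swap_other[OF i1(2), of i \<chi>]
      by (simp add: swap_apply)
    then have "crossing (Suc i) (swap i (swap (Suc i) \<chi>)) = crossing i \<chi>"
      using pq by (simp add: crossing_def swap_apply)
    then show ?thesis using crossing_closed[OF \<chi> i(1)] by (simp add: 1)
  next
    case ps
    have 1: "crossing i (swap (Suc i) (swap i \<chi>)) = \<one>" "crossing i \<chi> = \<one>"
      "crossing (Suc i) (swap i (swap (Suc i) \<chi>)) = \<one>" "crossing (Suc i) \<chi> = \<one>"
      using ps by (simp_all add: crossing_def swap_apply)
    have "rank (swap i \<chi>) (Suc i) = rank \<chi> i" "rank (swap (Suc i) \<chi>) i = rank \<chi> i"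
      using rank_transpose[OF i1(1), of \<chi> "Suc i"] ps rank_swap_other[OF i1(2), of i \<chi>] by simp_all
    then have "crossing (Suc i) (swap i \<chi>) = crossing i (swap (Suc i) \<chi>)"
      using ps by (simp add: crossing_def swap_apply)
    then show ?thesis using crossing_closed[OF W_swap[OF \<chi> i(2)] i(1)] by (simp add: 1)
  next
    case qs
    have s: "swap (Suc i) \<chi> = \<chi>" using qs by (auto intro: swap_eq)
    have 1: "crossing (Suc i) (swap i \<chi>) = \<one>" "crossing i \<chi> = \<one>"
      "crossing (Suc i) (swap i (swap (Suc i) \<chi>)) = \<one>" "crossing i (swap (Suc i) \<chi>) = \<one>"
      using qs by (simp_all add: s crossing_def swap_apply)
    have "rank (swap (Suc i) (swap i \<chi>)) i = rank \<chi> (Suc i)"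
      using rank_transpose[OF i1(1), of \<chi> i] qs rank_swap_other[OF i1(2), of i "swap i \<chi>"] by simp
    then have "crossing i (swap (Suc i) (swap i \<chi>)) = crossing (Suc i) \<chi>"
      using qs by (simp add: crossing_def swap_apply)
    then show ?thesis using crossing_closed[OF \<chi> i(2)] by (simp add: 1)
  next
    case none
    then show ?thesis by (simp add: crossing_def swap_apply)
  qed
qed

lemma F_mat_braid:
  assumes i: "i \<in> {1..<n}" "Suc i \<in> {1..<n}"
  shows "F_mat i \<otimes>\<^bsub>Mat\<^esub> F_mat (Suc i) \<otimes>\<^bsub>Mat\<^esub> F_mat i = F_mat (Suc i) \<otimes>\<^bsub>Mat\<^esub> F_mat i \<otimes>\<^bsub>Mat\<^esub> F_mat (Suc i)"
proof -
  have m: "F_mat j \<otimes>\<^bsub>Mat\<^esub> F_mat k \<otimes>\<^bsub>Mat\<^esub> F_mat j = monomial (\<lambda>\<chi>. swap j (swap k (swap j \<chi>)))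
      (\<lambda>\<chi>. crossing j (swap k (swap j \<chi>)) \<otimes> crossing k (swap j \<chi>) \<otimes> crossing j \<chi>)"
    if j: "j \<in> {1..<n}" and k: "k \<in> {1..<n}" for j k
  proof -
    have "F_mat j \<otimes>\<^bsub>Mat\<^esub> F_mat k = monomial (\<lambda>\<chi>. swap j (swap k \<chi>)) (\<lambda>\<chi>. crossing j (swap k \<chi>) \<otimes> crossing k \<chi>)"
      unfolding F_mat_def[of j] by (rule F_mat_mult[OF k]) (use j in simp)
    then show ?thesis
      using F_mat_mult[OF j, of "\<lambda>\<chi>. crossing j (swap k \<chi>) \<otimes> crossing k \<chi>" "\<lambda>\<chi>. swap j (swap k \<chi>)"] j k W_swap
      by (simp del: mat_algebra_simps)
  qed
  show ?thesis
    unfolding m[OF i] m[OF i(2,1)]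
    by (rule monomial_cong, rule swap_braid, rule crossing_braid[OF _ i])
qed

lemma T_mat_closed [simp]: "T_mat i \<in> carrier Mat"
  unfolding T_mat_def by (rule monomial_closed') simp

lemma X_mat_closed [simp]: "i \<in> {1..n} \<Longrightarrow> X_mat i \<in> carrier Mat"
  unfolding X_mat_def by (rule monomial_closed') simp

lemma F_mat_closed [simp]: "i \<in> {1..<n} \<Longrightarrow> F_mat i \<in> carrier Mat"
  unfolding F_mat_def by (rule monomial_closed') simp

lemma scalar_pow: "(a \<odot> \<one>) [^] (k::nat) = a ^ k \<odot> \<one>"
  by (induction k) (simp_all add: smult_assoc2 mult.commute flip: smult_assoc1)

text \<open>The matrices of the \<open>t i\<close> are diagonal, so orthogonality of the roots of
  unity applies to each diagonal entry.\<close>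

lemma e_mat:
  assumes i: "i \<in> {1..<n}"
  shows "yh_e Mat r T_mat i = monomial (\<lambda>\<chi>. \<chi>) (\<lambda>\<chi>. if \<chi> i = \<chi> (Suc i) then \<one> else \<zero>)"
proof -
  let ?c = "\<lambda>k \<chi>. (z (\<chi> i) ^ k * z (\<chi> (Suc i)) ^ (r - k)) \<odot> \<one>"
  have summand: "T_mat i [^]\<^bsub>Mat\<^esub> k \<otimes>\<^bsub>Mat\<^esub> T_mat (i + 1) [^]\<^bsub>Mat\<^esub> (r - k) = monomial (\<lambda>\<chi>. \<chi>) (?c k)" for k
    unfolding T_mat_def
    by (subst (1 2) diagonal_pow, simp, simp, subst diagonal_mult, simp, simp, rule monomial_cong)
      (simp_all add: scalar_pow smult_assoc2 smult_assoc1)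
  have "yh_e Mat r T_mat i = inverse (of_nat r) \<odot>\<^bsub>Mat\<^esub> monomial (\<lambda>\<chi>. \<chi>) (\<lambda>\<chi>. \<Oplus>k\<in>{..<r}. ?c k \<chi>)"
    unfolding yh_e_def summand by (subst monomial_finsum) auto
  also have "\<dots> = monomial (\<lambda>\<chi>. \<chi>) (\<lambda>\<chi>. inverse (of_nat r) \<odot> (\<Oplus>k\<in>{..<r}. ?c k \<chi>))"
    by (rule monomial_smult) (auto intro!: finsum_closed)
  also have "\<dots> = monomial (\<lambda>\<chi>. \<chi>) (\<lambda>\<chi>. if \<chi> i = \<chi> (Suc i) then \<one> else \<zero>)"
  proof (rule monomial_cong)
    fix \<chi> assume "\<chi> \<in> W"
    then have c: "\<chi> (Suc i) < r" "\<chi> i < r" using word_less[of \<chi>] i by auto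
    have "(\<Oplus>k\<in>{..<r}. ?c k \<chi>) = (if \<chi> (Suc i) = \<chi> i then of_nat r else 0) \<odot> \<one>"
      using z_orthogonal[OF c] by (simp flip: smult_sum)
    then show "inverse (of_nat r) \<odot> (\<Oplus>k\<in>{..<r}. ?c k \<chi>) = (if \<chi> i = \<chi> (Suc i) then \<one> else \<zero>)"
      using r_nz by (auto simp flip: smult_assoc1)
  qed simp
  finally show ?thesis .
qed

text \<open>Compared column by column: for equal letters this is the relation of the Hecke family
  with its term 1; for different letters the entry of \<open>e_i\<close> is 0 and the dot merely
  follows its strand.\<close>

lemma F_mat_X_Suc:
  assumes i: "i \<in> {1..<n}"
  shows "F_mat i \<otimes>\<^bsub>Mat\<^esub> X_mat (Suc i) = X_mat i \<otimes>\<^bsub>Mat\<^esub> F_mat i \<oplus>\<^bsub>Mat\<^esub> yh_e Mat r T_mat i"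
proof -
  let ?\<delta> = "\<lambda>\<chi>. if \<chi> i = \<chi> (Suc i) then \<one> else \<zero>"
  have "monomial (\<lambda>\<chi>. \<chi>) ?\<delta> = monomial (swap i) ?\<delta>"
    by (rule monomial_cong_support) (auto simp: swap_eq)
  then have e: "yh_e Mat r T_mat i = monomial (swap i) ?\<delta>" by (simp only: e_mat[OF i])
  have XF: "X_mat i \<otimes>\<^bsub>Mat\<^esub> F_mat i = monomial (swap i) (\<lambda>\<chi>. dot i (swap i \<chi>) \<otimes> crossing i \<chi>)"
    unfolding X_mat_def by (rule F_mat_mult[OF i]) (use i in simp)
  have "X_mat i \<otimes>\<^bsub>Mat\<^esub> F_mat i \<oplus>\<^bsub>Mat\<^esub> yh_e Mat r T_mat i =
      monomial (swap i) (\<lambda>\<chi>. dot i (swap i \<chi>) \<otimes> crossing i \<chi> \<oplus> ?\<delta> \<chi>)"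
    unfolding XF e by (rule monomial_add) (use i W_swap in auto)
  also have "\<dots> = monomial (swap i) (\<lambda>\<chi>. crossing i \<chi> \<otimes> dot (Suc i) \<chi>)"
  proof (rule monomial_cong)
    fix \<chi> assume \<chi>: "\<chi> \<in> W"
    show "dot i (swap i \<chi>) \<otimes> crossing i \<chi> \<oplus> ?\<delta> \<chi> = crossing i \<chi> \<otimes> dot (Suc i) \<chi>"
    proof (cases "\<chi> i = \<chi> (Suc i)")
      case True
      then show ?thesis
        using S_X_Suc[OF word_less[OF \<chi>] rank_mem'[OF \<chi> i True]] i
        by (simp add: swap_eq dot_def crossing_def rank_Suc)
    next
      case False
      then have "dot i (swap i \<chi>) = dot (Suc i) \<chi>"
        using rank_transpose[of i \<chi> i] i by (simp add: dot_def swap_apply)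
      then show ?thesis using False \<chi> i dot_closed[OF \<chi>, of "Suc i"] by (simp add: crossing_def)
    qed
  qed simp
  also have "\<dots> = F_mat i \<otimes>\<^bsub>Mat\<^esub> X_mat (Suc i)"
    unfolding F_mat_def X_mat_def by (rule monomial_mult[symmetric]) (use i in auto)
  finally show ?thesis by simp
qed

text \<open>Equal letters at \<open>i\<close> and \<open>Suc i\<close> have consecutive ranks. Any
  other position with the same letter has a rank different from both, as the Hecke relation
  requires; other letters belong to commuting factors.\<close>

lemma F_mat_X_other:
  assumes i: "i \<in> {1..<n}" and j: "j \<in> {1..n}" "j \<noteq> i" "j \<noteq> Suc i"
  shows "F_mat i \<otimes>\<^bsub>Mat\<^esub> X_mat j = X_mat j \<otimes>\<^bsub>Mat\<^esub> F_mat i"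
proof -
  have "F_mat i \<otimes>\<^bsub>Mat\<^esub> X_mat j = monomial (swap i) (\<lambda>\<chi>. crossing i \<chi> \<otimes> dot j \<chi>)"
    unfolding F_mat_def X_mat_def by (rule monomial_mult) (use i j in auto)
  also have "\<dots> = monomial (swap i) (\<lambda>\<chi>. dot j (swap i \<chi>) \<otimes> crossing i \<chi>)"
  proof (rule monomial_cong)
    fix \<chi> assume \<chi>: "\<chi> \<in> W"
    have d: "dot j (swap i \<chi>) = dot j \<chi>"
      using i j by (simp add: dot_def rank_swap_other) (simp add: swap_apply)
    show "crossing i \<chi> \<otimes> dot j \<chi> = dot j (swap i \<chi>) \<otimes> crossing i \<chi>"
    proof (cases "\<chi> i = \<chi> (Suc i)")
      case True
      note ri = rank_mem'[OF \<chi> i True] and rj = rank_mem[OF \<chi> j(1)]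
      have ci: "\<chi> i < r" "\<chi> j < r" using word_less[OF \<chi>] i j by auto
      show ?thesis
      proof (cases "\<chi> j = \<chi> i")
        case same: True
        have "rank \<chi> j \<noteq> rank \<chi> i" using rank_inj[of \<chi> j i] same j by auto
        moreover have "rank \<chi> j \<noteq> Suc (rank \<chi> i)"
          using rank_inj[of \<chi> j "Suc i"] rank_Suc[OF True] same True j by auto
        moreover have "rank \<chi> j \<in> {1..\<mu> ! \<chi> i}" using rj unfolding same .
        moreover have "crossing i \<chi> = S (\<chi> i) (rank \<chi> i)" "dot j \<chi> = X (\<chi> i) (rank \<chi> j)"
          using True same by (auto simp: crossing_def dot_def)
        ultimately show ?thesis
          unfolding d using S_X_other[OF ci(1) ri, of "rank \<chi> j"] by (simp only: simp_thms)
      next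
        case False
        then show ?thesis
          unfolding d using cross[OF ci, of "S (\<chi> i) (rank \<chi> i)" "X (\<chi> j) (rank \<chi> j)"] ri rj True
          by (simp add: crossing_def dot_def)
      qed
    next
      case False
      then show ?thesis unfolding d using dot_closed[OF \<chi> j(1)] by (simp add: crossing_def)
    qed
  qed simp
  also have "\<dots> = X_mat j \<otimes>\<^bsub>Mat\<^esub> F_mat i"
    unfolding X_mat_def by (rule F_mat_mult[symmetric, OF i]) (use j in simp)
  finally show ?thesis .
qed

lemma X_mat_commute:
  assumes i: "i \<in> {1..n}" and j: "j \<in> {1..n}"
  shows "X_mat i \<otimes>\<^bsub>Mat\<^esub> X_mat j = X_mat j \<otimes>\<^bsub>Mat\<^esub> X_mat i"
proof -
  have "dot i \<chi> \<otimes> dot j \<chi> = dot j \<chi> \<otimes> dot i \<chi>" if \<chi>: "\<chi> \<in> W" for \<chi>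
  proof -
    note ri = rank_mem[OF \<chi> i] and rj = rank_mem[OF \<chi> j]
    have ci: "\<chi> i < r" "\<chi> j < r" using word_less[OF \<chi>] i j by auto
    show ?thesis
    proof (cases "\<chi> i = \<chi> j")
      case True
      then have "rank \<chi> j \<in> {1..\<mu> ! \<chi> i}" "dot j \<chi> = X (\<chi> i) (rank \<chi> j)" using rj by (simp_all add: dot_def)
      then show ?thesis using X_commute[OF ci(1) ri, of "rank \<chi> j"] by (simp only: dot_def)
    next
      case False
      then show ?thesis
        using cross[OF ci False, of "X (\<chi> i) (rank \<chi> i)" "X (\<chi> j) (rank \<chi> j)"] ri rj by (simp add: dot_def)
    qed
  qed
  then show ?thesis
    unfolding X_mat_def using i j by (subst (1 2) diagonal_mult) (auto intro!: monomial_cong simp del: mat_algebra_simps)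
qed

lemma yh_family_mat: "yh_family Mat r n d v T_mat F_mat X_mat"
  unfolding yh_family_def yh_rels_all
proof (intro conjI ballI)
  fix i j assume ij: "i \<in> {1..<n}" "j \<in> {j \<in> {1..<n}. 2 \<le> \<bar>int i - int j\<bar>}"
  then consider "Suc i < j" | "Suc j < i" by fastforce
  then show "F_mat i \<otimes>\<^bsub>Mat\<^esub> F_mat j = F_mat j \<otimes>\<^bsub>Mat\<^esub> F_mat i"
    using F_mat_far[of i j] F_mat_far[of j i] ij by cases auto
next
  fix i assume "i \<in> {i \<in> {1..<n}. i + 1 < n}"
  then show "F_mat i \<otimes>\<^bsub>Mat\<^esub> F_mat (i + 1) \<otimes>\<^bsub>Mat\<^esub> F_mat i = F_mat (i + 1) \<otimes>\<^bsub>Mat\<^esub> F_mat i \<otimes>\<^bsub>Mat\<^esub> F_mat (i + 1)"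
    using F_mat_braid[of i] by (simp del: mat_algebra_simps)
next
  fix i j assume "i \<in> {1..n}" "j \<in> {1..n}"
  show "T_mat i \<otimes>\<^bsub>Mat\<^esub> T_mat j = T_mat j \<otimes>\<^bsub>Mat\<^esub> T_mat i"
    unfolding T_mat_def by (subst (1 2) diagonal_mult)
      (auto intro!: monomial_cong simp: smult_assoc2 mult.commute simp del: mat_algebra_simps simp flip: smult_assoc1)
next
  fix i j assume i: "i \<in> {1..<n}" and j: "j \<in> {1..n}"
  let ?s = "Transposition.transpose i (i + 1)"
  have "F_mat i \<otimes>\<^bsub>Mat\<^esub> T_mat j = monomial (swap i) (\<lambda>\<chi>. crossing i \<chi> \<otimes> (z (\<chi> j) \<odot> \<one>))"
    unfolding F_mat_def T_mat_def by (rule monomial_mult) (use i in auto)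
  \<comment> \<open>The transposition undoes the swap:
    \<open>swap i \<chi> (?s j) = \<chi> j\<close>.\<close>
  also have "\<dots> = monomial (swap i) (\<lambda>\<chi>. (z (swap i \<chi> (?s j)) \<odot> \<one>) \<otimes> crossing i \<chi>)"
    using i by (intro monomial_cong) (auto simp: swap_apply smult_assoc2 smult_assoc3)
  also have "\<dots> = T_mat (?s j) \<otimes>\<^bsub>Mat\<^esub> F_mat i"
    unfolding T_mat_def by (rule F_mat_mult[symmetric, OF i]) simp
  finally show "F_mat i \<otimes>\<^bsub>Mat\<^esub> T_mat j = T_mat (?s j) \<otimes>\<^bsub>Mat\<^esub> F_mat i" .
next
  fix i assume i: "i \<in> {1..n}"
  show "T_mat i [^]\<^bsub>Mat\<^esub> r = \<one>\<^bsub>Mat\<^esub>"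
    unfolding T_mat_def monomial_one
    by (subst diagonal_pow) (use i word_less in \<open>auto intro!: monomial_cong simp: scalar_pow z_root\<close>)
next
  fix i assume i: "i \<in> {1..<n}"
  have "F_mat i \<otimes>\<^bsub>Mat\<^esub> F_mat i = monomial (\<lambda>\<chi>. swap i (swap i \<chi>)) (\<lambda>\<chi>. crossing i (swap i \<chi>) \<otimes> crossing i \<chi>)"
    unfolding F_mat_def[of i] by (rule F_mat_mult[OF i, unfolded F_mat_def]) (use i in simp)
  also have "\<dots> = \<one>\<^bsub>Mat\<^esub>"
    unfolding monomial_one
  proof (rule monomial_cong)
    fix \<chi> assume \<chi>: "\<chi> \<in> W"
    show "crossing i (swap i \<chi>) \<otimes> crossing i \<chi> = \<one>"
    proof (cases "\<chi> i = \<chi> (Suc i)")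
      case True
      then show ?thesis using S_square[OF word_less[OF \<chi>] rank_mem'[OF \<chi> i True]] i
        by (simp add: swap_eq crossing_def)
    next
      case False
      then show ?thesis by (simp add: crossing_def swap_apply)
    qed
  qed simp
  finally show "F_mat i \<otimes>\<^bsub>Mat\<^esub> F_mat i = \<one>\<^bsub>Mat\<^esub>" .
  show "F_mat i \<otimes>\<^bsub>Mat\<^esub> X_mat (i + 1) = X_mat i \<otimes>\<^bsub>Mat\<^esub> F_mat i \<oplus>\<^bsub>Mat\<^esub> yh_e Mat r T_mat i"
    using F_mat_X_Suc[OF i] by (simp del: mat_algebra_simps)
next
  fix i j assume "i \<in> {1..<n}" "j \<in> {j \<in> {1..n}. j \<noteq> i \<and> j \<noteq> i + 1}"
  then show "F_mat i \<otimes>\<^bsub>Mat\<^esub> X_mat j = X_mat j \<otimes>\<^bsub>Mat\<^esub> F_mat i" by (intro F_mat_X_other) auto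
next
  fix i j assume i: "i \<in> {1..n}" and j: "j \<in> {1..n}"
  show "T_mat j \<otimes>\<^bsub>Mat\<^esub> X_mat i = X_mat i \<otimes>\<^bsub>Mat\<^esub> T_mat j"
    unfolding T_mat_def X_mat_def using i
    by (subst (1 2) diagonal_mult) (auto intro!: monomial_cong simp: smult_assoc2 smult_assoc3 simp del: mat_algebra_simps)
  show "X_mat i \<otimes>\<^bsub>Mat\<^esub> X_mat j = X_mat j \<otimes>\<^bsub>Mat\<^esub> X_mat i" by (rule X_mat_commute[OF i j])
next
  have "cyclotomic_element Mat d v (X_mat 1) = monomial (\<lambda>\<chi>. \<chi>) (\<lambda>\<chi>. cyclotomic_element A d v (dot 1 \<chi>))"
    unfolding X_mat_def by (rule diagonal_cyclotomic) (use n in simp)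
  also have "\<dots> = monomial (\<lambda>\<chi>. \<chi>) (\<lambda>\<chi>. \<zero>)"
  proof (rule monomial_cong)
    fix \<chi> assume \<chi>: "\<chi> \<in> W"
    \<comment> \<open>The first letter of a word has rank 1, so the entry is exactly the generator
      that satisfies the cyclotomic relation.\<close>
    have "1 \<le> \<mu> ! \<chi> 1" using rank_mem[OF \<chi>, of 1] n by simp
    then show "cyclotomic_element A d v (dot 1 \<chi>) = \<zero>"
      using X_cyclotomic[OF word_less[OF \<chi>, of 1]] n unfolding dot_def rank_first by simp
  qed simp
  finally show "cyclotomic_element Mat d v (X_mat 1) = \<zero>\<^bsub>Mat\<^esub>" by (simp only: monomial_zero)
qed (auto simp del: mat_algebra_simps)

end

section \<open>The isomorphism\<close>

text \<open>The idempotents are fixed expressions in the \<open>t i\<close> and the roots of unity,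
  so a homomorphism matching the \<open>t i\<close> also matches them.\<close>

lemma idem_hom:
  assumes "yh_algebra A r n d v t f x z" "yh_algebra B r n d v t' f' x' z"
    and "alg_morphism A B h" "\<And>i. i \<in> {1..n} \<Longrightarrow> h (t i) = t' i" "m \<le> n"
  shows "h (yh_algebra.E A r t z m \<chi>) = yh_algebra.E B r t' z m \<chi>"
proof -
  interpret A: yh_algebra A r n d v t f x z by fact
  interpret B: yh_algebra B r n d v t' f' x' z by fact
  interpret h: alg_morphism A B h by fact
  have P: "h (A.P a i) = B.P a i" if "i \<in> {1..n}" for a i
    unfolding A.P_def B.P_def using assms(4)[OF that] A.t_closed[OF that]
    by (subst h.hom_smult) (auto simp: h.hom_finsum intro!: A.finsum_closed)
  show ?thesis
    using assms(5)
  proof (induction m)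
    case (Suc m)
    then have "h (A.E m \<chi> \<otimes>\<^bsub>A\<^esub> A.P (\<chi> (Suc m)) (Suc m)) = h (A.E m \<chi>) \<otimes>\<^bsub>B\<^esub> h (A.P (\<chi> (Suc m)) (Suc m))"
      by (intro h.hom_mult) auto
    then show ?case using Suc P[of "Suc m"] by simp
  qed simp
qed

context indexed_matrices
begin

lemma unit_add: "g \<in> carrier A \<Longrightarrow> h \<in> carrier A \<Longrightarrow> unit \<chi> \<xi> g \<oplus>\<^bsub>Mat\<^esub> unit \<chi> \<xi> h = unit \<chi> \<xi> (g \<oplus> h)"
  by (rule mat_ext) (auto simp: unit_def)

lemma unit_smult: "h \<in> carrier A \<Longrightarrow> a \<odot>\<^bsub>Mat\<^esub> unit \<chi> \<xi> h = unit \<chi> \<xi> (a \<odot> h)"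
  by (rule mat_ext) (auto simp: unit_def)

lemma mult_unit_apply:
  assumes N: "N \<in> carrier Mat" and ij: "i < m" "j < m"
  shows "(N \<otimes>\<^bsub>Mat\<^esub> unit \<xi> \<xi> \<one>) (i, j) = (if \<beta> j = \<xi> then N (i, j) else \<zero>)"
proof -
  have c: "N (k, l) \<in> carrier A" if "k < m" "l < m" for k l using N that by auto
  have "(\<Oplus>k\<in>{..<m}. N (i, k) \<otimes> unit \<xi> \<xi> \<one> (k, j)) = N (i, j) \<otimes> unit \<xi> \<xi> \<one> (j, j)"
    by (rule finsum_only) (use ij c in \<open>auto simp: unit_apply \<beta>_eq_iff\<close>)
  then show ?thesis using ij c by (auto simp: unit_apply)
qed

lemma unit_mult_apply:
  assumes N: "N \<in> carrier Mat" and ij: "i < m" "j < m"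
  shows "(unit \<xi> \<xi> \<one> \<otimes>\<^bsub>Mat\<^esub> N) (i, j) = (if \<beta> i = \<xi> then N (i, j) else \<zero>)"
proof -
  have c: "N (k, l) \<in> carrier A" if "k < m" "l < m" for k l using N that by auto
  have "(\<Oplus>k\<in>{..<m}. unit \<xi> \<xi> \<one> (i, k) \<otimes> N (k, j)) = unit \<xi> \<xi> \<one> (i, i) \<otimes> N (i, j)"
    by (rule finsum_only) (use ij c in \<open>auto simp: unit_apply \<beta>_eq_iff\<close>)
  then show ?thesis using ij c by (auto simp: unit_apply)
qed

text \<open>Diagonal matrix units select a single row and a single column; this is how one entry is
  read off by multiplication.\<close>

lemma unit_sandwich:
  assumes N: "N \<in> carrier Mat" and ij: "i < m" "j < m"
  shows "unit (\<beta> i) (\<beta> i) \<one> \<otimes>\<^bsub>Mat\<^esub> N \<otimes>\<^bsub>Mat\<^esub> unit (\<beta> j) (\<beta> j) \<one> = unit (\<beta> i) (\<beta> j) (N (i, j))"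
proof (rule mat_ext)
  have c: "unit (\<beta> i) (\<beta> i) \<one> \<otimes>\<^bsub>Mat\<^esub> N \<in> carrier Mat" using N by (intro Mat.m_closed unit_closed one_closed)
  fix k l assume kl: "k < m" "l < m"
  show "(unit (\<beta> i) (\<beta> i) \<one> \<otimes>\<^bsub>Mat\<^esub> N \<otimes>\<^bsub>Mat\<^esub> unit (\<beta> j) (\<beta> j) \<one>) (k, l) = unit (\<beta> i) (\<beta> j) (N (i, j)) (k, l)"
    unfolding mult_unit_apply[OF c kl] unit_mult_apply[OF N kl] unit_apply[OF kl]
    using ij kl by (auto simp: \<beta>_eq_iff)
qed (auto simp: unit_def)

lemma unit_inject: "\<chi> \<in> W \<Longrightarrow> \<xi> \<in> W \<Longrightarrow> unit \<chi> \<xi> g = unit \<chi> \<xi> h \<Longrightarrow> g = h"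
  using \<beta>_surj[of \<chi>] \<beta>_surj[of \<xi>] unit_apply by metis

end

context hecke_matrices
begin

text \<open>Through this interpretation weight idempotents exist inside the matrix algebra as well,
  where \<open>idem_unit\<close> computes them.\<close>

sublocale M: yh_algebra Mat r n d v T_mat F_mat X_mat z
  by unfold_locales (use yh_family_mat n in auto)

lemma W_colorings: "\<chi> \<in> W \<Longrightarrow> \<chi> \<in> M.colorings"
  using word_less by simp

lemma W_PiE: "\<chi> \<in> W \<Longrightarrow> \<chi> \<in> {1..n} \<rightarrow>\<^sub>E {..<r}"
  by (auto simp: words_def len sum)

lemma wt_unit: "\<xi> \<in> W \<Longrightarrow> h \<in> carrier A \<Longrightarrow> M.wt \<xi> (unit \<xi> \<eta> h)"
  unfolding M.wt_def T_mat_def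
  by (auto simp: monomial_unit unit_closed unit_smult smult_assoc2 simp del: mat_algebra_simps)

text \<open>The diagonal matrix unit at \<open>\<xi>\<close> is a weight vector of weight
  \<open>\<xi>\<close>, so \<open>idem \<chi>\<close> keeps or kills it, and this determines column
  \<open>\<xi>\<close>. A word of different content matches no column and gives zero.\<close>

lemma idem_unit:
  assumes \<chi>: "\<chi> \<in> {1..n} \<rightarrow>\<^sub>E {..<r}"
  shows "M.idem \<chi> = (if \<chi> \<in> W then unit \<chi> \<chi> \<one> else \<zero>\<^bsub>Mat\<^esub>)"
proof (rule mat_ext)
  have c: "M.idem \<chi> \<in> carrier Mat" by (rule M.E_closed) simp
  then show "M.idem \<chi> \<in> extensional ({..<m} \<times> {..<m})" by (simp add: PiE_iff)
  show "(if \<chi> \<in> W then unit \<chi> \<chi> \<one> else \<zero>\<^bsub>Mat\<^esub>) \<in> extensional ({..<m} \<times> {..<m})"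
    by (auto simp: unit_def)
  fix i j assume ij: "i < m" "j < m"
  let ?\<xi> = "\<beta> j"
  have \<xi>: "?\<xi> \<in> W" using \<beta>_in ij by blast
  have eq: "(\<forall>k\<in>{1..n}. \<chi> k = ?\<xi> k) \<longleftrightarrow> \<chi> = ?\<xi>"
    using PiE_ext[OF \<chi> W_PiE[OF \<xi>]] by blast
  have "M.idem \<chi> \<otimes>\<^bsub>Mat\<^esub> unit ?\<xi> ?\<xi> \<one> = (if \<chi> = ?\<xi> then unit ?\<xi> ?\<xi> \<one> else \<zero>\<^bsub>Mat\<^esub>)"
    using M.E_wt[OF wt_unit[OF \<xi> one_closed] M.PiE_colorings[OF \<chi>] W_colorings[OF \<xi>] le_refl] unfolding eq .
  then have "M.idem \<chi> (i, j) = (if \<chi> = ?\<xi> then unit ?\<xi> ?\<xi> \<one> else \<zero>\<^bsub>Mat\<^esub>) (i, j)"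
    using mult_unit_apply[OF c ij, of ?\<xi>] by simp
  then show "M.idem \<chi> (i, j) = (if \<chi> \<in> W then unit \<chi> \<chi> \<one> else \<zero>\<^bsub>Mat\<^esub>) (i, j)"
    using ij \<xi> by (auto simp: unit_apply)
qed

end

lemma (in kalg) corner_finsum:
  assumes e: "e \<in> carrier A" "e \<otimes> e = e" and "finite S" "g \<in> S \<rightarrow> carrier (corner A e)"
  shows "finsum (corner A e) g S = finsum A g S"
proof -
  interpret C: kalg "corner A e" by (rule kalg_corner[OF e])
  show ?thesis
    using assms(3,4)
  proof (induction S rule: finite_induct)
    case empty
    then show ?case by (simp only: C.finsum_empty finsum_empty corner_simps)
  next
    case (insert i S)
    then have "finsum (corner A e) g (insert i S) = g i \<oplus> finsum A g S"
      by (subst C.finsum_insert) (auto simp: Pi_iff)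
    then show ?case using insert by (subst finsum_insert) (auto simp: Pi_iff)
  qed
qed

text \<open>The inverse from \<open>path_inverse\<close> is cut by \<open>e\<close> on the left and
  by \<open>idem \<chi>\<close> on the right; both equations survive, and the element now lies
  between the two corners.\<close>

lemma (in yh_block) u_inverse:
  assumes \<chi>: "\<chi> \<in> W"
  shows "\<exists>w\<in>carrier A. u \<chi> \<otimes> w = idem \<chi> \<and> w \<otimes> u \<chi> = e \<and> e \<otimes> w = w \<and> w \<otimes> idem \<chi> = w"
proof -
  obtain w where w: "w \<in> carrier A" "u \<chi> \<otimes> w = idem \<chi>" "w \<otimes> u \<chi> = e"
    using path_inverse[OF u_path[OF \<chi>]] by blast
  have uc: "u \<chi> \<in> carrier A" "idem \<chi> \<in> carrier A" using \<chi> by auto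
  have ii: "idem \<chi> \<otimes> idem \<chi> = idem \<chi>" by (rule idem_idem[OF W_colorings[OF \<chi>]])
  have ue: "u \<chi> \<otimes> e = u \<chi>" by (rule path_idem[OF u_path[OF \<chi>]])
  have iu: "idem \<chi> \<otimes> u \<chi> = u \<chi>" by (rule idem_wt[OF path_wt[OF u_path[OF \<chi>]] W_colorings[OF \<chi>]])
  have "u \<chi> \<otimes> (e \<otimes> w \<otimes> idem \<chi>) = (u \<chi> \<otimes> e) \<otimes> w \<otimes> idem \<chi>" using uc w(1) by (simp add: m_assoc)
  then have 1: "u \<chi> \<otimes> (e \<otimes> w \<otimes> idem \<chi>) = idem \<chi>" by (simp only: ue w(2) ii)
  have "e \<otimes> w \<otimes> idem \<chi> \<otimes> u \<chi> = e \<otimes> (w \<otimes> (idem \<chi> \<otimes> u \<chi>))" using uc w(1) by (simp add: m_assoc)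
  then have 2: "e \<otimes> w \<otimes> idem \<chi> \<otimes> u \<chi> = e" by (simp only: iu w(3) e_idem)
  have "e \<otimes> (e \<otimes> w \<otimes> idem \<chi>) = (e \<otimes> e) \<otimes> w \<otimes> idem \<chi>" using uc w(1) by (simp add: m_assoc)
  then have 3: "e \<otimes> (e \<otimes> w \<otimes> idem \<chi>) = e \<otimes> w \<otimes> idem \<chi>" by (simp only: e_idem)
  have "e \<otimes> w \<otimes> idem \<chi> \<otimes> idem \<chi> = e \<otimes> w \<otimes> (idem \<chi> \<otimes> idem \<chi>)" using uc w(1) by (simp add: m_assoc)
  then have 4: "e \<otimes> w \<otimes> idem \<chi> \<otimes> idem \<chi> = e \<otimes> w \<otimes> idem \<chi>" by (simp only: ii)
  show ?thesis
    by (rule bexI[of _ "e \<otimes> w \<otimes> idem \<chi>"], intro conjI 1 2 3 4) (use uc w(1) in simp)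
qed

text \<open>The data for a single composition: the representation \<open>\<Phi>\<close> and the map
  \<open>\<psi>\<close> into the corner, both prescribed on generators, with the generation of both
  algebras at hand for inductions.\<close>

locale block_iso = Y: yh_block A r n d v t f x z \<mu> + M: hecke_matrices H m \<mu> \<beta> r z n d v X S
  for A :: "('k::field, 'a) module" (structure) and r n d v t f x z \<mu>
    and H :: "('k, 'b) module" and m \<beta> X S +
  fixes \<Phi> :: "'a \<Rightarrow> nat \<times> nat \<Rightarrow> 'b" and \<psi> :: "'b \<Rightarrow> 'a"
  assumes \<Phi>: "\<Phi> \<in> alg_hom A M.Mat"
    and \<Phi>_t: "i \<in> {1..n} \<Longrightarrow> \<Phi> (t i) = M.T_mat i" and \<Phi>_f: "i \<in> {1..<n} \<Longrightarrow> \<Phi> (f i) = M.F_mat i"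
    and \<Phi>_x: "i \<in> {1..n} \<Longrightarrow> \<Phi> (x i) = M.X_mat i"
    and \<psi>: "\<psi> \<in> alg_hom H (corner A Y.e)"
    and \<psi>_X: "a < r \<Longrightarrow> k \<in> {1..\<mu> ! a} \<Longrightarrow> \<psi> (X a k) = Y.corner_x a k"
    and \<psi>_S: "a < r \<Longrightarrow> k \<in> {1..<\<mu> ! a} \<Longrightarrow> \<psi> (S a k) = Y.corner_s a k"
    and A_gen: "alg_gen A (t ` {1..n} \<union> f ` {1..<n} \<union> x ` {1..n}) = carrier A"
    and H_gen: "alg_gen H (\<Union>a<r. X a ` {1..\<mu> ! a} \<union> S a ` {1..<\<mu> ! a}) = carrier H"
begin

abbreviation "Mat \<equiv> M.Mat"

sublocale \<Phi>: alg_morphism A Mat \<Phi>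
  by (rule alg_morphismI[OF Y.kalg_axioms M.Mat.kalg_axioms \<Phi>])

sublocale C: alg_morphism H "corner A Y.e" \<psi>
  by (rule alg_morphismI[OF M.kalg_axioms Y.kalg_corner_e \<psi>])

lemma \<psi>_closed [simp]: "h \<in> carrier H \<Longrightarrow> \<psi> h \<in> carrier A"
  using C.hom_closed[of h] by auto

lemma \<psi>_mult: "g \<in> carrier H \<Longrightarrow> h \<in> carrier H \<Longrightarrow> \<psi> (g \<otimes>\<^bsub>H\<^esub> h) = \<psi> g \<otimes> \<psi> h"
  and \<psi>_add: "g \<in> carrier H \<Longrightarrow> h \<in> carrier H \<Longrightarrow> \<psi> (g \<oplus>\<^bsub>H\<^esub> h) = \<psi> g \<oplus> \<psi> h"
  and \<psi>_smult: "h \<in> carrier H \<Longrightarrow> \<psi> (c \<odot>\<^bsub>H\<^esub> h) = c \<odot> \<psi> h"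
  and \<psi>_one: "\<psi> \<one>\<^bsub>H\<^esub> = Y.e" and \<psi>_zero: "\<psi> \<zero>\<^bsub>H\<^esub> = \<zero>"
  using C.hom_mult[of g h] C.hom_add[of g h] C.hom_smult[of h c] C.hom_one C.hom_zero by simp_all

lemma \<psi>_finsum:
  assumes "finite I" "g \<in> I \<rightarrow> carrier H" shows "\<psi> (\<Oplus>\<^bsub>H\<^esub>i\<in>I. g i) = (\<Oplus>i\<in>I. \<psi> (g i))"
proof -
  have "(\<lambda>i. \<psi> (g i)) \<in> I \<rightarrow> carrier (corner A Y.e)" using assms(2) C.hom_closed by blast
  then show ?thesis
    using C.hom_finsum[OF assms] Y.corner_finsum[OF Y.e_carrier Y.e_idem assms(1)] by simp
qed

lemma \<beta>_W: "i < m \<Longrightarrow> \<beta> i \<in> M.W" by (rule M.\<beta>_in)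

lemma entry_closed [simp]: "y \<in> carrier A \<Longrightarrow> i < m \<Longrightarrow> j < m \<Longrightarrow> \<Phi> y (i, j) \<in> carrier H"
  using \<Phi>.hom_closed[of y] by auto

lemma u_closed [simp]: "\<chi> \<in> M.W \<Longrightarrow> Y.u \<chi> \<in> carrier A"
  by (rule Y.u_closed)

lemma u_e: "\<chi> \<in> M.W \<Longrightarrow> Y.u \<chi> \<otimes> Y.e = Y.u \<chi>"
  by (rule Y.path_idem[OF Y.u_path])

text \<open>A column of a monomial matrix has at most one nonzero entry, so the expansion over all
  words collapses to one term.\<close>

lemma sum_monomial:
  assumes j: "j < m" and \<sigma>: "\<And>\<chi>. \<chi> \<in> M.W \<Longrightarrow> \<sigma> \<chi> \<in> M.W" and c: "\<And>\<chi>. \<chi> \<in> M.W \<Longrightarrow> c \<chi> \<in> carrier H"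
  shows "(\<Oplus>i\<in>{..<m}. Y.u (\<beta> i) \<otimes> \<psi> (M.monomial \<sigma> c (i, j))) = Y.u (\<sigma> (\<beta> j)) \<otimes> \<psi> (c (\<beta> j))"
proof -
  obtain k where k: "k < m" "\<beta> k = \<sigma> (\<beta> j)" using M.\<beta>_surj[OF \<sigma>[OF \<beta>_W[OF j]]] by blast
  have "(\<Oplus>i\<in>{..<m}. Y.u (\<beta> i) \<otimes> \<psi> (M.monomial \<sigma> c (i, j))) =
      Y.u (\<beta> k) \<otimes> \<psi> (M.monomial \<sigma> c (k, j))"
  proof (rule Y.finsum_only)
    fix i assume i: "i \<in> {..<m}" "i \<noteq> k"
    then have "\<beta> i \<noteq> \<sigma> (\<beta> j)" using k M.\<beta>_eq_iff[of i k] by auto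
    then show "Y.u (\<beta> i) \<otimes> \<psi> (M.monomial \<sigma> c (i, j)) = \<zero>"
      using i j \<beta>_W by (simp add: M.monomial_apply \<psi>_zero)
  qed (use j k c \<sigma> \<beta>_W in \<open>auto simp: M.monomial_apply\<close>)
  then show ?thesis using j k by (simp add: M.monomial_apply)
qed

lemma t_expand: "k \<in> {1..n} \<Longrightarrow> \<chi> \<in> M.W \<Longrightarrow> t k \<otimes> Y.u \<chi> = Y.u \<chi> \<otimes> \<psi> (z (\<chi> k) \<odot>\<^bsub>H\<^esub> \<one>\<^bsub>H\<^esub>)"
  using Y.path_wt[OF Y.u_path[of \<chi>]] by (simp add: Y.wt_def \<psi>_smult \<psi>_one Y.smult_assoc3 u_e)

lemma x_expand:
  assumes k: "k \<in> {1..n}" and \<chi>: "\<chi> \<in> M.W"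
  shows "x k \<otimes> Y.u \<chi> = Y.u \<chi> \<otimes> \<psi> (M.dot k \<chi>)"
proof -
  have m: "\<chi> k < r" "rank \<chi> k \<in> {1..\<mu> ! \<chi> k}" using M.word_less[OF \<chi> k] M.rank_mem[OF \<chi> k] .
  let ?x = "x (Y.p (\<chi> k) (rank \<chi> k))"
  note p = Y.pos_mem(1)[OF m]
  have "x k \<otimes> Y.u \<chi> = (Y.u \<chi> \<otimes> Y.e) \<otimes> ?x"
    using Y.path_x[OF Y.u_path[OF \<chi>] k] \<chi> by (simp only: u_e)
  also have "\<dots> = Y.u \<chi> \<otimes> (?x \<otimes> Y.e)"
    unfolding Y.e_x[OF p, symmetric] using \<chi> p by (intro Y.m_assoc) auto
  finally show ?thesis using m by (simp add: M.dot_def \<psi>_X Y.corner_x_def)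
qed

lemma f_expand:
  assumes k: "k \<in> {1..<n}" and \<chi>: "\<chi> \<in> M.W"
  shows "f k \<otimes> Y.u \<chi> = Y.u (swap k \<chi>) \<otimes> \<psi> (M.crossing k \<chi>)"
proof (cases "\<chi> k = \<chi> (Suc k)")
  case True
  have m: "\<chi> k < r" "rank \<chi> k \<in> {1..<\<mu> ! \<chi> k}"
    using M.word_less[OF \<chi>, of k] M.rank_mem'[OF \<chi> k True] k by auto
  let ?f = "f (Y.p (\<chi> k) (rank \<chi> k))"
  note p = Y.pos_less[OF m]
  have "f k \<otimes> Y.u \<chi> = (Y.u \<chi> \<otimes> Y.e) \<otimes> ?f"
    using Y.path_f[OF Y.u_path[OF \<chi>] k True] \<chi> by (simp only: u_e)
  also have "\<dots> = Y.u \<chi> \<otimes> (?f \<otimes> Y.e)"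
    unfolding Y.e_f[OF m, symmetric] using \<chi> p by (intro Y.m_assoc) auto
  also have "?f \<otimes> Y.e = \<psi> (M.crossing k \<chi>)"
    using \<psi>_S[OF m] True by (simp add: M.crossing_def Y.corner_s_def)
  finally show ?thesis using True by (simp only: swap_eq)
next
  case False
  then show ?thesis
    using Y.u_swap[OF \<chi> k False] u_e[OF Y.W_swap[OF \<chi> k]] by (simp add: M.crossing_def \<psi>_one)
qed

lemma G_closed: "t ` {1..n} \<union> f ` {1..<n} \<union> x ` {1..n} \<subseteq> carrier A"
  by auto

text \<open>The columns of \<open>\<Phi> y\<close> are the coordinates of \<open>y\<close> acting on the elements \<open>u \<chi>\<close>.\<close>

lemma expand:
  assumes y: "y \<in> alg_gen A (t ` {1..n} \<union> f ` {1..<n} \<union> x ` {1..n})" and j: "j < m"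
  shows "y \<otimes> Y.u (\<beta> j) = (\<Oplus>i\<in>{..<m}. Y.u (\<beta> i) \<otimes> \<psi> (\<Phi> y (i, j)))"
  using y j
proof (induction arbitrary: j rule: alg_gen.induct)
  case (gen g)
  note \<beta>j = \<beta>_W[OF gen(2)]
  from gen(1) show ?case
  proof (elim UnE imageE)
    fix k assume g: "g = t k" "k \<in> {1..n}"
    show ?thesis
      unfolding g \<Phi>_t[OF g(2)] M.T_mat_def
      by (subst sum_monomial[OF gen(2)]) (use t_expand[OF g(2) \<beta>j] in auto)
  next
    fix k assume g: "g = f k" "k \<in> {1..<n}"
    show ?thesis
      unfolding g \<Phi>_f[OF g(2)] M.F_mat_def
      by (subst sum_monomial[OF gen(2)]) (use f_expand[OF g(2) \<beta>j] M.W_swap M.crossing_closed g in auto)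
  next
    fix k assume g: "g = x k" "k \<in> {1..n}"
    show ?thesis
      unfolding g \<Phi>_x[OF g(2)] M.X_mat_def
      by (subst sum_monomial[OF gen(2)]) (use x_expand[OF g(2) \<beta>j] M.dot_closed g in auto)
  qed
next
  case one
  show ?case
    unfolding \<Phi>.hom_one M.monomial_one
    by (subst sum_monomial[OF one]) (use u_e[OF \<beta>_W[OF one]] \<beta>_W[OF one] in \<open>auto simp: \<psi>_one\<close>)
next
  case (add y w)
  have c: "y \<in> carrier A" "w \<in> carrier A" using add Y.alg_gen_closed[OF _ G_closed] by auto
  have "(y \<oplus> w) \<otimes> Y.u (\<beta> j) = (\<Oplus>i\<in>{..<m}. Y.u (\<beta> i) \<otimes> \<psi> (\<Phi> y (i, j)) \<oplus> Y.u (\<beta> i) \<otimes> \<psi> (\<Phi> w (i, j)))"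
    using add c \<beta>_W by (subst Y.finsum_addf) (auto simp: Y.l_distr)
  also have "\<dots> = (\<Oplus>i\<in>{..<m}. Y.u (\<beta> i) \<otimes> \<psi> (\<Phi> (y \<oplus> w) (i, j)))"
    using add.prems c \<beta>_W by (intro Y.finsum_cong') (auto simp: \<psi>_add Y.r_distr)
  finally show ?case .
next
  case (smult y a)
  have c: "y \<in> carrier A" using smult Y.alg_gen_closed[OF _ G_closed] by auto
  have "(a \<odot> y) \<otimes> Y.u (\<beta> j) = (\<Oplus>i\<in>{..<m}. a \<odot> (Y.u (\<beta> i) \<otimes> \<psi> (\<Phi> y (i, j))))"
    using smult c \<beta>_W by (subst Y.smult_finsum[symmetric]) (auto simp: Y.smult_assoc2)
  also have "\<dots> = (\<Oplus>i\<in>{..<m}. Y.u (\<beta> i) \<otimes> \<psi> (\<Phi> (a \<odot> y) (i, j)))"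
    using smult.prems c \<beta>_W by (intro Y.finsum_cong') (auto simp: \<psi>_smult Y.smult_assoc3)
  finally show ?case .
next
  case (mult y w)
  have c: "y \<in> carrier A" "w \<in> carrier A" using mult Y.alg_gen_closed[OF _ G_closed] by auto
  have U: "Y.u (\<beta> i) \<in> carrier A" if "i < m" for i using \<beta>_W[OF that] by simp
  let ?F = "\<lambda>k i. Y.u (\<beta> k) \<otimes> \<psi> (\<Phi> y (k, i)) \<otimes> \<psi> (\<Phi> w (i, j))"
  have F: "?F k i \<in> carrier A" if "k < m" "i < m" for k i using that U c mult.prems by simp
  have "(y \<otimes> w) \<otimes> Y.u (\<beta> j) = y \<otimes> (\<Oplus>i\<in>{..<m}. Y.u (\<beta> i) \<otimes> \<psi> (\<Phi> w (i, j)))"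
    using mult.IH(2)[OF mult.prems] c U[OF mult.prems] by (simp add: Y.m_assoc)
  also have "\<dots> = (\<Oplus>i\<in>{..<m}. y \<otimes> (Y.u (\<beta> i) \<otimes> \<psi> (\<Phi> w (i, j))))"
    using c U mult.prems by (intro Y.finsum_rdistr) auto
  also have "\<dots> = (\<Oplus>i\<in>{..<m}. \<Oplus>k\<in>{..<m}. ?F k i)"
  proof (intro Y.finsum_cong' refl)
    fix i assume "i \<in> {..<m}"
    then have i: "i < m" by simp
    have "y \<otimes> (Y.u (\<beta> i) \<otimes> \<psi> (\<Phi> w (i, j))) = (y \<otimes> Y.u (\<beta> i)) \<otimes> \<psi> (\<Phi> w (i, j))"
      using c U[OF i] i mult.prems by (simp add: Y.m_assoc)
    also have "\<dots> = (\<Oplus>k\<in>{..<m}. ?F k i)"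
      unfolding mult.IH(1)[OF i] using c U i mult.prems by (intro Y.finsum_ldistr) auto
    finally show "y \<otimes> (Y.u (\<beta> i) \<otimes> \<psi> (\<Phi> w (i, j))) = (\<Oplus>k\<in>{..<m}. ?F k i)" .
  qed (use F in \<open>auto intro!: Y.finsum_closed\<close>)
  \<comment> \<open>Exchanging the sums collects the terms into the entries of the matrix
    product.\<close>
  also have "\<dots> = (\<Oplus>k\<in>{..<m}. \<Oplus>i\<in>{..<m}. ?F k i)"
    by (rule Y.finsum_swap) (use F in auto)
  also have "\<dots> = (\<Oplus>k\<in>{..<m}. Y.u (\<beta> k) \<otimes> \<psi> (\<Phi> (y \<otimes> w) (k, j)))"
  proof (intro Y.finsum_cong' refl)
    fix k assume "k \<in> {..<m}"
    then have k: "k < m" by simp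
    have "\<psi> (\<Phi> (y \<otimes> w) (k, j)) = \<psi> (\<Oplus>\<^bsub>H\<^esub>i\<in>{..<m}. \<Phi> y (k, i) \<otimes>\<^bsub>H\<^esub> \<Phi> w (i, j))"
      using c k mult.prems by simp
    also have "\<dots> = (\<Oplus>i\<in>{..<m}. \<psi> (\<Phi> y (k, i) \<otimes>\<^bsub>H\<^esub> \<Phi> w (i, j)))"
      using c k mult.prems by (intro \<psi>_finsum) auto
    also have "\<dots> = (\<Oplus>i\<in>{..<m}. \<psi> (\<Phi> y (k, i)) \<otimes> \<psi> (\<Phi> w (i, j)))"
      using c k mult.prems by (intro Y.finsum_cong') (auto simp: \<psi>_mult)
    finally have "Y.u (\<beta> k) \<otimes> \<psi> (\<Phi> (y \<otimes> w) (k, j)) =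
        (\<Oplus>i\<in>{..<m}. Y.u (\<beta> k) \<otimes> (\<psi> (\<Phi> y (k, i)) \<otimes> \<psi> (\<Phi> w (i, j))))"
      using c k U mult.prems by (simp only:) (intro Y.finsum_rdistr, auto)
    also have "\<dots> = (\<Oplus>i\<in>{..<m}. ?F k i)"
      using c k U mult.prems by (intro Y.finsum_cong') (auto simp: Y.m_assoc)
    finally show "(\<Oplus>i\<in>{..<m}. ?F k i) = Y.u (\<beta> k) \<otimes> \<psi> (\<Phi> (y \<otimes> w) (k, j))" by simp
  qed (use c U mult.prems in auto)
  finally show ?case .
qed

text \<open>Equal matrices have equal columns, hence \<open>y\<close> and \<open>w\<close> have the
  same product with \<open>u \<chi>\<close>; a right inverse of \<open>u \<chi>\<close> replaces it
  by the idempotent.\<close>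

lemma block_injective:
  assumes "y \<in> carrier A" "w \<in> carrier A" "\<Phi> y = \<Phi> w" "\<chi> \<in> M.W"
  shows "y \<otimes> Y.idem \<chi> = w \<otimes> Y.idem \<chi>"
proof -
  obtain j where j: "j < m" "\<beta> j = \<chi>" using M.\<beta>_surj[OF assms(4)] by blast
  have "y \<otimes> Y.u \<chi> = w \<otimes> Y.u \<chi>"
    using expand[unfolded A_gen, OF assms(1) j(1)] expand[unfolded A_gen, OF assms(2) j(1)] assms(3) j(2)
    by simp
  moreover obtain u' where "u' \<in> carrier A" "Y.u \<chi> \<otimes> u' = Y.idem \<chi>"
    using Y.u_inverse[OF assms(4)] by blast
  ultimately show ?thesis
    using assms by (metis Y.m_assoc u_closed)
qed

lemma b_W: "Y.b \<in> M.W" by (rule Y.b_word)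

lemma \<Phi>_idem: "\<chi> \<in> {1..n} \<rightarrow>\<^sub>E {..<r} \<Longrightarrow> \<Phi> (Y.idem \<chi>) = (if \<chi> \<in> M.W then M.unit \<chi> \<chi> \<one>\<^bsub>H\<^esub> else \<zero>\<^bsub>Mat\<^esub>)"
  using idem_hom[OF Y.yh_algebra_axioms M.M.yh_algebra_axioms \<Phi>.alg_morphism_axioms \<Phi>_t le_refl, of \<chi>]
    M.idem_unit[of \<chi>] by (simp only:)

lemma \<Phi>_e: "\<Phi> Y.e = M.unit Y.b Y.b \<one>\<^bsub>H\<^esub>"
  using \<Phi>_idem[OF M.W_PiE[OF b_W]] b_W by (simp only: if_True)

text \<open>Along a path only different letters cross, so all coefficients are 1 and the single
  entry just moves from row to row.\<close>

lemma \<Phi>_path: "Y.path \<chi> y \<Longrightarrow> \<Phi> y = M.unit \<chi> Y.b \<one>\<^bsub>H\<^esub>"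
proof (induction rule: Y.path.induct)
  case base
  then show ?case by (rule \<Phi>_e)
next
  case (step \<chi> y i)
  have \<chi>: "\<chi> \<in> M.W" using step by (intro Y.path_word)
  have "\<Phi> (f i \<otimes> y) = \<Phi> (f i) \<otimes>\<^bsub>Mat\<^esub> \<Phi> y" using step by (intro \<Phi>.hom_mult) auto
  also have "\<dots> = M.monomial (swap i) (M.crossing i) \<otimes>\<^bsub>Mat\<^esub> M.unit \<chi> Y.b \<one>\<^bsub>H\<^esub>"
    using step.IH \<Phi>_f[OF step.hyps(2)] by (simp only: M.F_mat_def)
  also have "\<dots> = M.unit (swap i \<chi>) Y.b (M.crossing i \<chi> \<otimes>\<^bsub>H\<^esub> \<one>\<^bsub>H\<^esub>)"
    by (rule M.monomial_unit) (use \<chi> step.hyps(2) in auto)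
  also have "M.crossing i \<chi> \<otimes>\<^bsub>H\<^esub> \<one>\<^bsub>H\<^esub> = \<one>\<^bsub>H\<^esub>" using step by (simp add: M.crossing_def)
  finally show ?case .
qed

lemma HG_closed: "(\<Union>a<r. X a ` {1..\<mu> ! a} \<union> S a ` {1..<\<mu> ! a}) \<subseteq> carrier H"
  using M.X_closed M.S_closed by blast

text \<open>The letter \<open>a\<close> at place \<open>p a k\<close> of the sorted word has rank
  \<open>k\<close>, so \<open>x\<close> and \<open>f\<close> at that place have exactly
  \<open>X a k\<close> and \<open>S a k\<close> as entries in column \<open>b\<close>; sums,
  products and scalar multiples follow the matrix units.\<close>

lemma \<Phi>_\<psi>: "h \<in> carrier H \<Longrightarrow> \<Phi> (\<psi> h) = M.unit Y.b Y.b h"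
proof -
  assume "h \<in> carrier H"
  then have "h \<in> alg_gen H (\<Union>a<r. X a ` {1..\<mu> ! a} \<union> S a ` {1..<\<mu> ! a})" by (simp only: H_gen)
  then show ?thesis
  proof (induction rule: alg_gen.induct)
    case (gen g)
    then obtain a where a: "a < r" "g \<in> X a ` {1..\<mu> ! a} \<union> S a ` {1..<\<mu> ! a}" by blast
    from a(2) show ?case
    proof (elim UnE imageE)
      fix k assume g: "g = X a k" "k \<in> {1..\<mu> ! a}"
      note p = Y.pos_mem[OF a(1) g(2)]
      have "\<Phi> (\<psi> g) = M.X_mat (Y.p a k) \<otimes>\<^bsub>Mat\<^esub> M.unit Y.b Y.b \<one>\<^bsub>H\<^esub>"
        unfolding g \<psi>_X[OF a(1) g(2)] Y.corner_x_def
        by (subst \<Phi>.hom_mult) (use p in \<open>simp_all add: \<Phi>_x \<Phi>_e del: mat_algebra_simps\<close>)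
      also have "\<dots> = M.unit Y.b Y.b (M.dot (Y.p a k) Y.b \<otimes>\<^bsub>H\<^esub> \<one>\<^bsub>H\<^esub>)"
        unfolding M.X_mat_def by (rule M.monomial_unit) (use b_W p in auto)
      also have "M.dot (Y.p a k) Y.b \<otimes>\<^bsub>H\<^esub> \<one>\<^bsub>H\<^esub> = g"
        using p a g by (simp add: M.dot_def)
      finally show ?thesis .
    next
      fix k assume g: "g = S a k" "k \<in> {1..<\<mu> ! a}"
      then have k: "k \<in> {1..\<mu> ! a}" "Suc k \<in> {1..\<mu> ! a}" by auto
      note p = Y.pos_mem[OF a(1) k(1)] and pl = Y.pos_less[OF a(1) g(2)]
      have eq: "Y.b (Y.p a k) = Y.b (Suc (Y.p a k))"
        using Y.pos_next[OF a(1) g(2)] Y.pos_mem(2)[OF a(1) k(2)] p(2) by simp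
      have "\<Phi> (\<psi> g) = M.F_mat (Y.p a k) \<otimes>\<^bsub>Mat\<^esub> M.unit Y.b Y.b \<one>\<^bsub>H\<^esub>"
        unfolding g \<psi>_S[OF a(1) g(2)] Y.corner_s_def
        by (subst \<Phi>.hom_mult) (use pl in \<open>simp_all add: \<Phi>_f \<Phi>_e del: mat_algebra_simps\<close>)
      also have "\<dots> = M.unit (swap (Y.p a k) Y.b) Y.b (M.crossing (Y.p a k) Y.b \<otimes>\<^bsub>H\<^esub> \<one>\<^bsub>H\<^esub>)"
        unfolding M.F_mat_def by (rule M.monomial_unit) (use b_W pl in auto)
      also have "M.crossing (Y.p a k) Y.b \<otimes>\<^bsub>H\<^esub> \<one>\<^bsub>H\<^esub> = g"
        using p(2,3) a g eq by (simp add: M.crossing_def)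
      finally show ?thesis by (simp only: swap_eq[OF eq])
    qed
  next
    case one
    then show ?case by (simp only: \<psi>_one \<Phi>_e)
  next
    case (add g h)
    then have "g \<in> carrier H" "h \<in> carrier H" using M.alg_gen_closed[OF _ HG_closed] by auto
    then show ?case using add by (simp add: \<psi>_add M.unit_add del: mat_algebra_simps)
  next
    case (mult g h)
    then have "g \<in> carrier H" "h \<in> carrier H" using M.alg_gen_closed[OF _ HG_closed] by auto
    then show ?case using mult b_W by (simp add: \<psi>_mult M.unit_mult del: mat_algebra_simps)
  next
    case (smult g c)
    then have "g \<in> carrier H" using M.alg_gen_closed[OF _ HG_closed] by auto
    then show ?case using smult by (simp add: \<psi>_smult M.unit_smult del: mat_algebra_simps)
  qed
qed

text \<open>The preimage is \<open>u \<chi> \<otimes> \<psi> h \<otimes> w\<close> with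
  \<open>w\<close> inverse to \<open>u \<xi>\<close>. Its factorization through \<open>e\<close> is
  recorded because it forces the element to vanish under every homomorphism that kills
  \<open>e\<close>.\<close>

lemma unit_preimage:
  assumes \<chi>: "\<chi> \<in> M.W" and \<xi>: "\<xi> \<in> M.W" and h: "h \<in> carrier H"
  shows "\<exists>y\<in>carrier A. \<Phi> y = M.unit \<chi> \<xi> h \<and> y \<in> {a \<otimes> Y.e \<otimes> c | a c. a \<in> carrier A \<and> c \<in> carrier A}"
proof -
  obtain w where w: "w \<in> carrier A" "w \<otimes> Y.u \<xi> = Y.e" "Y.e \<otimes> w = w" "w \<otimes> Y.idem \<xi> = w"
    using Y.u_inverse[OF \<xi>] by blast
  obtain i where i: "i < m" "\<beta> i = Y.b" using M.\<beta>_surj[OF b_W] by blast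
  obtain j where j: "j < m" "\<beta> j = \<xi>" using M.\<beta>_surj[OF \<xi>] by blast
  let ?N = "\<Phi> w"
  have N: "?N \<in> carrier Mat" using w(1) by (rule \<Phi>.hom_closed)
  have Ni: "?N (i, j) \<in> carrier H" using w(1) i j by simp
  have u\<Phi>: "\<Phi> (Y.u \<eta>) = M.unit \<eta> Y.b \<one>\<^bsub>H\<^esub>" if "\<eta> \<in> M.W" for \<eta>
    using that by (intro \<Phi>_path Y.u_path)
  \<comment> \<open>The matrix of the inverse \<open>w\<close> is found indirectly: the two
    idempotents around \<open>w\<close> leave one possible entry, and
    \<open>w \<otimes> u \<xi> = e\<close> shows that it is 1.\<close>
  have "?N = \<Phi> (Y.e \<otimes> w \<otimes> Y.idem \<xi>)" using w by simp
  also have "\<dots> = \<Phi> Y.e \<otimes>\<^bsub>Mat\<^esub> ?N \<otimes>\<^bsub>Mat\<^esub> \<Phi> (Y.idem \<xi>)"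
    using w(1) by (simp only: \<Phi>.hom_mult Y.m_closed Y.E_closed le_refl)
  also have "\<dots> = M.unit Y.b Y.b \<one>\<^bsub>H\<^esub> \<otimes>\<^bsub>Mat\<^esub> ?N \<otimes>\<^bsub>Mat\<^esub> M.unit \<xi> \<xi> \<one>\<^bsub>H\<^esub>"
    using \<Phi>_idem[OF M.W_PiE[OF \<xi>]] \<xi> by (simp only: \<Phi>_e if_True)
  also have "\<dots> = M.unit Y.b \<xi> (?N (i, j))"
    using M.unit_sandwich[OF N i(1) j(1)] i j by (simp only:)
  finally have N': "?N = M.unit Y.b \<xi> (?N (i, j))" .
  have "M.unit Y.b Y.b \<one>\<^bsub>H\<^esub> = ?N \<otimes>\<^bsub>Mat\<^esub> \<Phi> (Y.u \<xi>)"
    using \<Phi>.hom_mult[OF w(1) u_closed[OF \<xi>]] w(2) \<Phi>_e by (simp only:)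
  also have "\<dots> = M.unit Y.b \<xi> (?N (i, j)) \<otimes>\<^bsub>Mat\<^esub> M.unit \<xi> Y.b \<one>\<^bsub>H\<^esub>"
    using N' u\<Phi>[OF \<xi>] by (simp only:)
  also have "\<dots> = M.unit Y.b Y.b (?N (i, j) \<otimes>\<^bsub>H\<^esub> \<one>\<^bsub>H\<^esub>)"
    by (rule M.unit_mult) (use \<xi> Ni in auto)
  finally have "?N (i, j) = \<one>\<^bsub>H\<^esub>"
    using M.unit_inject[OF b_W b_W] Ni by (metis M.r_one)
  then have w\<Phi>: "?N = M.unit Y.b \<xi> \<one>\<^bsub>H\<^esub>" using N' by simp
  let ?y = "Y.u \<chi> \<otimes> \<psi> h \<otimes> w"
  have uc: "Y.u \<chi> \<in> carrier A" "\<psi> h \<in> carrier A" using \<chi> h by auto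
  have "\<Phi> ?y = \<Phi> (Y.u \<chi>) \<otimes>\<^bsub>Mat\<^esub> \<Phi> (\<psi> h) \<otimes>\<^bsub>Mat\<^esub> \<Phi> w"
    using uc w(1) by (simp only: \<Phi>.hom_mult Y.m_closed)
  also have "\<dots> = M.unit \<chi> Y.b \<one>\<^bsub>H\<^esub> \<otimes>\<^bsub>Mat\<^esub> M.unit Y.b Y.b h \<otimes>\<^bsub>Mat\<^esub> M.unit Y.b \<xi> \<one>\<^bsub>H\<^esub>"
    using u\<Phi>[OF \<chi>] \<Phi>_\<psi>[OF h] w\<Phi> by (simp only:)
  also have "\<dots> = M.unit \<chi> \<xi> h"
    using h b_W by (simp add: M.unit_mult del: mat_algebra_simps)
  finally have "\<Phi> ?y = M.unit \<chi> \<xi> h" .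
  moreover have "?y = Y.u \<chi> \<otimes> Y.e \<otimes> (\<psi> h \<otimes> w)"
    using u_e[OF \<chi>] uc w(1) by (simp add: Y.m_assoc)
  ultimately show ?thesis using uc w(1) by (intro bexI[of _ ?y]) auto
qed

lemma hom_double_sum:
  fixes B :: "('k, 'c) module"
  assumes hm: "alg_morphism A B h" and y: "\<And>i j. i < m \<Longrightarrow> j < m \<Longrightarrow> y i j \<in> carrier A"
  shows "h (\<Oplus>i\<in>{..<m}. \<Oplus>j\<in>{..<m}. y i j) = (\<Oplus>\<^bsub>B\<^esub>i\<in>{..<m}. \<Oplus>\<^bsub>B\<^esub>j\<in>{..<m}. h (y i j))"
proof -
  interpret h: alg_morphism A B h by (rule hm)
  have "h (\<Oplus>i\<in>{..<m}. \<Oplus>j\<in>{..<m}. y i j) = (\<Oplus>\<^bsub>B\<^esub>i\<in>{..<m}. h (\<Oplus>j\<in>{..<m}. y i j))"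
    using y by (intro h.hom_finsum) (auto intro!: Y.finsum_closed)
  also have "\<dots> = (\<Oplus>\<^bsub>B\<^esub>i\<in>{..<m}. \<Oplus>\<^bsub>B\<^esub>j\<in>{..<m}. h (y i j))"
    using y by (intro h.B.finsum_cong' h.hom_finsum) (auto intro!: h.B.finsum_closed)
  finally show ?thesis .
qed

text \<open>Preimages of the scaled matrix units are added up. Each lies in the ideal generated by
  \<open>e\<close>, so the sum is killed by all \<open>h \<nu>\<close>, which will be the
  representations of the other blocks.\<close>

lemma block_surjective:
  fixes B :: "'i \<Rightarrow> ('k, 'c) module"
  assumes N: "N \<in> carrier Mat"
    and B: "\<And>\<nu>. \<nu> \<in> J \<Longrightarrow> alg_morphism A (B \<nu>) (h \<nu>)" "\<And>\<nu>. \<nu> \<in> J \<Longrightarrow> h \<nu> Y.e = \<zero>\<^bsub>B \<nu>\<^esub>"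
  shows "\<exists>y\<in>carrier A. \<Phi> y = N \<and> (\<forall>\<nu>\<in>J. h \<nu> y = \<zero>\<^bsub>B \<nu>\<^esub>)"
proof -
  have c: "N (i, j) \<in> carrier H" if "i < m" "j < m" for i j using N that by auto
  define Q where "Q i j y \<longleftrightarrow> y \<in> carrier A \<and> \<Phi> y = M.unit (\<beta> i) (\<beta> j) (N (i, j)) \<and>
      y \<in> {a \<otimes> Y.e \<otimes> c | a c. a \<in> carrier A \<and> c \<in> carrier A}" for i j y
  define y where "y i j = (SOME y. Q i j y)" for i j
  have Q: "Q i j (y i j)" if "i < m" "j < m" for i j
  proof -
    have "\<exists>y. Q i j y"
      unfolding Q_def using unit_preimage[OF \<beta>_W[OF that(1)] \<beta>_W[OF that(2)] c[OF that]] by blast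
    then show ?thesis unfolding y_def by (rule someI_ex)
  qed
  have y: "y i j \<in> carrier A" "\<Phi> (y i j) = M.unit (\<beta> i) (\<beta> j) (N (i, j))"
    "y i j \<in> {a \<otimes> Y.e \<otimes> c | a c. a \<in> carrier A \<and> c \<in> carrier A}" if "i < m" "j < m" for i j
    using Q[OF that] unfolding Q_def by blast+
  let ?y = "\<Oplus>i\<in>{..<m}. \<Oplus>j\<in>{..<m}. y i j"
  show ?thesis
  proof (intro bexI[of _ ?y] conjI ballI)
    have "\<Phi> ?y = (\<Oplus>\<^bsub>Mat\<^esub>i\<in>{..<m}. \<Oplus>\<^bsub>Mat\<^esub>j\<in>{..<m}. \<Phi> (y i j))"
      by (rule hom_double_sum[OF \<Phi>.alg_morphism_axioms y(1)])
    also have "\<dots> = (\<Oplus>\<^bsub>Mat\<^esub>i\<in>{..<m}. \<Oplus>\<^bsub>Mat\<^esub>j\<in>{..<m}. M.unit (\<beta> i) (\<beta> j) (N (i, j)))"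
      by (intro M.Mat.finsum_cong' refl)
        (use y(2) c in \<open>auto intro!: M.Mat.finsum_closed M.unit_closed simp del: mat_algebra_simps\<close>)
    also have "\<dots> = N" by (rule M.mat_eq_sum_units[OF N, symmetric])
    finally show "\<Phi> ?y = N" .
    show "?y \<in> carrier A" using y(1) by (auto intro!: Y.finsum_closed)
    fix \<nu> assume \<nu>: "\<nu> \<in> J"
    note z = B(2)[OF \<nu>]
    interpret h: alg_morphism A "B \<nu>" "h \<nu>" by (rule B(1)[OF \<nu>])
    have "h \<nu> (y i j) = \<zero>\<^bsub>B \<nu>\<^esub>" if ij: "i < m" "j < m" for i j
    proof -
      obtain a c where "y i j = a \<otimes> Y.e \<otimes> c" "a \<in> carrier A" "c \<in> carrier A"
        using y(3)[OF ij] by blast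
      then show ?thesis using z by simp
    qed
    then have "(\<Oplus>\<^bsub>B \<nu>\<^esub>i\<in>{..<m}. \<Oplus>\<^bsub>B \<nu>\<^esub>j\<in>{..<m}. h \<nu> (y i j)) = (\<Oplus>\<^bsub>B \<nu>\<^esub>i\<in>{..<m}. \<Oplus>\<^bsub>B \<nu>\<^esub>j\<in>{..<m}. \<zero>\<^bsub>B \<nu>\<^esub>)"
      by (intro h.B.finsum_cong' refl) (auto intro!: h.B.finsum_closed)
    then show "h \<nu> ?y = \<zero>\<^bsub>B \<nu>\<^esub>" by (simp only: hom_double_sum[OF B(1)[OF \<nu>] y(1)] h.B.finsum_zero)
  qed
qed

end

section \<open>Assembling the blocks\<close>

lemma finite_compositions: "finite (compositions r n)"
proof (rule finite_subset)
  show "compositions r n \<subseteq> {l. set l \<subseteq> {..n} \<and> length l = r}"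
    by (auto simp: compositions_def intro: member_le_sum_list)
qed (rule finite_lists_length_eq, simp)

theorem theorem3p4:
  fixes n r d :: nat and v :: "nat \<Rightarrow> 'k::alg_closed_field"
  assumes "n \<ge> 1" and "r \<ge> 1" and "d \<ge> 1"
    and "\<not> CHAR('k) dvd r"
  shows "\<exists>\<phi>. \<phi> \<in> alg_iso (cyclotomic_yokonuma_hecke r n d v)
    (direct_sum_algebra (compositions r n) (\<lambda>\<mu>. mat_algebra (comp_mult \<mu>) (hecke_tensor \<mu> d v)))"
proof -
  let ?Y = "cyclotomic_yokonuma_hecke r n d v"
  let ?C = "compositions r n"
  let ?H = "\<lambda>\<mu>. hecke_tensor \<mu> d v"
  let ?M = "\<lambda>\<mu>. mat_algebra (comp_mult \<mu>) (?H \<mu>)"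
  let ?D = "direct_sum_algebra ?C ?M"
  obtain z :: "nat \<Rightarrow> 'k" where z: "inj_on z {..<r}" "\<And>a. a < r \<Longrightarrow> z a ^ r = 1"
    "\<And>k. 0 < k \<Longrightarrow> k < r \<Longrightarrow> (\<Sum>a<r. z a ^ k) = 0"
    using roots_of_unity_enumeration[OF assms(2,4)] by blast
  have roots: "unity_roots r z"
    by unfold_locales (use z assms in \<open>auto simp: of_nat_eq_0_iff_char_dvd\<close>)
  let ?t = "yh_t r n d v" and ?f = "yh_f r n d v" and ?x = "yh_x r n d v"
  have Y: "yh_algebra ?Y r n d v ?t ?f ?x z"
    by (intro yh_algebra.intro yh_algebra_axioms.intro kalg_cyclotomic_yh yh_family_cyclotomic roots assms)
  interpret Y: yh_algebra ?Y r n d v ?t ?f ?x z by (rule Y)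
  have "\<forall>\<mu>\<in>?C. \<exists>\<beta> \<Phi> \<psi>. block_iso ?Y r n d v ?t ?f ?x z \<mu> (?H \<mu>) (comp_mult \<mu>) \<beta>
    (tensor_x \<mu> d v) (tensor_s \<mu> d v) \<Phi> \<psi>"
  proof
    fix \<mu> assume "\<mu> \<in> ?C"
    then have \<mu>: "length \<mu> = r" "sum_list \<mu> = n" by (auto simp: compositions_def)
    have YB: "yh_block ?Y r n d v ?t ?f ?x z \<mu>"
      by (intro yh_block.intro yh_block_axioms.intro Y \<mu>)
    then interpret YB: yh_block ?Y r n d v ?t ?f ?x z \<mu> .
    \<comment> \<open>There are exactly \<open>comp_mult \<mu>\<close> words of content
      \<open>\<mu>\<close>, so any numbering of them can index the matrices.\<close>
    obtain \<beta> where \<beta>: "bij_betw \<beta> {..<comp_mult \<mu>} (words \<mu>)"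
      using ex_bij_betw_nat_finite[OF finite_words] by (auto simp: card_words atLeast0LessThan)
    have HM: "hecke_matrices (?H \<mu>) (comp_mult \<mu>) \<mu> \<beta> r z n d v (tensor_x \<mu> d v) (tensor_s \<mu> d v)"
    proof (intro hecke_matrices.intro hecke_matrices_axioms.intro indexed_matrices.intro
        indexed_matrices_axioms.intro kalg_hecke_tensor \<beta> roots assms \<mu>)
      show "hecke_family (?H \<mu>) (\<mu> ! a) d v (tensor_x \<mu> d v a) (tensor_s \<mu> d v a)" if "a < r" for a
        using that \<mu> by (intro hecke_family_tensor) simp
      show "g \<otimes>\<^bsub>?H \<mu>\<^esub> h = h \<otimes>\<^bsub>?H \<mu>\<^esub> g" if "a < r" "c < r" "a \<noteq> c"
        "g \<in> tensor_x \<mu> d v a ` {1..\<mu> ! a} \<union> tensor_s \<mu> d v a ` {1..<\<mu> ! a}"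
        "h \<in> tensor_x \<mu> d v c ` {1..\<mu> ! c} \<union> tensor_s \<mu> d v c ` {1..<\<mu> ! c}" for a c g h
        by (rule tensor_gens_commute[of a \<mu> c]) (use that \<mu> in \<open>simp_all add: tensor_gens_def\<close>)
    qed
    then interpret HM: hecke_matrices "?H \<mu>" "comp_mult \<mu>" \<mu> \<beta> r z n d v "tensor_x \<mu> d v" "tensor_s \<mu> d v" .
    obtain \<Phi> where \<Phi>: "\<Phi> \<in> alg_hom ?Y HM.Mat" "\<forall>k\<in>{1..n}. \<Phi> (?t k) = HM.T_mat k"
      "\<forall>k\<in>{1..<n}. \<Phi> (?f k) = HM.F_mat k" "\<forall>k\<in>{1..n}. \<Phi> (?x k) = HM.X_mat k"
      using cyclotomic_yh_lift[OF assms(1) HM.Mat.kalg_axioms HM.yh_family_mat] by blast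
    obtain \<psi> where \<psi>: "\<psi> \<in> alg_hom (?H \<mu>) (corner ?Y YB.e)"
      "\<And>a k. a < r \<Longrightarrow> k \<in> {1..\<mu> ! a} \<Longrightarrow> \<psi> (tensor_x \<mu> d v a k) = YB.corner_x a k"
      "\<And>a k. a < r \<Longrightarrow> k \<in> {1..<\<mu> ! a} \<Longrightarrow> \<psi> (tensor_s \<mu> d v a k) = YB.corner_s a k"
      using YB.corner_lift by blast
    have "block_iso ?Y r n d v ?t ?f ?x z \<mu> (?H \<mu>) (comp_mult \<mu>) \<beta> (tensor_x \<mu> d v) (tensor_s \<mu> d v) \<Phi> \<psi>"
    proof (intro block_iso.intro block_iso_axioms.intro YB HM \<Phi>(1) \<psi>)
      show "alg_gen ?Y (?t ` {1..n} \<union> ?f ` {1..<n} \<union> ?x ` {1..n}) = carrier ?Y"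
        by (rule cyclotomic_yh_generated[OF assms(1)])
      show "alg_gen (?H \<mu>) (\<Union>a<r. tensor_x \<mu> d v a ` {1..\<mu> ! a} \<union> tensor_s \<mu> d v a ` {1..<\<mu> ! a}) =
          carrier (?H \<mu>)"
        using hecke_tensor_generated[of \<mu> d v] \<mu> by (simp add: tensor_gens_def)
    qed (use \<Phi> in blast)+
    then show "\<exists>\<beta> \<Phi> \<psi>. block_iso ?Y r n d v ?t ?f ?x z \<mu> (?H \<mu>) (comp_mult \<mu>) \<beta>
      (tensor_x \<mu> d v) (tensor_s \<mu> d v) \<Phi> \<psi>" by blast
  qed
  then obtain \<beta> \<Phi> \<psi> where B: "\<And>\<mu>. \<mu> \<in> ?C \<Longrightarrow> block_iso ?Y r n d v ?t ?f ?x z \<mu> (?H \<mu>) (comp_mult \<mu>) (\<beta> \<mu>)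
      (tensor_x \<mu> d v) (tensor_s \<mu> d v) (\<Phi> \<mu>) (\<psi> \<mu>)"
    by metis
  have hom: "alg_morphism ?Y (?M \<mu>) (\<Phi> \<mu>)" if "\<mu> \<in> ?C" for \<mu>
  proof -
    interpret block_iso ?Y r n d v ?t ?f ?x z \<mu> "?H \<mu>" "comp_mult \<mu>" "\<beta> \<mu>"
      "tensor_x \<mu> d v" "tensor_s \<mu> d v" "\<Phi> \<mu>" "\<psi> \<mu>" by (rule B[OF that])
    show ?thesis by (rule \<Phi>.alg_morphism_axioms)
  qed
  define \<phi> where "\<phi> y = (\<lambda>\<mu>\<in>?C. \<Phi> \<mu> y)" for y
  have closed: "\<phi> y \<in> carrier ?D" if "y \<in> carrier ?Y" for y
    unfolding \<phi>_def direct_sum_algebra_simps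
    by (rule restrict_PiE_iff[THEN iffD2], rule ballI, rule alg_morphism.hom_closed[OF hom that])
  have "\<phi> \<in> alg_hom ?Y ?D"
  proof (rule alg_homI)
    fix y w assume y: "y \<in> carrier ?Y" and w: "w \<in> carrier ?Y"
    show "\<phi> (y \<otimes>\<^bsub>?Y\<^esub> w) = \<phi> y \<otimes>\<^bsub>?D\<^esub> \<phi> w"
      unfolding \<phi>_def direct_sum_algebra_simps
      by (rule restrict_ext) (simp add: alg_morphism.hom_mult[OF hom y w] del: mat_algebra_simps)
    show "\<phi> (y \<oplus>\<^bsub>?Y\<^esub> w) = \<phi> y \<oplus>\<^bsub>?D\<^esub> \<phi> w"
      unfolding \<phi>_def direct_sum_algebra_simps
      by (rule restrict_ext) (simp add: alg_morphism.hom_add[OF hom y w] del: mat_algebra_simps)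
    show "\<phi> (c \<odot>\<^bsub>?Y\<^esub> y) = c \<odot>\<^bsub>?D\<^esub> \<phi> y" for c
      unfolding \<phi>_def direct_sum_algebra_simps
      by (rule restrict_ext) (simp add: alg_morphism.hom_smult[OF hom y] del: mat_algebra_simps)
  next
    show "\<phi> \<one>\<^bsub>?Y\<^esub> = \<one>\<^bsub>?D\<^esub>"
      unfolding \<phi>_def direct_sum_algebra_simps
      by (rule restrict_ext) (simp only: alg_morphism.hom_one[OF hom])
  qed (rule closed)
  moreover have "inj_on \<phi> (carrier ?Y)"
  proof (rule inj_onI)
    fix y w assume y: "y \<in> carrier ?Y" and w: "w \<in> carrier ?Y" and eq: "\<phi> y = \<phi> w"
    show "y = w"
    proof (rule Y.eq_by_weights[OF y w])
      fix \<chi> assume "\<chi> \<in> {1..n} \<rightarrow>\<^sub>E {..<r}"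
      \<comment> \<open>Every word belongs to the block of its content, where the matrices of
        \<open>y\<close> and \<open>w\<close> agree.\<close>
      then obtain \<mu> where \<mu>: "\<mu> \<in> ?C" "\<chi> \<in> words \<mu>" using words_exists by blast
      have "\<phi> y \<mu> = \<phi> w \<mu>" using eq by simp
      then have eq': "\<Phi> \<mu> y = \<Phi> \<mu> w" using \<mu> by (simp add: \<phi>_def)
      show "y \<otimes>\<^bsub>?Y\<^esub> Y.idem \<chi> = w \<otimes>\<^bsub>?Y\<^esub> Y.idem \<chi>"
        by (rule block_iso.block_injective[OF B[OF \<mu>(1)] y w eq' \<mu>(2)])
    qed
  qed
  moreover have "\<phi> ` carrier ?Y = carrier ?D"
  proof
    show "carrier ?D \<subseteq> \<phi> ` carrier ?Y"
    proof
      fix N assume N: "N \<in> carrier ?D"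
      have "\<forall>\<mu>\<in>?C. \<exists>y\<in>carrier ?Y. \<Phi> \<mu> y = N \<mu> \<and> (\<forall>\<nu>\<in>?C. \<nu> \<noteq> \<mu> \<longrightarrow> \<Phi> \<nu> y = \<zero>\<^bsub>?M \<nu>\<^esub>)"
      proof
        fix \<mu> assume \<mu>: "\<mu> \<in> ?C"
        then have N\<mu>: "N \<mu> \<in> carrier (?M \<mu>)" using N by (simp add: PiE_iff del: mat_algebra_simps)
        \<comment> \<open>The sorted word of \<open>\<mu>\<close> has content \<open>\<mu>\<close>
          only, so its idempotent vanishes in the blocks of all other compositions.\<close>
        have z: "\<Phi> \<nu> (Y.idem (base \<mu>)) = \<zero>\<^bsub>?M \<nu>\<^esub>" if \<nu>: "\<nu> \<in> ?C - {\<mu>}" for \<nu>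
        proof -
          have \<nu>': "\<nu> \<in> ?C" "\<nu> \<noteq> \<mu>" using \<nu> by auto
          have "base \<mu> \<in> words \<mu>" by (rule base_in_words)
          then have "base \<mu> \<in> {1..n} \<rightarrow>\<^sub>E {..<r}" "base \<mu> \<notin> words \<nu>"
            using words_subset[OF \<mu>] words_disjoint[OF \<nu>'(1) \<mu>] \<nu>'(2) by blast+
          then show ?thesis
            using block_iso.\<Phi>_idem[OF B[OF \<nu>'(1)], of "base \<mu>"] by (simp only: if_False)
        qed
        have hom': "alg_morphism ?Y (?M \<nu>) (\<Phi> \<nu>)" if "\<nu> \<in> ?C - {\<mu>}" for \<nu>
          using that by (intro hom) blast
        show "\<exists>y\<in>carrier ?Y. \<Phi> \<mu> y = N \<mu> \<and> (\<forall>\<nu>\<in>?C. \<nu> \<noteq> \<mu> \<longrightarrow> \<Phi> \<nu> y = \<zero>\<^bsub>?M \<nu>\<^esub>)"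
          using block_iso.block_surjective[where h = \<Phi> and B = ?M and J = "?C - {\<mu>}",
              OF B[OF \<mu>] N\<mu> hom' z] by blast
      qed
      then obtain y where y: "\<And>\<mu>. \<mu> \<in> ?C \<Longrightarrow> y \<mu> \<in> carrier ?Y" "\<And>\<mu>. \<mu> \<in> ?C \<Longrightarrow> \<Phi> \<mu> (y \<mu>) = N \<mu>"
        "\<And>\<mu> \<nu>. \<mu> \<in> ?C \<Longrightarrow> \<nu> \<in> ?C \<Longrightarrow> \<nu> \<noteq> \<mu> \<Longrightarrow> \<Phi> \<nu> (y \<mu>) = \<zero>\<^bsub>?M \<nu>\<^esub>"
        by metis
      \<comment> \<open>Preimages of the components are added; in each block only the summand
        belonging to it survives.\<close>
      let ?y = "\<Oplus>\<^bsub>?Y\<^esub>\<mu>\<in>?C. y \<mu>"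
      have yc: "?y \<in> carrier ?Y" using y(1) by (auto intro!: Y.finsum_closed)
      have "\<Phi> \<nu> ?y = N \<nu>" if \<nu>: "\<nu> \<in> ?C" for \<nu>
      proof -
        interpret h: alg_morphism ?Y "?M \<nu>" "\<Phi> \<nu>" by (rule hom[OF \<nu>])
        have "\<Phi> \<nu> ?y = (\<Oplus>\<^bsub>?M \<nu>\<^esub>\<mu>\<in>?C. \<Phi> \<nu> (y \<mu>))"
          by (rule h.hom_finsum[OF finite_compositions]) (use y(1) in blast)
        also have "\<dots> = \<Phi> \<nu> (y \<nu>)"
          by (rule h.B.finsum_only[OF finite_compositions \<nu>])
            (use y(1,3) \<nu> h.hom_closed in blast)+
        finally show ?thesis using y(2)[OF \<nu>] by simp
      qed
      then have "\<phi> ?y = N"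
        using N unfolding \<phi>_def by (intro extensionalityI[of _ ?C]) (auto simp: PiE_iff)
      then show "N \<in> \<phi> ` carrier ?Y" using yc by blast
    qed
  qed (use closed in blast)
  ultimately show ?thesis by (intro exI[of _ \<phi>] alg_isoI bij_betw_imageI)
qed

end
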